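(* Let $p_i-1\ge r_i\ge 1$ for $i=1,2,3$. The discrete spaces form a subcomplex of the Hessian complex, i.e. $$\nabla^2V_h^1\subset V_h^2,\qquad \nabla\times V_h^2\subset V_h^3,\qquad \nabla\cdot V_h^3\subset V_h^4,$$ and the projections $\Pi_h^i$ commute with the differential operators: $$\nabla^2(\Pi_h^1\phi)=\Pi_h^2(\nabla^2\phi),\qquad \nabla\times(\Pi_h^2S)=\Pi_h^3(\nabla\times S),\qquad \nabla\cdot(\Pi_h^3T)=\Pi_h^4(\nabla\cdot T)$$ for all $\phi\in H^2(\Omega)$, $S\in H(\Omega,\mathrm{curl},\mathbb S)$, $T\in H(\Omega,\mathrm{div},\mathbb T)$. Moreover $\Pi_h^1$ restricts to the identity on the space $P_1(\Omega)$ of polynomials of degree at most one.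
   Context: **Geometry.** $\widehat\Omega=(0,1)^3$, $F(\zeta)=A\zeta+b$ with $A\in\mathbb R^{3\times3}$ invertible and $b\in\mathbb R^3$, $\Omega=F(\widehat\Omega)$, $J=DF=A$. Curl and divergence of matrix functions act row-wise. $H(\Omega,\mathrm{curl},\mathbb S)$: symmetric matrix functions in $L^2(\Omega)$ with row-wise curl in $L^2$. $H(\Omega,\mathrm{div},\mathbb T)$: trace-free matrix functions in $L^2(\Omega)$ with row-wise divergence in $L^2$. **Pullbacks** (functions on $\Omega$ to functions on $\widehat\Omega$): $\mathcal Y_1(\phi)=\phi\circ F$, $\mathcal Y_2(S)=J^T(S\circ F)J$, $\mathcal Y_3(T)=\det(J)\,J^T(T\circ F)J^{-T}$, $\mathcal Y_4(v)=\det(J)\,J^T(v\circ F)$. They are invertible. **Splines.** For each direction $i=1,2,3$ fix a $p_i$-open knot vector $\Xi_i$ on $[0,1]$ (first and last knots $0$ and $1$ repeated $p_i+1$ times) whose interior knots have multiplicity between $1$ and $p_i-r_i$. $S_{p_i}^{r_i}$ is the span of the B-splines $\widehat B_{j,p_i}$ on $\Xi_i$ (Cox–de Boor); it consists of $C^{r_i}$ functions. $S_{p_i-1}^{r_i-1}$ and $S_{p_i-2}^{r_i-2}$ are the spline spaces of degree $p_i-1$, $p_i-2$ with the same interior knots (multiplicities kept) and end knots repeated $p_i$, $p_i-1$ times; regularity $-1$ means discontinuous. For $a,b,c\in\{0,1,2\}$ write $S(a,b,c)=S_{p_1-a}^{r_1-a}\otimes S_{p_2-b}^{r_2-b}\otimes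 S_{p_3-c}^{r_3-c}$. **Discrete spaces.** $\widehat V_h^1=S(0,0,0)$; $\widehat V_h^2$ is the space of symmetric matrix functions with $(i,j)$ entry in the $(i,j)$ entry of the first array below; $\widehat V_h^3$ the space of trace-free matrix functions with entries in the second array; $\widehat V_h^4=S(2,1,1)\times S(1,2,1)\times S(1,1,2)$, where the arrays are $$\begin{pmatrix}S(2,0,0)&S(1,1,0)&S(1,0,1)\\S(1,1,0)&S(0,2,0)&S(0,1,1)\\S(1,0,1)&S(0,1,1)&S(0,0,2)\end{pmatrix},\qquad\begin{pmatrix}S(1,1,1)&S(2,0,1)&S(2,1,0)\\S(0,2,1)&S(1,1,1)&S(1,2,0)\\S(0,1,2)&S(1,0,2)&S(1,1,1)\end{pmatrix}.$$ The physical spaces are $V_h^i=\mathcal Y_i^{-1}(\widehat V_h^i)$, $i=1,\dots,4$. **Univariate projections.** $\widehat\Pi_p v=\sum_i(\lambda_i^pv)\widehat B_{i,p}$ for $v\in L^2(0,1)$, where $\lambda_i^p$ are Schumaker's canonical dual functionals: with $\xi_k$ the knots of the univariate knot vector in question, $\lambda_i^pv=\int_{\xi_i}^{\xi_{i+p+1}}v(\tau)\,\frac{d^{p+1}}{d\tau^{p+1}}\big(g_i(\tau)q_i(\tau)\big)\,d\tau$, where $q_i(\tau)=\frac1{p!}\prod_{k=1}^p(\tau-\xi_{i+k})$, $g_i(\tau)=g\big(\frac{2\tau-\xi_i-\xi_{i+p+1}}{\xi_{i+p+1}-\xi_i}\big)$, $g(x)=\int_{-1}^xB(t)\,dt\big/\int_{-1}^1B(t)\,dt$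 for $-1\le x\le1$, and $B$ is the degree-$p$ B-spline on the knots $-\cos(k\pi/(p+1))$, $k=0,\dots,p+1$. These are linear functionals on $L^2(0,1)$ with $\lambda_i^p(\widehat B_{j,p})=\delta_{ij}$, $|\lambda_i^pv|\le C_p(\xi_{i+p+1}-\xi_i)^{-1/2}\|v\|_{L^2(\xi_i,\xi_{i+p+1})}$. Further $\widehat\Pi^{c,1}_{p-1}v=\frac{d}{d\zeta}\widehat\Pi_p\int_0^\zeta v(\tau)\,d\tau$ and $\widehat\Pi^{c,2}_{p-2}v=\frac{d^2}{d\zeta^2}\widehat\Pi_p\int_0^\zeta\int_0^\tau v(\rho)\,d\rho\,d\tau$. **Multivariate projections.** Let $(a,b,c)$ denote the tensor product projection $L^2(\widehat\Omega)\to S(a,b,c)$ whose factor in direction $i$ is $\widehat\Pi_{p_i}$, $\widehat\Pi^{c,1}_{p_i-1}$, $\widehat\Pi^{c,2}_{p_i-2}$ according to the entry $0,1,2$. $\widehat\Pi_h^1=(0,0,0)$; $\widehat\Pi_h^2$ and $\widehat\Pi_h^3$ act entrywise on matrix functions by the arrays above with each $S(a,b,c)$ replaced by $(a,b,c)$; $\widehat\Pi_h^4$ acts componentwise by $(2,1,1),(1,2,1),(1,1,2)$. The physical projections are $\Pi_h^i=\mathcal Y_i^{-1}\circ\widehat\Pi_h^i\circ\mathcal Y_i$, $i=1,\dots,4$. *)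

theory Defs
  imports "HOL-Analysis.Analysis"
begin

section \<open>Weak derivatives in L2\<close>

text \<open>
  Functions on a domain are represented by total functions; values outside the domain never
  matter. Elements of L2 are represented by functions, and the function spaces below are closed
  under almost everywhere equality on the domain.
\<close>

definition L2_on :: "(real^3) set \<Rightarrow> (real^3 \<Rightarrow> 'b::euclidean_space) \<Rightarrow> bool" where
  "L2_on D f \<longleftrightarrow> f \<in> borel_measurable (lebesgue_on D) \<and>
     integrable (lebesgue_on D) (\<lambda>x. (norm (f x))\<^sup>2)"

definition pd :: "3 \<Rightarrow> (real^3 \<Rightarrow> real) \<Rightarrow> real^3 \<Rightarrow> real" where
  "pd k \<psi> x = frechet_derivative \<psi> (at x) (axis k 1)"

definition grad :: "(real^3 \<Rightarrow> real) \<Rightarrow> real^3 \<Rightarrow> real^3" where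
  "grad \<psi> x = (\<chi> k. pd k \<psi> x)"

text \<open>All iterated partial derivatives are differentiable, hence continuous.\<close>

definition smooth :: "(real^3 \<Rightarrow> real) \<Rightarrow> bool" where
  "smooth \<psi> \<longleftrightarrow> (\<forall>ks x. foldr pd ks \<psi> differentiable (at x))"

definition test_fun :: "(real^3) set \<Rightarrow> (real^3 \<Rightarrow> real) \<Rightarrow> bool" where
  "test_fun D \<psi> \<longleftrightarrow> smooth \<psi> \<and> compact (closure {x. \<psi> x \<noteq> 0}) \<and> closure {x. \<psi> x \<noteq> 0} \<subseteq> D"

text \<open>
  The differential operators are unbounded operators between L2 spaces, given by their graphs:
  both the argument and the value are required to be in L2. The value is unique up to almost
  everywhere equality.
\<close>

definition has_weak_grad ::
  "(real^3) set \<Rightarrow> (real^3 \<Rightarrow> real) \<Rightarrow> (real^3 \<Rightarrow> real^3) \<Rightarrow> bool" where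
  "has_weak_grad D \<phi> g \<longleftrightarrow> L2_on D \<phi> \<and> L2_on D g \<and>
     (\<forall>\<psi>. test_fun D \<psi> \<longrightarrow>
        (LINT x|lebesgue_on D. \<psi> x *\<^sub>R g x) = - (LINT x|lebesgue_on D. \<phi> x *\<^sub>R grad \<psi> x))"

definition has_weak_hessian ::
  "(real^3) set \<Rightarrow> (real^3 \<Rightarrow> real) \<Rightarrow> (real^3 \<Rightarrow> real^3^3) \<Rightarrow> bool" where
  "has_weak_hessian D \<phi> H \<longleftrightarrow>
     (\<exists>g. has_weak_grad D \<phi> g \<and> (\<forall>i. has_weak_grad D (\<lambda>x. g x $ i) (\<lambda>x. H x $ i)))"

text \<open>
  Row-wise curl. The sign is that of the product rule
  curl(\<open>\<psi> u\<close>) = \<open>\<psi>\<close> curl(\<open>u\<close>) + (grad \<open>\<psi>\<close>) \<open>\<times>\<close> \<open>u\<close>, whose left side integrates to zero.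
\<close>

definition has_weak_curl ::
  "(real^3) set \<Rightarrow> (real^3 \<Rightarrow> real^3^3) \<Rightarrow> (real^3 \<Rightarrow> real^3^3) \<Rightarrow> bool" where
  "has_weak_curl D S T \<longleftrightarrow> L2_on D S \<and> L2_on D T \<and>
     (\<forall>\<psi>. test_fun D \<psi> \<longrightarrow> (\<forall>i.
        (LINT x|lebesgue_on D. \<psi> x *\<^sub>R (T x $ i)) =
        (LINT x|lebesgue_on D. cross3 (S x $ i) (grad \<psi> x))))"

definition has_weak_div ::
  "(real^3) set \<Rightarrow> (real^3 \<Rightarrow> real^3^3) \<Rightarrow> (real^3 \<Rightarrow> real^3) \<Rightarrow> bool" where
  "has_weak_div D T v \<longleftrightarrow> L2_on D T \<and> L2_on D v \<and>
     (\<forall>\<psi>. test_fun D \<psi> \<longrightarrow> (\<forall>i.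
        (LINT x|lebesgue_on D. \<psi> x * v x $ i) =
        - (LINT x|lebesgue_on D. (T x $ i) \<bullet> grad \<psi> x)))"

definition H2 :: "(real^3) set \<Rightarrow> (real^3 \<Rightarrow> real) set" where
  "H2 D = {\<phi>. \<exists>H. has_weak_hessian D \<phi> H}"

definition symmetric_on :: "(real^3) set \<Rightarrow> (real^3 \<Rightarrow> real^3^3) \<Rightarrow> bool" where
  "symmetric_on D S \<longleftrightarrow> (AE x in lebesgue_on D. transpose (S x) = S x)"

definition tracefree_on :: "(real^3) set \<Rightarrow> (real^3 \<Rightarrow> real^3^3) \<Rightarrow> bool" where
  "tracefree_on D T \<longleftrightarrow> (AE x in lebesgue_on D. trace (T x) = 0)"

definition Hcurl_sym :: "(real^3) set \<Rightarrow> (real^3 \<Rightarrow> real^3^3) set" where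
  "Hcurl_sym D = {S. symmetric_on D S \<and> (\<exists>T. has_weak_curl D S T)}"

definition Hdiv_tracefree :: "(real^3) set \<Rightarrow> (real^3 \<Rightarrow> real^3^3) set" where
  "Hdiv_tracefree D = {T. tracefree_on D T \<and> (\<exists>v. has_weak_div D T v)}"

definition P1 :: "(real^3) set \<Rightarrow> (real^3 \<Rightarrow> real) set" where
  "P1 D = {\<phi>. \<exists>c a. \<forall>x\<in>D. \<phi> x = c + a \<bullet> x}"


section \<open>Geometry and pullbacks\<close>

definition cube :: "(real^3) set" where
  "cube = box 0 1"

definition F_map :: "real^3^3 \<Rightarrow> real^3 \<Rightarrow> real^3 \<Rightarrow> real^3" where
  "F_map A b \<zeta> = A *v \<zeta> + b"

definition phys_dom :: "real^3^3 \<Rightarrow> real^3 \<Rightarrow> (real^3) set" where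
  "phys_dom A b = F_map A b ` cube"

definition Y1 :: "real^3^3 \<Rightarrow> real^3 \<Rightarrow> (real^3 \<Rightarrow> real) \<Rightarrow> (real^3 \<Rightarrow> real)" where
  "Y1 A b \<phi> = \<phi> \<circ> F_map A b"

definition Y2 :: "real^3^3 \<Rightarrow> real^3 \<Rightarrow> (real^3 \<Rightarrow> real^3^3) \<Rightarrow> (real^3 \<Rightarrow> real^3^3)" where
  "Y2 A b S = (\<lambda>\<zeta>. transpose A ** S (F_map A b \<zeta>) ** A)"

definition Y3 :: "real^3^3 \<Rightarrow> real^3 \<Rightarrow> (real^3 \<Rightarrow> real^3^3) \<Rightarrow> (real^3 \<Rightarrow> real^3^3)" where
  "Y3 A b T =
     (\<lambda>\<zeta>. det A *\<^sub>R (transpose A ** T (F_map A b \<zeta>) ** transpose (matrix_inv A)))"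

definition Y4 :: "real^3^3 \<Rightarrow> real^3 \<Rightarrow> (real^3 \<Rightarrow> real^3) \<Rightarrow> (real^3 \<Rightarrow> real^3)" where
  "Y4 A b v = (\<lambda>\<zeta>. det A *\<^sub>R (transpose A *v v (F_map A b \<zeta>)))"


section \<open>Splines\<close>

text \<open>Cox--de Boor recursion; the convention 0/0 = 0 is that of HOL division.\<close>

fun bspline :: "(nat \<Rightarrow> real) \<Rightarrow> nat \<Rightarrow> nat \<Rightarrow> real \<Rightarrow> real" where
  "bspline \<xi> 0 i x = (if \<xi> i \<le> x \<and> x < \<xi> (i + 1) then 1 else 0)"
| "bspline \<xi> (Suc q) i x =
     (x - \<xi> i) / (\<xi> (i + q + 1) - \<xi> i) * bspline \<xi> q i x +
     (\<xi> (i + q + 2) - x) / (\<xi> (i + q + 2) - \<xi> (i + 1)) * bspline \<xi> q (i + 1) x"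

definition open_knot_vector :: "nat \<Rightarrow> nat \<Rightarrow> real list \<Rightarrow> bool" where
  "open_knot_vector p r \<Xi> \<longleftrightarrow> sorted \<Xi> \<and> set \<Xi> \<subseteq> {0..1} \<and>
     count_list \<Xi> 0 = p + 1 \<and> count_list \<Xi> 1 = p + 1 \<and>
     (\<forall>x \<in> set \<Xi> \<inter> {0<..<1}. count_list \<Xi> x \<le> p - r)"

text \<open>Remove \<open>a\<close> knots at either end: the knot vector of the spline space of degree \<open>p - a\<close>.\<close>

definition reduce_knots :: "nat \<Rightarrow> real list \<Rightarrow> real list" where
  "reduce_knots a \<Xi> = drop a (take (length \<Xi> - a) \<Xi>)"

text \<open>Number of B-splines of degree \<open>q\<close>; they are indexed from 0.\<close>

definition num_bsplines :: "nat \<Rightarrow> real list \<Rightarrow> nat" where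
  "num_bsplines q \<Xi> = length \<Xi> - q - 1"

text \<open>
  \<open>spline_space p \<Xi> (a,b,c)\<close> is the span of the products of univariate B-splines, as a subspace of
  L2(cube).
\<close>

definition spline_space :: "(3 \<Rightarrow> nat) \<Rightarrow> (3 \<Rightarrow> real list) \<Rightarrow> nat^3 \<Rightarrow> (real^3 \<Rightarrow> real) set" where
  "spline_space p \<Xi> a =
     (let K = (\<lambda>d. reduce_knots (a $ d) (\<Xi> d));
          q = (\<lambda>d. p d - a $ d);
          n = (\<lambda>d. num_bsplines (q d) (K d));
          N = (\<lambda>d i \<zeta>. bspline ((!) (K d)) (q d) i (\<zeta> $ d))
      in {f. \<exists>c :: nat \<Rightarrow> nat \<Rightarrow> nat \<Rightarrow> real. AE \<zeta> in lebesgue_on cube.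
            f \<zeta> = (\<Sum>i<n 1. \<Sum>j<n 2. \<Sum>k<n 3. c i j k * (N 1 i \<zeta> * N 2 j \<zeta> * N 3 k \<zeta>))})"

definition arr1 :: "nat^3" where
  "arr1 = vector [0,0,0]"

definition arr2 :: "nat^3^3^3" where
  "arr2 = vector
    [vector [vector [2,0,0], vector [1,1,0], vector [1,0,1]],
     vector [vector [1,1,0], vector [0,2,0], vector [0,1,1]],
     vector [vector [1,0,1], vector [0,1,1], vector [0,0,2]]]"

definition arr3 :: "nat^3^3^3" where
  "arr3 = vector
    [vector [vector [1,1,1], vector [2,0,1], vector [2,1,0]],
     vector [vector [0,2,1], vector [1,1,1], vector [1,2,0]],
     vector [vector [0,1,2], vector [1,0,2], vector [1,1,1]]]"

definition arr4 :: "nat^3^3" where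
  "arr4 = vector [vector [2,1,1], vector [1,2,1], vector [1,1,2]]"

definition Vhat1 :: "(3 \<Rightarrow> nat) \<Rightarrow> (3 \<Rightarrow> real list) \<Rightarrow> (real^3 \<Rightarrow> real) set" where
  "Vhat1 p \<Xi> = spline_space p \<Xi> arr1"

definition Vhat2 :: "(3 \<Rightarrow> nat) \<Rightarrow> (3 \<Rightarrow> real list) \<Rightarrow> (real^3 \<Rightarrow> real^3^3) set" where
  "Vhat2 p \<Xi> = {M. symmetric_on cube M \<and> (\<forall>i j. (\<lambda>x. M x $ i $ j) \<in> spline_space p \<Xi> (arr2 $ i $ j))}"

definition Vhat3 :: "(3 \<Rightarrow> nat) \<Rightarrow> (3 \<Rightarrow> real list) \<Rightarrow> (real^3 \<Rightarrow> real^3^3) set" where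
  "Vhat3 p \<Xi> = {M. tracefree_on cube M \<and> (\<forall>i j. (\<lambda>x. M x $ i $ j) \<in> spline_space p \<Xi> (arr3 $ i $ j))}"

definition Vhat4 :: "(3 \<Rightarrow> nat) \<Rightarrow> (3 \<Rightarrow> real list) \<Rightarrow> (real^3 \<Rightarrow> real^3) set" where
  "Vhat4 p \<Xi> = {v. \<forall>i. (\<lambda>x. v x $ i) \<in> spline_space p \<Xi> (arr4 $ i)}"

definition "V1 A b p \<Xi> = Y1 A b -` Vhat1 p \<Xi>"
definition "V2 A b p \<Xi> = Y2 A b -` Vhat2 p \<Xi>"
definition "V3 A b p \<Xi> = Y3 A b -` Vhat3 p \<Xi>"
definition "V4 A b p \<Xi> = Y4 A b -` Vhat4 p \<Xi>"


section \<open>Univariate projections\<close>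

definition perfect_bspline :: "nat \<Rightarrow> real \<Rightarrow> real" where
  "perfect_bspline p = bspline (\<lambda>k. - cos (real k * pi / real (p + 1))) p 0"

definition transition :: "nat \<Rightarrow> real \<Rightarrow> real" where
  "transition p x =
     (LINT t:{-1..x}|lebesgue. perfect_bspline p t) / (LINT t:{-1..1}|lebesgue. perfect_bspline p t)"

definition schumaker_g :: "(nat \<Rightarrow> real) \<Rightarrow> nat \<Rightarrow> nat \<Rightarrow> real \<Rightarrow> real" where
  "schumaker_g \<xi> p i \<tau> =
     transition p ((2 * \<tau> - \<xi> i - \<xi> (i + p + 1)) / (\<xi> (i + p + 1) - \<xi> i))"

definition schumaker_q :: "(nat \<Rightarrow> real) \<Rightarrow> nat \<Rightarrow> nat \<Rightarrow> real \<Rightarrow> real" where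
  "schumaker_q \<xi> p i \<tau> = (1 / fact p) * (\<Prod>k=1..p. \<tau> - \<xi> (i + k))"

text \<open>
  The derivative of order \<open>p + 1\<close> fails to exist at finitely many points, where \<open>deriv\<close> is
  unspecified; this does not affect the integral. The same remark applies to the second
  derivative in \<open>spline_proj_c2\<close> below, whose values matter only almost everywhere.
\<close>

definition schumaker_functional ::
  "(nat \<Rightarrow> real) \<Rightarrow> nat \<Rightarrow> nat \<Rightarrow> (real \<Rightarrow> real) \<Rightarrow> real" where
  "schumaker_functional \<xi> p i v =
     (LINT \<tau>:{\<xi> i..\<xi> (i + p + 1)}|lebesgue.
        v \<tau> * (deriv ^^ (p + 1)) (\<lambda>t. schumaker_g \<xi> p i t * schumaker_q \<xi> p i t) \<tau>)"

definition spline_proj :: "nat \<Rightarrow> real list \<Rightarrow> (real \<Rightarrow> real) \<Rightarrow> real \<Rightarrow> real" where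
  "spline_proj p \<Xi> v \<zeta> =
     (\<Sum>i<num_bsplines p \<Xi>. schumaker_functional ((!) \<Xi>) p i v * bspline ((!) \<Xi>) p i \<zeta>)"

definition spline_proj_c1 :: "nat \<Rightarrow> real list \<Rightarrow> (real \<Rightarrow> real) \<Rightarrow> real \<Rightarrow> real" where
  "spline_proj_c1 p \<Xi> v = deriv (spline_proj p \<Xi> (\<lambda>\<zeta>. LINT \<tau>:{0..\<zeta>}|lebesgue. v \<tau>))"

definition spline_proj_c2 :: "nat \<Rightarrow> real list \<Rightarrow> (real \<Rightarrow> real) \<Rightarrow> real \<Rightarrow> real" where
  "spline_proj_c2 p \<Xi> v =
     (deriv ^^ 2) (spline_proj p \<Xi> (\<lambda>\<zeta>. LINT \<tau>:{0..\<zeta>}|lebesgue. (LINT \<rho>:{0..\<tau>}|lebesgue. v \<rho>)))"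

definition spline_proj_order :: "nat \<Rightarrow> real list \<Rightarrow> nat \<Rightarrow> (real \<Rightarrow> real) \<Rightarrow> real \<Rightarrow> real" where
  "spline_proj_order p \<Xi> a =
     (if a = 0 then spline_proj p \<Xi>
      else if a = 1 then spline_proj_c1 p \<Xi>
      else spline_proj_c2 p \<Xi>)"


section \<open>Multivariate projections\<close>

text \<open>A univariate operator acting in direction \<open>d\<close>, the other variables being frozen.\<close>

definition in_direction ::
  "3 \<Rightarrow> ((real \<Rightarrow> real) \<Rightarrow> real \<Rightarrow> real) \<Rightarrow> (real^3 \<Rightarrow> real) \<Rightarrow> real^3 \<Rightarrow> real" where
  "in_direction d P f \<zeta> = P (\<lambda>t. f (\<chi> k. if k = d then t else \<zeta> $ k)) (\<zeta> $ d)"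

definition tensor_proj ::
  "(3 \<Rightarrow> nat) \<Rightarrow> (3 \<Rightarrow> real list) \<Rightarrow> nat^3 \<Rightarrow> (real^3 \<Rightarrow> real) \<Rightarrow> real^3 \<Rightarrow> real" where
  "tensor_proj p \<Xi> a =
     (let P = (\<lambda>d. in_direction d (spline_proj_order (p d) (\<Xi> d) (a $ d))) in P 1 \<circ> P 2 \<circ> P 3)"

definition Pihat1 :: "(3 \<Rightarrow> nat) \<Rightarrow> (3 \<Rightarrow> real list) \<Rightarrow> (real^3 \<Rightarrow> real) \<Rightarrow> real^3 \<Rightarrow> real" where
  "Pihat1 p \<Xi> = tensor_proj p \<Xi> arr1"

definition Pihat2 :: "(3 \<Rightarrow> nat) \<Rightarrow> (3 \<Rightarrow> real list) \<Rightarrow> (real^3 \<Rightarrow> real^3^3) \<Rightarrow> real^3 \<Rightarrow> real^3^3" where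
  "Pihat2 p \<Xi> M \<zeta> = (\<chi> i j. tensor_proj p \<Xi> (arr2 $ i $ j) (\<lambda>x. M x $ i $ j) \<zeta>)"

definition Pihat3 :: "(3 \<Rightarrow> nat) \<Rightarrow> (3 \<Rightarrow> real list) \<Rightarrow> (real^3 \<Rightarrow> real^3^3) \<Rightarrow> real^3 \<Rightarrow> real^3^3" where
  "Pihat3 p \<Xi> M \<zeta> = (\<chi> i j. tensor_proj p \<Xi> (arr3 $ i $ j) (\<lambda>x. M x $ i $ j) \<zeta>)"

definition Pihat4 :: "(3 \<Rightarrow> nat) \<Rightarrow> (3 \<Rightarrow> real list) \<Rightarrow> (real^3 \<Rightarrow> real^3) \<Rightarrow> real^3 \<Rightarrow> real^3" where
  "Pihat4 p \<Xi> v \<zeta> = (\<chi> i. tensor_proj p \<Xi> (arr4 $ i) (\<lambda>x. v x $ i) \<zeta>)"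

text \<open>For invertible \<open>A\<close> the pullbacks are bijections of the total functions, so \<open>inv\<close> applies.\<close>

definition "Pi1 A b p \<Xi> = inv (Y1 A b) \<circ> Pihat1 p \<Xi> \<circ> Y1 A b"
definition "Pi2 A b p \<Xi> = inv (Y2 A b) \<circ> Pihat2 p \<Xi> \<circ> Y2 A b"
definition "Pi3 A b p \<Xi> = inv (Y3 A b) \<circ> Pihat3 p \<Xi> \<circ> Y3 A b"
definition "Pi4 A b p \<Xi> = inv (Y4 A b) \<circ> Pihat4 p \<Xi> \<circ> Y4 A b"

end

theory Submission
  imports Defs
begin

text \<open>
  Fix one direction and an order \<open>a \<le> 2\<close>. The univariate projection of order \<open>a\<close> is an integral
  operator with the kernel \<open>k\<^sub>a(x,t) = \<Sum>\<^sub>i B\<^sub>i\<^sup>(\<^sup>a\<^sup>)(x) m\<^sub>i\<^sub>,\<^sub>a(t)\<close>: the functional \<open>\<lambda>\<^sub>i\<close> has a density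
  \<open>m\<^sub>i\<^sub>,\<^sub>0\<close>, and since integration over \<open>(t,1)\<close> is adjoint to integration over \<open>(0,t)\<close>, the primitives in
  the projections of positive order turn into iterated integrals \<open>m\<^sub>i\<^sub>,\<^sub>a\<close> of this density
  (\<open>spline_proj_order_kernel\<close>). Two properties of the kernels carry the proof. The identity
  \<open>\<partial>\<^sub>t k\<^sub>a = - \<partial>\<^sub>x k\<^sub>a\<^sub>-\<^sub>1\<close> holds by construction. For \<open>a > 0\<close> the kernel vanishes at \<open>t = 1\<close>, by construction,
  and at \<open>t = 0\<close>, where its value is the derivative of order \<open>a\<close> of the projection of a monomial of
  degree \<open>a - 1\<close>, and the projection reproduces linear functions (\<open>kernel_boundary\<close>). The reproduction
  of linear functions comes from the moments of order zero and one of \<open>\<lambda>\<^sub>i\<close>, which integration by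
  parts computes as one and the Greville abscissa (\<open>schumaker_density\<close>).
  
  On the cube, the projection of multi-order \<open>a\<close> has the product kernel at almost every point
  (\<open>tensor_proj_kernel\<close>). Let \<open>w\<close> be the weak divergence of a field \<open>u\<close> whose components vanish in the
  directions of order zero. The product kernel is a legitimate test function for this identity,
  because it has a bounded derivative and vanishes on the boundary in all directions that occur in it;
  weak identities extend to such products from smooth compactly supported ones
  (\<open>extend_tensor\<close>). The derivative that falls on the kernel becomes a derivative in \<open>x\<close> of
  the kernel with one order less. Hence the projection of multi-order \<open>a\<close> of \<open>w\<close> is the weak divergence of
  the field whose component \<open>k\<close> is the projection of multi-order \<open>a - e\<^sub>k\<close> of \<open>u\<^sub>k\<close>
  (\<open>tensor_proj_weak_div\<close>).
  
  Each component of the gradient, the curl and the divergence is the divergence of some field, whose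
  entries are up to signs entries of the argument. The arrays of multi-orders are made so that these
  entries have order \<open>a - e\<^sub>k\<close>, whence all three commutation relations on the cube. For the inclusions,
  the interior knots have multiplicity at most \<open>p - 1\<close>, so that the splines are continuously
  differentiable and their piecewise derivatives, which are splines, are weak derivatives
  (\<open>spline_space_derivative\<close>). Finally, the pullbacks are the transformations under which the
  operators are invariant for an affine map (\<open>hessian_iff\<close>, \<open>curl_iff\<close>, \<open>div_iff\<close>), which transfers
  everything to the physical domain.
\<close>


section \<open>B-splines, their derivatives and the reproduction of linear functions\<close>

lemma bspline_cong:
  assumes "\<And>j. i \<le> j \<Longrightarrow> j \<le> i + q + 1 \<Longrightarrow> \<xi> j = \<eta> j"
  shows "bspline \<xi> q i x = bspline \<eta> q i x"
  using assms by (induction q arbitrary: i) auto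

lemma bspline_shift: "bspline (\<lambda>j. \<xi> (j + a)) q i x = bspline \<xi> q (i + a) x"
  by (induction q arbitrary: i) (auto simp: algebra_simps)

lemma bspline_eq_0:
  assumes "mono \<xi>" "x < \<xi> i \<or> \<xi> (i + q + 1) \<le> x"
  shows "bspline \<xi> q i x = 0"
  using assms(2)
proof (induction q arbitrary: i)
  case (Suc q)
  have "\<xi> i \<le> \<xi> (i+1)" "\<xi> (i+q+1) \<le> \<xi> (i+q+2)"
    using assms(1) by (auto intro: monoD)
  then have "x < \<xi> i \<or> \<xi> (i + q + 1) \<le> x" "x < \<xi> (i+1) \<or> \<xi> (i + 1 + q + 1) \<le> x"
    using Suc.prems by auto
  then have "bspline \<xi> q i x = 0" "bspline \<xi> q (i+1) x = 0"
    using Suc.IH by blast+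
  then show ?case by simp
qed auto

lemma bspline_range:
  assumes "mono \<xi>"
  shows "0 \<le> bspline \<xi> q i x \<and> bspline \<xi> q i x \<le> 2 ^ q"
proof (induction q arbitrary: i)
  case (Suc q)
  have *: "0 \<le> c * bspline \<xi> q j x \<and> c * bspline \<xi> q j x \<le> 2 ^ q"
    if "\<xi> j \<le> x \<and> x < \<xi> (j+q+1) \<Longrightarrow> 0 \<le> c \<and> c \<le> 1" for c j
  proof (cases "\<xi> j \<le> x \<and> x < \<xi> (j+q+1)")
    case True
    then have "0 \<le> c" "c \<le> 1" using that by auto
    moreover have "c * bspline \<xi> q j x \<le> 1 * 2 ^ q"
      using calculation Suc.IH[of j] by (intro mult_mono) auto
    ultimately show ?thesis using Suc.IH[of j] by auto
  next
    case False
    then show ?thesis using bspline_eq_0[OF assms, of x j q] by force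
  qed
  have "0 \<le> (x - \<xi> i) / (\<xi> (i + q + 1) - \<xi> i) * bspline \<xi> q i x
      \<and> (x - \<xi> i) / (\<xi> (i + q + 1) - \<xi> i) * bspline \<xi> q i x \<le> 2 ^ q"
    by (rule *) (auto simp: divide_simps)
  moreover have "0 \<le> (\<xi> (i + q + 2) - x) / (\<xi> (i + q + 2) - \<xi> (i + 1)) * bspline \<xi> q (i+1) x
      \<and> (\<xi> (i + q + 2) - x) / (\<xi> (i + q + 2) - \<xi> (i + 1)) * bspline \<xi> q (i+1) x \<le> 2 ^ q"
    by (rule *) (auto simp: divide_simps)
  ultimately show ?case by auto
qed auto

lemma bspline_pos:
  assumes "mono \<xi>" "\<xi> i < x" "x < \<xi> (i + 1)"
  shows "bspline \<xi> q i x > 0"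
proof (induction q)
  case (Suc q)
  have "\<xi> (i+1) \<le> \<xi> (i+q+1)" using assms(1) by (auto intro: monoD)
  then have "(x - \<xi> i) / (\<xi> (i + q + 1) - \<xi> i) > 0" using assms by auto
  moreover have "bspline \<xi> q (i+1) x = 0" using assms by (intro bspline_eq_0) auto
  ultimately show ?case
    unfolding bspline.simps using mult_pos_pos[OF _ Suc] by (simp del: times_divide_eq_left)
qed (use assms in auto)

lemma bspline_measurable[measurable]: "bspline \<xi> q i \<in> borel_measurable borel"
proof (induction q arbitrary: i)
  case 0
  have "bspline \<xi> 0 i = (\<lambda>x. indicator {\<xi> i..<\<xi> (i+1)} x)" by (auto simp: indicator_def)
  then show ?case by simp
next
  case (Suc q)
  note [measurable] = Suc.IH
  have "bspline \<xi> (Suc q) i = (\<lambda>x. (x - \<xi> i) / (\<xi> (i + q + 1) - \<xi> i) * bspline \<xi> q i x +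
     (\<xi> (i + q + 2) - x) / (\<xi> (i + q + 2) - \<xi> (i + 1)) * bspline \<xi> q (i + 1) x)" by auto
  then show ?case by simp
qed

text \<open>
  The derivative of order \<open>a\<close> of a B-spline, given by the difference formula for derivatives of
  B-splines. As in the Cox--de Boor recursion, terms with coinciding knots vanish by 0/0 = 0.
\<close>

fun bspline_deriv :: "(nat \<Rightarrow> real) \<Rightarrow> nat \<Rightarrow> nat \<Rightarrow> nat \<Rightarrow> real \<Rightarrow> real" where
  "bspline_deriv \<xi> 0 q i x = bspline \<xi> q i x"
| "bspline_deriv \<xi> (Suc a) 0 i x = 0"
| "bspline_deriv \<xi> (Suc a) (Suc q) i x = (real q + 1) *
     (bspline_deriv \<xi> a q i x / (\<xi> (i + q + 1) - \<xi> i) -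
      bspline_deriv \<xi> a q (i + 1) x / (\<xi> (i + q + 2) - \<xi> (i + 1)))"

lemma bspline_deriv_fun:
  "bspline_deriv \<xi> 0 q i = bspline \<xi> q i"
  "bspline_deriv \<xi> (Suc a) 0 i = (\<lambda>_. 0)"
  "bspline_deriv \<xi> (Suc a) (Suc q) i = (\<lambda>x. (real q + 1) *
     (bspline_deriv \<xi> a q i x / (\<xi> (i + q + 1) - \<xi> i) -
      bspline_deriv \<xi> a q (i + 1) x / (\<xi> (i + q + 2) - \<xi> (i + 1))))"
  by auto

lemma bspline_deriv_measurable[measurable]: "bspline_deriv \<xi> a q i \<in> borel_measurable borel"
proof (induction a arbitrary: q i)
  case 0
  then show ?case by (simp only: bspline_deriv_fun bspline_measurable)
next
  case (Suc a)
  note [measurable] = Suc.IH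
  show ?case by (cases q) (simp_all only: bspline_deriv_fun, measurable)
qed

lemma bspline_deriv_bounded:
  assumes "mono \<xi>"
  shows "\<exists>C. \<forall>x. \<bar>bspline_deriv \<xi> a q i x\<bar> \<le> C"
proof (induction a arbitrary: q i)
  case 0
  then show ?case using bspline_range[OF assms, of q i] by (auto intro!: exI[of _ "2 ^ q"])
next
  case (Suc a)
  show ?case
  proof (cases q)
    case 0
    then show ?thesis by (intro exI[of _ 0]) auto
  next
    case (Suc r)
    obtain C D where C: "\<And>x. \<bar>bspline_deriv \<xi> a r i x\<bar> \<le> C" "\<And>x. \<bar>bspline_deriv \<xi> a r (i+1) x\<bar> \<le> D"
      using Suc.IH[of r] by blast
    have "\<bar>bspline_deriv \<xi> (Suc a) q i x\<bar> \<le> (real r + 1) *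
       (C / \<bar>\<xi> (i + r + 1) - \<xi> i\<bar> + D / \<bar>\<xi> (i + r + 2) - \<xi> (i + 1)\<bar>)" for x
      unfolding Suc bspline_deriv.simps abs_mult
      by (intro mult_mono order.trans[OF abs_triangle_ineq4] add_mono)
        (auto simp: abs_divide intro!: divide_right_mono C(1)[simplified] C(2)[simplified])
    then show ?thesis by blast
  qed
qed

text \<open>
  Differentiating the Cox--de Boor recursion yields B-splines of lower degree \<open>q\<close>, from the weights,
  and derivatives of such B-splines. The latter regroup to \<open>q\<close> times the difference quotient that the
  former consist of, which gives the factor \<open>q + 1\<close>.
\<close>

lemma bspline_deriv_1:
  assumes "mono \<xi>" "x \<notin> range \<xi>"
  shows "(bspline \<xi> q i has_real_derivative bspline_deriv \<xi> 1 q i x) (at x)"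
proof (induction q arbitrary: i)
  case 0
  have "\<forall>\<^sub>F y in nhds x. bspline \<xi> 0 i y = bspline \<xi> 0 i x"
  proof (cases "x < \<xi> i \<or> \<xi> (i+1) < x")
    case True
    then have "\<forall>\<^sub>F y in nhds x. y \<in> {..<\<xi> i} \<union> {\<xi> (i+1)<..}"
      by (intro eventually_nhds_in_open) auto
    then show ?thesis by eventually_elim (use True in auto)
  next
    case False
    then have "\<xi> i < x" "x < \<xi> (i+1)" using assms(2) by (metis linorder_neqE range_eqI)+
    then have "\<forall>\<^sub>F y in nhds x. \<xi> i < y \<and> y < \<xi> (i+1)"
      using order_tendstoD[of "\<lambda>y. y" x "nhds x"] by (auto simp: eventually_conj_iff intro: filterlim_ident)
    then show ?thesis by eventually_elim (use \<open>\<xi> i < x\<close> \<open>x < \<xi> (i+1)\<close> in auto)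
  qed
  then have "(bspline \<xi> 0 i has_real_derivative 0) (at x)"
    using DERIV_cong_ev[of x x "bspline \<xi> 0 i" "\<lambda>_. bspline \<xi> 0 i x" 0 0] by auto
  then show ?case by (simp del: bspline.simps)
next
  case (Suc q)
  let ?d = "\<lambda>i. \<xi> (i+q+1) - \<xi> i"
  let ?B = "\<lambda>i. bspline \<xi> q i x" and ?D = "\<lambda>i. bspline_deriv \<xi> 1 q i x"
  have fe: "bspline \<xi> (Suc q) i = (\<lambda>x. (x - \<xi> i) / ?d i * bspline \<xi> q i x +
     (\<xi> (i + q + 2) - x) / ?d (i+1) * bspline \<xi> q (i + 1) x)" by auto
  have der: "(bspline \<xi> (Suc q) i has_real_derivative
      (1 / ?d i * ?B i + (x - \<xi> i) / ?d i * ?D i) +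
      ((-1) / ?d (i+1) * ?B (i+1) + (\<xi> (i + q + 2) - x) / ?d (i+1) * ?D (i+1))) (at x)"
  proof -
    have *: "((\<lambda>x. (x - s) * k * bspline \<xi> q j x) has_real_derivative
        k * ?B j + (x - s) * k * ?D j) (at x)"
      "((\<lambda>x. (s - x) * k * bspline \<xi> q j x) has_real_derivative
        (-1) * k * ?B j + (s - x) * k * ?D j) (at x)" for s k j
      by (rule derivative_eq_intros Suc.IH refl | simp)+
    show ?thesis unfolding fe divide_inverse mult_1_left by (intro DERIV_add *)
  qed
  have eq: "(x - \<xi> i) / ?d i * ?D i + (\<xi> (i + q + 2) - x) / ?d (i+1) * ?D (i+1)
      = real q * (?B i / ?d i - ?B (i+1) / ?d (i+1))"
  proof (cases q)
    case (Suc r)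
    let ?e = "\<lambda>i. \<xi> (i+r+1) - \<xi> i" and ?b = "\<lambda>i. bspline \<xi> r i x"
    have m: "\<xi> i \<le> \<xi> (i+1)" "\<xi> (i+1) \<le> \<xi> (i+r+2)" "\<xi> (i+r+2) \<le> \<xi> (i+r+3)" "\<xi> (i+2) \<le> \<xi> (i+r+3)"
      "\<xi> (i+1) \<le> \<xi> (i+2)" "\<xi> i \<le> \<xi> (i+r+1)" "\<xi> (i+r+1) \<le> \<xi> (i+r+2)"
      using assms(1) by (auto intro: monoD)
    define b0 b1 b2 where "b0 = (if ?e i = 0 then 0 else ?b i / ?e i)"
      and "b1 = (if ?e (i+1) = 0 then 0 else ?b (i+1) / ?e (i+1))"
      and "b2 = (if ?e (i+2) = 0 then 0 else ?b (i+2) / ?e (i+2))"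
    have D: "?D i = real q * (b0 - b1)" "?D (i+1) = real q * (b1 - b2)"
      using Suc unfolding b0_def b1_def b2_def by (auto simp: numeral_2_eq_2 numeral_3_eq_3)
    have B: "?B i = (x - \<xi> i) * b0 + (\<xi> (i+r+2) - x) * b1"
      "?B (i+1) = (x - \<xi> (i+1)) * b1 + (\<xi> (i+r+3) - x) * b2"
      using Suc unfolding b0_def b1_def b2_def by (auto simp: numeral_2_eq_2 numeral_3_eq_3)
    have z: "?d i = 0 \<Longrightarrow> b0 = 0" "?d i = 0 \<Longrightarrow> b1 = 0" "?d (i+1) = 0 \<Longrightarrow> b1 = 0" "?d (i+1) = 0 \<Longrightarrow> b2 = 0"
      unfolding b0_def b1_def b2_def using m Suc by (auto simp: numeral_2_eq_2 numeral_3_eq_3)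
    have "?D i * (x - \<xi> i) / ?d i = real q * ((x - \<xi> i) * b0 + (\<xi> (i+r+2) - x) * b1) / ?d i - real q * b1"
    proof (cases "?d i = 0")
      case False
      then show ?thesis unfolding D using Suc by (simp add: field_simps)
    qed (use z in \<open>simp add: D\<close>)
    moreover have "?D (i+1) * (\<xi> (i + q + 2) - x) / ?d (i+1)
        = real q * b1 - real q * ((x - \<xi> (i+1)) * b1 + (\<xi> (i+r+3) - x) * b2) / ?d (i+1)"
    proof (cases "?d (i+1) = 0")
      case False
      then show ?thesis unfolding D using Suc by (simp add: field_simps numeral_3_eq_3)
    qed (use z in \<open>simp add: D\<close>)
    ultimately show ?thesis unfolding B by (simp add: algebra_simps)
  qed simp
  have rearrange: "(a + b) + (c + d) = (a + c) + (b + d)" for a b c d :: real by simp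
  show ?case
    by (rule DERIV_cong[OF der], subst rearrange, subst eq) (simp add: algebra_simps add_divide_distrib)
qed

lemma bspline_deriv_deriv:
  assumes "mono \<xi>" "x \<notin> range \<xi>"
  shows "(bspline_deriv \<xi> a q i has_real_derivative bspline_deriv \<xi> (Suc a) q i x) (at x)"
proof (induction a arbitrary: q i)
  case 0
  have "bspline_deriv \<xi> 0 q i = bspline \<xi> q i" by auto
  then show ?case using bspline_deriv_1[OF assms] by simp
next
  case (Suc a)
  show ?case
  proof (cases q)
    case 0
    have "bspline_deriv \<xi> (Suc a) 0 i = (\<lambda>_. 0)" by auto
    then show ?thesis using 0 by simp
  next
    case (Suc r)
    have fe: "bspline_deriv \<xi> (Suc a) (Suc r) i = (\<lambda>x. (real r + 1) *
     (bspline_deriv \<xi> a r i x / (\<xi> (i + r + 1) - \<xi> i) -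
      bspline_deriv \<xi> a r (i + 1) x / (\<xi> (i + r + 2) - \<xi> (i + 1))))" by auto
    show ?thesis unfolding Suc fe
      by (rule derivative_eq_intros Suc.IH refl DERIV_cdivide | simp)+
  qed
qed

text \<open>The same recursion with left-continuous indicators computes the left limits of B-splines.\<close>

fun bspline_left :: "(nat \<Rightarrow> real) \<Rightarrow> nat \<Rightarrow> nat \<Rightarrow> real \<Rightarrow> real" where
  "bspline_left \<xi> 0 i x = (if \<xi> i < x \<and> x \<le> \<xi> (i + 1) then 1 else 0)"
| "bspline_left \<xi> (Suc q) i x =
     (x - \<xi> i) / (\<xi> (i + q + 1) - \<xi> i) * bspline_left \<xi> q i x +
     (\<xi> (i + q + 2) - x) / (\<xi> (i + q + 2) - \<xi> (i + 1)) * bspline_left \<xi> q (i + 1) x"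

lemma bspline_left_limit: "(bspline \<xi> q i \<longlongrightarrow> bspline_left \<xi> q i x) (at_left x)"
proof (induction q arbitrary: i)
  case 0
  have lt: "\<forall>\<^sub>F y in at_left x. y < x" by (auto simp: eventually_at_filter)
  have gt: "\<forall>\<^sub>F y in at_left x. c < y" if "c < x" for c
    using that order_tendstoD(1)[OF tendsto_ident_at] by blast
  have "\<forall>\<^sub>F y in at_left x. bspline \<xi> 0 i y = bspline_left \<xi> 0 i x"
  proof (cases "x \<le> \<xi> i")
    case True
    then show ?thesis using lt by (auto elim: eventually_mono)
  next
    case False
    show ?thesis
    proof (cases "x \<le> \<xi> (i+1)")
      case True
      show ?thesis using lt gt[of "\<xi> i"] False True by (auto elim: eventually_elim2)
    next
      case F: False
      then show ?thesis using gt[of "\<xi> (i+1)"] by (auto elim: eventually_mono)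
    qed
  qed
  then show ?case by (rule tendsto_eventually)
next
  case (Suc q)
  have "bspline \<xi> (Suc q) i = (\<lambda>x. (x - \<xi> i) / (\<xi> (i + q + 1) - \<xi> i) * bspline \<xi> q i x +
     (\<xi> (i + q + 2) - x) / (\<xi> (i + q + 2) - \<xi> (i + 1)) * bspline \<xi> q (i + 1) x)" by auto
  then show ?case unfolding bspline_left.simps divide_inverse by (auto intro!: tendsto_intros Suc.IH)
qed

lemma bspline_right_limit: "(bspline \<xi> q i \<longlongrightarrow> bspline \<xi> q i x) (at_right x)"
proof (induction q arbitrary: i)
  case 0
  have gt: "\<forall>\<^sub>F y in at_right x. x < y" by (auto simp: eventually_at_filter)
  have lt: "\<forall>\<^sub>F y in at_right x. y < c" if "x < c" for c
    using that order_tendstoD(2)[OF tendsto_ident_at] by blast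
  have "\<forall>\<^sub>F y in at_right x. bspline \<xi> 0 i y = bspline \<xi> 0 i x"
  proof (cases "x < \<xi> i")
    case True
    then show ?thesis using lt[OF True] by (auto elim: eventually_mono)
  next
    case False
    show ?thesis
    proof (cases "x < \<xi> (i+1)")
      case True
      show ?thesis using gt lt[OF True] False True by (auto elim: eventually_elim2)
    next
      case F: False
      then show ?thesis using gt by (auto elim: eventually_mono)
    qed
  qed
  then show ?case by (rule tendsto_eventually)
next
  case (Suc q)
  have "bspline \<xi> (Suc q) i = (\<lambda>x. (x - \<xi> i) / (\<xi> (i + q + 1) - \<xi> i) * bspline \<xi> q i x +
     (\<xi> (i + q + 2) - x) / (\<xi> (i + q + 2) - \<xi> (i + 1)) * bspline \<xi> q (i + 1) x)" by auto
  then show ?case unfolding bspline.simps divide_inverse by (auto intro!: tendsto_intros Suc.IH)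
qed

text \<open>
  At a knot of multiplicity \<open>q + 1\<close> exactly two neighbouring B-splines of degree \<open>q\<close> jump, one from
  one to zero and the other from zero to one.
\<close>

lemma bspline_at_full_knot:
  assumes "mono \<xi>" "\<xi> (i + 1) = x" "\<xi> (i + q + 1) = x"
  shows "bspline \<xi> q i x = 0" "\<xi> i < x \<Longrightarrow> bspline_left \<xi> q i x = 1"
    "x < \<xi> (i + q + 2) \<Longrightarrow> bspline \<xi> q (i + 1) x = 1" "bspline_left \<xi> q (i + 1) x = 0"
proof -
  have eq: "\<xi> j = x" if "i + 1 \<le> j" "j \<le> i + q + 1" for j
    using monoD[OF assms(1) that(1)] monoD[OF assms(1) that(2)] assms by auto
  show "bspline \<xi> q i x = 0" using assms by (intro bspline_eq_0) auto
  show "bspline_left \<xi> q i x = 1" if "\<xi> i < x"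
    using eq
  proof (induction q)
    case (Suc q)
    have "\<xi> (i+1) = x" "\<xi> (i+q+1) = x" "\<xi> (i+q+2) = x" using Suc.prems by auto
    then show ?case using Suc.IH Suc.prems that by simp
  qed (use that in auto)
  have L0: "bspline_left \<xi> r j x = 0" if "i + 1 \<le> j" "j + r \<le> i + q + 1" for r j
    using that
  proof (induction r arbitrary: j)
    case 0
    then show ?case using eq[of j] by simp
  next
    case (Suc r)
    have "\<xi> j = x" "\<xi> (j+1) = x" using eq Suc.prems by auto
    then show ?case using Suc.IH[of "j+1"] Suc.prems by simp
  qed
  show "bspline_left \<xi> q (i + 1) x = 0" by (rule L0) auto
  show "bspline \<xi> q (i + 1) x = 1" if "x < \<xi> (i + q + 2)"
    using that eq
  proof (induction q arbitrary: i)
    case (Suc q)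
    have a: "\<xi> (i+1) = x" "\<xi> (i+q+2) = x" "\<xi> (i+2) = x" using Suc.prems by auto
    have "bspline \<xi> q (i + 1 + 1) x = 1"
      using Suc.prems by (intro Suc.IH) (auto simp: algebra_simps)
    then show ?case using a Suc.prems(1) by (simp add: numeral_3_eq_3)
  qed auto
qed

text \<open>
  A B-spline of degree \<open>q\<close> is continuous at a point that is not a knot of multiplicity \<open>q + 1\<close>:
  both one-sided limits satisfy the same recursion, and the only jumps that occur in the course of
  the recursion either are multiplied by a vanishing factor or come in two neighbouring B-splines
  with opposite signs.
\<close>

lemma bspline_left_eq:
  assumes "mono \<xi>" "\<not> (\<xi> i = x \<and> \<xi> (i + q) = x)" "\<not> (\<xi> (i + 1) = x \<and> \<xi> (i + q + 1) = x)"
  shows "bspline_left \<xi> q i x = bspline \<xi> q i x"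
  using assms(2,3)
proof (induction q arbitrary: i)
  case 0
  then show ?case using monoD[OF assms(1), of i "i+1"] by auto
next
  case (Suc q)
  let ?a = "(x - \<xi> i) / (\<xi> (i + q + 1) - \<xi> i)"
  let ?b = "(\<xi> (i + q + 2) - x) / (\<xi> (i + q + 2) - \<xi> (i + 1))"
  show ?case
  proof (cases "\<xi> (i+1) = x \<and> \<xi> (i+q+1) = x")
    case True
    then have ne: "\<xi> i \<noteq> x" "\<xi> (i+q+2) \<noteq> x" using Suc.prems by (auto simp: numeral_2_eq_2)
    moreover have "\<xi> i \<le> \<xi> (i+1)" "\<xi> (i+q+1) \<le> \<xi> (i+q+2)"
      using assms(1) by (auto intro: monoD)
    ultimately have "\<xi> i < x" "x < \<xi> (i+q+2)" using True by auto
    then show ?thesis using bspline_at_full_knot[OF assms(1), of i x q] True by simp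
  next
    case False
    have "?a * bspline_left \<xi> q i x = ?a * bspline \<xi> q i x"
    proof (cases "\<xi> i = x")
      case n: False
      then show ?thesis using Suc.IH[of i] False by auto
    qed simp
    moreover have "?b * bspline_left \<xi> q (i+1) x = ?b * bspline \<xi> q (i+1) x"
    proof (cases "\<xi> (i+q+2) = x")
      case n: False
      then show ?thesis using Suc.IH[of "i+1"] False by (auto simp: numeral_2_eq_2)
    qed simp
    ultimately show ?thesis unfolding bspline.simps bspline_left.simps by (rule arg_cong2)
  qed
qed

lemma bspline_isCont:
  assumes "mono \<xi>" "\<not> (\<xi> i = x \<and> \<xi> (i + q) = x)" "\<not> (\<xi> (i + 1) = x \<and> \<xi> (i + q + 1) = x)"
  shows "isCont (bspline \<xi> q i) x"
  unfolding isCont_def filterlim_at_split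
  using bspline_left_limit[of \<xi> q i x] bspline_right_limit[of \<xi> q i x] bspline_left_eq[OF assms] by auto

lemma bspline_deriv_isCont:
  assumes "mono \<xi>" "a \<le> q" "\<And>j. \<not> (\<xi> j = x \<and> \<xi> (j + (q - a)) = x)"
  shows "isCont (bspline_deriv \<xi> a q i) x"
  using assms(2,3)
proof (induction a arbitrary: q i)
  case 0
  have "isCont (bspline \<xi> q i) x"
    using 0 by (intro bspline_isCont[OF assms(1)]) (auto, metis add_Suc)
  moreover have "bspline_deriv \<xi> 0 q i = bspline \<xi> q i" by auto
  ultimately show ?case by simp
next
  case (Suc a)
  then obtain r where q: "q = Suc r" by (cases q) auto
  have fe: "bspline_deriv \<xi> (Suc a) (Suc r) i = (\<lambda>x. (real r + 1) *
     (bspline_deriv \<xi> a r i x / (\<xi> (i + r + 1) - \<xi> i) -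
      bspline_deriv \<xi> a r (i + 1) x / (\<xi> (i + r + 2) - \<xi> (i + 1))))" by auto
  show ?case unfolding q fe divide_inverse
    using Suc q by (intro continuous_intros Suc.IH) auto
qed

text \<open>
  One step of the Cox--de Boor recursion replaces coefficients by convex combinations of neighbouring
  ones. Constant coefficients stay constant, which gives the partition of unity; the sums of the
  inner knots lose one knot and gain the term \<open>x\<close>, which gives the Greville representation of the identity.
\<close>

lemma bspline_sum_recursion:
  assumes "mono \<xi>" "Suc q \<le> m" "\<xi> m \<le> x" "x < \<xi> M"
  shows "(\<Sum>i=m - Suc q..<M. c i * bspline \<xi> (Suc q) i x)
    = (\<Sum>i=m - q..<M. (c i * ((x - \<xi> i) / (\<xi> (i + q + 1) - \<xi> i)) +
        c (i - 1) * (1 - (x - \<xi> i) / (\<xi> (i + q + 1) - \<xi> i))) * bspline \<xi> q i x)"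
proof -
  let ?w = "\<lambda>i. (x - \<xi> i) / (\<xi> (i + q + 1) - \<xi> i)"
  let ?B = "\<lambda>i. bspline \<xi> q i x"
  have mM: "m < M" using assms(1,3,4) by (metis linorder_not_less monoD order.trans)
  have w: "(\<xi> (i + q + 1) - x) / (\<xi> (i + q + 1) - \<xi> i) * ?B i = (1 - ?w i) * ?B i" for i
  proof (cases "\<xi> (i+q+1) = \<xi> i")
    case True
    then have "?B i = 0" using bspline_eq_0[OF assms(1), of x i q] by force
    then show ?thesis by simp
  next
    case False
    then show ?thesis by (simp add: field_simps)
  qed
  have lo: "?B (m - Suc q) = 0"
    using assms by (intro bspline_eq_0) (auto simp: Suc_diff_le)
  have hi: "?B M = 0" using assms by (intro bspline_eq_0) auto
  have "(\<Sum>i=m - Suc q..<M. c i * bspline \<xi> (Suc q) i x)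
      = (\<Sum>i=m - Suc q..<M. c i * ?w i * ?B i)
        + (\<Sum>i=m - Suc q..<M. c i * ((1 - ?w (i+1)) * ?B (i+1)))"
    unfolding sum.distrib[symmetric] w[symmetric] by (intro sum.cong) (auto simp: algebra_simps)
  also have "(\<Sum>i=m - Suc q..<M. c i * ?w i * ?B i) = (\<Sum>i=m - q..<M. c i * ?w i * ?B i)"
    using mM lo assms(2) by (subst sum.atLeast_Suc_lessThan) (auto simp: Suc_diff_Suc)
  also have "(\<Sum>i=m - Suc q..<M. c i * ((1 - ?w (i+1)) * ?B (i+1)))
      = (\<Sum>i=m - q..<Suc M. c (i-1) * ((1 - ?w i) * ?B i))"
    using assms(2) mM by (intro sum.reindex_bij_witness[of _ "\<lambda>i. i - 1" "\<lambda>i. i + 1"]) auto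
  also have "\<dots> = (\<Sum>i=m - q..<M. c (i-1) * ((1 - ?w i) * ?B i))"
    using mM hi by auto
  finally show ?thesis
    unfolding sum.distrib[symmetric] by (simp add: algebra_simps)
qed

lemma bspline_partition_of_unity:
  assumes "mono \<xi>" "q \<le> m" "\<xi> m \<le> x" "x < \<xi> M"
  shows "(\<Sum>i=m - q..<M. bspline \<xi> q i x) = 1"
  using assms(2)
proof (induction q)
  case 0
  define S where "S = {i. m \<le> i \<and> \<xi> i \<le> x}"
  have lt: "i < M" if "\<xi> i \<le> x" for i
    using that assms(1,4) by (metis linorder_not_less monoD order.trans)
  then have fin: "finite S" and mS: "m \<in> S"
    unfolding S_def using assms by (auto intro: finite_subset[of _ "{..<M}"])
  define k where "k = Max S"
  have k: "k \<in> S" "\<And>i. i \<in> S \<Longrightarrow> i \<le> k" unfolding k_def using Max_in[OF fin] mS Max_ge[OF fin] by blast+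
  have "x < \<xi> (k+1)" using k(2)[of "k+1"] k(1) unfolding S_def by force
  then have "bspline \<xi> 0 i x = (if i = k then 1 else 0)" for i
  proof -
    have "\<xi> i \<le> x \<and> x < \<xi> (i+1) \<longleftrightarrow> i = k"
    proof
      assume *: "\<xi> i \<le> x \<and> x < \<xi> (i+1)"
      have "i < k + 1" using * \<open>x < \<xi> (k+1)\<close> by (metis assms(1) linorder_not_less monoD order.trans)
      moreover have "k < i + 1" using * k(1) unfolding S_def
        by (metis (mono_tags, lifting) assms(1) linorder_not_less mem_Collect_eq monoD order.trans)
      ultimately show "i = k" by simp
    qed (use k(1) \<open>x < \<xi> (k+1)\<close> in \<open>auto simp: S_def\<close>)
    then show ?thesis by simp
  qed
  then show ?case using k(1) lt[of k] by (auto simp: S_def)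
next
  case (Suc q)
  have "(\<Sum>i=m - Suc q..<M. 1 * bspline \<xi> (Suc q) i x) = (\<Sum>i=m - q..<M. bspline \<xi> q i x)"
    unfolding bspline_sum_recursion[OF assms(1) Suc.prems assms(3,4), of "\<lambda>_. 1"] by simp
  then show ?case using Suc by simp
qed

lemma bspline_greville:
  assumes "mono \<xi>" "q \<le> m" "\<xi> m \<le> x" "x < \<xi> M"
  shows "(\<Sum>i=m - q..<M. (\<Sum>k=1..q. \<xi> (i + k)) * bspline \<xi> q i x) = real q * x"
  using assms(2)
proof (induction q)
  case (Suc q)
  let ?w = "\<lambda>i. (x - \<xi> i) / (\<xi> (i + q + 1) - \<xi> i)"
  have *: "((\<Sum>k=1..Suc q. \<xi> (i + k)) * ?w i + (\<Sum>k=1..Suc q. \<xi> (i - 1 + k)) * (1 - ?w i)) * bspline \<xi> q i x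
     = (\<Sum>k=1..q. \<xi> (i + k)) * bspline \<xi> q i x + x * bspline \<xi> q i x" if "i \<ge> m - q" for i
  proof (cases "\<xi> (i+q+1) = \<xi> i")
    case True
    then have "bspline \<xi> q i x = 0" using bspline_eq_0[OF assms(1), of x i q] by force
    then show ?thesis by simp
  next
    case False
    have "i \<ge> 1" using that Suc.prems by simp
    then have "(\<Sum>k=1..Suc q. \<xi> (i - 1 + k)) = (\<Sum>k=0..q. \<xi> (i + k))"
      by (intro sum.reindex_bij_witness[of _ "\<lambda>k. k + 1" "\<lambda>k. k - 1"]) auto
    also have "\<dots> = \<xi> i + (\<Sum>k=1..q. \<xi> (i + k))" by (simp add: sum.atLeast_Suc_atMost)
    finally have 1: "(\<Sum>k=1..Suc q. \<xi> (i - 1 + k)) = \<xi> i + (\<Sum>k=1..q. \<xi> (i + k))" .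
    have 2: "(\<Sum>k=1..Suc q. \<xi> (i + k)) = \<xi> (i+q+1) + (\<Sum>k=1..q. \<xi> (i + k))" by simp
    define w where "w = ?w i"
    have "\<xi> (i+q+1) * w + \<xi> i * (1 - w) = x"
    proof -
      have "w * (\<xi> (i+q+1) - \<xi> i) = x - \<xi> i" using False by (simp add: w_def)
      then show ?thesis by (simp only: algebra_simps)
    qed
    then have x: "x = \<xi> (i+q+1) * w + \<xi> i * (1 - w)" by simp
    show ?thesis unfolding 1 2 w_def[symmetric] by (subst (3) x) (simp only: algebra_simps)
  qed
  have "(\<Sum>i=m - Suc q..<M. (\<Sum>k=1..Suc q. \<xi> (i + k)) * bspline \<xi> (Suc q) i x)
     = (\<Sum>i=m - q..<M. (\<Sum>k=1..q. \<xi> (i + k)) * bspline \<xi> q i x + x * bspline \<xi> q i x)"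
    unfolding bspline_sum_recursion[OF assms(1) Suc.prems assms(3,4), of "\<lambda>i. \<Sum>k=1..Suc q. \<xi> (i + k)"]
    by (intro sum.cong refl *) auto
  also have "\<dots> = real q * x + x * (\<Sum>i=m - q..<M. bspline \<xi> q i x)"
    using Suc by (simp add: sum.distrib sum_distrib_left)
  also have "\<dots> = real (Suc q) * x"
    using bspline_partition_of_unity[OF assms(1) _ assms(3,4)] Suc.prems by (simp add: algebra_simps)
  finally show ?case .
qed simp

section \<open>Calculus tools\<close>

lemma lebesgue_measurable_AE:
  fixes f g :: "'a::euclidean_space \<Rightarrow> 'b::topological_space"
  assumes "f \<in> borel_measurable borel" "AE x in lborel. g x = f x"
  shows "g \<in> borel_measurable lebesgue"
proof (rule measurableI)
  fix A :: "'b set" assume "A \<in> sets borel"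
  then have 1: "f -` A \<inter> space lebesgue \<in> sets lebesgue"
    using assms(1) by (intro measurable_sets[OF measurable_completion]) auto
  have 2: "AE x in lebesgue. x \<in> f -` A \<inter> space lebesgue \<longleftrightarrow> x \<in> g -` A \<inter> space lebesgue"
    using AE_completion[OF assms(2)] by eventually_elim auto
  show "g -` A \<inter> space lebesgue \<in> sets lebesgue"
    by (rule completion.in_sets_AE[OF 2 1]) simp
qed simp

lemma lebesgue_integral_AE_borel:
  fixes f g :: "'a::euclidean_space \<Rightarrow> 'b::{banach, second_countable_topology}"
  assumes "f \<in> borel_measurable borel" "AE x in lborel. g x = f x"
  shows "integral\<^sup>L lebesgue g = integral\<^sup>L lborel f"
proof -
  have f: "f \<in> borel_measurable lborel" using assms(1) by simp
  have "integral\<^sup>L lebesgue g = integral\<^sup>L lebesgue f"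
    by (rule integral_cong_AE[OF lebesgue_measurable_AE[OF assms] measurable_completion[OF f] AE_completion[OF assms(2)]])
  then show ?thesis using integral_completion[OF f] by simp
qed

text \<open>
  Finitely many exceptional points do no harm when the expected derivative is continuous: by the
  strong form of the fundamental theorem of calculus, \<open>f\<close> is a primitive of \<open>g\<close>.
\<close>

lemma removable_derivative:
  fixes f g :: "real \<Rightarrow> real"
  assumes "finite K" "x \<in> {a<..<b}" "continuous_on {a<..<b} f" "continuous_on {a<..<b} g"
    and der: "\<And>y. y \<in> {a<..<b} - K \<Longrightarrow> (f has_real_derivative g y) (at y)"
  shows "(f has_real_derivative g x) (at x)"
proof -
  obtain c where c: "a < c" "c < x" using assms(2) dense[of a x] by auto
  obtain d where d: "x < d" "d < b" using assms(2) dense[of x b] by auto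
  have sub: "{c..d} \<subseteq> {a<..<b}" using c d by auto
  have eq: "f c + integral {c..y} g = f y" if "y \<in> {c..d}" for y
  proof -
    have "(g has_integral (f y - f c)) {c..y}"
      using that sub c d assms(1,3)
      by (intro fundamental_theorem_of_calculus_interior_strong[of K])
        (auto intro!: der[unfolded has_real_derivative_iff_has_vector_derivative]
          intro: continuous_on_subset)
    then show ?thesis by (auto simp: integral_unique)
  qed
  have "((\<lambda>y. f c + integral {c..y} g) has_real_derivative g x) (at x within {c..d})"
    using c d sub assms(4) by (auto intro!: derivative_eq_intros integral_has_real_derivative intro: continuous_on_subset)
  then have "(f has_real_derivative g x) (at x within {c..d})"
    by (rule has_field_derivative_transform_within[OF _ zero_less_one]) (use c d eq in auto)
  then show ?thesis using c d by (simp add: at_within_Icc_at)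
qed

text \<open>
  The derivative of order \<open>k\<close> of a product, with \<open>F j\<close> and \<open>G j\<close> in the role of the derivatives of order
  \<open>j\<close> of the factors. Working with given sequences instead of iterated \<open>deriv\<close> makes the top order
  meaningful everywhere, although the derivative of this order exists only off the knots.
\<close>

fun leibniz :: "(nat \<Rightarrow> real \<Rightarrow> real) \<Rightarrow> (nat \<Rightarrow> real \<Rightarrow> real) \<Rightarrow> nat \<Rightarrow> real \<Rightarrow> real" where
  "leibniz F G 0 x = F 0 x * G 0 x"
| "leibniz F G (Suc k) x = leibniz (\<lambda>j. F (Suc j)) G k x + leibniz F (\<lambda>j. G (Suc j)) k x"

lemma leibniz_deriv:
  assumes "\<And>j. j \<le> k \<Longrightarrow> (F j has_real_derivative F (Suc j) x) (at x)"
    and "\<And>j. j \<le> k \<Longrightarrow> (G j has_real_derivative G (Suc j) x) (at x)"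
  shows "(leibniz F G k has_real_derivative leibniz F G (Suc k) x) (at x)"
  using assms
proof (induction k arbitrary: F G)
  case 0
  have "leibniz F G 0 = (\<lambda>x. F 0 x * G 0 x)" by auto
  then show ?case using DERIV_mult[OF "0"(1)[of 0] "0"(2)[of 0]] by (simp add: mult.commute)
next
  case (Suc k)
  have fe: "leibniz F G (Suc k) = (\<lambda>x. leibniz (\<lambda>j. F (Suc j)) G k x + leibniz F (\<lambda>j. G (Suc j)) k x)"
    by auto
  have "(leibniz F G (Suc k) has_real_derivative
     leibniz (\<lambda>j. F (Suc j)) G (Suc k) x + leibniz F (\<lambda>j. G (Suc j)) (Suc k) x) (at x)"
    unfolding fe using Suc.prems by (intro DERIV_add Suc.IH) auto
  then show ?case by (subst leibniz.simps(2)[of F G "Suc k"])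
qed

lemma leibniz_eq_0: "(\<And>j. j \<le> k \<Longrightarrow> F j x = 0) \<Longrightarrow> leibniz F G k x = 0"
  by (induction k arbitrary: F G) auto

lemma leibniz_const:
  "F 0 x = 1 \<Longrightarrow> (\<And>j. 0 < j \<Longrightarrow> j \<le> k \<Longrightarrow> F j x = 0) \<Longrightarrow> leibniz F G k x = G k x"
  by (induction k arbitrary: G) (auto intro!: leibniz_eq_0)

lemma leibniz_measurable:
  assumes "\<And>j. F j \<in> borel_measurable borel" "\<And>j. G j \<in> borel_measurable borel"
  shows "leibniz F G k \<in> borel_measurable borel"
  using assms
proof (induction k arbitrary: F G)
  case 0
  have "leibniz F G 0 = (\<lambda>x. F 0 x * G 0 x)" by auto
  then show ?case using 0 by simp
next
  case (Suc k)
  have "leibniz F G (Suc k) = (\<lambda>x. leibniz (\<lambda>j. F (Suc j)) G k x + leibniz F (\<lambda>j. G (Suc j)) k x)"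
    by auto
  then show ?case using Suc by simp
qed

lemma leibniz_bounded:
  assumes "\<And>j. \<exists>C. \<forall>x\<in>S. \<bar>F j x\<bar> \<le> C" "\<And>j. \<exists>C. \<forall>x\<in>S. \<bar>G j x\<bar> \<le> C"
  shows "\<exists>C. \<forall>x\<in>S. \<bar>leibniz F G k x\<bar> \<le> C"
  using assms
proof (induction k arbitrary: F G)
  case 0
  obtain C D where "\<forall>x\<in>S. \<bar>F 0 x\<bar> \<le> C" "\<forall>x\<in>S. \<bar>G 0 x\<bar> \<le> D" using 0 by meson
  then have "\<forall>x\<in>S. \<bar>leibniz F G 0 x\<bar> \<le> \<bar>C\<bar> * \<bar>D\<bar>"
    by (auto simp: abs_mult intro!: mult_mono)
  then show ?case by blast
next
  case (Suc k)
  obtain C where C: "\<forall>x\<in>S. \<bar>leibniz (\<lambda>j. F (Suc j)) G k x\<bar> \<le> C"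
    using Suc.IH[of "\<lambda>j. F (Suc j)" G] Suc.prems by meson
  obtain D where D: "\<forall>x\<in>S. \<bar>leibniz F (\<lambda>j. G (Suc j)) k x\<bar> \<le> D"
    using Suc.IH[of F "\<lambda>j. G (Suc j)"] Suc.prems by meson
  have "\<forall>x\<in>S. \<bar>leibniz F G (Suc k) x\<bar> \<le> C + D"
    using C D by (force intro: order.trans[OF abs_triangle_ineq])
  then show ?case by blast
qed

lemma higher_deriv_eq:
  assumes "\<And>j y. j < k \<Longrightarrow> (F j has_real_derivative F (Suc j) y) (at y)"
  shows "(deriv ^^ k) (F 0) = F k"
  using assms
proof (induction k)
  case (Suc k)
  then have "(deriv ^^ Suc k) (F 0) = deriv (F k)" by simp
  also have "\<dots> = F (Suc k)" using Suc.prems[of k] by (auto intro!: DERIV_imp_deriv)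
  finally show ?case .
qed simp

section \<open>Moments of the dual functionals\<close>

text \<open>
  The continuation beyond the last Chebyshev knot only serves to have a strictly increasing function
  on all indices.
\<close>

definition cheb_knot :: "nat \<Rightarrow> nat \<Rightarrow> real" where
  "cheb_knot p k = (if k \<le> p + 1 then - cos (real k * pi / real (p + 1)) else real k)"

lemma cheb_knot_strict_mono: "strict_mono (cheb_knot p)"
proof (rule strict_mono_Suc_iff[THEN iffD2, rule_format])
  fix k
  show "cheb_knot p k < cheb_knot p (Suc k)"
  proof (cases "Suc k \<le> p + 1")
    case True
    have *: "real (Suc k) * pi / real (p + 1) \<le> pi"
      using True by (simp add: field_simps del: of_nat_Suc)
    have "cos (real (Suc k) * pi / real (p + 1)) < cos (real k * pi / real (p + 1))"
      by (intro cos_monotone_0_pi *) (auto intro!: divide_strict_right_mono)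
    then show ?thesis using True by (simp add: cheb_knot_def)
  next
    case False
    have "- cos y < real (Suc (p+1))" for y
      using cos_ge_minus_one[of y] of_nat_0_le_iff[of p, where ?'a = real] by (simp, linarith)
    then show ?thesis using False by (auto simp: cheb_knot_def not_le le_Suc_eq intro: order.strict_trans2)
  qed
qed

lemma cheb_knot_mono: "mono (cheb_knot p)"
  using cheb_knot_strict_mono by (rule strict_mono_mono)

lemma cheb_knot_ends: "cheb_knot p 0 = - 1" "cheb_knot p (p + 1) = 1"
  by (simp_all add: cheb_knot_def)

lemma perfect_bspline_eq: "perfect_bspline p = bspline (cheb_knot p) p 0"
  unfolding perfect_bspline_def by (intro ext bspline_cong) (auto simp: cheb_knot_def)

lemma bspline_deriv_eq_0:
  assumes "mono \<xi>" "x < \<xi> i \<or> \<xi> (i + q + 1) \<le> x"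
  shows "bspline_deriv \<xi> a q i x = 0"
  using assms(2)
proof (induction a arbitrary: q i)
  case 0
  then show ?case using bspline_eq_0[OF assms(1)] by simp
next
  case (Suc a)
  show ?case
  proof (cases q)
    case (Suc r)
    have "\<xi> i \<le> \<xi> (i+1)" "\<xi> (i+r+1) \<le> \<xi> (i+r+2)"
      using assms(1) by (auto intro: monoD)
    then have "x < \<xi> i \<or> \<xi> (i + r + 1) \<le> x" "x < \<xi> (i+1) \<or> \<xi> (i + 1 + r + 1) \<le> x"
      using Suc.prems Suc by auto
    then have "bspline_deriv \<xi> a r i x = 0" "bspline_deriv \<xi> a r (i+1) x = 0"
      using Suc.IH by blast+
    then show ?thesis using Suc by simp
  qed simp
qed

definition perfect_deriv :: "nat \<Rightarrow> nat \<Rightarrow> real \<Rightarrow> real" where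
  "perfect_deriv p k = bspline_deriv (cheb_knot p) k p 0"

lemma perfect_deriv_cont:
  assumes "k < p" shows "continuous_on S (perfect_deriv p k)"
proof -
  have "isCont (perfect_deriv p k) x" for x
    unfolding perfect_deriv_def
    using assms strict_mono_eq[OF cheb_knot_strict_mono]
    by (intro bspline_deriv_isCont cheb_knot_mono) auto
  then show ?thesis by (simp add: continuous_at_imp_continuous_on)
qed

lemma perfect_deriv_outside:
  assumes "x < -1 \<or> 1 \<le> x" shows "perfect_deriv p k x = 0"
  unfolding perfect_deriv_def
  using assms cheb_knot_ends[of p] by (intro bspline_deriv_eq_0 cheb_knot_mono) auto

lemma perfect_deriv_minus_1:
  assumes "k < p" shows "perfect_deriv p k (-1) = 0"
proof -
  have "isCont (perfect_deriv p k) (-1)"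
    using perfect_deriv_cont[OF assms, of UNIV] by (simp add: continuous_on_eq_continuous_at)
  then have "(perfect_deriv p k \<longlongrightarrow> perfect_deriv p k (-1)) (at_left (-1))"
    unfolding isCont_def by (rule tendsto_within_subset) auto
  moreover have "(perfect_deriv p k \<longlongrightarrow> 0) (at_left (-1))"
    by (rule tendsto_eventually) (auto simp: eventually_at_filter perfect_deriv_outside)
  ultimately show ?thesis using tendsto_unique trivial_limit_at_left_real by blast
qed

lemma perfect_deriv_deriv:
  assumes "x \<notin> range (cheb_knot p)"
  shows "(perfect_deriv p k has_real_derivative perfect_deriv p (Suc k) x) (at x)"
  unfolding perfect_deriv_def by (rule bspline_deriv_deriv[OF cheb_knot_mono assms])

lemma finite_cheb_knots: "finite (range (cheb_knot p) \<inter> {..c})"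
proof -
  have "cheb_knot p k \<le> c \<Longrightarrow> k \<le> max (p+1) (nat \<lceil>c\<rceil>)" for k
    by (auto simp: cheb_knot_def split: if_splits) linarith
  then have "range (cheb_knot p) \<inter> {..c} \<subseteq> cheb_knot p ` {..max (p+1) (nat \<lceil>c\<rceil>)}" by auto
  then show ?thesis using finite_surj by blast
qed

lemma perfect_deriv_deriv_smooth:
  assumes "Suc k < p"
  shows "(perfect_deriv p k has_real_derivative perfect_deriv p (Suc k) x) (at x)"
  by (rule removable_derivative[OF finite_cheb_knots[of p "x+1"], where a = "x - 1" and b = "x+1"])
    (use assms in \<open>auto intro!: perfect_deriv_cont perfect_deriv_deriv\<close>)

definition perfect_mass :: "nat \<Rightarrow> real" where
  "perfect_mass p = (LINT t:{-1..1}|lebesgue. perfect_bspline p t)"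

lemma perfect_set_integral:
  assumes "0 < p" "a \<le> -1"
  shows "(LINT t:{-1..x}|lebesgue. perfect_bspline p t) = integral {a..x} (perfect_deriv p 0)"
proof -
  have "(LINT t:{-1..x}|lebesgue. perfect_bspline p t) = (LINT t:{a..x}|lebesgue. perfect_deriv p 0 t)"
    unfolding set_lebesgue_integral_def using assms(2) perfect_deriv_outside[of _ p 0]
    by (intro Bochner_Integration.integral_cong refl)
      (auto simp: indicator_def perfect_bspline_eq perfect_deriv_def not_le)
  also have "\<dots> = integral {a..x} (perfect_deriv p 0)"
    by (intro set_lebesgue_integral_eq_integral absolutely_integrable_continuous_real perfect_deriv_cont assms)
  finally show ?thesis .
qed

lemma perfect_mass_pos:
  assumes "0 < p" shows "perfect_mass p > 0"
proof -
  have nonneg: "perfect_deriv p 0 x \<ge> 0" for x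
    using bspline_range[OF cheb_knot_mono] by (simp add: perfect_deriv_def)
  have "perfect_mass p = integral {-1..1} (perfect_deriv p 0)"
    unfolding perfect_mass_def using assms by (intro perfect_set_integral) auto
  moreover have "integral {-1..1} (perfect_deriv p 0) \<ge> 0"
    using nonneg by (intro integral_nonneg integrable_continuous_real perfect_deriv_cont assms) auto
  moreover have "integral {-1..1} (perfect_deriv p 0) \<noteq> 0"
  proof
    assume *: "integral {-1..1} (perfect_deriv p 0) = 0"
    have lt: "cheb_knot p 0 < cheb_knot p (0+1)" using strict_monoD[OF cheb_knot_strict_mono] by simp
    then obtain x where x: "cheb_knot p 0 < x" "x < cheb_knot p (0+1)" using dense by blast
    moreover have "cheb_knot p 1 \<le> cheb_knot p (p+1)" by (rule monoD[OF cheb_knot_mono]) simp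
    ultimately have "x \<in> {-1..1}" using cheb_knot_ends[of p] by auto
    then have "perfect_deriv p 0 x = 0"
      using * nonneg integral_eq_0_iff[OF perfect_deriv_cont[OF assms]] by auto
    then show False using bspline_pos[OF cheb_knot_mono x, of p] by (simp add: perfect_deriv_def)
  qed
  ultimately show ?thesis by linarith
qed

text \<open>
  The transition function is zero to the left of \<open>[-1,1]\<close> and one to the right of it, where the
  integral over the B-spline does not change any more. It is therefore a primitive of the normalised
  B-spline on the whole line.
\<close>

fun transition_deriv :: "nat \<Rightarrow> nat \<Rightarrow> real \<Rightarrow> real" where
  "transition_deriv p 0 = transition p"
| "transition_deriv p (Suc k) = (\<lambda>x. perfect_deriv p k x / perfect_mass p)"

lemma transition_eq:
  assumes "0 < p" "a \<le> -1"
  shows "transition p x = integral {a..x} (perfect_deriv p 0) / perfect_mass p"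
  unfolding transition_def perfect_mass_def using perfect_set_integral[OF assms] by simp

lemma transition_left: "x \<le> -1 \<Longrightarrow> 0 < p \<Longrightarrow> transition p x = 0"
  using transition_eq[of p "-1" x] by (cases "x = -1") auto

lemma transition_right:
  assumes "1 \<le> x" "0 < p" shows "transition p x = 1"
proof -
  have "integral {-1..1} (perfect_deriv p 0) + integral {1..x} (perfect_deriv p 0)
      = integral {-1..x} (perfect_deriv p 0)"
    using assms by (intro Henstock_Kurzweil_Integration.integral_combine integrable_continuous_real perfect_deriv_cont) auto
  moreover have "integral {1..x} (perfect_deriv p 0) = integral {1..x} (\<lambda>_. 0)"
    by (intro integral_cong) (auto simp: perfect_deriv_outside)
  ultimately have "transition p x = transition p 1" using assms by (simp add: transition_eq[where a="-1"])
  also have "\<dots> = 1"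
    using perfect_mass_pos[OF assms(2)] by (simp add: transition_def perfect_mass_def)
  finally show ?thesis .
qed

lemma transition_deriv_deriv:
  assumes "k < p \<or> (k \<le> p \<and> x \<notin> range (cheb_knot p))" "0 < p"
  shows "(transition_deriv p k has_real_derivative transition_deriv p (Suc k) x) (at x)"
proof (cases k)
  case 0
  define a where "a = min (-1) (x - 1)"
  have "((\<lambda>y. integral {a..y} (perfect_deriv p 0)) has_real_derivative perfect_deriv p 0 x) (at x within {a..x+1})"
    using assms by (intro integral_has_real_derivative perfect_deriv_cont) (auto simp: a_def)
  then have "((\<lambda>y. integral {a..y} (perfect_deriv p 0)) has_real_derivative perfect_deriv p 0 x) (at x)"
    by (simp add: at_within_Icc_at a_def)
  moreover have "transition p = (\<lambda>y. integral {a..y} (perfect_deriv p 0) / perfect_mass p)"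
    using transition_eq[OF assms(2), of a] by (auto simp: a_def)
  ultimately show ?thesis using 0 by (simp add: DERIV_cdivide)
next
  case (Suc j)
  have "(perfect_deriv p j has_real_derivative perfect_deriv p (Suc j) x) (at x)"
    using assms Suc perfect_deriv_deriv_smooth[of j p] perfect_deriv_deriv by fastforce
  then show ?thesis using Suc by (simp add: DERIV_cdivide)
qed

lemma transition_deriv_outside:
  assumes "x \<le> -1 \<or> (1 \<le> x \<and> 0 < k)" "k \<le> p" "0 < p"
  shows "transition_deriv p k x = 0"
proof (cases k)
  case 0
  then show ?thesis using assms transition_left by auto
next
  case (Suc j)
  then show ?thesis
    using assms perfect_deriv_outside[of x p j] perfect_deriv_minus_1[of j p] by (cases "x = -1") auto
qed

lemma transition_deriv_measurable:
  assumes "0 < p" shows "transition_deriv p k \<in> borel_measurable borel"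
proof (cases k)
  case 0
  have "isCont (transition p) x" for x
    using transition_deriv_deriv[of 0 p x] assms by (auto intro: DERIV_isCont)
  then have "continuous_on UNIV (transition p)" by (simp add: continuous_at_imp_continuous_on)
  then show ?thesis using 0 by (simp add: borel_measurable_continuous_onI)
next
  case (Suc j)
  then show ?thesis by (simp add: perfect_deriv_def)
qed

lemma transition_deriv_bounded:
  assumes "0 < p" shows "\<exists>C. \<forall>x. \<bar>transition_deriv p k x\<bar> \<le> C"
proof (cases k)
  case 0
  have "isCont (transition p) x" for x
    using transition_deriv_deriv[of 0 p x] assms by (auto intro: DERIV_isCont)
  then have "compact (transition p ` {-1..1})"
    by (intro compact_continuous_image continuous_at_imp_continuous_on) auto
  then obtain C where C: "\<And>x. x \<in> {-1..1} \<Longrightarrow> \<bar>transition p x\<bar> \<le> C"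
    using compact_imp_bounded bounded_iff by (metis imageI real_norm_def)
  have "\<bar>transition p x\<bar> \<le> max C 1" for x
    using C[of x] transition_left[of x p] transition_right[of x p] assms by fastforce
  then show ?thesis using 0 by auto
next
  case (Suc j)
  obtain C where C: "\<And>x. \<bar>perfect_deriv p j x\<bar> \<le> C"
    using bspline_deriv_bounded[OF cheb_knot_mono] unfolding perfect_deriv_def by blast
  have "\<bar>transition_deriv p k x\<bar> \<le> C / perfect_mass p" for x
    using C perfect_mass_pos[OF assms] Suc by (simp add: abs_divide divide_right_mono)
  then show ?thesis by blast
qed

lemma coeff_prod_linear:
  fixes c :: "nat \<Rightarrow> real"
  shows "degree (\<Prod>k=1..p. [:- c k, 1:]) = p \<and> coeff (\<Prod>k=1..p. [:- c k, 1:]) p = 1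
    \<and> (0 < p \<longrightarrow> coeff (\<Prod>k=1..p. [:- c k, 1:]) (p - 1) = - (\<Sum>k=1..p. c k))"
proof (induction p)
  case (Suc p)
  let ?R = "\<Prod>k=1..p. [:- c k, 1:]"
  have e: "(\<Prod>k=1..Suc p. [:- c k, 1:]) = smult (- c (Suc p)) ?R + pCons 0 ?R"
    by (simp add: mult.commute)
  have z: "coeff ?R (Suc p) = 0" using Suc by (simp add: coeff_eq_0)
  have m: "coeff (\<Prod>k=1..Suc p. [:- c k, 1:]) (Suc p) = 1"
    unfolding e using Suc z by simp
  have "degree (\<Prod>k=1..Suc p. [:- c k, 1:]) = (\<Sum>k=1..Suc p. degree [:- c k, 1:])"
    by (rule degree_prod_eq_sum_degree) auto
  then have "degree (\<Prod>k=1..Suc p. [:- c k, 1:]) = Suc p" by simp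
  moreover have "coeff (\<Prod>k=1..Suc p. [:- c k, 1:]) p = - (\<Sum>k=1..Suc p. c k)"
    unfolding e using Suc by (cases p) auto
  ultimately show ?case using m by auto
qed simp

text \<open>
  The density is the derivative of order \<open>p + 1\<close> of \<open>g q\<close>. When the moments are integrated by parts,
  all boundary terms at the left end vanish, because \<open>g\<close> vanishes there together with its derivatives;
  at the right end \<open>g\<close> is one and its derivatives vanish, so that only derivatives of the polynomial
  \<open>q\<close> remain. These are \<open>q\<^sup>(\<^sup>p\<^sup>) = 1\<close> and \<open>q\<^sup>(\<^sup>p\<^sup>-\<^sup>1\<^sup>)(t) = t - \<mu>\<close> with the mean \<open>\<mu>\<close> of the inner knots,
  and the first moment is \<open>b - (b - \<mu>)\<close>.
\<close>

lemma schumaker_density: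
  assumes p: "0 < p" and lt: "\<xi> i < \<xi> (i + p + 1)"
  obtains m :: "real \<Rightarrow> real" and C and K where
    "m \<in> borel_measurable borel" "\<And>t. \<bar>m t\<bar> \<le> C" "\<And>t. t \<notin> {\<xi> i..\<xi> (i + p + 1)} \<Longrightarrow> m t = 0"
    "finite K" "\<And>t. t \<in> {\<xi> i..\<xi> (i + p + 1)} - K \<Longrightarrow>
       (deriv ^^ (p + 1)) (\<lambda>t. schumaker_g \<xi> p i t * schumaker_q \<xi> p i t) t = m t"
    "(LINT t|lborel. m t) = 1" "(LINT t|lborel. t * m t) = (\<Sum>k=1..p. \<xi> (i + k)) / real p"
proof -
  define a b where "a = \<xi> i" and "b = \<xi> (i + p + 1)"
  have ab: "a < b" using lt by (simp add: a_def b_def)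
  define s y where "s = 2 / (b - a)" and "y = (\<lambda>t. (2 * t - a - b) / (b - a))"
  define F where "F = (\<lambda>k t. s ^ k * transition_deriv p k (y t))"
  define Q where "Q = smult (1 / fact p) (\<Prod>k=1..p. [:- \<xi> (i + k), 1:])"
  define G where "G = (\<lambda>k. poly ((pderiv ^^ k) Q))"
  have y: "y a = -1" "y b = 1" using ab by (simp_all add: y_def field_simps)
  have y_deriv: "(y has_real_derivative s) (at t)" for t
  proof -
    have "y = (\<lambda>t. s * t - (a + b) / (b - a))" by (auto simp: y_def s_def diff_divide_distrib add_divide_distrib)
    then show ?thesis by (auto intro!: derivative_eq_intros)
  qed
  have y_iff: "y t \<le> 1 \<longleftrightarrow> t \<le> b" for t using ab by (auto simp: y_def field_simps)
  have F_deriv: "(F k has_real_derivative F (Suc k) t) (at t)"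
    if "k < p \<or> (k \<le> p \<and> y t \<notin> range (cheb_knot p))" for k t
  proof -
    have "((\<lambda>t. transition_deriv p k (y t)) has_real_derivative transition_deriv p (Suc k) (y t) * s) (at t)"
      by (rule DERIV_chain2[OF transition_deriv_deriv[OF that p] y_deriv])
    then show ?thesis unfolding F_def using DERIV_cmult by (fastforce simp: mult_ac)
  qed
  have G_deriv: "(G k has_real_derivative G (Suc k) t) (at t)" for k t
    unfolding G_def by (simp add: poly_DERIV)
  have F0: "F 0 = schumaker_g \<xi> p i"
    by (auto simp: F_def schumaker_g_def y_def a_def b_def)
  have G0: "G 0 = schumaker_q \<xi> p i"
    by (auto simp: G_def Q_def schumaker_q_def poly_prod)
  define L where "L = leibniz F G"
  have L_deriv: "(L k has_real_derivative L (Suc k) t) (at t)"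
    if "k < p \<or> (k \<le> p \<and> y t \<notin> range (cheb_knot p))" for k t
    unfolding L_def using that by (intro leibniz_deriv F_deriv G_deriv) auto
  have L0: "L 0 = (\<lambda>t. schumaker_g \<xi> p i t * schumaker_q \<xi> p i t)"
    by (auto simp: L_def F0 G0)
  have higher: "(deriv ^^ p) (\<lambda>t. schumaker_g \<xi> p i t * schumaker_q \<xi> p i t) = L p"
    unfolding L0[symmetric] by (rule higher_deriv_eq) (auto intro: L_deriv)
  \<comment> \<open>the points of \<open>[a,b]\<close> that the affine map \<open>y\<close> sends to Chebyshev knots\<close>
  define K where "K = (\<lambda>x. ((b - a) * x + a + b) / 2) ` (range (cheb_knot p) \<inter> {..1})"
  have finK: "finite K" unfolding K_def by (intro finite_imageI finite_cheb_knots)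
  have notK: "y t \<notin> range (cheb_knot p)" if "t \<in> {a..b} - K" for t
  proof
    assume "y t \<in> range (cheb_knot p)"
    then have "y t \<in> range (cheb_knot p) \<inter> {..1}" using that y_iff by auto
    moreover have "t = ((b - a) * y t + a + b) / 2" using ab by (simp add: y_def)
    ultimately have "t \<in> K" unfolding K_def by blast
    then show False using that by simp
  qed
  define m where "m = (\<lambda>t. indicator {a..b} t * L (p + 1) t)"
  have deriv_m: "(deriv ^^ (p + 1)) (\<lambda>t. schumaker_g \<xi> p i t * schumaker_q \<xi> p i t) t = m t"
    if "t \<in> {a..b} - K" for t
    using L_deriv[of p t] notK[OF that] that by (simp add: higher m_def DERIV_imp_deriv)
  have F_meas: "F k \<in> borel_measurable borel" for k
  proof -
    note [measurable] = transition_deriv_measurable[OF p]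
    show ?thesis unfolding F_def y_def by measurable
  qed
  have G_cont: "continuous_on S (G k)" for k S
    unfolding G_def by (intro continuous_intros)
  have G_meas: "G k \<in> borel_measurable borel" for k
    using G_cont by (rule borel_measurable_continuous_onI)
  have L_meas: "L k \<in> borel_measurable borel" for k
    unfolding L_def by (rule leibniz_measurable[OF F_meas G_meas])
  have F_bdd: "\<exists>C. \<forall>t\<in>{a..b}. \<bar>F k t\<bar> \<le> C" for k
  proof -
    obtain C where "\<And>x. \<bar>transition_deriv p k x\<bar> \<le> C" using transition_deriv_bounded[OF p] by blast
    then have "\<bar>F k t\<bar> \<le> \<bar>s ^ k\<bar> * C" for t
      unfolding F_def abs_mult by (intro mult_left_mono) auto
    then show ?thesis by blast
  qed
  have G_bdd: "\<exists>C. \<forall>t\<in>{a..b}. \<bar>G k t\<bar> \<le> C" for k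
  proof -
    have "compact (G k ` {a..b})" by (intro compact_continuous_image G_cont) auto
    then show ?thesis using compact_imp_bounded bounded_iff by (metis imageI real_norm_def)
  qed
  obtain C where C: "\<And>t. t \<in> {a..b} \<Longrightarrow> \<bar>L (p+1) t\<bar> \<le> C"
    using leibniz_bounded[where F=F and G=G and S="{a..b}", OF F_bdd G_bdd] unfolding L_def by blast
  have m_meas[measurable]: "m \<in> borel_measurable borel" unfolding m_def using L_meas[measurable] by measurable
  have "0 \<le> C" using C[of a] ab by force
  then have m_bdd: "\<bar>m t\<bar> \<le> C" for t
    using C[of t] by (auto simp: m_def indicator_def)
  have Lp_cont: "continuous_on {a..b} (L p)"
  proof -
    have "isCont (F p) t" for t
    proof -
      obtain j where j: "p = Suc j" using p by (cases p) auto
      have "isCont (transition_deriv p p) (y t)"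
        using perfect_deriv_cont[of j p UNIV] perfect_mass_pos[OF p] unfolding j
        by (auto simp: continuous_on_eq_continuous_at intro!: continuous_intros)
      then show ?thesis unfolding F_def
        by (intro continuous_intros isCont_o2[OF DERIV_isCont[OF y_deriv]])
    qed
    then have F_cont: "continuous_on {a..b} (F k)" if "k \<le> p" for k
      using that DERIV_isCont[OF F_deriv[of k]]
      by (cases "k = p") (auto intro!: continuous_at_imp_continuous_on)
    have *: "continuous_on {a..b} (leibniz F' G' k)" 
      if "\<And>j. j \<le> k \<Longrightarrow> continuous_on {a..b} (F' j)" "\<And>j. j \<le> k \<Longrightarrow> continuous_on {a..b} (G' j)" for k F' G'
      using that
    proof (induction k arbitrary: F' G')
      case 0
      have "leibniz F' G' 0 = (\<lambda>x. F' 0 x * G' 0 x)" by auto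
      then show ?case using 0 by (auto intro!: continuous_intros)
    next
      case (Suc k)
      have fe: "leibniz F' G' (Suc k) = (\<lambda>x. leibniz (\<lambda>j. F' (Suc j)) G' k x + leibniz F' (\<lambda>j. G' (Suc j)) k x)"
        by auto
      show ?case unfolding fe using Suc by (intro continuous_intros) auto
    qed
    show ?thesis unfolding L_def by (intro * F_cont G_cont)
  qed
  have L_a: "L k a = 0" if "k \<le> p" for k
    unfolding L_def using that p y by (intro leibniz_eq_0) (auto simp: F_def transition_deriv_outside)
  have L_b: "L k b = G k b" if "k \<le> p" for k
    unfolding L_def using that p y
    by (intro leibniz_const) (auto simp: F_def transition_deriv_outside transition_right)
  note R = coeff_prod_linear[where p=p and c="\<lambda>k. \<xi> (i + k)"]
  have cf: "coeff Q p = 1 / fact p" "coeff Q (p - 1) = - (\<Sum>k=1..p. \<xi> (i + k)) / fact p"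
    using R p by (simp_all add: Q_def)
  have cf0: "coeff Q n = 0" if "n > p" for n
    unfolding Q_def coeff_smult using R that by (simp add: coeff_eq_0)
  have "(pderiv ^^ p) Q = [:1:]"
    by (rule poly_eqI) (auto simp: coeff_higher_pderiv cf(1) cf0 coeff_pCons pochhammer_fact[symmetric] split: nat.splits)
  then have Gp: "G p t = 1" for t by (simp add: G_def)
  define \<mu> where "\<mu> = (\<Sum>k=1..p. \<xi> (i + k)) / real p"
  have "(pderiv ^^ (p - 1)) Q = [:- \<mu>, 1:]"
  proof (rule poly_eqI)
    fix n :: nat
    obtain j where j: "p = Suc j" using p by (cases p) auto
    have f: "fact p = real p * fact (p - 1)" using p by (simp add: fact_reduce)
    have 0: "pochhammer (1::real) (p - 1) = fact (p - 1)" by (simp add: pochhammer_fact)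
    have 1: "pochhammer (2::real) (p - 1) = fact p"
      using j pochhammer_rec[of "1::real" "j"] by (simp add: pochhammer_fact[symmetric])
    consider "n = 0" | "n = 1" | "n \<ge> 2" by linarith
    then show "coeff ((pderiv ^^ (p - 1)) Q) n = coeff [:- \<mu>, 1:] n"
    proof cases
      case 1
      then show ?thesis using cf(2) f 0 p by (simp add: coeff_higher_pderiv \<mu>_def)
    next
      case 2
      then show ?thesis using cf(1) 1 p by (simp add: coeff_higher_pderiv)
    next
      case 3
      then have "n + (p - 1) > p" using p by auto
      then show ?thesis using cf0 3 by (auto simp: coeff_higher_pderiv coeff_pCons split: nat.splits)
    qed
  qed
  then have Gp1: "G (p - 1) t = t - \<mu>" for t by (simp add: G_def)
  have to_lborel: "(LINT t|lborel. h t * m t) = c"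
    if hI: "((\<lambda>t. h t * L (p+1) t) has_integral c) {a..b}"
      and hc: "continuous_on {a..b} h" and hm: "h \<in> borel_measurable borel" for h c
  proof -
    obtain D where D: "\<And>t. t \<in> {a..b} \<Longrightarrow> \<bar>h t\<bar> \<le> D"
      using compact_imp_bounded[OF compact_continuous_image[OF hc]] bounded_iff
      by (metis compact_Icc imageI real_norm_def)
    have "set_integrable lborel {a..b} (\<lambda>t. h t * L (p+1) t)"
      unfolding set_integrable_def
    proof (rule integrableI_bounded_set[where A="{a..b}" and B="D * C"])
      show "(\<lambda>t. indicat_real {a..b} t *\<^sub>R (h t * L (p + 1) t)) \<in> borel_measurable lborel"
        using hm[measurable] L_meas[measurable] by measurable
      show "AE t in lborel. t \<in> {a..b} \<longrightarrow> norm (indicat_real {a..b} t *\<^sub>R (h t * L (p + 1) t)) \<le> D * C"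
      proof (intro AE_I2 impI)
        fix t assume t: "t \<in> {a..b}"
        have "0 \<le> D" using D[OF t] by simp
        then have "\<bar>h t\<bar> * \<bar>L (p+1) t\<bar> \<le> D * C" by (intro mult_mono D C t) auto
        then show "norm (indicat_real {a..b} t *\<^sub>R (h t * L (p + 1) t)) \<le> D * C"
          using t by (simp add: abs_mult)
      qed
    qed (auto simp: emeasure_lborel_Icc_eq)
    then have "(LINT t:{a..b}|lborel. h t * L (p+1) t) = c"
      using set_borel_integral_eq_integral(2) hI by (metis integral_unique)
    then show ?thesis by (simp add: set_lebesgue_integral_def m_def mult_ac)
  qed
  have L_vec: "(L p has_vector_derivative L (Suc p) t) (at t)" if "t \<in> {a<..<b} - K" for t
    using L_deriv[of p t] notK[of t] that by (auto simp: has_real_derivative_iff_has_vector_derivative)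
  have I1: "(L (p+1) has_integral 1) {a..b}"
  proof -
    have "(L (Suc p) has_integral (L p b - L p a)) {a..b}"
      by (rule fundamental_theorem_of_calculus_interior_strong[OF finK _ L_vec Lp_cont]) (use ab in auto)
    then show ?thesis using L_a[of p] L_b[of p] Gp by simp
  qed
  \<comment> \<open>integration by parts against the factor \<open>t\<close>, with \<open>L p\<close> integrated once more\<close>
  have I2: "((\<lambda>t. t * L (p+1) t) has_integral \<mu>) {a..b}"
  proof -
    have "(((\<lambda>t. t * L (Suc p) t + L p t)) has_integral (b * L p b - a * L p a)) {a..b}"
    proof (rule fundamental_theorem_of_calculus_interior_strong[OF finK])
      fix t assume "t \<in> {a<..<b} - K"
      then have "(L p has_real_derivative L (Suc p) t) (at t)"
        using L_vec by (simp add: has_real_derivative_iff_has_vector_derivative)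
      then have "((\<lambda>t. t * L p t) has_real_derivative t * L (Suc p) t + L p t) (at t)"
        by (auto intro!: derivative_eq_intros)
      then show "((\<lambda>t. t * L p t) has_vector_derivative t * L (Suc p) t + L p t) (at t)"
        by (simp add: has_real_derivative_iff_has_vector_derivative)
    qed (use ab Lp_cont in \<open>auto intro!: continuous_intros\<close>)
    moreover have "(L p has_integral (L (p-1) b - L (p-1) a)) {a..b}"
      using L_deriv[of "p - 1"] p ab
      by (intro fundamental_theorem_of_calculus)
        (auto simp: has_real_derivative_iff_has_vector_derivative intro: has_vector_derivative_at_within)
    ultimately have "((\<lambda>t. (t * L (Suc p) t + L p t) - L p t) has_integral
        ((b * L p b - a * L p a) - (L (p-1) b - L (p-1) a))) {a..b}"
      by (rule has_integral_diff)
    then show ?thesis using L_a[of p] L_b[of p] L_a[of "p-1"] L_b[of "p-1"] Gp Gp1 by simp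
  qed
  show thesis
  proof (rule that[of m C K])
    show "(LINT t|lborel. m t) = 1" using to_lborel[of "\<lambda>_. 1"] I1 by simp
    show "(LINT t|lborel. t * m t) = (\<Sum>k=1..p. \<xi> (i + k)) / real p"
      using to_lborel[of "\<lambda>t. t"] I2 by (simp add: \<mu>_def)
    show "m t = 0" if "t \<notin> {\<xi> i..\<xi> (i + p + 1)}" for t
      using that by (simp add: m_def a_def b_def)
    show "(deriv ^^ (p + 1)) (\<lambda>t. schumaker_g \<xi> p i t * schumaker_q \<xi> p i t) t = m t"
      if "t \<in> {\<xi> i..\<xi> (i + p + 1)} - K" for t
      using deriv_m that unfolding a_def b_def .
  qed (use m_meas m_bdd finK in auto)
qed

section \<open>Univariate spline spaces and projections\<close>

definition admissible :: "nat \<Rightarrow> real list \<Rightarrow> bool" where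
  "admissible p \<Xi> \<longleftrightarrow> (\<exists>r. open_knot_vector p r \<Xi> \<and> r \<le> p - 1 \<and> 1 \<le> r)"

text \<open>
  The last knot is repeated forever, which makes the knots a monotone function on all indices; list
  access beyond the length is unspecified.
\<close>

definition knot :: "real list \<Rightarrow> nat \<Rightarrow> real" where
  "knot \<Xi> j = \<Xi> ! min j (length \<Xi> - 1)"

locale spline_knots =
  fixes p :: nat and \<Xi> :: "real list"
  assumes adm: "admissible p \<Xi>"
begin

abbreviation "\<xi> \<equiv> knot \<Xi>"
abbreviation "n \<equiv> num_bsplines p \<Xi>"

lemma p_ge_2: "2 \<le> p"
  using adm unfolding admissible_def by auto

lemma count_card: "count_list \<Xi> x = card {i. i < length \<Xi> \<and> \<Xi> ! i = x}"
  by (simp add: count_list_eq_length_filter length_filter_conv_card eq_commute)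

lemma sorted_\<Xi>: "sorted \<Xi>" and in_unit: "i < length \<Xi> \<Longrightarrow> 0 \<le> \<Xi> ! i \<and> \<Xi> ! i \<le> 1"
  and count_0: "count_list \<Xi> 0 = p + 1" and count_1: "count_list \<Xi> 1 = p + 1"
  and count_inner: "x \<in> set \<Xi> \<Longrightarrow> 0 < x \<Longrightarrow> x < 1 \<Longrightarrow> count_list \<Xi> x \<le> p - 1"
proof -
  obtain r where r: "open_knot_vector p r \<Xi>" "r \<le> p - 1" "1 \<le> r"
    using adm unfolding admissible_def by auto
  then show "sorted \<Xi>" "count_list \<Xi> 0 = p + 1" "count_list \<Xi> 1 = p + 1"
    unfolding open_knot_vector_def by auto
  show "0 \<le> \<Xi> ! i \<and> \<Xi> ! i \<le> 1" if "i < length \<Xi>"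
    using r that nth_mem[of i \<Xi>] unfolding open_knot_vector_def by fastforce
  show "count_list \<Xi> x \<le> p - 1" if "x \<in> set \<Xi>" "0 < x" "x < 1"
  proof -
    have "count_list \<Xi> x \<le> p - r" using r that unfolding open_knot_vector_def by auto
    then show ?thesis using r by linarith
  qed
qed

lemma length_gt: "p < length \<Xi>"
proof -
  have "card {i. i < length \<Xi> \<and> \<Xi> ! i = 0} \<le> card {..<length \<Xi>}" by (intro card_mono) auto
  then show ?thesis using count_card[of 0] count_0 by simp
qed

lemma n_eq: "n = length \<Xi> - p - 1"
  by (simp add: num_bsplines_def)

lemma knot_mono: "mono \<xi>"
proof (rule monoI)
  fix i j :: nat assume "i \<le> j"
  then show "\<xi> i \<le> \<xi> j"
    unfolding knot_def using length_gt by (intro sorted_nth_mono sorted_\<Xi>) auto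
qed

lemma knot_unit: "0 \<le> \<xi> j" "\<xi> j \<le> 1"
  unfolding knot_def using length_gt in_unit[of "min j (length \<Xi> - 1)"] by auto

lemma knot_nth: "j < length \<Xi> \<Longrightarrow> \<xi> j = \<Xi> ! j"
  unfolding knot_def by (rule arg_cong[of _ _ "(!) \<Xi>"]) simp

lemma knot_first: assumes "j \<le> p" shows "\<xi> j = 0"
proof -
  have "\<Xi> ! p = 0"
  proof (rule ccontr)
    assume ne: "\<Xi> ! p \<noteq> 0"
    have "i < p" if "i < length \<Xi>" "\<Xi> ! i = 0" for i
    proof (rule ccontr)
      assume "\<not> i < p"
      then have "\<Xi> ! p \<le> \<Xi> ! i" using sorted_nth_mono[OF sorted_\<Xi>, of p i] that by auto
      then show False using that in_unit[OF length_gt] ne by auto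
    qed
    then have "card {i. i < length \<Xi> \<and> \<Xi> ! i = 0} \<le> card {..<p}" by (intro card_mono) auto
    then show False using count_card[of 0] count_0 by simp
  qed
  then have "\<xi> p = 0" using knot_nth[OF length_gt] by simp
  then show ?thesis using monoD[OF knot_mono assms] knot_unit(1)[of j] by simp
qed

lemma knot_last: assumes "n \<le> j" shows "\<xi> j = 1"
proof -
  have nl: "n < length \<Xi>" using length_gt by (auto simp: n_eq)
  have "\<Xi> ! n = 1"
  proof (rule ccontr)
    assume ne: "\<Xi> ! n \<noteq> 1"
    have "n < i" if "i < length \<Xi>" "\<Xi> ! i = 1" for i
    proof (rule ccontr)
      assume "\<not> n < i"
      then have "\<Xi> ! i \<le> \<Xi> ! n" using sorted_nth_mono[OF sorted_\<Xi>, of i n] nl by auto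
      then show False using that in_unit[OF nl] ne by auto
    qed
    then have "card {i. i < length \<Xi> \<and> \<Xi> ! i = 1} \<le> card {n<..<length \<Xi>}" by (intro card_mono) auto
    then show False using count_card[of 1] count_1 by (simp add: n_eq)
  qed
  then have "\<xi> n = 1" using knot_nth[OF nl] by simp
  then show ?thesis using monoD[OF knot_mono assms] knot_unit(2)[of j] by simp
qed

lemma p_less_n: "p < n"
proof (rule ccontr)
  assume "\<not> p < n"
  then have "\<xi> p = 1" by (intro knot_last) auto
  then show False using knot_first[of p] by simp
qed

lemma length_eq: "length \<Xi> = n + p + 1"
  using length_gt by (simp add: n_eq)

lemma knot_multiplicity:
  assumes "\<xi> j = x" "\<xi> (j + k) = x" "j + k < length \<Xi>"
  shows "k < count_list \<Xi> x" "x \<in> set \<Xi>"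
proof -
  have "\<Xi> ! l = x" if "j \<le> l" "l \<le> j + k" for l
    using monoD[OF knot_mono that(1)] monoD[OF knot_mono that(2)] assms knot_nth[of l] that by auto
  then have "card {j..j + k} \<le> card {i. i < length \<Xi> \<and> \<Xi> ! i = x}"
    using assms(3) by (intro card_mono) auto
  then show "k < count_list \<Xi> x" using count_card[of x] by simp
  show "x \<in> set \<Xi>" using assms knot_nth[of j] nth_mem[of j \<Xi>] by auto
qed

lemma knot_less: assumes "i < n" shows "\<xi> i < \<xi> (i + p + 1)"
proof -
  have "\<xi> i \<noteq> \<xi> (i + (p + 1))"
  proof
    assume *: "\<xi> i = \<xi> (i + (p + 1))"
    have "p + 1 < count_list \<Xi> (\<xi> i)" "\<xi> i \<in> set \<Xi>"
      using knot_multiplicity[of i "\<xi> i" "p+1"] * assms length_eq by auto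
    then show False
      using count_0 count_1 count_inner[of "\<xi> i"] knot_unit[of i]
      by (cases "\<xi> i = 0"; cases "\<xi> i = 1") auto
  qed
  then show ?thesis using monoD[OF knot_mono, of i "i + p + 1"] by (simp add: add.assoc)
qed

lemma knot_inner:
  assumes "0 < x" "x < 1" "p - 1 \<le> k" shows "\<not> (\<xi> j = x \<and> \<xi> (j + k) = x)"
proof
  assume *: "\<xi> j = x \<and> \<xi> (j + k) = x"
  then have eq: "\<xi> (j + (p - 1)) = x"
    using monoD[OF knot_mono, of j "j + (p-1)"] monoD[OF knot_mono, of "j + (p-1)" "j + k"] assms by auto
  have "j + (p - 1) < n" using eq knot_last[of "j + (p-1)"] assms by (cases "n \<le> j + (p-1)") auto
  then have "p - 1 < count_list \<Xi> x" "x \<in> set \<Xi>"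
    using knot_multiplicity[of j x "p - 1"] * eq length_eq by auto
  then show False using count_inner[of x] assms by auto
qed

lemma finite_knots: "finite (range \<xi>)"
proof -
  have "range \<xi> \<subseteq> set \<Xi>" using length_gt by (auto simp: knot_def)
  then show ?thesis using finite_subset by blast
qed

lemma bspline_nth: "i < n \<Longrightarrow> bspline ((!) \<Xi>) p i = bspline \<xi> p i"
  using length_eq by (intro ext bspline_cong) (simp add: knot_nth)

lemma bspline_reduce:
  assumes "a \<le> p" "j < n - a"
  shows "bspline ((!) (reduce_knots a \<Xi>)) (p - a) j = bspline \<xi> (p - a) (j + a)"
proof
  fix x
  have "bspline ((!) (reduce_knots a \<Xi>)) (p - a) j x = bspline (\<lambda>k. \<xi> (k + a)) (p - a) j x"
    using assms length_eq
    by (intro bspline_cong) (auto simp: reduce_knots_def knot_nth add.commute)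
  then show "bspline ((!) (reduce_knots a \<Xi>)) (p - a) j x = bspline \<xi> (p - a) (j + a) x"
    by (simp add: bspline_shift)
qed

lemma num_reduce: "a \<le> p \<Longrightarrow> num_bsplines (p - a) (reduce_knots a \<Xi>) = n - a"
  using length_eq p_less_n by (simp add: num_bsplines_def reduce_knots_def)

lemma bspline_outside:
  assumes "0 < x" "x < 1" "k < a \<or> n \<le> k" "a \<le> p"
  shows "bspline \<xi> (p - a) k x = 0"
proof (rule bspline_eq_0[OF knot_mono])
  show "x < \<xi> k \<or> \<xi> (k + (p - a) + 1) \<le> x"
  proof (cases "k < a")
    case True
    then have "k + (p - a) + 1 \<le> p" using assms(4) by linarith
    then show ?thesis using assms(1) knot_first by fastforce
  next
    case False
    then show ?thesis using assms knot_last[of k] by auto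
  qed
qed

lemma bspline_deriv_cont:
  assumes "a + q \<le> 1" "0 < x" "x < 1"
  shows "isCont (bspline_deriv \<xi> a (p - q) i) x"
proof (rule bspline_deriv_isCont[OF knot_mono])
  show "a \<le> p - q" using assms(1) p_ge_2 by linarith
  have "p - 1 \<le> p - q - a" using assms(1) by linarith
  then show "\<not> (\<xi> j = x \<and> \<xi> (j + (p - q - a)) = x)" for j
    using knot_inner[OF assms(2,3)] by blast
qed

text \<open>
  On \<open>(0,1)\<close>, \<open>spline_fun a\<close> is the space of splines of degree \<open>p - a\<close> on the reduced knots.
  B-splines of degree \<open>p - a\<close> on the full knot vector that are missing from the reduced one
  vanish on \<open>(0,1)\<close>.
\<close>

definition spline_fun :: "nat \<Rightarrow> (real \<Rightarrow> real) \<Rightarrow> bool" where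
  "spline_fun a f \<longleftrightarrow> (\<exists>c. \<forall>x. 0 < x \<and> x < 1 \<longrightarrow>
      f x = (\<Sum>j<n - a. c j * bspline \<xi> (p - a) (j + a) x))"

lemma spline_fun_bspline:
  assumes "a \<le> p" shows "spline_fun a (bspline \<xi> (p - a) k)"
proof (cases "k < a \<or> n \<le> k")
  case True
  then show ?thesis unfolding spline_fun_def
    using bspline_outside assms by (intro exI[of _ "\<lambda>_. 0"]) auto
next
  case False
  have "bspline \<xi> (p - a) k x = (\<Sum>j<n - a. (if j = k - a then 1 else 0) * bspline \<xi> (p - a) (j + a) x)" for x
  proof -
    have "(\<Sum>j<n - a. (if j = k - a then 1 else 0) * bspline \<xi> (p - a) (j + a) x)
        = (\<Sum>j<n - a. if j = k - a then bspline \<xi> (p - a) (j + a) x else 0)"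
      by (intro sum.cong) auto
    then show ?thesis using False by (simp add: less_diff_conv)
  qed
  then show ?thesis unfolding spline_fun_def by (intro exI[of _ "\<lambda>j. if j = k - a then 1 else 0"]) auto
qed

lemma spline_fun_diff:
  assumes "spline_fun a f" "spline_fun a g" shows "spline_fun a (\<lambda>x. C * (f x / r - g x / s))"
proof -
  obtain c d where "\<forall>x. 0 < x \<and> x < 1 \<longrightarrow> f x = (\<Sum>j<n - a. c j * bspline \<xi> (p - a) (j + a) x)"
     "\<forall>x. 0 < x \<and> x < 1 \<longrightarrow> g x = (\<Sum>j<n - a. d j * bspline \<xi> (p - a) (j + a) x)"
    using assms unfolding spline_fun_def by blast
  then have "\<forall>x. 0 < x \<and> x < 1 \<longrightarrow> C * (f x / r - g x / s)
      = (\<Sum>j<n - a. (C * (c j / r - d j / s)) * bspline \<xi> (p - a) (j + a) x)"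
    by (simp add: sum_distrib_left sum_subtractf[symmetric] sum_divide_distrib algebra_simps)
  then show ?thesis unfolding spline_fun_def
    by (intro exI[of _ "\<lambda>j. C * (c j / r - d j / s)"])
qed

lemma spline_fun_bspline_deriv:
  assumes "a + q \<le> p" shows "spline_fun (a + q) (bspline_deriv \<xi> a (p - q) k)"
  using assms
proof (induction a arbitrary: q k)
  case 0
  then show ?case using spline_fun_bspline by (simp add: bspline_deriv_fun)
next
  case (Suc a)
  then have *: "p - q = Suc (p - Suc q)" by simp
  have "spline_fun (a + Suc q) (bspline_deriv \<xi> a (p - Suc q) k)" for k
    using Suc.prems by (intro Suc.IH) auto
  then show ?case
    unfolding * bspline_deriv_fun by (intro spline_fun_diff) (auto)
qed

text \<open>
  These numbers are the first moments of the dual functionals as well as the coefficients of the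
  identity in the B-spline basis. Their agreement is the reproduction of linear functions.
\<close>

definition greville :: "nat \<Rightarrow> real" where
  "greville i = (\<Sum>k=1..p. \<xi> (i + k)) / real p"

lemma sum_bspline: "0 < x \<Longrightarrow> x < 1 \<Longrightarrow> (\<Sum>i<n. bspline \<xi> p i x) = 1"
  using bspline_partition_of_unity[OF knot_mono order_refl, of p x n] knot_first[of p] knot_last[of n]
  by (simp add: lessThan_atLeast0)

lemma sum_greville: "0 < x \<Longrightarrow> x < 1 \<Longrightarrow> (\<Sum>i<n. greville i * bspline \<xi> p i x) = x"
  using bspline_greville[OF knot_mono order_refl, of p x n] knot_first[of p] knot_last[of n] p_ge_2
  by (simp add: lessThan_atLeast0 greville_def sum_divide_distrib[symmetric] field_simps)

lemma spline_deriv: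
  assumes "x \<notin> range \<xi>"
  shows "((\<lambda>x. \<Sum>i<n. c i * bspline_deriv \<xi> a p i x) has_real_derivative
     (\<Sum>i<n. c i * bspline_deriv \<xi> (Suc a) p i x)) (at x)"
  by (intro DERIV_sum DERIV_cmult bspline_deriv_deriv knot_mono assms)

lemma eventually_good:
  assumes "0 < x" "x < 1" "x \<notin> range \<xi>"
  shows "\<forall>\<^sub>F y in nhds x. 0 < y \<and> y < 1 \<and> y \<notin> range \<xi>"
proof -
  have "open ({0<..<1} - range \<xi>)" using finite_imp_closed[OF finite_knots] by (intro open_Diff) auto
  then have "\<forall>\<^sub>F y in nhds x. y \<in> {0<..<1} - range \<xi>" using assms by (intro eventually_nhds_in_open) auto
  then show ?thesis by eventually_elim auto
qed

lemma spline_deriv_eq: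
  assumes "0 < x" "x < 1" "x \<notin> range \<xi>"
    and eq: "\<And>y. 0 < y \<Longrightarrow> y < 1 \<Longrightarrow> y \<notin> range \<xi> \<Longrightarrow> (\<Sum>i<n. c i * bspline_deriv \<xi> a p i y) = f y"
    and f: "(f has_real_derivative f') (at x)"
  shows "(\<Sum>i<n. c i * bspline_deriv \<xi> (Suc a) p i x) = f'"
proof -
  have "\<forall>\<^sub>F y in nhds x. (\<Sum>i<n. c i * bspline_deriv \<xi> a p i y) = f y"
    using eventually_good[OF assms(1-3)] by eventually_elim (use eq in auto)
  then have "((\<lambda>x. \<Sum>i<n. c i * bspline_deriv \<xi> a p i x) has_real_derivative f') (at x)"
    using f by (subst DERIV_cong_ev[OF refl _ refl])
  then show ?thesis using spline_deriv[OF assms(3)] DERIV_unique by blast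
qed

lemma sum_bspline_deriv:
  assumes "0 < x" "x < 1" "x \<notin> range \<xi>"
  shows "(\<Sum>i<n. bspline_deriv \<xi> 1 p i x) = 0"
    "(\<Sum>i<n. greville i * bspline_deriv \<xi> 2 p i x) = 0"
proof -
  show "(\<Sum>i<n. bspline_deriv \<xi> 1 p i x) = 0"
    using spline_deriv_eq[OF assms, of "\<lambda>_. 1" 0 "\<lambda>_. 1" 0] sum_bspline by simp
  have "(\<Sum>i<n. greville i * bspline_deriv \<xi> (Suc 0) p i y) = 1"
    if "0 < y" "y < 1" "y \<notin> range \<xi>" for y
    using spline_deriv_eq[OF that, of greville 0 "\<lambda>y. y" 1] sum_greville by simp
  then show "(\<Sum>i<n. greville i * bspline_deriv \<xi> 2 p i x) = 0"
    using spline_deriv_eq[OF assms, of greville 1 "\<lambda>_. 1" 0] by (simp add: numeral_2_eq_2)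
qed

end

text \<open>
  A density of the functional \<open>v \<mapsto> \<lambda>\<^sub>i v\<close>, cut off at the ends of the unit interval. The functional
  sees \<open>v\<close> only up to null sets and is given here for every \<open>v\<close> that has a Borel representative.
\<close>

definition is_dual_density :: "nat \<Rightarrow> real list \<Rightarrow> nat \<Rightarrow> (real \<Rightarrow> real) \<Rightarrow> bool" where
  "is_dual_density p \<Xi> i m \<longleftrightarrow> m \<in> borel_measurable borel \<and> (\<exists>C. \<forall>t. \<bar>m t\<bar> \<le> C) \<and>
     (\<forall>t. t \<notin> {0<..<1} \<longrightarrow> m t = 0) \<and> (LINT t|lborel. m t) = 1 \<and>
     (LINT t|lborel. t * m t) = spline_knots.greville p \<Xi> i \<and>
     (\<forall>v w. w \<in> borel_measurable borel \<longrightarrow> (AE t in lborel. 0 < t \<and> t < 1 \<longrightarrow> v t = w t) \<longrightarrow>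
        schumaker_functional ((!) \<Xi>) p i v = (LINT t|lborel. w t * m t))"

definition dual_density :: "nat \<Rightarrow> real list \<Rightarrow> nat \<Rightarrow> real \<Rightarrow> real" where
  "dual_density p \<Xi> i = (SOME m. is_dual_density p \<Xi> i m)"

lemma AE_not_in_finite: "finite (K :: real set) \<Longrightarrow> AE t in lborel. t \<notin> K"
  using finite_imp_null_set_lborel AE_not_in by blast

lemma (in spline_knots) dual_density:
  assumes "i < n" shows "is_dual_density p \<Xi> i (dual_density p \<Xi> i)"
proof -
  have "0 < p" using p_ge_2 by simp
  obtain m C K where m: "m \<in> borel_measurable borel" "\<And>t. \<bar>m t\<bar> \<le> C"
      "\<And>t. t \<notin> {\<xi> i..\<xi> (i + p + 1)} \<Longrightarrow> m t = 0" "finite K"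
    and D: "\<And>t. t \<in> {\<xi> i..\<xi> (i + p + 1)} - K \<Longrightarrow>
       (deriv ^^ (p + 1)) (\<lambda>t. schumaker_g \<xi> p i t * schumaker_q \<xi> p i t) t = m t"
    and I: "(LINT t|lborel. m t) = 1" "(LINT t|lborel. t * m t) = greville i"
    unfolding greville_def by (fact schumaker_density[OF \<open>0 < p\<close> knot_less[OF assms]])
  define m' where "m' t = indicator {0<..<1} t * m t" for t
  have m'[measurable]: "m' \<in> borel_measurable borel" unfolding m'_def using m(1) by measurable
  have outside: "m t = 0" if "t < 0 \<or> 1 < t" for t
    using m(3)[of t] that knot_unit(1)[of i] knot_unit(2)[of "i + p + 1"] by auto
  have ae: "AE t in lborel. t \<notin> {0,1} \<union> K" using m(4) by (intro AE_not_in_finite) auto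
  then have ae_m: "AE t in lborel. m' t = m t"
  proof eventually_elim
    case (elim t)
    then show ?case using outside[of t] by (cases "t < 0 \<or> 1 < t") (auto simp: m'_def indicator_def)
  qed
  have knots: "((!) \<Xi>) j = \<xi> j" if "j \<le> i + p + 1" for j
    using that assms length_eq by (simp add: knot_nth)
  have gq: "schumaker_g ((!) \<Xi>) p i = schumaker_g \<xi> p i" "schumaker_q ((!) \<Xi>) p i = schumaker_q \<xi> p i"
    unfolding schumaker_g_def schumaker_q_def using knots by (auto intro!: ext prod.cong)
  have "is_dual_density p \<Xi> i m'"
    unfolding is_dual_density_def
  proof (intro conjI allI impI)
    show "\<exists>C. \<forall>t. \<bar>m' t\<bar> \<le> C" using m(2) order.trans[OF abs_ge_zero m(2)]
      by (intro exI[of _ C]) (auto simp: m'_def indicator_def)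
    show "(LINT t|lborel. m' t) = 1"
      unfolding I(1)[symmetric] using ae_m m(1) by (intro integral_cong_AE) auto
    show "(LINT t|lborel. t * m' t) = greville i"
      unfolding I(2)[symmetric] using ae_m m(1) by (intro integral_cong_AE) (auto elim: eventually_mono)
    fix v w :: "real \<Rightarrow> real"
    assume w: "w \<in> borel_measurable borel" and vw: "AE t in lborel. 0 < t \<and> t < 1 \<longrightarrow> v t = w t"
    note [measurable] = w
    show "schumaker_functional ((!) \<Xi>) p i v = (LINT t|lborel. w t * m' t)"
      unfolding schumaker_functional_def gq set_lebesgue_integral_def
    proof (rule lebesgue_integral_AE_borel)
      show "AE t in lborel. indicat_real {\<Xi> ! i..\<Xi> ! (i + p + 1)} t *\<^sub>R
           (v t * (deriv ^^ (p + 1)) (\<lambda>t. schumaker_g \<xi> p i t * schumaker_q \<xi> p i t) t) = w t * m' t"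
        using ae ae_m vw
      proof eventually_elim
        case (elim t)
        show ?case
        proof (cases "t \<in> {\<xi> i..\<xi> (i + p + 1)}")
          case True
          then have "t \<in> {\<Xi> ! i..\<Xi> ! (i + p + 1)}" using knots[of i] knots[of "i+p+1"] by simp
          moreover have "0 < t" "t < 1" using True elim(1) knot_unit(1)[of i] knot_unit(2)[of "i + p + 1"] by auto
          ultimately show ?thesis using elim D[of t] True by simp
        next
          case False
          then have "t \<notin> {\<Xi> ! i..\<Xi> ! (i + p + 1)}" using knots[of i] knots[of "i+p+1"] by simp
          then show ?thesis using elim(2) m(3)[OF False] by simp
        qed
      qed
    qed (use w in measurable)
  qed (auto simp: m'_def)
  then show ?thesis unfolding dual_density_def by (rule someI[of "is_dual_density p \<Xi> i"])
qed

text \<open>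
  Integration over \<open>(t,1)\<close> is the adjoint of the integration over \<open>(0,t)\<close> that occurs in the
  projections for the derivatives.
\<close>

definition tail_integral :: "(real \<Rightarrow> real) \<Rightarrow> real \<Rightarrow> real" where
  "tail_integral f s = indicator {0<..<1} s * (LINT t|lborel. indicator {s..} t * f t)"

definition unit_fun :: "(real \<Rightarrow> real) \<Rightarrow> bool" where
  "unit_fun f \<longleftrightarrow> f \<in> borel_measurable borel \<and> (\<exists>C. \<forall>t. \<bar>f t\<bar> \<le> C) \<and> (\<forall>t. t \<notin> {0<..<1} \<longrightarrow> f t = 0)"

lemma unit_fun_measurable: "unit_fun f \<Longrightarrow> f \<in> borel_measurable borel"
  by (simp add: unit_fun_def)

lemma unit_fun_bound:
  assumes "unit_fun f" obtains C where "0 \<le> C" "\<And>t. \<bar>f t\<bar> \<le> C * indicator {0<..<1} t"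
proof -
  obtain C where C: "\<And>t. \<bar>f t\<bar> \<le> C" "\<And>t. t \<notin> {0<..<1} \<Longrightarrow> f t = 0" using assms by (auto simp: unit_fun_def)
  then show thesis using order.trans[OF abs_ge_zero C(1)] by (intro that[of C]) (auto simp: indicator_def)
qed

lemma integrable_unit_indicator[simp]: "integrable lborel (indicator {0<..<1::real} :: real \<Rightarrow> real)"
  by (simp add: integrable_real_indicator)

lemma unit_fun_integrable:
  assumes "unit_fun f" shows "integrable lborel f"
proof -
  obtain C where C: "0 \<le> C" "\<And>t. \<bar>f t\<bar> \<le> C * indicator {0<..<1} t"
    by (fact unit_fun_bound[OF assms])
  show ?thesis
  proof (rule Bochner_Integration.integrable_bound)
    show "integrable lborel (\<lambda>t. C * indicator {0<..<1::real} t)" by simp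
    show "AE t in lborel. norm (f t) \<le> norm (C * indicator {0<..<1} t)"
      using C by (intro AE_I2) (simp add: abs_mult)
  qed (use unit_fun_measurable[OF assms] in simp)
qed

lemma unit_fun_tail:
  assumes "unit_fun f" shows "unit_fun (tail_integral f)"
proof -
  note [measurable] = unit_fun_measurable[OF assms]
  have int: "integrable lborel f" by (rule unit_fun_integrable[OF assms])
  have "\<bar>LINT t|lborel. indicator {s..} t * f t\<bar> \<le> (LINT t|lborel. \<bar>f t\<bar>)" for s
  proof -
    have "\<bar>LINT t|lborel. indicator {s..} t * f t\<bar> \<le> (LINT t|lborel. \<bar>indicator {s..} t * f t\<bar>)"
      by (rule integral_abs_bound)
    also have "\<dots> \<le> (LINT t|lborel. \<bar>f t\<bar>)"
      using int by (intro integral_mono') (auto simp: indicator_def)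
    finally show ?thesis .
  qed
  then have bd: "\<bar>tail_integral f s\<bar> \<le> (LINT t|lborel. \<bar>f t\<bar>)" for s
    unfolding tail_integral_def by (auto simp: indicator_def)
  have "(\<lambda>s. indicator {0<..<1} s * (LINT t|lborel. (if s \<le> t then 1 else 0) * f t)) \<in> borel_measurable borel"
    by measurable
  then have "tail_integral f \<in> borel_measurable borel"
    unfolding tail_integral_def by (simp add: indicator_def if_distrib cong: if_cong)
  then show ?thesis unfolding unit_fun_def using bd by (auto simp: tail_integral_def)
qed

lemma integrable_product:
  fixes v :: "'a::euclidean_space \<Rightarrow> real" and f :: "'b::euclidean_space \<Rightarrow> real"
  assumes v: "integrable lborel v" and f: "integrable lborel f"
  shows "integrable (lborel \<Otimes>\<^sub>M lborel) (\<lambda>(s, t). v s * f t)"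
proof (rule lborel_pair.Fubini_integrable)
  note [measurable] = borel_measurable_integrable[OF v] borel_measurable_integrable[OF f]
  show "(\<lambda>(s, t). v s * f t) \<in> borel_measurable (lborel \<Otimes>\<^sub>M lborel)" by measurable
  show "integrable lborel (\<lambda>s. LINT t|lborel. norm (case (s, t) of (s, t) \<Rightarrow> v s * f t))"
    using v f by (simp add: abs_mult)
  show "AE s in lborel. integrable lborel (\<lambda>t. case (s, t) of (s, t) \<Rightarrow> v s * f t)"
    using f by simp
qed

lemma tail_integral_adjoint:
  assumes f: "unit_fun f" and v: "integrable lborel v"
  shows "(LINT t|lborel. (LINT s|lborel. indicator {0<..<1} s * indicator {..t} s * v s) * f t)
    = (LINT s|lborel. v s * tail_integral f s)"
proof -
  note [measurable] = unit_fun_measurable[OF f] borel_measurable_integrable[OF v]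
  have fi: "integrable lborel f" by (rule unit_fun_integrable[OF f])
  define h where "h s t = indicator {0<..<1} s * (if s \<le> t then 1 else 0) * v s * f t" for s t :: real
  have "integrable (lborel \<Otimes>\<^sub>M lborel) (\<lambda>(s, t). v s * f t)"
    by (rule integrable_product[OF v fi])
  then have "integrable (lborel \<Otimes>\<^sub>M lborel) (\<lambda>(s, t). h s t)"
    unfolding h_def by (rule Bochner_Integration.integrable_bound) (auto simp: indicator_def)
  then have "(LINT t|lborel. (LINT s|lborel. h s t)) = (LINT s|lborel. (LINT t|lborel. h s t))"
    by (rule lborel_pair.Fubini_integral)
  moreover have "(LINT s|lborel. h s t) = (LINT s|lborel. indicator {0<..<1} s * indicator {..t} s * v s) * f t" for t
    unfolding h_def by (auto simp: indicator_def integral_mult_left_zero[symmetric] simp del: integral_mult_left_zero intro!: Bochner_Integration.integral_cong)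
  moreover have "(LINT t|lborel. h s t) = v s * tail_integral f s" for s
    unfolding h_def tail_integral_def
    by (auto simp: indicator_def integral_mult_right_zero[symmetric] simp del: integral_mult_right_zero intro!: Bochner_Integration.integral_cong)
  ultimately show ?thesis by simp
qed

definition prim_integral :: "(real \<Rightarrow> real) \<Rightarrow> real \<Rightarrow> real" where
  "prim_integral w t = (LINT s|lborel. indicator {0<..<1} s * indicator {..t} s * w s)"

lemma lebesgue_prim_integral:
  assumes w: "w \<in> borel_measurable borel" and ae: "AE t in lborel. 0 < t \<and> t < 1 \<longrightarrow> v t = w t"
    and t: "0 < t" "t < 1"
  shows "(LINT s:{0..t}|lebesgue. v s) = prim_integral w t"
  unfolding set_lebesgue_integral_def prim_integral_def
proof (rule lebesgue_integral_AE_borel)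
  have "AE s :: real in lborel. s \<notin> {0, 1}" by (rule AE_not_in_finite) simp
  then show "AE s in lborel. indicat_real {0..t} s *\<^sub>R v s = indicat_real {0<..<1} s * indicat_real {..t} s * w s"
    using ae by eventually_elim (use t in \<open>auto simp: indicator_def\<close>)
qed (use w in measurable)

lemma prim_integral_unit:
  assumes w: "integrable lborel w"
  shows "unit_fun (\<lambda>t. indicator {0<..<1} t * prim_integral w t)"
proof -
  note [measurable] = borel_measurable_integrable[OF w]
  have "\<bar>prim_integral w t\<bar> \<le> (LINT s|lborel. \<bar>w s\<bar>)" for t
  proof -
    have "\<bar>prim_integral w t\<bar> \<le> (LINT s|lborel. \<bar>indicator {0<..<1} s * indicator {..t} s * w s\<bar>)"
      unfolding prim_integral_def by (rule integral_abs_bound)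
    also have "\<dots> \<le> (LINT s|lborel. \<bar>w s\<bar>)"
      using w by (intro integral_mono') (auto simp: indicator_def)
    finally show ?thesis .
  qed
  moreover have "(\<lambda>t. indicator {0<..<1} t *
      (LINT s|lborel. indicator {0<..<1} s * (if s \<le> t then 1 else 0) * w s)) \<in> borel_measurable borel"
    by measurable
  then have "(\<lambda>t. indicator {0<..<1} t * prim_integral w t) \<in> borel_measurable borel"
    unfolding prim_integral_def by (simp add: indicator_def if_distrib cong: if_cong)
  ultimately show ?thesis unfolding unit_fun_def by (auto simp: indicator_def intro!: exI[of _ "LINT s|lborel. \<bar>w s\<bar>"])
qed

lemma prim_integral_adjoint:
  "unit_fun f \<Longrightarrow> integrable lborel w \<Longrightarrow>
    (LINT t|lborel. prim_integral w t * f t) = (LINT s|lborel. w s * tail_integral f s)"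
  unfolding prim_integral_def by (rule tail_integral_adjoint)

text \<open>
  The projection of order \<open>a\<close> has the kernel \<open>\<Sum>\<^sub>i primal a i x * dual a i t\<close>: the primal functions
  are the derivatives of the B-splines, and the dual functions are iterated integrals of the
  densities of Schumaker's functionals.
\<close>

definition primal :: "nat \<Rightarrow> real list \<Rightarrow> nat \<Rightarrow> nat \<Rightarrow> real \<Rightarrow> real" where
  "primal p \<Xi> a i x = indicator {0<..<1} x * bspline_deriv (knot \<Xi>) a p i x"

fun dual :: "nat \<Rightarrow> real list \<Rightarrow> nat \<Rightarrow> nat \<Rightarrow> real \<Rightarrow> real" where
  "dual p \<Xi> 0 i = dual_density p \<Xi> i"
| "dual p \<Xi> (Suc a) i = tail_integral (dual p \<Xi> a i)"

context spline_knots begin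

lemma unit_fun_dual: "i < n \<Longrightarrow> unit_fun (dual p \<Xi> a i)"
proof (induction a)
  case 0
  then show ?case using dual_density[of i] by (auto simp: is_dual_density_def unit_fun_def)
next
  case (Suc a)
  then show ?case by (simp add: unit_fun_tail)
qed

lemma unit_fun_primal: "unit_fun (primal p \<Xi> a i)"
proof -
  obtain C where C: "\<And>x. \<bar>bspline_deriv \<xi> a p i x\<bar> \<le> C" using bspline_deriv_bounded[OF knot_mono] by blast
  have "0 \<le> C" using order.trans[OF abs_ge_zero C[of 0]] .
  then have "\<bar>primal p \<Xi> a i x\<bar> \<le> C" for x using C[of x] by (auto simp: primal_def indicator_def)
  moreover have "primal p \<Xi> a i \<in> borel_measurable borel" unfolding primal_def by measurable
  ultimately show ?thesis unfolding unit_fun_def by (auto simp: primal_def)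
qed

lemma functional_dual:
  assumes "i < n" "integrable lborel w" "AE t in lborel. 0 < t \<and> t < 1 \<longrightarrow> v t = w t"
  shows "schumaker_functional ((!) \<Xi>) p i v = (LINT t|lborel. w t * dual p \<Xi> 0 i t)"
  using dual_density[OF assms(1)] assms(2,3) unfolding is_dual_density_def by auto

lemma functional_dual_1:
  assumes "i < n" "integrable lborel w" "\<And>t. 0 < t \<Longrightarrow> t < 1 \<Longrightarrow> v t = prim_integral w t"
  shows "schumaker_functional ((!) \<Xi>) p i v = (LINT t|lborel. w t * dual p \<Xi> 1 i t)"
proof -
  have u: "unit_fun (dual p \<Xi> 0 i)" by (rule unit_fun_dual[OF assms(1)])
  have "schumaker_functional ((!) \<Xi>) p i v
      = (LINT t|lborel. (indicator {0<..<1} t * prim_integral w t) * dual p \<Xi> 0 i t)"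
    using assms unit_fun_integrable[OF prim_integral_unit[OF assms(2)]]
    by (intro functional_dual) auto
  also have "\<dots> = (LINT t|lborel. prim_integral w t * dual p \<Xi> 0 i t)"
    using u by (intro Bochner_Integration.integral_cong) (auto simp: unit_fun_def indicator_def)
  also have "\<dots> = (LINT t|lborel. w t * dual p \<Xi> 1 i t)"
    using prim_integral_adjoint[OF u assms(2)] by simp
  finally show ?thesis .
qed

lemma functional_dual_2:
  assumes "i < n" "integrable lborel w"
    "\<And>t. 0 < t \<Longrightarrow> t < 1 \<Longrightarrow> v t = prim_integral (\<lambda>t. indicator {0<..<1} t * prim_integral w t) t"
  shows "schumaker_functional ((!) \<Xi>) p i v = (LINT t|lborel. w t * dual p \<Xi> 2 i t)"
proof -
  have u: "unit_fun (dual p \<Xi> 1 i)" by (rule unit_fun_dual[OF assms(1)])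
  have "schumaker_functional ((!) \<Xi>) p i v
      = (LINT t|lborel. (indicator {0<..<1} t * prim_integral w t) * dual p \<Xi> 1 i t)"
    using assms unit_fun_integrable[OF prim_integral_unit[OF assms(2)]]
    by (intro functional_dual_1) auto
  also have "\<dots> = (LINT t|lborel. prim_integral w t * dual p \<Xi> 1 i t)"
    using u by (intro Bochner_Integration.integral_cong) (auto simp: unit_fun_def indicator_def)
  also have "\<dots> = (LINT t|lborel. w t * dual p \<Xi> 2 i t)"
    using prim_integral_adjoint[OF u assms(2)] by (simp add: numeral_2_eq_2)
  finally show ?thesis .
qed

lemma spline_proj_eq:
  "spline_proj p \<Xi> v = (\<lambda>x. \<Sum>i<n. schumaker_functional ((!) \<Xi>) p i v * bspline_deriv \<xi> 0 p i x)"
  unfolding spline_proj_def by (auto simp: bspline_nth)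

lemma spline_proj_deriv:
  assumes "x \<notin> range \<xi>"
  shows "deriv (spline_proj p \<Xi> v) x = (\<Sum>i<n. schumaker_functional ((!) \<Xi>) p i v * bspline_deriv \<xi> 1 p i x)"
  unfolding spline_proj_eq using spline_deriv[OF assms, where a = 0] by (intro DERIV_imp_deriv) auto

lemma spline_proj_deriv2:
  assumes x: "0 < x" "x < 1" "x \<notin> range \<xi>"
  shows "(deriv ^^ 2) (spline_proj p \<Xi> v) x = (\<Sum>i<n. schumaker_functional ((!) \<Xi>) p i v * bspline_deriv \<xi> 2 p i x)"
proof -
  let ?f = "\<lambda>x. \<Sum>i<n. schumaker_functional ((!) \<Xi>) p i v * bspline_deriv \<xi> 1 p i x"
  have "\<forall>\<^sub>F y in nhds x. deriv (spline_proj p \<Xi> v) y = ?f y"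
    using eventually_good[OF x] by eventually_elim (use spline_proj_deriv in auto)
  moreover have "(?f has_real_derivative (\<Sum>i<n. schumaker_functional ((!) \<Xi>) p i v * bspline_deriv \<xi> 2 p i x)) (at x)"
    using spline_deriv[OF x(3), where a = 1] by (simp only: numeral_2_eq_2 One_nat_def)
  ultimately have "(deriv (spline_proj p \<Xi> v) has_real_derivative
      (\<Sum>i<n. schumaker_functional ((!) \<Xi>) p i v * bspline_deriv \<xi> 2 p i x)) (at x)"
    by (subst DERIV_cong_ev[OF refl _ refl])
  then show ?thesis by (simp add: numeral_2_eq_2 DERIV_imp_deriv)
qed

text \<open>
  The primitives in the definition of the projections are moved to the densities by adjointness. For
  \<open>a > 0\<close> the point \<open>x\<close> has to avoid the knots, where the derivative of the projection may not exist.
\<close>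

lemma spline_proj_order_kernel:
  assumes w: "integrable lborel w" and ae: "AE t in lborel. 0 < t \<and> t < 1 \<longrightarrow> v t = w t"
    and x: "0 < x" "x < 1" "a = 0 \<or> x \<notin> range \<xi>" and a: "a \<le> 2"
  shows "spline_proj_order p \<Xi> a v x = (\<Sum>i<n. (LINT t|lborel. w t * dual p \<Xi> a i t) * primal p \<Xi> a i x)"
proof -
  have wm: "w \<in> borel_measurable borel" using w by (simp add: borel_measurable_integrable)
  define w1 where "w1 = (\<lambda>t. indicator {0<..<1} t * prim_integral w t)"
  have w1: "w1 \<in> borel_measurable borel"
    unfolding w1_def by (rule unit_fun_measurable[OF prim_integral_unit[OF w]])
  have v1: "(LINT s:{0..t}|lebesgue. v s) = prim_integral w t" if "0 < t" "t < 1" for t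
    by (rule lebesgue_prim_integral[OF wm ae that])
  have v2: "(LINT s:{0..t}|lebesgue. (LINT s:{0..s}|lebesgue. v s)) = prim_integral w1 t" if "0 < t" "t < 1" for t
    using v1 that by (intro lebesgue_prim_integral[OF w1]) (auto simp: w1_def)
  consider "a = 0" | "a = 1" | "a = 2" using a by linarith
  then show ?thesis
  proof cases
    case 1
    then show ?thesis
      using x functional_dual[OF _ w ae] by (simp add: spline_proj_order_def spline_proj_eq primal_def)
  next
    case 2
    then show ?thesis
      using x functional_dual_1[OF _ w v1]
      by (simp add: spline_proj_order_def spline_proj_c1_def spline_proj_deriv primal_def)
  next
    case 3
    then show ?thesis
      using x functional_dual_2[OF _ w v2[unfolded w1_def]]
      by (simp add: spline_proj_order_def spline_proj_c2_def spline_proj_deriv2 primal_def)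
  qed
qed

text \<open>
  The left side is the value at \<open>t = 0\<close> of the kernel of order \<open>a + 1\<close>, up to the continuous extension
  to the end point. It is also the derivative of order \<open>a + 1\<close> of the projection of a monomial of degree
  \<open>a \<le> 1\<close>, and the projection reproduces linear functions.
\<close>

lemma kernel_boundary:
  assumes x: "0 < x" "x < 1" "x \<notin> range \<xi>" and a: "a < 2"
  shows "(\<Sum>i<n. primal p \<Xi> (Suc a) i x * (LINT t|lborel. dual p \<Xi> a i t)) = 0"
proof (cases "a = 0")
  case True
  then show ?thesis
    using x sum_bspline_deriv(1)[OF x] dual_density by (simp add: primal_def is_dual_density_def)
next
  case False
  then have a1: "a = 1" using a by simp
  have "(LINT t|lborel. dual p \<Xi> 1 i t) = greville i" if i: "i < n" for i
  proof -
    have u: "unit_fun (dual p \<Xi> 0 i)" by (rule unit_fun_dual[OF i])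
    have P: "prim_integral (indicator {0<..<1}) t = t" if "0 < t" "t < 1" for t
    proof -
      have "prim_integral (indicator {0<..<1}) t = (LINT s|lborel. indicator {0<..t} s)"
        unfolding prim_integral_def using that by (intro Bochner_Integration.integral_cong) (auto simp: indicator_def)
      then show ?thesis using that by simp
    qed
    have "(LINT t|lborel. dual p \<Xi> 1 i t) = (LINT t|lborel. indicator {0<..<1} t * tail_integral (dual p \<Xi> 0 i) t)"
      by (intro Bochner_Integration.integral_cong) (auto simp: tail_integral_def indicator_def)
    also have "\<dots> = (LINT t|lborel. prim_integral (indicator {0<..<1}) t * dual p \<Xi> 0 i t)"
      using prim_integral_adjoint[OF u integrable_unit_indicator] by simp
    also have "\<dots> = (LINT t|lborel. t * dual p \<Xi> 0 i t)"
      using u P by (intro Bochner_Integration.integral_cong) (auto simp: unit_fun_def)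
    finally show ?thesis using dual_density[OF i] by (simp add: is_dual_density_def)
  qed
  then show ?thesis
    using x sum_bspline_deriv(2)[OF x] by (simp add: a1 primal_def mult.commute numeral_2_eq_2)
qed

lemma primal_deriv:
  assumes x: "0 < x" "x < 1" "x \<notin> range \<xi>"
  shows "(primal p \<Xi> a i has_real_derivative primal p \<Xi> (Suc a) i x) (at x)"
proof -
  have "\<forall>\<^sub>F y in nhds x. primal p \<Xi> a i y = bspline_deriv \<xi> a p i y"
    using eventually_good[OF x] by eventually_elim (auto simp: primal_def)
  then show ?thesis
    using x bspline_deriv_deriv[OF knot_mono x(3)] by (subst DERIV_cong_ev[OF refl _ refl]) (auto simp: primal_def)
qed

lemma spline_proj_linear:
  assumes "0 < x" "x < 1" and v: "\<And>t. 0 < t \<Longrightarrow> t < 1 \<Longrightarrow> v t = \<alpha> + \<beta> * t"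
  shows "spline_proj p \<Xi> v x = \<alpha> + \<beta> * x"
proof -
  have "schumaker_functional ((!) \<Xi>) p i v = \<alpha> + \<beta> * greville i" if i: "i < n" for i
  proof -
    have D: "is_dual_density p \<Xi> i (dual_density p \<Xi> i)" by (rule dual_density[OF i])
    have u: "unit_fun (dual_density p \<Xi> i)" using unit_fun_dual[OF i, of 0] by simp
    have it: "integrable lborel (\<lambda>t. t * dual_density p \<Xi> i t)"
    proof (rule Bochner_Integration.integrable_bound)
      show "integrable lborel (dual_density p \<Xi> i)" by (rule unit_fun_integrable[OF u])
      show "AE t in lborel. norm (t * dual_density p \<Xi> i t) \<le> norm (dual_density p \<Xi> i t)"
      proof (rule AE_I2)
        fix t :: real
        show "norm (t * dual_density p \<Xi> i t) \<le> norm (dual_density p \<Xi> i t)"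
          using u by (cases "t \<in> {0<..<1}") (auto simp: unit_fun_def abs_mult mult_left_le_one_le)
      qed
    qed (use unit_fun_measurable[OF u] in simp)
    have "schumaker_functional ((!) \<Xi>) p i v = (LINT t|lborel. (\<alpha> + \<beta> * t) * dual_density p \<Xi> i t)"
      using D v unfolding is_dual_density_def by auto
    also have "\<dots> = (LINT t|lborel. \<alpha> * dual_density p \<Xi> i t + \<beta> * (t * dual_density p \<Xi> i t))"
      by (simp add: algebra_simps)
    also have "\<dots> = \<alpha> + \<beta> * greville i"
      using it unit_fun_integrable[OF u] D by (simp add: is_dual_density_def)
    finally show ?thesis .
  qed
  then have "spline_proj p \<Xi> v x = (\<Sum>i<n. (\<alpha> + \<beta> * greville i) * bspline \<xi> p i x)"
    by (simp add: spline_proj_eq)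
  also have "\<dots> = \<alpha> * (\<Sum>i<n. bspline \<xi> p i x) + \<beta> * (\<Sum>i<n. greville i * bspline \<xi> p i x)"
    by (simp add: sum_distrib_left sum.distrib algebra_simps)
  finally show ?thesis using sum_bspline sum_greville assms by simp
qed

end

section \<open>Iterated integrals and tensor product projections\<close>

definition triple :: "real \<times> real \<times> real \<Rightarrow> real^3" where
  "triple = (\<lambda>(a, b, c). vector [a, b, c])"

lemma triple_nth[simp]: "triple (a, b, c) $ 1 = a" "triple (a, b, c) $ 2 = b" "triple (a, b, c) $ 3 = c"
  by (simp_all add: triple_def)

lemma triple_eq: "triple z = fst z *\<^sub>R axis 1 1 + fst (snd z) *\<^sub>R axis 2 1 + snd (snd z) *\<^sub>R axis 3 1"
  by (cases z) (auto simp: vec_eq_iff forall_3 axis_def)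

lemma triple_surj: "x = triple (x $ 1, x $ 2, x $ 3)"
  by (auto simp: vec_eq_iff forall_3)

lemma triple_measurable[measurable]: "triple \<in> borel_measurable borel"
  unfolding triple_eq by (intro borel_measurable_continuous_onI continuous_intros)

lemma prod_3: "prod f (UNIV::3 set) = f 1 * f 2 * (f 3 :: real)"
  unfolding UNIV_3 by (simp add: ac_simps)

lemma prod_Basis_cart:
  fixes f :: "real^'n \<Rightarrow> real"
  shows "(\<Prod>b\<in>Basis. f b) = (\<Prod>i\<in>UNIV. f (axis i 1))"
proof -
  have B: "(Basis :: (real^'n) set) = range (\<lambda>i. axis i 1)" by (auto simp: Basis_vec_def)
  have "inj (\<lambda>i::'n. axis i (1::real))" by (auto simp: inj_def axis_eq_axis)
  then show ?thesis unfolding B by (subst prod.reindex) auto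
qed

text \<open>
  Identification with the product measure, for which Fubini's theorem is available.
\<close>

lemma lborel_triple: "lborel = distr lborel borel triple"
proof (rule lborel_eqI)
  fix l u :: "real^3" assume le: "\<And>b. b \<in> Basis \<Longrightarrow> l \<bullet> b \<le> u \<bullet> b"
  have le': "l $ i \<le> u $ i" for i using le[of "axis i 1"] by (simp add: inner_axis)
  have v: "triple -` box l u = {l$1<..<u$1} \<times> ({l$2<..<u$2} \<times> {l$3<..<u$3})"
    by (auto simp: mem_box_cart forall_3)
  have "emeasure (distr lborel borel triple) (box l u) = emeasure lborel (triple -` box l u)"
    by (subst emeasure_distr) auto
  also have "\<dots> = emeasure (lborel \<Otimes>\<^sub>M lborel) ({l$1<..<u$1} \<times> ({l$2<..<u$2} \<times> {l$3<..<u$3}))"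
    unfolding v lborel_prod ..
  also have "\<dots> = ennreal (u$1 - l$1) * (ennreal (u$2 - l$2) * emeasure lborel {l$3<..<u$3})"
    by (subst lborel.emeasure_pair_measure_Times)
      (auto simp: lborel_prod[symmetric] lborel.emeasure_pair_measure_Times le')
  also have "\<dots> = ennreal (\<Prod>b\<in>Basis. (u - l) \<bullet> b)"
    using le' by (simp add: prod_Basis_cart inner_axis prod_3 ennreal_mult[symmetric] mult.assoc)
  finally show "emeasure (distr lborel borel triple) (box l u) = ennreal (\<Prod>b\<in>Basis. (u - l) \<bullet> b)" .
qed simp

lemma integrable_triple:
  fixes h :: "real^3 \<Rightarrow> real"
  assumes "integrable lborel h"
  shows "integrable (lborel \<Otimes>\<^sub>M lborel) (\<lambda>(a, z). h (triple (a, z)))"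
proof -
  have "integrable (distr lborel borel triple) h" using assms by (subst lborel_triple[symmetric])
  then have "integrable lborel (\<lambda>z. h (triple z))"
    using borel_measurable_integrable[OF assms] by (subst (asm) integrable_distr_eq) auto
  then show ?thesis unfolding lborel_prod by (simp add: case_prod_beta')
qed

lemma integral_triple:
  fixes h :: "real^3 \<Rightarrow> real"
  assumes "integrable lborel h"
  shows "integral\<^sup>L lborel h = (LINT a|lborel. LINT z|lborel. h (triple (a, z)))"
proof -
  have "integral\<^sup>L lborel h = integral\<^sup>L (distr lborel borel triple) h"
    by (subst lborel_triple[symmetric]) (rule refl)
  also have "\<dots> = integral\<^sup>L lborel (\<lambda>z. h (triple z))"
    using borel_measurable_integrable[OF assms] by (subst integral_distr) auto
  also have "\<dots> = integral\<^sup>L (lborel \<Otimes>\<^sub>M lborel) (\<lambda>(a, z). h (triple (a, z)))"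
    unfolding lborel_prod by (simp add: case_prod_beta')
  also have "\<dots> = (LINT a|lborel. LINT z|lborel. h (triple (a, z)))"
    using lborel_pair.integral_fst[OF integrable_triple[OF assms]] by simp
  finally show ?thesis .
qed

lemma AE_triple:
  assumes "AE x in lborel. P x"
  shows "AE a in lborel. AE z in lborel. P (triple (a, z))"
proof -
  have "AE x in distr lborel borel triple. P x" using assms by (subst lborel_triple[symmetric])
  then have "AE z in lborel. P (triple z)" by (rule AE_distrD[rotated]) simp
  then have "AE z in lborel \<Otimes>\<^sub>M lborel. P (triple z)" unfolding lborel_prod .
  then show ?thesis by (rule lborel_pair.AE_pair)
qed

lemma AE_pair_real:
  fixes P :: "real \<times> real \<Rightarrow> bool"
  assumes "AE z in lborel. P z" shows "AE a in lborel. AE b in lborel. P (a, b)"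
proof -
  have "AE z in lborel \<Otimes>\<^sub>M lborel. P z" using assms unfolding lborel_prod .
  then show ?thesis by (rule lborel_pair.AE_pair)
qed

lemma integral_pair_real:
  fixes h :: "real \<times> real \<Rightarrow> real"
  assumes "integrable lborel h"
  shows "integral\<^sup>L lborel h = (LINT a|lborel. LINT b|lborel. h (a, b))"
    and "AE a in lborel. integrable lborel (\<lambda>b. h (a, b))"
    and "integrable lborel (\<lambda>a. LINT b|lborel. h (a, b))"
    and "integral\<^sup>L lborel h = (LINT b|lborel. LINT a|lborel. h (a, b))"
proof -
  have *: "integrable (lborel \<Otimes>\<^sub>M lborel) (\<lambda>(a, b). h (a, b))"
    unfolding lborel_prod using assms by (simp add: case_prod_beta')
  show 1: "integral\<^sup>L lborel h = (LINT a|lborel. LINT b|lborel. h (a, b))"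
    using lborel_pair.integral_fst[OF *] by (simp add: lborel_prod case_prod_beta')
  show "AE a in lborel. integrable lborel (\<lambda>b. h (a, b))"
    using lborel_pair.AE_integrable_fst[OF *] by simp
  show "integrable lborel (\<lambda>a. LINT b|lborel. h (a, b))"
    using lborel_pair.integrable_fst[OF *] by simp
  show "integral\<^sup>L lborel h = (LINT b|lborel. LINT a|lborel. h (a, b))"
    using lborel_pair.Fubini_integral[OF *] 1 by simp
qed

definition upd :: "real^3 \<Rightarrow> 3 \<Rightarrow> real \<Rightarrow> real^3" where
  "upd x d t = (\<chi> k. if k = d then t else x $ k)"

lemma upd_triple:
  "upd (triple (a, b, c)) 1 t = triple (t, b, c)"
  "upd (triple (a, b, c)) 2 t = triple (a, t, c)"
  "upd (triple (a, b, c)) 3 t = triple (a, b, t)"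
  by (auto simp: upd_def vec_eq_iff forall_3)

lemma integral_eq_0_by_direction:
  fixes h :: "real^3 \<Rightarrow> real"
  assumes h: "integrable lborel h" and 0: "\<And>x. (LINT t|lborel. h (upd x d t)) = 0"
  shows "integral\<^sup>L lborel h = 0"
proof -
  have I: "integral\<^sup>L lborel h = (LINT a|lborel. LINT z|lborel. h (triple (a, z)))"
    by (rule integral_triple[OF h])
  have ae: "AE a in lborel. integrable lborel (\<lambda>z. h (triple (a, z)))"
    using lborel_pair.AE_integrable_fst[OF integrable_triple[OF h]] by simp
  consider "d = 1" | "d = 2" | "d = 3" using exhaust_3 by blast
  then show ?thesis
  proof cases
    case 1
    have "integral\<^sup>L lborel h = (LINT z|lborel. LINT a|lborel. h (triple (a, z)))"
      using I lborel_pair.Fubini_integral[OF integrable_triple[OF h]] by simp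
    moreover have "(LINT a|lborel. h (triple (a, z))) = 0" for z
      using 0[of "triple (0, fst z, snd z)"] unfolding 1 upd_triple by simp
    ultimately show ?thesis by simp
  next
    case 2
    have "AE a in lborel. (LINT z|lborel. h (triple (a, z))) = 0"
      using ae
    proof eventually_elim
      case (elim a)
      have "(LINT t|lborel. h (triple (a, t, c))) = 0" for c
        using 0[of "triple (a, 0, c)"] by (simp add: 2 upd_triple)
      then show ?case using integral_pair_real(4)[OF elim] by simp
    qed
    then show ?thesis using I by (simp add: integral_eq_zero_AE)
  next
    case 3
    have "AE a in lborel. (LINT z|lborel. h (triple (a, z))) = 0"
      using ae
    proof eventually_elim
      case (elim a)
      have "(LINT t|lborel. h (triple (a, b, t))) = 0" for b
        using 0[of "triple (a, b, 0)"] by (simp add: 3 upd_triple)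
      then show ?case using integral_pair_real(1)[OF elim] by simp
    qed
    then show ?thesis using I by (simp add: integral_eq_zero_AE)
  qed
qed

lemma integrable_mult_bounded:
  fixes w k :: "'a \<Rightarrow> real"
  assumes "integrable M w" "k \<in> borel_measurable M" "\<And>x. \<bar>k x\<bar> \<le> C"
  shows "integrable M (\<lambda>x. w x * k x)"
proof (rule Bochner_Integration.integrable_bound)
  show "integrable M (\<lambda>x. C * w x)" using assms(1) by simp
  show "(\<lambda>x. w x * k x) \<in> borel_measurable M" using assms by measurable
  have "\<bar>w x\<bar> * \<bar>k x\<bar> \<le> \<bar>w x\<bar> * \<bar>C\<bar>" for x
    using assms(3)[of x] by (intro mult_left_mono) auto
  then show "AE x in M. norm (w x * k x) \<le> norm (C * w x)"
    by (intro AE_I2) (simp add: abs_mult mult.commute)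
qed

lemma integrable_mult_unit: "integrable lborel w \<Longrightarrow> unit_fun k \<Longrightarrow> integrable lborel (\<lambda>t. w t * k t)"
  using integrable_mult_bounded[of lborel w k] by (auto simp: unit_fun_def)

lemma unit_fun_cmult: "unit_fun f \<Longrightarrow> unit_fun (\<lambda>t. c * f t)"
proof -
  assume f: "unit_fun f"
  obtain C where C: "\<And>t. \<bar>f t\<bar> \<le> C" using f by (auto simp: unit_fun_def)
  have "\<bar>c * f t\<bar> \<le> \<bar>c\<bar> * C" for t unfolding abs_mult by (rule mult_left_mono[OF C]) simp
  then show ?thesis using f unfolding unit_fun_def by (auto intro!: exI[of _ "\<bar>c\<bar> * C"])
qed

lemma unit_fun_add: "unit_fun f \<Longrightarrow> unit_fun g \<Longrightarrow> unit_fun (\<lambda>t. f t + g t)"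
proof -
  assume f: "unit_fun f" and g: "unit_fun g"
  obtain C D where C: "\<And>t. \<bar>f t\<bar> \<le> C" "\<And>t. \<bar>g t\<bar> \<le> D" using f g unfolding unit_fun_def by blast
  have "\<bar>f t + g t\<bar> \<le> C + D" for t using C(1)[of t] C(2)[of t] by linarith
  then show ?thesis using f g unfolding unit_fun_def by (auto intro!: exI[of _ "C + D"])
qed

lemma unit_fun_sum:
  fixes f :: "nat \<Rightarrow> real \<Rightarrow> real"
  shows "(\<And>i. i < n \<Longrightarrow> unit_fun (f i)) \<Longrightarrow> unit_fun (\<lambda>t. \<Sum>i<n. f i t)"
proof (induction n)
  case 0
  show ?case by (auto simp: unit_fun_def)
next
  case (Suc n)
  then show ?case using unit_fun_add[of "\<lambda>t. \<Sum>i<n. f i t" "f n"] by simp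
qed

definition kernel :: "nat \<Rightarrow> real list \<Rightarrow> nat \<Rightarrow> real \<Rightarrow> real \<Rightarrow> real" where
  "kernel p \<Xi> a x t = (\<Sum>i<num_bsplines p \<Xi>. primal p \<Xi> a i x * dual p \<Xi> a i t)"

lemma (in spline_knots) unit_fun_kernel: "unit_fun (kernel p \<Xi> a x)"
  unfolding kernel_def by (intro unit_fun_sum unit_fun_cmult unit_fun_dual)

lemma (in spline_knots) spline_proj_order_eq:
  assumes "integrable lborel w" "AE t in lborel. 0 < t \<and> t < 1 \<longrightarrow> v t = w t"
    and "0 < x" "x < 1" "a = 0 \<or> x \<notin> range \<xi>" "a \<le> 2"
  shows "spline_proj_order p \<Xi> a v x = (LINT t|lborel. w t * kernel p \<Xi> a x t)"
proof -
  have "(LINT t|lborel. w t * kernel p \<Xi> a x t)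
      = (LINT t|lborel. (\<Sum>i<n. primal p \<Xi> a i x * (w t * dual p \<Xi> a i t)))"
    by (simp add: kernel_def sum_distrib_left mult_ac)
  also have "\<dots> = (\<Sum>i<n. LINT t|lborel. primal p \<Xi> a i x * (w t * dual p \<Xi> a i t))"
    by (intro Bochner_Integration.integral_sum integrable_mult_right integrable_mult_unit assms unit_fun_dual) auto
  finally show ?thesis
    using spline_proj_order_kernel[OF assms] by (simp add: mult.commute)
qed

lemma tensor_proj_triple:
  "tensor_proj p \<Xi> a f (triple (x1, x2, x3)) =
    spline_proj_order (p 1) (\<Xi> 1) (a $ 1) (\<lambda>t1.
      spline_proj_order (p 2) (\<Xi> 2) (a $ 2) (\<lambda>t2.
        spline_proj_order (p 3) (\<Xi> 3) (a $ 3) (\<lambda>t3. f (triple (t1, t2, t3))) x3) x2) x1"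
proof -
  have "in_direction 3 P f (triple (a, b, c)) = P (\<lambda>t. f (triple (a, b, t))) c"
    "in_direction 2 P f (triple (a, b, c)) = P (\<lambda>t. f (triple (a, t, c))) b"
    "in_direction 1 P f (triple (a, b, c)) = P (\<lambda>t. f (triple (t, b, c))) a" for P f a b c
    unfolding in_direction_def using upd_triple[of a b c] by (simp_all add: upd_def)
  then show ?thesis unfolding tensor_proj_def Let_def by simp
qed

definition tensor_kernel :: "(3 \<Rightarrow> nat) \<Rightarrow> (3 \<Rightarrow> real list) \<Rightarrow> nat^3 \<Rightarrow> real^3 \<Rightarrow> real^3 \<Rightarrow> real" where
  "tensor_kernel p \<Xi> a x t = (\<Prod>d\<in>UNIV. kernel (p d) (\<Xi> d) (a $ d) (x $ d) (t $ d))"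

definition off_knots :: "(3 \<Rightarrow> real list) \<Rightarrow> real^3 \<Rightarrow> bool" where
  "off_knots \<Xi> x \<longleftrightarrow> (\<forall>d. 0 < x $ d \<and> x $ d < 1 \<and> x $ d \<notin> range (knot (\<Xi> d)))"

lemma unit_fun_coord_measurable:
  assumes "unit_fun k" shows "(\<lambda>t :: real^3. k (t $ d)) \<in> borel_measurable borel"
proof -
  note [measurable] = unit_fun_measurable[OF assms]
  have [measurable]: "(\<lambda>t :: real^3. t $ d) \<in> borel_measurable borel"
    by (intro borel_measurable_continuous_onI continuous_intros)
  show ?thesis by measurable
qed

lemma integrable_mult_coord:
  assumes "integrable lborel g" "unit_fun k"
  shows "integrable lborel (\<lambda>t :: real^3. g t * k (t $ d))"
  using integrable_mult_bounded[OF assms(1), of "\<lambda>t. k (t $ d)"] unit_fun_coord_measurable[OF assms(2)] assms(2)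
  by (auto simp: unit_fun_def)

text \<open>
  The integral representation holds at every point off the knots, although the fibres of \<open>f\<close>
  need not be integrable: the exceptional fibres form null sets, on which the outer functionals do
  not depend.
\<close>

lemma tensor_proj_kernel:
  assumes adm: "\<And>d. admissible (p d) (\<Xi> d)" and a: "\<And>d. a $ d \<le> 2"
    and g: "integrable lborel g" and fg: "AE x in lborel. x \<in> cube \<longrightarrow> f x = g x"
    and x: "off_knots \<Xi> x"
  shows "tensor_proj p \<Xi> a f x = (LINT t|lborel. g t * tensor_kernel p \<Xi> a x t)"
proof -
  interpret spline_knots "p d" "\<Xi> d" for d by (rule spline_knots.intro[OF adm])
  define K where "K d = kernel (p d) (\<Xi> d) (a $ d) (x $ d)" for d
  have K: "unit_fun (K d)" for d unfolding K_def by (rule unit_fun_kernel)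
  have proj: "spline_proj_order (p d) (\<Xi> d) (a $ d) v (x $ d) = (LINT t|lborel. w t * K d t)"
    if "integrable lborel w" "AE t in lborel. 0 < t \<and> t < 1 \<longrightarrow> v t = w t" for v w d
    unfolding K_def using x a that by (intro spline_proj_order_eq) (auto simp: off_knots_def)
  have in_cube: "triple (t1, t2, t3) \<in> cube" if "0 < t1" "t1 < 1" "0 < t2" "t2 < 1" "0 < t3" "t3 < 1" for t1 t2 t3
    using that by (auto simp: cube_def mem_box_cart forall_3)
  define w3 where "w3 t1 t2 = (LINT t3|lborel. g (triple (t1, t2, t3)) * K 3 t3)" for t1 t2
  define w2 where "w2 t1 = (LINT t2|lborel. w3 t1 t2 * K 2 t2)" for t1
  have gK: "integrable lborel (\<lambda>t. g t * K 3 (t $ 3) * K 2 (t $ 2))"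
    by (intro integrable_mult_coord K g)
  have gKK: "integrable lborel (\<lambda>t. g t * K 3 (t $ 3) * K 2 (t $ 2) * K 1 (t $ 1))"
    by (intro integrable_mult_coord K g)
  have ae_int: "AE t1 in lborel. integrable lborel (\<lambda>z. h (triple (t1, z)))" if "integrable lborel h" for h :: "real^3 \<Rightarrow> real"
    using lborel_pair.AE_integrable_fst[OF integrable_triple[OF that]] by simp
  have w3_int: "integrable lborel (w3 t1)"
    and w2_eq: "(LINT z|lborel. g (triple (t1, z)) * K 3 (triple (t1, z) $ 3) * K 2 (triple (t1, z) $ 2)) = w2 t1"
    if gz: "integrable lborel (\<lambda>z. g (triple (t1, z)))" for t1
  proof -
    have m: "(\<lambda>z :: real \<times> real. K 3 (snd z)) \<in> borel_measurable lborel" "(\<lambda>z :: real \<times> real. K 2 (fst z)) \<in> borel_measurable lborel"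
    proof -
      note [measurable] = unit_fun_measurable[OF K]
      show "(\<lambda>z :: real \<times> real. K 3 (snd z)) \<in> borel_measurable lborel" "(\<lambda>z :: real \<times> real. K 2 (fst z)) \<in> borel_measurable lborel"
        by (simp_all add: borel_prod[symmetric])
    qed
    have i3: "integrable lborel (\<lambda>z. g (triple (t1, z)) * K 3 (snd z))"
      using integrable_mult_bounded[OF gz m(1)] K[of 3] by (auto simp: unit_fun_def)
    have i2: "integrable lborel (\<lambda>z. g (triple (t1, z)) * K 3 (snd z) * K 2 (fst z))"
      using integrable_mult_bounded[OF i3 m(2)] K[of 2] by (auto simp: unit_fun_def)
    show "integrable lborel (w3 t1)" using integral_pair_real(3)[OF i3] by (simp add: w3_def[abs_def])
    have "(LINT z|lborel. g (triple (t1, z)) * K 3 (triple (t1, z) $ 3) * K 2 (triple (t1, z) $ 2))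
        = (LINT z|lborel. g (triple (t1, z)) * K 3 (snd z) * K 2 (fst z))"
      by (intro Bochner_Integration.integral_cong) (auto simp: split_paired_all)
    also have "\<dots> = w2 t1"
      using integral_pair_real(1)[OF i2] by (simp add: w2_def w3_def)
    finally show "(LINT z|lborel. g (triple (t1, z)) * K 3 (triple (t1, z) $ 3) * K 2 (triple (t1, z) $ 2)) = w2 t1" .
  qed
  have step3: "AE t2 in lborel. 0 < t2 \<and> t2 < 1 \<longrightarrow>
      spline_proj_order (p 3) (\<Xi> 3) (a $ 3) (\<lambda>t3. f (triple (t1, t2, t3))) (x $ 3) = w3 t1 t2"
    if "integrable lborel (\<lambda>z. g (triple (t1, z)))" "0 < t1" "t1 < 1"
      "AE z in lborel. triple (t1, z) \<in> cube \<longrightarrow> f (triple (t1, z)) = g (triple (t1, z))" for t1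
    using integral_pair_real(2)[OF that(1)] AE_pair_real[OF that(4)]
  proof eventually_elim
    case (elim t2)
    show ?case
    proof
      assume "0 < t2 \<and> t2 < 1"
      then have "AE t3 in lborel. 0 < t3 \<and> t3 < 1 \<longrightarrow> f (triple (t1, t2, t3)) = g (triple (t1, t2, t3))"
        using elim(2) by eventually_elim (use in_cube that(2,3) \<open>0 < t2 \<and> t2 < 1\<close> in auto)
      then show "spline_proj_order (p 3) (\<Xi> 3) (a $ 3) (\<lambda>t3. f (triple (t1, t2, t3))) (x $ 3) = w3 t1 t2"
        unfolding w3_def by (intro proj elim(1))
    qed
  qed
  have step2: "AE t1 in lborel. 0 < t1 \<and> t1 < 1 \<longrightarrow>
      spline_proj_order (p 2) (\<Xi> 2) (a $ 2) (\<lambda>t2.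
        spline_proj_order (p 3) (\<Xi> 3) (a $ 3) (\<lambda>t3. f (triple (t1, t2, t3))) (x $ 3)) (x $ 2) = w2 t1"
    using ae_int[OF g] AE_triple[OF fg]
  proof eventually_elim
    case (elim t1)
    then show ?case unfolding w2_def by (intro impI proj w3_int step3) auto
  qed
  have w2: "AE t1 in lborel. (LINT z|lborel. g (triple (t1, z)) * K 3 (triple (t1, z) $ 3) * K 2 (triple (t1, z) $ 2)) = w2 t1"
    using ae_int[OF g] by eventually_elim (rule w2_eq)
  have w2_meas: "w2 \<in> borel_measurable borel"
  proof -
    note [measurable] = borel_measurable_integrable[OF g] unit_fun_measurable[OF K]
    have [measurable]: "(\<lambda>z. g (triple z)) \<in> borel_measurable (borel \<Otimes>\<^sub>M (borel \<Otimes>\<^sub>M borel))"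
      using measurable_compose[OF triple_measurable, of g borel] borel_measurable_integrable[OF g]
      by (simp add: borel_prod)
    show ?thesis unfolding w2_def w3_def by measurable
  qed
  have w2_int: "integrable lborel w2"
  proof -
    have "integrable lborel (\<lambda>t1. LINT z|lborel. g (triple (t1, z)) * K 3 (triple (t1, z) $ 3) * K 2 (triple (t1, z) $ 2))"
      using lborel_pair.integrable_fst[OF integrable_triple[OF gK]] by simp
    then show ?thesis by (rule integrable_cong_AE_imp) (use w2 w2_meas in \<open>auto elim: eventually_mono\<close>)
  qed
  have "tensor_proj p \<Xi> a f x = tensor_proj p \<Xi> a f (triple (x $ 1, x $ 2, x $ 3))"
    using triple_surj by metis
  also have "\<dots> = (LINT t1|lborel. w2 t1 * K 1 t1)"
    unfolding tensor_proj_triple by (rule proj[OF w2_int step2])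
  also have "\<dots> = (LINT t1|lborel. LINT z|lborel.
      g (triple (t1, z)) * K 3 (triple (t1, z) $ 3) * K 2 (triple (t1, z) $ 2) * K 1 (triple (t1, z) $ 1))"
  proof (rule integral_cong_AE)
    show "(\<lambda>t1. LINT z|lborel. g (triple (t1, z)) * K 3 (triple (t1, z) $ 3) * K 2 (triple (t1, z) $ 2) * K 1 (triple (t1, z) $ 1))
        \<in> borel_measurable lborel"
      using lborel_pair.integrable_fst[OF integrable_triple[OF gKK]] by (simp add: borel_measurable_integrable)
    show "(\<lambda>t1. w2 t1 * K 1 t1) \<in> borel_measurable lborel"
      using w2_meas unit_fun_measurable[OF K[of 1]] by simp
    have "(LINT z|lborel. g (triple (t1, z)) * K 3 (triple (t1, z) $ 3) * K 2 (triple (t1, z) $ 2) * K 1 (triple (t1, z) $ 1))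
       = (LINT z|lborel. g (triple (t1, z)) * K 3 (triple (t1, z) $ 3) * K 2 (triple (t1, z) $ 2)) * K 1 t1" for t1
      by (subst integral_mult_left_zero[symmetric], intro Bochner_Integration.integral_cong)
        (auto simp: split_paired_all)
    then show "AE t1 in lborel. w2 t1 * K 1 t1 =
       (LINT z|lborel. g (triple (t1, z)) * K 3 (triple (t1, z) $ 3) * K 2 (triple (t1, z) $ 2) * K 1 (triple (t1, z) $ 1))"
      using w2 by (auto elim: eventually_mono)
  qed
  also have "\<dots> = (LINT t|lborel. g t * K 3 (t $ 3) * K 2 (t $ 2) * K 1 (t $ 1))"
    using integral_triple[OF gKK] by simp
  also have "\<dots> = (LINT t|lborel. g t * tensor_kernel p \<Xi> a x t)"
    by (simp add: tensor_kernel_def prod_3 K_def mult_ac)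
  finally show ?thesis .
qed

section \<open>Test functions\<close>

text \<open>
  Defined coinductively, so that smoothness follows from a class of functions that contains the given
  one and is closed under differentiation.
\<close>

coinductive smooth1 :: "(real \<Rightarrow> real) \<Rightarrow> bool" where
  smooth1I: "(\<And>x. (f has_real_derivative g x) (at x)) \<Longrightarrow> smooth1 g \<Longrightarrow> smooth1 f"

lemma smooth1_cases:
  assumes "smooth1 f" obtains g where "\<And>x. (f has_real_derivative g x) (at x)" "smooth1 g"
  using assms by (cases rule: smooth1.cases) blast

lemma smooth1_deriv:
  assumes "smooth1 f"
  shows "smooth1 (deriv f)" "(f has_real_derivative deriv f x) (at x)"
proof -
  obtain g where g: "\<And>x. (f has_real_derivative g x) (at x)" "smooth1 g"
    by (fact smooth1_cases[OF assms])
  then have "deriv f = g" by (auto intro: DERIV_imp_deriv)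
  then show "smooth1 (deriv f)" "(f has_real_derivative deriv f x) (at x)" using g by auto
qed

lemma smooth1_coinduct:
  assumes "X f" and step: "\<And>f. X f \<Longrightarrow> \<exists>g. (\<forall>x. (f has_real_derivative g x) (at x)) \<and> X g"
  shows "smooth1 f"
  using assms(1)
proof (coinduction arbitrary: f)
  case smooth1
  then show ?case using step[OF smooth1] by blast
qed

lemma smooth1_const: "smooth1 (\<lambda>_. c)"
proof (rule smooth1_coinduct[where X = "\<lambda>f. \<exists>c. f = (\<lambda>_. c)"])
  fix f :: "real \<Rightarrow> real" assume "\<exists>c. f = (\<lambda>_. c)"
  then show "\<exists>g. (\<forall>x. (f has_real_derivative g x) (at x)) \<and> (\<exists>c. g = (\<lambda>_. c))"
    by (intro exI[of _ "\<lambda>_. 0"]) auto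
qed auto

text \<open>
  Products alone are not closed under differentiation, but sums of products are.
\<close>

inductive product_sum :: "(real \<Rightarrow> real) \<Rightarrow> bool" where
  product: "smooth1 f \<Longrightarrow> smooth1 g \<Longrightarrow> product_sum (\<lambda>x. f x * g x)"
| plus: "product_sum f \<Longrightarrow> product_sum g \<Longrightarrow> product_sum (\<lambda>x. f x + g x)"

lemma product_sum_smooth1: "product_sum f \<Longrightarrow> smooth1 f"
proof (rule smooth1_coinduct[where X = product_sum])
  fix f assume "product_sum f"
  then show "\<exists>g. (\<forall>x. (f has_real_derivative g x) (at x)) \<and> product_sum g"
  proof induction
    case (product f g)
    obtain f' g' where f': "\<And>x. (f has_real_derivative f' x) (at x)" "smooth1 f'"
      and g': "\<And>x. (g has_real_derivative g' x) (at x)" "smooth1 g'"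
      using product smooth1_cases by metis
    have "product_sum (\<lambda>x. f' x * g x + f x * g' x)"
      using product f' g' product_sum.intros by simp
    moreover have "((\<lambda>x. f x * g x) has_real_derivative f' x * g x + f x * g' x) (at x)" for x
      using DERIV_mult[OF f'(1) g'(1)] by (simp add: mult.commute)
    ultimately show ?case by (intro exI[of _ "\<lambda>x. f' x * g x + f x * g' x"]) auto
  next
    case (plus f g)
    then obtain f' g' where "\<And>x. (f has_real_derivative f' x) (at x)" "product_sum f'"
      "\<And>x. (g has_real_derivative g' x) (at x)" "product_sum g'" by auto
    then show ?case by (intro exI[of _ "\<lambda>x. f' x + g' x"]) (auto intro: DERIV_add product_sum.plus)
  qed
qed

lemma smooth1_mult: "smooth1 f \<Longrightarrow> smooth1 g \<Longrightarrow> smooth1 (\<lambda>x. f x * g x)"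
  by (rule product_sum_smooth1[OF product_sum.product])

lemma smooth1_add:
  assumes "smooth1 f" "smooth1 g" shows "smooth1 (\<lambda>x. f x + g x)"
proof -
  have *: "product_sum h" if "smooth1 h" for h
    using product_sum.product[OF that smooth1_const[of 1]] by simp
  show ?thesis
    by (rule product_sum_smooth1[OF product_sum.plus[OF *[OF assms(1)] *[OF assms(2)]]])
qed

lemma smooth1_affine: "smooth1 f \<Longrightarrow> smooth1 (\<lambda>x. f (c * x + d))"
proof (rule smooth1_coinduct[where X = "\<lambda>h. \<exists>e f. smooth1 f \<and> h = (\<lambda>x. e * f (c * x + d))"])
  fix h assume "\<exists>e f. smooth1 f \<and> h = (\<lambda>x. e * f (c * x + d))"
  then obtain e f where f: "smooth1 f" "h = (\<lambda>x. e * f (c * x + d))" by blast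
  obtain g where g: "\<And>x. (f has_real_derivative g x) (at x)" "smooth1 g"
    by (fact smooth1_cases[OF f(1)])
  have "(h has_real_derivative (e * c) * g (c * x + d)) (at x)" for x
    unfolding f(2) by (rule derivative_eq_intros DERIV_chain2[OF g(1)] refl | simp)+
  then show "\<exists>g. (\<forall>x. (h has_real_derivative g x) (at x)) \<and> (\<exists>e f. smooth1 f \<and> g = (\<lambda>x. e * f (c * x + d)))"
    using g(2) by (intro exI[of _ "\<lambda>x. (e * c) * g (c * x + d)"]) blast
qed (auto intro!: exI[of _ 1])

text \<open>
  The derivatives of the flat function \<open>exp (- 1 / x)\<close> are its products with polynomials in \<open>1 / x\<close>, so
  that this class is closed under differentiation.
\<close>

definition flat :: "real poly \<Rightarrow> real \<Rightarrow> real" where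
  "flat P x = (if 0 < x then poly P (1 / x) * exp (- (1 / x)) else 0)"

lemma poly_exp_tendsto_0: "((\<lambda>u. poly P u * exp (- u)) \<longlongrightarrow> (0::real)) at_top"
proof -
  have "((\<lambda>u. \<Sum>i\<le>degree P. coeff P i * (u ^ i / exp u)) \<longlongrightarrow> (\<Sum>i\<le>degree P. coeff P i * 0)) at_top"
    by (intro tendsto_intros tendsto_power_div_exp_0)
  moreover have "(\<lambda>u. \<Sum>i\<le>degree P. coeff P i * (u ^ i / exp u)) = (\<lambda>u. poly P u * exp (- u))"
    by (auto simp: poly_altdef sum_distrib_right exp_minus divide_inverse mult.assoc)
  ultimately show ?thesis by simp
qed

lemma flat_deriv: "(flat P has_real_derivative flat ((P - pderiv P) * [:0, 0, 1:]) x) (at x)"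
proof -
  consider "x < 0" | "x = 0" | "0 < x" by linarith
  then show ?thesis
  proof cases
    case 1
    have "\<forall>\<^sub>F y in nhds x. y \<in> {..<0}" using 1 by (intro eventually_nhds_in_open) auto
    then have "\<forall>\<^sub>F y in nhds x. flat P y = 0" by eventually_elim (auto simp: flat_def)
    then show ?thesis using 1 by (subst DERIV_cong_ev[OF refl _ refl]) (auto simp: flat_def)
  next
    case 3
    have "\<forall>\<^sub>F y in nhds x. y \<in> {0<..}" using 3 by (intro eventually_nhds_in_open) auto
    then have ev: "\<forall>\<^sub>F y in nhds x. flat P y = poly P (1 / y) * exp (- (1 / y))"
      by eventually_elim (auto simp: flat_def)
    have inv: "((\<lambda>y. 1 / y) has_real_derivative - (1 / x\<^sup>2)) (at x)"
      using 3 by (auto intro!: derivative_eq_intros simp: power2_eq_square)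
    have "((\<lambda>y. poly P (1 / y) * exp (- (1 / y))) has_real_derivative
      (poly (pderiv P) (1 / x) * (- (1 / x\<^sup>2))) * exp (- (1 / x)) +
      poly P (1 / x) * (exp (- (1 / x)) * (- (- (1 / x\<^sup>2))))) (at x)"
      by (rule derivative_eq_intros DERIV_chain2[OF poly_DERIV inv] DERIV_chain2[OF DERIV_exp] inv refl | simp)+
    moreover have "(poly (pderiv P) (1 / x) * (- (1 / x\<^sup>2))) * exp (- (1 / x)) +
      poly P (1 / x) * (exp (- (1 / x)) * (- (- (1 / x\<^sup>2)))) = flat ((P - pderiv P) * [:0, 0, 1:]) x"
      using 3 by (simp add: flat_def power2_eq_square algebra_simps)
    ultimately show ?thesis by (subst DERIV_cong_ev[OF refl ev refl]) simp
  next
    case 2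
    have "((\<lambda>y. flat P y / y) \<longlongrightarrow> 0) (at_right 0)"
    proof -
      have "((\<lambda>u. poly (pCons 0 P) (1 / u) * exp (- (1 / u))) \<longlongrightarrow> (0::real)) (at_right 0)"
        using filterlim_compose[OF poly_exp_tendsto_0[of "pCons 0 P"] filterlim_inverse_at_top_right]
        by (simp add: inverse_eq_divide)
      then show ?thesis
        by (rule Lim_transform_eventually) (auto simp: eventually_at_filter flat_def)
    qed
    moreover have "((\<lambda>y. flat P y / y) \<longlongrightarrow> 0) (at_left 0)"
      by (rule tendsto_eventually) (auto simp: eventually_at_filter flat_def)
    ultimately have "((\<lambda>y. flat P y / y) \<longlongrightarrow> 0) (at 0)" by (simp add: filterlim_at_split)
    then show ?thesis using 2 by (simp add: has_field_derivative_iff flat_def)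
  qed
qed

lemma smooth1_flat: "smooth1 (flat P)"
  by (rule smooth1_coinduct[where X = "\<lambda>f. \<exists>P. f = flat P"]) (use flat_deriv in blast)+

definition test1 :: "(real \<Rightarrow> real) \<Rightarrow> bool" where
  "test1 f \<longleftrightarrow> smooth1 f \<and> (\<exists>a b. 0 < a \<and> a \<le> b \<and> b < 1 \<and> (\<forall>x. x \<notin> {a..b} \<longrightarrow> f x = 0))"

lemma test1_deriv:
  assumes "test1 f" shows "test1 (deriv f)" "(f has_real_derivative deriv f x) (at x)"
proof -
  obtain a b where f: "smooth1 f" and ab: "0 < a" "a \<le> b" "b < 1" "\<And>x. x \<notin> {a..b} \<Longrightarrow> f x = 0"
    using assms by (auto simp: test1_def)
  have "deriv f x = 0" if "x \<notin> {a..b}" for x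
  proof -
    have "\<forall>\<^sub>F y in nhds x. y \<in> - {a..b}" using that by (intro eventually_nhds_in_open) auto
    then have "\<forall>\<^sub>F y in nhds x. f y = 0" by eventually_elim (use ab(4) in auto)
    then have "(f has_real_derivative 0) (at x)" by (subst DERIV_cong_ev[OF refl _ refl]) auto
    then show ?thesis by (rule DERIV_imp_deriv)
  qed
  then show "test1 (deriv f)" using smooth1_deriv(1)[OF f] ab unfolding test1_def by blast
  show "(f has_real_derivative deriv f x) (at x)" by (rule smooth1_deriv(2)[OF f])
qed

lemma test1_cont: "test1 f \<Longrightarrow> continuous_on S f"
  using test1_deriv(2) by (meson DERIV_isCont continuous_at_imp_continuous_on)

lemma test1_unit_fun:
  assumes "test1 f" shows "unit_fun f"
proof -
  obtain a b where ab: "0 < a" "a \<le> b" "b < 1" "\<And>x. x \<notin> {a..b} \<Longrightarrow> f x = 0"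
    using assms by (auto simp: test1_def)
  obtain C where C: "\<And>x. x \<in> {a..b} \<Longrightarrow> \<bar>f x\<bar> \<le> C"
    using compact_imp_bounded[OF compact_continuous_image[OF test1_cont[OF assms] compact_Icc]] bounded_iff
    by (metis imageI real_norm_def)
  have "\<bar>f x\<bar> \<le> \<bar>C\<bar>" for x using C[of x] ab(4)[of x] by (cases "x \<in> {a..b}") auto
  moreover have "f x = 0" if "x \<notin> {0<..<1}" for x using ab that by auto
  ultimately show ?thesis
    using borel_measurable_continuous_onI[OF test1_cont[OF assms]] by (auto simp: unit_fun_def)
qed

lemma test1_lincomb:
  assumes "test1 f" "test1 g" shows "test1 (\<lambda>x. f x + c * g x)"
proof -
  obtain a b where f: "smooth1 f" "0 < a" "a \<le> b" "b < 1" "\<And>x. x \<notin> {a..b} \<Longrightarrow> f x = 0"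
    using assms(1) by (auto simp: test1_def)
  obtain a' b' where g: "smooth1 g" "0 < a'" "a' \<le> b'" "b' < 1" "\<And>x. x \<notin> {a'..b'} \<Longrightarrow> g x = 0"
    using assms(2) by (auto simp: test1_def)
  have "smooth1 (\<lambda>x. f x + c * g x)" 
    by (rule smooth1_add[OF f(1) smooth1_mult[OF smooth1_const g(1)]])
  moreover have "\<forall>x. x \<notin> {min a a'..max b b'} \<longrightarrow> f x + c * g x = 0"
  proof (intro allI impI)
    fix x assume "x \<notin> {min a a'..max b b'}"
    then have "x \<notin> {a..b}" "x \<notin> {a'..b'}" by auto
    then show "f x + c * g x = 0" using f(5) g(5) by simp
  qed
  ultimately show ?thesis unfolding test1_def using f(2-4) g(2-4)
    by (intro conjI exI[of _ "min a a'"] exI[of _ "max b b'"]) auto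
qed

text \<open>
  As \<open>k\<close> grows, \<open>exp (- 1 / (k x))\<close> tends to one for every \<open>x > 0\<close>, and the bump functions tend to the
  indicator function of \<open>(a,b)\<close>. In the limit below the end points move outwards to \<open>a\<close> and \<open>b\<close> at the same
  time, so that the supports are compact in the unit interval even if \<open>a = 0\<close> or \<open>b = 1\<close>.
\<close>

definition bump :: "real \<Rightarrow> real \<Rightarrow> real \<Rightarrow> real \<Rightarrow> real" where
  "bump k a b x = flat 1 (k * (x - a)) * flat 1 (k * (b - x))"

lemma bump_test1:
  assumes "0 < k" "0 < a" "a \<le> b" "b < 1" shows "test1 (bump k a b)"
proof -
  have "smooth1 (\<lambda>x. flat 1 (k * x + (- k * a)) * flat 1 (- k * x + k * b))"
    by (rule smooth1_mult[OF smooth1_affine[OF smooth1_flat] smooth1_affine[OF smooth1_flat]])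
  moreover have "(\<lambda>x. flat 1 (k * x + (- k * a)) * flat 1 (- k * x + k * b)) = bump k a b"
    by (auto simp: bump_def algebra_simps)
  ultimately have "smooth1 (bump k a b)" by simp
  moreover have "bump k a b x = 0" if "x \<notin> {a..b}" for x
  proof -
    have "k * (x - a) \<le> 0 \<or> k * (b - x) \<le> 0" using that assms(1) by (auto simp: mult_le_0_iff)
    then show ?thesis by (auto simp: bump_def flat_def)
  qed
  ultimately show ?thesis unfolding test1_def using assms by blast
qed

lemma flat_1_range: "0 \<le> flat 1 x" "flat 1 x \<le> 1"
  by (auto simp: flat_def)

lemma bump_range: "0 \<le> bump k a b x" "bump k a b x \<le> 1"
  unfolding bump_def using flat_1_range mult_mono[of "flat 1 _" 1 "flat 1 _" 1] by auto

lemma bump_tendsto: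
  assumes "a < b"
  shows "(\<lambda>m. bump (real (Suc m)) (a + (b - a) / (real m + 3)) (b - (b - a) / (real m + 3)) x)
    \<longlonglongrightarrow> indicator {a<..<b} x"
proof -
  have small: "(\<lambda>m. (b - a) / (real m + 3)) \<longlonglongrightarrow> 0"
  proof -
    have "filterlim (\<lambda>m. real m + 3) at_top sequentially"
      by (rule filterlim_at_top_mono[OF filterlim_real_sequentially]) auto
    then show ?thesis by (intro tendsto_divide_0[OF tendsto_const] filterlim_at_top_imp_at_infinity)
  qed
  have one: "(\<lambda>m. flat 1 (real (Suc m) * y m)) \<longlonglongrightarrow> 1" if "y \<longlonglongrightarrow> l" "0 < l" for y l
  proof -
    have "filterlim (\<lambda>m. y m * real (Suc m)) at_top sequentially"
      using that by (intro filterlim_tendsto_pos_mult_at_top[of y l] filterlim_compose[OF filterlim_real_sequentially filterlim_Suc]) auto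
    then have at_top: "filterlim (\<lambda>m. real (Suc m) * y m) at_top sequentially" by (simp add: mult.commute)
    then have "(\<lambda>m. 1 / (real (Suc m) * y m)) \<longlonglongrightarrow> 0"
      by (intro tendsto_divide_0[OF tendsto_const] filterlim_at_top_imp_at_infinity)
    then have "(\<lambda>m. exp (- (1 / (real (Suc m) * y m)))) \<longlonglongrightarrow> exp (- 0)" by (intro tendsto_intros)
    moreover have "\<forall>\<^sub>F m in sequentially. 0 < real (Suc m) * y m"
      using at_top by (simp add: filterlim_at_top_dense)
    then have "\<forall>\<^sub>F m in sequentially. exp (- (1 / (real (Suc m) * y m))) = flat 1 (real (Suc m) * y m)"
      by eventually_elim (simp add: flat_def)
    ultimately show ?thesis by (auto intro: Lim_transform_eventually)
  qed
  show ?thesis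
  proof (cases "x \<in> {a<..<b}")
    case True
    have "(\<lambda>m. x - (a + (b - a) / (real m + 3))) \<longlonglongrightarrow> x - (a + 0)"
      "(\<lambda>m. b - (b - a) / (real m + 3) - x) \<longlonglongrightarrow> b - 0 - x"
      by (intro tendsto_intros small)+
    then have "(\<lambda>m. bump (real (Suc m)) (a + (b - a) / (real m + 3)) (b - (b - a) / (real m + 3)) x) \<longlonglongrightarrow> 1 * 1"
      unfolding bump_def using True by (intro tendsto_mult one) auto
    then show ?thesis using True by simp
  next
    case False
    have "bump (real (Suc m)) (a + (b - a) / (real m + 3)) (b - (b - a) / (real m + 3)) x = 0" for m
    proof -
      have "0 < (b - a) / (real m + 3)" using assms by simp
      then have "x - (a + (b - a) / (real m + 3)) \<le> 0 \<or> b - (b - a) / (real m + 3) - x \<le> 0" using False by auto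
      then have "real (Suc m) * (x - (a + (b - a) / (real m + 3))) \<le> 0 \<or> real (Suc m) * (b - (b - a) / (real m + 3) - x) \<le> 0"
        by (auto simp: mult_le_0_iff)
      then show ?thesis by (auto simp: bump_def flat_def)
    qed
    then show ?thesis using False by simp
  qed
qed

lemma bump_interval:
  fixes a b :: real
  assumes "0 \<le> a" "a < b" "b \<le> 1"
  shows "0 < a + (b - a) / (real m + 3)" "a + (b - a) / (real m + 3) \<le> b - (b - a) / (real m + 3)"
    "b - (b - a) / (real m + 3) < 1"
proof -
  define \<delta> where "\<delta> = (b - a) / (real m + 3)"
  have "0 < \<delta>" using assms by (simp add: \<delta>_def)
  moreover have "\<delta> \<le> (b - a) / 3" unfolding \<delta>_def using assms by (intro divide_left_mono) auto
  ultimately show "0 < a + (b - a) / (real m + 3)" "a + (b - a) / (real m + 3) \<le> b - (b - a) / (real m + 3)"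
    "b - (b - a) / (real m + 3) < 1" unfolding \<delta>_def[symmetric] using assms by auto
qed

lemma unit_fun_indicator: "A \<in> sets borel \<Longrightarrow> unit_fun (indicator (A \<inter> {0<..<1}))"
  unfolding unit_fun_def by (auto simp: indicator_def intro!: exI[of _ 1])

text \<open>
  A monotone class argument. Indicator functions of intervals are bounded limits of test functions;
  the Borel sets follow by Dynkin's lemma, and bounded functions as limits of simple ones.
\<close>

lemma bounded_functional_eq_0:
  fixes \<Lambda> :: "(real \<Rightarrow> real) \<Rightarrow> real"
  assumes lin: "\<And>f g c. unit_fun f \<Longrightarrow> unit_fun g \<Longrightarrow> \<Lambda> (\<lambda>t. f t + c * g t) = \<Lambda> f + c * \<Lambda> g"
    and conv: "\<And>F f C. (\<And>m :: nat. unit_fun (F m)) \<Longrightarrow> unit_fun f \<Longrightarrow> (\<And>m t. \<bar>F m t\<bar> \<le> C) \<Longrightarrow>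
       (\<And>t. (\<lambda>m. F m t) \<longlonglongrightarrow> f t) \<Longrightarrow> (\<lambda>m. \<Lambda> (F m)) \<longlonglongrightarrow> \<Lambda> f"
    and test: "\<And>f. test1 f \<Longrightarrow> \<Lambda> f = 0"
    and f: "unit_fun f"
  shows "\<Lambda> f = 0"
proof -
  have z: "unit_fun (\<lambda>_. 0)" by (auto simp: unit_fun_def)
  have \<Lambda>_0: "\<Lambda> (\<lambda>_. 0) = 0" using lin[OF z z, of "-1"] by simp
  have interval: "\<Lambda> (indicator {a<..<b}) = 0" if "0 \<le> a" "a < b" "b \<le> 1" for a b
  proof -
    let ?F = "\<lambda>m. bump (real (Suc m)) (a + (b - a) / (real m + 3)) (b - (b - a) / (real m + 3))"
    have t: "test1 (?F m)" for m by (intro bump_test1 bump_interval that) simp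
    have "{a<..<b} = {a<..<b} \<inter> {0<..<1}" using that by auto
    then have "unit_fun (indicator {a<..<b})" using unit_fun_indicator[of "{a<..<b}"] by simp
    then have "(\<lambda>m. \<Lambda> (?F m)) \<longlonglongrightarrow> \<Lambda> (indicator {a<..<b})"
      using bump_tendsto[OF that(2)]
      by (intro conv[where C = 1 and F = ?F, OF test1_unit_fun[OF t]])
        (auto simp: abs_of_nonneg[OF bump_range(1)] bump_range(2))
    then show ?thesis using test[OF t] by (simp add: LIMSEQ_const_iff)
  qed
  have gen: "(borel :: real measure) = sigma UNIV (range (\<lambda>(a, b). {a<..<b}))"
    using borel_eq_box[where 'a = real] by simp
  have borel: "\<Lambda> (indicator (A \<inter> {0<..<1})) = 0" if "A \<in> sets borel" for A
  proof -
    have A: "A \<in> sigma_sets UNIV (range (\<lambda>(a, b). {a<..<b::real}))"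
      using that unfolding gen by simp
    have stable: "Int_stable (range (\<lambda>(a, b). {a<..<b::real}))"
    proof (rule Int_stableI, clarify)
      fix a b c d :: real
      have "{a<..<b} \<inter> {c<..<d} = {max a c<..<min b d}" by auto
      then show "{a<..<b} \<inter> {c<..<d} \<in> range (\<lambda>(a, b). {a<..<b})"
        by (metis (mono_tags, lifting) case_prod_conv range_eqI)
    qed
    have "range (\<lambda>(a, b). {a<..<b::real}) \<subseteq> Pow UNIV" by simp
    from stable this A show ?thesis
    proof (induction rule: sigma_sets_induct_disjoint)
      case (basic A)
      then obtain a b where "A = {a<..<b}" by auto
      then have A: "A \<inter> {0<..<1} = {max a 0<..<min b 1}" by auto
      show ?case
      proof (cases "max a 0 < min b 1")
        case True
        then show ?thesis unfolding A by (intro interval) auto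
      next
        case False
        then have "A \<inter> {0<..<1} = {}" unfolding A by auto
        then show ?thesis using \<Lambda>_0 by simp
      qed
    next
      case empty
      then show ?case using \<Lambda>_0 by simp
    next
      case (compl A)
      then have "A \<in> sets borel" unfolding gen by simp
      then have u: "unit_fun (indicator (A \<inter> {0<..<1}))" "unit_fun (indicator {0<..<1})"
        using unit_fun_indicator unit_fun_indicator[of UNIV] by auto
      have "indicator ((UNIV - A) \<inter> {0<..<1}) = (\<lambda>t. indicator {0<..<1} t + (-1) * indicator (A \<inter> {0<..<1}) t :: real)"
        by (auto simp: indicator_def)
      then show ?case using lin[OF u(2,1), of "-1"] compl interval[of 0 1] by simp
    next
      case (union A)
      then have Ai: "A i \<in> sets borel" for i unfolding gen by auto
      let ?F = "\<lambda>m t. \<Sum>i<m. indicator (A i \<inter> {0<..<1}) t :: real"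
      have F: "unit_fun (?F m)" for m by (intro unit_fun_sum unit_fun_indicator Ai)
      have F0: "\<Lambda> (?F m) = 0" for m
      proof (induction m)
        case (Suc m)
        then show ?case using lin[OF F[of m] unit_fun_indicator[OF Ai[of m]], of 1] union by simp
      qed (simp add: \<Lambda>_0)
      have ind: "?F m t = indicator ((\<Union>i<m. A i) \<inter> {0<..<1}) t" for m t
      proof (induction m)
        case (Suc m)
        define U where "U = (\<Union>i<m. A i)"
        have U: "(\<Union>i<Suc m. A i) = U \<union> A m" unfolding U_def lessThan_Suc by blast
        have "A i \<inter> A m = {}" if "i < m" for i
          using union(1) that unfolding disjoint_family_on_def by (metis UNIV_I nat_neq_iff)
        then have "U \<inter> A m = {}" unfolding U_def by blast
        then have "t \<notin> U \<or> t \<notin> A m" by blast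
        then show ?case unfolding sum.lessThan_Suc Suc U U_def[symmetric]
          by (cases "t \<in> U"; cases "t \<in> A m"; cases "t \<in> {0<..<1}") (simp_all add: indicator_def)
      qed simp
      have "(\<lambda>m. \<Lambda> (?F m)) \<longlonglongrightarrow> \<Lambda> (indicator ((\<Union>i. A i) \<inter> {0<..<1}))"
      proof (rule conv[where C = 1, OF F])
        show "unit_fun (indicator ((\<Union>i. A i) \<inter> {0<..<1}))" using Ai by (intro unit_fun_indicator) auto
        show "\<bar>?F m t\<bar> \<le> 1" for m t unfolding ind by (simp add: indicator_def)
        show "(\<lambda>m. ?F m t) \<longlonglongrightarrow> indicator ((\<Union>i. A i) \<inter> {0<..<1}) t" for t
        proof (rule tendsto_eventually)
          show "\<forall>\<^sub>F m in sequentially. ?F m t = indicator ((\<Union>i. A i) \<inter> {0<..<1}) t"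
          proof (cases "\<exists>i. t \<in> A i")
            case True
            then obtain i where "t \<in> A i" by blast
            then show ?thesis unfolding ind
              by (intro eventually_sequentiallyI[of "Suc i"]) (force simp: indicator_def)
          next
            case False
            then show ?thesis unfolding ind by (auto simp: indicator_def)
          qed
        qed
      qed
      then show ?case using F0 by (simp add: LIMSEQ_const_iff)
    qed
  qed
  obtain F where F: "\<And>i. simple_function borel (F i)" "\<And>x. (\<lambda>i. F i x) \<longlonglongrightarrow> f x"
    "\<And>i x. norm (F i x) \<le> 2 * norm (f x)"
    using borel_measurable_implies_sequence_metric[OF unit_fun_measurable[OF f], of 0] by auto
  obtain C where C: "\<And>t. \<bar>f t\<bar> \<le> C" "\<And>t. t \<notin> {0<..<1} \<Longrightarrow> f t = 0" using f by (auto simp: unit_fun_def)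
  have F_bd: "\<bar>F i t\<bar> \<le> 2 * C" for i t using F(3)[of i t] C(1)[of t] by simp
  have F_0: "F i t = 0" if "t \<notin> {0<..<1}" for i t using F(3)[of i t] C(2)[OF that] by simp
  have F_unit: "unit_fun (F i)" for i
    unfolding unit_fun_def using F_bd F_0 borel_measurable_simple_function[OF F(1)] by blast
  have "\<Lambda> (F i) = 0" for i
  proof -
    have fin: "finite (range (F i))" using simple_functionD(1)[OF F(1)] by simp
    have *: "unit_fun (\<lambda>t. \<Sum>y\<in>Y. y * indicator (F i -` {y} \<inter> {0<..<1}) t) \<and>
        \<Lambda> (\<lambda>t. \<Sum>y\<in>Y. y * indicator (F i -` {y} \<inter> {0<..<1}) t) = 0" if "finite Y" for Y
      using that
    proof induction
      case empty
      then show ?case using z \<Lambda>_0 by simp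
    next
      case (insert y Y)
      have Y: "F i -` {y} \<in> sets borel" using simple_functionD(2)[OF F(1), of i "{y}"] by simp
      let ?S = "\<lambda>t. \<Sum>y\<in>Y. y * indicator (F i -` {y} \<inter> {0<..<1}) t"
      have e: "(\<lambda>t. \<Sum>y\<in>insert y Y. y * indicator (F i -` {y} \<inter> {0<..<1}) t)
          = (\<lambda>t. ?S t + y * indicator (F i -` {y} \<inter> {0<..<1}) t)"
        by (rule ext) (simp only: sum.insert[OF insert(1,2)] add.commute)
      show ?case unfolding e
        using insert lin[of ?S "indicator (F i -` {y} \<inter> {0<..<1})" y] borel[OF Y] unit_fun_indicator[OF Y]
        by (auto intro!: unit_fun_add unit_fun_cmult)
    qed
    have "F i t = (\<Sum>y\<in>range (F i). y * indicator (F i -` {y} \<inter> {0<..<1}) t)" for t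
    proof (cases "t \<in> {0<..<1}")
      case True
      have "(\<Sum>y\<in>range (F i). y * indicator (F i -` {y} \<inter> {0<..<1}) t)
          = (\<Sum>y\<in>range (F i). if y = F i t then y else 0)"
        using True by (intro sum.cong) (auto simp: indicator_def)
      then show ?thesis using fin by simp
    next
      case False
      then show ?thesis using F_0 by simp
    qed
    then have "F i = (\<lambda>t. \<Sum>y\<in>range (F i). y * indicator (F i -` {y} \<inter> {0<..<1}) t)" by blast
    then show ?thesis using *[OF fin] by simp
  qed
  then show ?thesis using conv[OF F_unit f F_bd F(2)] by (simp add: LIMSEQ_const_iff)
qed

definition tensor :: "(3 \<Rightarrow> real \<Rightarrow> real) \<Rightarrow> real^3 \<Rightarrow> real" where
  "tensor f x = (\<Prod>d\<in>UNIV. f d (x $ d))"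

lemma tensor_remove: "tensor f x = f k (x $ k) * (\<Prod>d\<in>UNIV - {k}. f d (x $ d))"
  unfolding tensor_def by (rule prod.remove) auto

lemma tensor_upd: "tensor (f(k := g)) x = g (x $ k) * (\<Prod>d\<in>UNIV - {k}. f d (x $ d))"
  unfolding tensor_remove[of _ _ k] by (auto intro!: prod.cong)

lemma tensor_has_derivative:
  assumes "\<And>d x. (f d has_real_derivative f' d x) (at x)"
  shows "(tensor f has_derivative (\<lambda>h. \<Sum>k\<in>UNIV. f' k (x $ k) * h $ k * (\<Prod>d\<in>UNIV - {k}. f d (x $ d)))) (at x)"
proof -
  have "((\<lambda>x. f d (x $ d)) has_derivative (\<lambda>h. f' d (x $ d) * h $ d)) (at x)" for d
  proof -
    have "((\<lambda>x :: real^3. x $ d) has_derivative (\<lambda>h. h $ d)) (at x)"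
      by (rule bounded_linear_imp_has_derivative[OF bounded_linear_vec_nth])
    moreover have "(f d has_derivative (*) (f' d (x $ d))) (at (x $ d))"
      using assms by (simp add: has_field_derivative_def)
    ultimately show ?thesis using has_derivative_compose by blast
  qed
  then show ?thesis unfolding tensor_def[abs_def] by (intro has_derivative_prod)
qed

lemma pd_tensor:
  assumes "\<And>d. smooth1 (f d)"
  shows "pd k (tensor f) = tensor (f(k := deriv (f k)))" "tensor f differentiable (at x)"
proof -
  have D: "(tensor f has_derivative (\<lambda>h. \<Sum>k\<in>UNIV. deriv (f k) (x $ k) * h $ k * (\<Prod>d\<in>UNIV - {k}. f d (x $ d)))) (at x)" for x
    by (rule tensor_has_derivative[OF smooth1_deriv(2)[OF assms]])
  then show "tensor f differentiable (at x)" by (auto simp: differentiable_def)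
  show "pd k (tensor f) = tensor (f(k := deriv (f k)))"
  proof
    fix x
    have "pd k (tensor f) x = (\<Sum>i\<in>UNIV. deriv (f i) (x $ i) * (axis k 1 :: real^3) $ i * (\<Prod>d\<in>UNIV - {i}. f d (x $ d)))"
      unfolding pd_def frechet_derivative_at[OF D, symmetric] ..
    also have "\<dots> = (\<Sum>i\<in>UNIV. if i = k then deriv (f k) (x $ k) * (\<Prod>d\<in>UNIV - {k}. f d (x $ d)) else 0)"
      by (intro sum.cong) (auto simp: axis_def)
    also have "\<dots> = tensor (f(k := deriv (f k))) x" by (simp add: tensor_upd)
    finally show "pd k (tensor f) x = tensor (f(k := deriv (f k))) x" .
  qed
qed

lemma smooth_tensor:
  assumes "\<And>d. smooth1 (f d)" shows "smooth (tensor f)"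
proof -
  have "\<exists>g. (\<forall>d. smooth1 (g d)) \<and> foldr pd ks (tensor f) = tensor g" for ks
  proof (induction ks)
    case Nil
    then show ?case using assms by auto
  next
    case (Cons k ks)
    then obtain g where g: "\<And>d. smooth1 (g d)" "foldr pd ks (tensor f) = tensor g" by blast
    have "foldr pd (k # ks) (tensor f) = tensor (g(k := deriv (g k)))"
      using g pd_tensor(1)[OF g(1)] by simp
    moreover have "\<forall>d. smooth1 ((g(k := deriv (g k))) d)" using g(1) smooth1_deriv(1) by simp
    ultimately show ?case by blast
  qed
  then show ?thesis unfolding smooth_def using pd_tensor(2) by metis
qed

lemma test_fun_tensor:
  assumes "\<And>d. test1 (f d)" shows "test_fun cube (tensor f)"
proof -
  have sm: "smooth1 (f d)" for d using assms by (simp add: test1_def)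
  have "\<forall>d. \<exists>a b. 0 < a \<and> a \<le> b \<and> b < 1 \<and> (\<forall>x. x \<notin> {a..b} \<longrightarrow> f d x = 0)"
    using assms by (simp add: test1_def)
  then obtain a b where ab: "\<And>d. 0 < a d" "\<And>d. b d < 1" "\<And>d x. x \<notin> {a d..b d} \<Longrightarrow> f d x = 0" by metis
  let ?K = "cbox (\<chi> d. a d) (\<chi> d. b d) :: (real^3) set"
  have "{x. tensor f x \<noteq> 0} \<subseteq> ?K"
  proof
    fix x assume "x \<in> {x. tensor f x \<noteq> 0}"
    then have "f d (x $ d) \<noteq> 0" for d by (auto simp: tensor_def)
    then have "x $ d \<in> {a d..b d}" for d using ab(3) by blast
    then show "x \<in> ?K" by (simp add: mem_box_cart)
  qed
  then have cl: "closure {x. tensor f x \<noteq> 0} \<subseteq> ?K" by (rule closure_minimal[OF _ closed_cbox])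
  moreover have "?K \<subseteq> cube"
  proof
    fix x assume "x \<in> ?K"
    then have "a d \<le> x $ d \<and> x $ d \<le> b d" for d by (simp add: mem_box_cart)
    then have "0 < x $ d \<and> x $ d < 1" for d using ab(1,2)[of d] by (meson le_less_trans less_le_trans)
    then show "x \<in> cube" by (simp add: cube_def mem_box_cart)
  qed
  moreover have "compact (closure {x. tensor f x \<noteq> 0})"
    using cl compact_cbox by (metis closed_closure compact_Int_closed inf.absorb_iff2)
  ultimately show ?thesis unfolding test_fun_def using smooth_tensor[of f, OF sm] by blast
qed

section \<open>Weak identities tested with products of bounded functions\<close>

definition unit_prim :: "(real \<Rightarrow> real) \<Rightarrow> real \<Rightarrow> real" where
  "unit_prim \<beta> t = indicator {0<..<1} t * prim_integral \<beta> t"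

lemma unit_fun_unit_prim: "unit_fun \<beta> \<Longrightarrow> unit_fun (unit_prim \<beta>)"
  using prim_integral_unit[OF unit_fun_integrable, of \<beta>] by (simp add: unit_prim_def[abs_def])

lemma unit_prim_lincomb:
  assumes "unit_fun f" "unit_fun g"
  shows "unit_prim (\<lambda>t. f t + c * g t) t = unit_prim f t + c * unit_prim g t"
proof -
  have int: "integrable lborel (\<lambda>s. indicator {0<..<1} s * indicator {..t} s * h s)" if "unit_fun h" for h :: "real \<Rightarrow> real"
    using integrable_mult_bounded[OF unit_fun_integrable[OF that], of "\<lambda>s. indicator {0<..<1} s * indicator {..t} s" 1]
    by (simp add: mult.commute indicator_def)
  have "prim_integral (\<lambda>t. f t + c * g t) t = (LINT s|lborel. indicator {0<..<1} s * indicator {..t} s * f s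
     + c * (indicator {0<..<1} s * indicator {..t} s * g s))"
    unfolding prim_integral_def by (simp add: algebra_simps)
  also have "\<dots> = prim_integral f t + c * prim_integral g t"
    unfolding prim_integral_def using int[OF assms(1)] int[OF assms(2)] by simp
  finally show ?thesis by (simp add: unit_prim_def algebra_simps)
qed

lemma unit_prim_bound:
  assumes "unit_fun f" "\<And>s. \<bar>f s\<bar> \<le> C" shows "\<bar>unit_prim f t\<bar> \<le> C"
proof -
  have C: "0 \<le> C" using order.trans[OF abs_ge_zero assms(2)] .
  have "\<bar>prim_integral f t\<bar> \<le> (LINT s|lborel. \<bar>indicator {0<..<1} s * indicator {..t} s * f s\<bar>)"
    unfolding prim_integral_def by (rule integral_abs_bound)
  also have "\<dots> \<le> (LINT s|lborel. C * indicator {0<..<1::real} s)"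
  proof (rule integral_mono')
    show "integrable lborel (\<lambda>s. C * indicator {0<..<1::real} s)" by simp
  qed (use C assms(2) in \<open>auto simp: indicator_def\<close>)
  also have "\<dots> = C" by simp
  finally show ?thesis using C by (simp add: unit_prim_def indicator_def)
qed

lemma unit_prim_tendsto:
  assumes "\<And>m. unit_fun (F m)" "unit_fun f" "\<And>m s. \<bar>F m s\<bar> \<le> C" "\<And>s. (\<lambda>m. F m s) \<longlonglongrightarrow> f s"
  shows "(\<lambda>m. unit_prim (F m) t) \<longlonglongrightarrow> unit_prim f t"
proof -
  note [measurable] = unit_fun_measurable[OF assms(1)] unit_fun_measurable[OF assms(2)]
  have C: "0 \<le> C" using order.trans[OF abs_ge_zero assms(3)] .
  have "(\<lambda>m. prim_integral (F m) t) \<longlonglongrightarrow> prim_integral f t"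
    unfolding prim_integral_def
  proof (rule integral_dominated_convergence)
    show "integrable lborel (\<lambda>s. C * indicator {0<..<1::real} s)" by simp
    show "AE s in lborel. (\<lambda>m. indicator {0<..<1} s * indicator {..t} s * F m s)
        \<longlonglongrightarrow> indicator {0<..<1} s * indicator {..t} s * f s"
      using assms(4) by (intro AE_I2 tendsto_mult_left) auto
    show "AE s in lborel. norm (indicator {0<..<1} s * indicator {..t} s * F m s) \<le> C * indicator {0<..<1} s" for m
      using assms(3) C by (intro AE_I2) (auto simp: indicator_def)
  qed measurable
  then show ?thesis unfolding unit_prim_def by (rule tendsto_mult_left)
qed

text \<open>
  Vanishing mean is what makes the primitive of a test function compactly supported again.
\<close>

lemma test1_unit_prim:
  assumes \<eta>: "test1 \<eta>" and 0: "(LINT t|lborel. \<eta> t) = 0"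
  shows "test1 (unit_prim \<eta>)" "deriv (unit_prim \<eta>) = \<eta>"
proof -
  obtain a b where ab: "0 < a" "a \<le> b" "b < 1" "\<And>x. x \<notin> {a..b} \<Longrightarrow> \<eta> x = 0"
    using \<eta> by (auto simp: test1_def)
  have supp: "0 < s \<and> s < 1 \<and> a \<le> s \<and> s \<le> b" if "\<eta> s \<noteq> 0" for s
  proof -
    have "s \<in> {a..b}" using ab(4) that by blast
    then show ?thesis using ab(1-3) by auto
  qed
  have cong: "prim_integral \<eta> t = (LINT s|lborel. g s)"
    if "\<And>s. \<eta> s \<noteq> 0 \<Longrightarrow> a \<le> s \<Longrightarrow> s \<le> b \<Longrightarrow> g s = indicator {..t} s * \<eta> s" "\<And>s. \<eta> s = 0 \<Longrightarrow> g s = 0" for g t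
  proof -
    have "indicator {0<..<1} s * indicator {..t} s * \<eta> s = g s" for s
      using that[of s] supp[of s] by (cases "\<eta> s = 0") auto
    then show ?thesis unfolding prim_integral_def by simp
  qed
  have prim: "prim_integral \<eta> t = (LINT s|lborel. indicator {c..t} s *\<^sub>R \<eta> s)" if "c \<le> 0" for c t
    using that ab(1) by (intro cong) (auto simp: indicator_def)
  have left: "prim_integral \<eta> t = 0" if "t < a" for t
    using cong[of "\<lambda>_. 0" t] that by (auto simp: indicator_def)
  have right: "prim_integral \<eta> t = 0" if "b < t" for t
    using cong[of \<eta> t] that 0 by (auto simp: indicator_def)
  have eq: "unit_prim \<eta> t = prim_integral \<eta> t" for t
  proof (cases "t < a \<or> b < t")
    case True
    then show ?thesis using left right by (auto simp: unit_prim_def)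
  next
    case False
    then have "0 < t" "t < 1" using ab(1-3) by auto
    then show ?thesis by (simp add: unit_prim_def)
  qed
  have der: "(unit_prim \<eta> has_real_derivative \<eta> t) (at t)" for t
  proof -
    define c where "c = min 0 (t - 1)"
    have "prim_integral \<eta> y = integral {c..y} \<eta>" for y
    proof -
      have "set_integrable lborel {c..y} \<eta>"
        by (rule borel_integrable_atLeastAtMost'[OF test1_cont[OF \<eta>]])
      then show ?thesis
        using prim[of c y] set_borel_integral_eq_integral(2)[of "{c..y}" \<eta>] by (simp add: c_def set_lebesgue_integral_def)
    qed
    then have fe: "unit_prim \<eta> = (\<lambda>y. integral {c..y} \<eta>)" using eq by auto
    have "((\<lambda>y. integral {c..y} \<eta>) has_real_derivative \<eta> t) (at t within {c..t+1})"
      using test1_cont[OF \<eta>] by (intro integral_has_real_derivative) (auto simp: c_def)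
    then show ?thesis unfolding fe by (simp add: at_within_Icc_at c_def)
  qed
  show "deriv (unit_prim \<eta>) = \<eta>" using der by (auto intro: DERIV_imp_deriv)
  have "smooth1 (unit_prim \<eta>)" using smooth1I[of "unit_prim \<eta>" \<eta>] der \<eta> by (simp add: test1_def)
  moreover have "unit_prim \<eta> x = 0" if "x \<notin> {a..b}" for x
    using left right that by (auto simp: eq not_le)
  ultimately show "test1 (unit_prim \<eta>)" unfolding test1_def using ab by blast
qed

lemma integral_coord_tendsto:
  fixes R :: "real^3 \<Rightarrow> real"
  assumes R: "integrable lborel R"
    and F: "\<And>m :: nat. unit_fun (F m)" "unit_fun f" "\<And>m t. \<bar>F m t\<bar> \<le> C" "\<And>t. (\<lambda>m. F m t) \<longlonglongrightarrow> f t"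
  shows "(\<lambda>m. LINT t|lborel. R t * F m (t $ d)) \<longlonglongrightarrow> (LINT t|lborel. R t * f (t $ d))"
proof (rule integral_dominated_convergence)
  note [measurable] = unit_fun_coord_measurable[OF F(1)] unit_fun_coord_measurable[OF F(2)]
    borel_measurable_integrable[OF R]
  show "(\<lambda>t. R t * f (t $ d)) \<in> borel_measurable lborel" "\<And>m. (\<lambda>t. R t * F m (t $ d)) \<in> borel_measurable lborel"
    by measurable
  show "integrable lborel (\<lambda>t. C * \<bar>R t\<bar>)" using R by simp
  show "AE t in lborel. (\<lambda>m. R t * F m (t $ d)) \<longlonglongrightarrow> R t * f (t $ d)"
    using F(4) by (intro AE_I2 tendsto_mult_left) auto
  have "\<bar>R t\<bar> * \<bar>F m (t $ d)\<bar> \<le> \<bar>R t\<bar> * C" for m t using F(3) by (intro mult_left_mono) auto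
  then show "AE t in lborel. norm (R t * F m (t $ d)) \<le> C * \<bar>R t\<bar>" for m
    by (intro AE_I2) (simp add: abs_mult mult.commute)
qed

lemma extend_inactive:
  fixes R :: "real^3 \<Rightarrow> real"
  assumes R: "integrable lborel R"
    and test: "\<And>\<theta>. test1 \<theta> \<Longrightarrow> (LINT t|lborel. R t * \<theta> (t $ d)) = 0" and \<alpha>: "unit_fun \<alpha>"
  shows "(LINT t|lborel. R t * \<alpha> (t $ d)) = 0"
proof (rule bounded_functional_eq_0[of "\<lambda>\<alpha>. LINT t|lborel. R t * \<alpha> (t $ d)", OF _ _ test \<alpha>])
  fix f g :: "real \<Rightarrow> real" and c :: real assume fg: "unit_fun f" "unit_fun g"
  have "(LINT t|lborel. R t * (f (t $ d) + c * g (t $ d))) = (LINT t|lborel. R t * f (t $ d) + c * (R t * g (t $ d)))"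
    by (simp add: algebra_simps)
  then show "(LINT t|lborel. R t * (f (t $ d) + c * g (t $ d))) = (LINT t|lborel. R t * f (t $ d)) + c * (LINT t|lborel. R t * g (t $ d))"
    using integrable_mult_coord[OF R fg(1)] integrable_mult_coord[OF R fg(2)] by simp
qed (rule integral_coord_tendsto[OF R])

lemma exists_normalized_test: "\<exists>\<rho>. test1 \<rho> \<and> (LINT t|lborel. \<rho> t) = 1"
proof -
  define \<beta> where "\<beta> = bump 1 (1/4) (3/4)"
  have t: "test1 \<beta>" unfolding \<beta>_def by (rule bump_test1) auto
  have "(LINT t|lborel. \<beta> t) \<noteq> 0"
  proof
    assume *: "(LINT t|lborel. \<beta> t) = 0"
    have "AE t in lborel. \<beta> t = 0"
      using * integral_nonneg_eq_0_iff_AE[of lborel \<beta>] unit_fun_integrable[OF test1_unit_fun[OF t]] bump_range(1)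
      by (auto simp: \<beta>_def)
    then have "AE t in lborel. t \<notin> {1/4<..<3/4::real}"
      by eventually_elim (auto simp: \<beta>_def bump_def flat_def)
    then have "{1/4<..<3/4::real} \<in> null_sets lborel" by (subst AE_iff_null_sets) auto
    then show False by (auto simp: null_sets_def)
  qed
  then show ?thesis
    using test1_lincomb[OF t t, of "1 / (LINT t|lborel. \<beta> t) - 1"]
    by (intro exI[of _ "\<lambda>x. \<beta> x + (1 / (LINT t|lborel. \<beta> t) - 1) * \<beta> x"])
      (use unit_fun_integrable[OF test1_unit_fun[OF t]] in \<open>simp add: algebra_simps\<close>)
qed

text \<open>
  The pairs \<open>(unit_prim \<beta>, \<beta>)\<close> generalise the pairs of a test function and its derivative. Since \<open>\<beta>\<close> is
  restricted to mean zero, the monotone class argument is applied after the projection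
  \<open>\<beta> \<mapsto> \<beta> - (\<integral> \<beta>) \<rho>\<close> along a fixed test function \<open>\<rho>\<close> of mean one.
\<close>

lemma extend_active:
  fixes R S :: "real^3 \<Rightarrow> real"
  assumes R: "integrable lborel R" and S: "integrable lborel S"
    and test: "\<And>\<theta>. test1 \<theta> \<Longrightarrow> (LINT t|lborel. R t * \<theta> (t $ d)) + (LINT t|lborel. S t * deriv \<theta> (t $ d)) = 0"
    and \<beta>: "unit_fun \<beta>" "(LINT t|lborel. \<beta> t) = 0"
  shows "(LINT t|lborel. R t * unit_prim \<beta> (t $ d)) + (LINT t|lborel. S t * \<beta> (t $ d)) = 0"
proof -
  obtain \<rho> where \<rho>: "test1 \<rho>" "(LINT t|lborel. \<rho> t) = 1" using exists_normalized_test by blast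
  define \<Phi> where "\<Phi> \<beta> = (LINT t|lborel. R t * unit_prim \<beta> (t $ d)) + (LINT t|lborel. S t * \<beta> (t $ d))" for \<beta>
  define \<Lambda> where "\<Lambda> \<beta> = \<Phi> \<beta> - (LINT t|lborel. \<beta> t) * \<Phi> \<rho>" for \<beta>
  have lin: "\<Phi> (\<lambda>t. f t + c * g t) = \<Phi> f + c * \<Phi> g" if fg: "unit_fun f" "unit_fun g" for f g c
  proof -
    have "(LINT t|lborel. R t * (unit_prim f (t $ d) + c * unit_prim g (t $ d)))
        = (LINT t|lborel. R t * unit_prim f (t $ d) + c * (R t * unit_prim g (t $ d)))"
      "(LINT t|lborel. S t * (f (t $ d) + c * g (t $ d))) = (LINT t|lborel. S t * f (t $ d) + c * (S t * g (t $ d)))"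
      by (simp_all add: algebra_simps)
    then show ?thesis unfolding \<Phi>_def unit_prim_lincomb[OF fg]
      using integrable_mult_coord[OF R unit_fun_unit_prim[OF fg(1)]] integrable_mult_coord[OF R unit_fun_unit_prim[OF fg(2)]]
        integrable_mult_coord[OF S fg(1)] integrable_mult_coord[OF S fg(2)] by (simp add: algebra_simps)
  qed
  have "\<Lambda> \<beta> = 0"
  proof (rule bounded_functional_eq_0[of \<Lambda>])
    fix f g :: "real \<Rightarrow> real" and c :: real assume fg: "unit_fun f" "unit_fun g"
    show "\<Lambda> (\<lambda>t. f t + c * g t) = \<Lambda> f + c * \<Lambda> g"
      unfolding \<Lambda>_def lin[OF fg] using unit_fun_integrable[OF fg(1)] unit_fun_integrable[OF fg(2)]
      by (simp add: algebra_simps)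
  next
    fix F :: "nat \<Rightarrow> real \<Rightarrow> real" and f :: "real \<Rightarrow> real" and C
    assume F: "\<And>m. unit_fun (F m)" "unit_fun f" "\<And>m t. \<bar>F m t\<bar> \<le> C" "\<And>t. (\<lambda>m. F m t) \<longlonglongrightarrow> f t"
    have "(\<lambda>m. \<Phi> (F m)) \<longlonglongrightarrow> \<Phi> f"
      unfolding \<Phi>_def
      by (intro tendsto_add integral_coord_tendsto[OF S F] integral_coord_tendsto[OF R, of "\<lambda>m. unit_prim (F m)" _ C]
          unit_fun_unit_prim F unit_prim_bound unit_prim_tendsto[OF F])
    moreover have "(\<lambda>m. LINT t|lborel. F m t) \<longlonglongrightarrow> (LINT t|lborel. f t)"
    proof (rule integral_dominated_convergence)
      show "integrable lborel (\<lambda>s. C * indicator {0<..<1::real} s)" by simp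
      show "AE t in lborel. norm (F m t) \<le> C * indicator {0<..<1} t" for m
        using F(1)[of m] F(3)[of m] by (intro AE_I2) (auto simp: indicator_def unit_fun_def)
    qed (use F unit_fun_measurable in auto)
    ultimately show "(\<lambda>m. \<Lambda> (F m)) \<longlonglongrightarrow> \<Lambda> f"
      unfolding \<Lambda>_def by (intro tendsto_intros)
  next
    fix f assume f: "test1 f"
    let ?c = "- (LINT t|lborel. f t)"
    let ?g = "\<lambda>t. f t + ?c * \<rho> t"
    have g: "test1 ?g" by (rule test1_lincomb[OF f \<rho>(1)])
    have fu: "unit_fun f" "unit_fun \<rho>" using f \<rho> test1_unit_fun by auto
    have g0: "(LINT t|lborel. ?g t) = 0"
      using unit_fun_integrable[OF fu(1)] unit_fun_integrable[OF fu(2)] \<rho>(2) by simp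
    have "\<Phi> ?g = 0"
      unfolding \<Phi>_def using test[OF test1_unit_prim(1)[OF g g0]] test1_unit_prim(2)[OF g g0] by simp
    then show "\<Lambda> f = 0" unfolding \<Lambda>_def lin[OF fu] by simp
  qed (rule \<beta>(1))
  then show ?thesis using \<beta>(2) by (simp add: \<Lambda>_def \<Phi>_def)
qed

lemma integrable_mult_prod:
  fixes g :: "real^3 \<Rightarrow> real" and f :: "3 \<Rightarrow> real \<Rightarrow> real"
  assumes "integrable lborel g" "\<And>d. d \<in> I \<Longrightarrow> unit_fun (f d)"
  shows "integrable lborel (\<lambda>t. g t * (\<Prod>d\<in>I. f d (t $ d)))"
proof -
  have "finite I" by simp
  then show ?thesis using assms(2)
  proof induction
    case empty
    then show ?case using assms(1) by simp
  next
    case (insert d I)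
    have "integrable lborel (\<lambda>t. (g t * (\<Prod>d\<in>I. f d (t $ d))) * f d (t $ d))"
      using insert by (intro integrable_mult_coord) auto
    then show ?case using insert by (simp add: mult_ac)
  qed
qed

text \<open>
  An identity tested with products of test functions holds for products of bounded functions,
  provided that the factors in the directions of differentiation have a bounded derivative and
  vanish at both ends of the interval. The directions are treated one after the other.
\<close>

lemma extend_tensor:
  fixes w :: "real^3 \<Rightarrow> real" and u :: "3 \<Rightarrow> real^3 \<Rightarrow> real"
  assumes w: "integrable lborel w" and u: "\<And>k. integrable lborel (u k)"
    and inactive: "\<And>k x. k \<notin> S \<Longrightarrow> u k x = 0"
    and test: "\<And>\<theta>. (\<And>d. test1 (\<theta> d)) \<Longrightarrow>
      (LINT t|lborel. w t * tensor \<theta> t) + (\<Sum>k\<in>UNIV. LINT t|lborel. u k t * tensor (\<theta>(k := deriv (\<theta> k))) t) = 0"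
    and \<beta>: "\<And>d. unit_fun (\<beta> d)" and \<alpha>: "\<And>d. unit_fun (\<alpha> d)"
    and active: "\<And>d. d \<in> S \<Longrightarrow> (LINT t|lborel. \<beta> d t) = 0 \<and> \<alpha> d = unit_prim (\<beta> d)"
  shows "(LINT t|lborel. w t * tensor \<alpha> t) + (\<Sum>k\<in>UNIV. LINT t|lborel. u k t * tensor (\<alpha>(k := \<beta> k)) t) = 0"
proof -
  define E where "E \<alpha> \<beta> = (LINT t|lborel. w t * tensor \<alpha> t) + (\<Sum>k\<in>UNIV. LINT t|lborel. u k t * tensor (\<alpha>(k := \<beta> k)) t)" for \<alpha> \<beta>
  define ok where "ok d a b \<longleftrightarrow> unit_fun a \<and> unit_fun b \<and> (d \<in> S \<longrightarrow> (LINT t|lborel. b t) = 0 \<and> a = unit_prim b)" for d :: 3 and a b :: "real \<Rightarrow> real"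
  \<comment> \<open>\<open>D\<close> is the set of directions in which test functions have already been replaced\<close>
  have "E \<alpha> \<beta> = 0" if "\<And>d. d \<in> D \<Longrightarrow> ok d (\<alpha> d) (\<beta> d)" "\<And>d. d \<notin> D \<Longrightarrow> test1 (\<alpha> d) \<and> \<beta> d = deriv (\<alpha> d)" for D \<alpha> \<beta>
  proof -
    have "finite D" by simp
    then show ?thesis using that
    proof (induction arbitrary: \<alpha> \<beta>)
      case empty
      then have "E \<alpha> (\<lambda>k. deriv (\<alpha> k)) = 0" unfolding E_def by (intro test) auto
      moreover have "\<beta> = (\<lambda>k. deriv (\<alpha> k))" using empty by auto
      ultimately show ?case by simp
    next
      case (insert e D)
      have un: "unit_fun (\<alpha> d)" "unit_fun (\<beta> d)" for d
      proof -
        have "unit_fun (\<alpha> d) \<and> unit_fun (\<beta> d)"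
        proof (cases "d \<in> insert e D")
          case True
          then show ?thesis using insert.prems(1)[of d] by (simp add: ok_def)
        next
          case False
          then have "test1 (\<alpha> d)" "\<beta> d = deriv (\<alpha> d)" using insert.prems(2)[of d] by auto
          then show ?thesis using test1_unit_fun test1_deriv(1) by simp
        qed
        then show "unit_fun (\<alpha> d)" "unit_fun (\<beta> d)" by auto
      qed
      define R where "R t = w t * (\<Prod>d\<in>UNIV - {e}. \<alpha> d (t $ d)) +
        (\<Sum>k\<in>UNIV - {e}. u k t * (\<Prod>d\<in>UNIV - {e}. (\<alpha>(k := \<beta> k)) d (t $ d)))" for t
      define Q where "Q t = u e t * (\<Prod>d\<in>UNIV - {e}. \<alpha> d (t $ d))" for t
      have iR: "integrable lborel (\<lambda>t. w t * (\<Prod>d\<in>UNIV - {e}. \<alpha> d (t $ d)))"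
        "integrable lborel (\<lambda>t. u k t * (\<Prod>d\<in>UNIV - {e}. (\<alpha>(k := \<beta> k)) d (t $ d)))" for k
        by (intro integrable_mult_prod w u; simp add: un)+
      have R: "integrable lborel R" unfolding R_def[abs_def] using iR by (intro Bochner_Integration.integrable_add Bochner_Integration.integrable_sum)
      have Q: "integrable lborel Q" unfolding Q_def[abs_def] by (intro integrable_mult_prod u un)
      have E_eq: "E (\<alpha>(e := a)) (\<beta>(e := b)) = (LINT t|lborel. R t * a (t $ e)) + (LINT t|lborel. Q t * b (t $ e))"
        if a: "unit_fun a" for a b
      proof -
        have pr: "(\<Prod>d\<in>UNIV - {e}. (f(e := a)) d (t $ d)) = (\<Prod>d\<in>UNIV - {e}. f d (t $ d))" for f :: "3 \<Rightarrow> real \<Rightarrow> real" and a t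
          by (intro prod.cong) auto
        have Qb: "(LINT t|lborel. u e t * tensor (\<alpha>(e := b)) t) = (LINT t|lborel. Q t * b (t $ e))"
          unfolding tensor_upd Q_def by (simp add: mult_ac)
        have "(\<Sum>k\<in>UNIV. LINT t|lborel. u k t * tensor ((\<alpha>(e := a))(k := (\<beta>(e := b)) k)) t)
           = (LINT t|lborel. u e t * tensor (\<alpha>(e := b)) t) +
             (\<Sum>k\<in>UNIV - {e}. LINT t|lborel. u k t * tensor ((\<alpha>(e := a))(k := \<beta> k)) t)"
          by (subst sum.remove[of UNIV e]) (auto intro!: sum.cong)
        also have "(\<Sum>k\<in>UNIV - {e}. LINT t|lborel. u k t * tensor ((\<alpha>(e := a))(k := \<beta> k)) t)
           = (\<Sum>k\<in>UNIV - {e}. LINT t|lborel. (u k t * (\<Prod>d\<in>UNIV - {e}. (\<alpha>(k := \<beta> k)) d (t $ d))) * a (t $ e))"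
        proof (intro sum.cong refl)
          fix k assume k: "k \<in> UNIV - {e}"
          have tw: "(\<alpha>(e := a))(k := \<beta> k) = (\<alpha>(k := \<beta> k))(e := a)" using k by (auto simp: fun_upd_twist)
          show "(LINT t|lborel. u k t * tensor ((\<alpha>(e := a))(k := \<beta> k)) t)
             = (LINT t|lborel. (u k t * (\<Prod>d\<in>UNIV - {e}. (\<alpha>(k := \<beta> k)) d (t $ d))) * a (t $ e))"
            unfolding tw tensor_upd by (simp add: mult_ac)
        qed
        also have "\<dots> = (LINT t|lborel. (\<Sum>k\<in>UNIV - {e}. (u k t * (\<Prod>d\<in>UNIV - {e}. (\<alpha>(k := \<beta> k)) d (t $ d))) * a (t $ e)))"
          using iR(2) a by (intro Bochner_Integration.integral_sum[symmetric] integrable_mult_coord)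
        finally have 1: "(\<Sum>k\<in>UNIV. LINT t|lborel. u k t * tensor ((\<alpha>(e := a))(k := (\<beta>(e := b)) k)) t)
           = (LINT t|lborel. Q t * b (t $ e)) + (LINT t|lborel. (\<Sum>k\<in>UNIV - {e}. (u k t * (\<Prod>d\<in>UNIV - {e}. (\<alpha>(k := \<beta> k)) d (t $ d))) * a (t $ e)))"
          unfolding Qb .
        have 2: "(LINT t|lborel. w t * tensor (\<alpha>(e := a)) t) = (LINT t|lborel. (w t * (\<Prod>d\<in>UNIV - {e}. \<alpha> d (t $ d))) * a (t $ e))"
          by (simp add: tensor_upd mult_ac)
        have "(LINT t|lborel. R t * a (t $ e)) = (LINT t|lborel. (w t * (\<Prod>d\<in>UNIV - {e}. \<alpha> d (t $ d))) * a (t $ e)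
           + (\<Sum>k\<in>UNIV - {e}. (u k t * (\<Prod>d\<in>UNIV - {e}. (\<alpha>(k := \<beta> k)) d (t $ d))) * a (t $ e)))"
          by (simp add: R_def distrib_right sum_distrib_right)
        also have "\<dots> = (LINT t|lborel. (w t * (\<Prod>d\<in>UNIV - {e}. \<alpha> d (t $ d))) * a (t $ e))
           + (LINT t|lborel. (\<Sum>k\<in>UNIV - {e}. (u k t * (\<Prod>d\<in>UNIV - {e}. (\<alpha>(k := \<beta> k)) d (t $ d))) * a (t $ e)))"
          using iR a by (intro Bochner_Integration.integral_add Bochner_Integration.integrable_sum integrable_mult_coord)
        finally show ?thesis unfolding E_def 1 2 by simp
      qed
      have ok_e: "ok e (\<alpha> e) (\<beta> e)" using insert.prems(1)[of e] by simp
      have test_e: "(LINT t|lborel. R t * \<theta> (t $ e)) + (LINT t|lborel. Q t * deriv \<theta> (t $ e)) = 0" if \<theta>: "test1 \<theta>" for \<theta>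
      proof -
        have "E (\<alpha>(e := \<theta>)) (\<beta>(e := deriv \<theta>)) = 0"
          using insert.prems insert.hyps \<theta> by (intro insert.IH) auto
        then show ?thesis using E_eq[OF test1_unit_fun[OF \<theta>]] by simp
      qed
      have "(LINT t|lborel. R t * \<alpha> e (t $ e)) + (LINT t|lborel. Q t * \<beta> e (t $ e)) = 0"
      proof (cases "e \<in> S")
        case True
        then show ?thesis using ok_e extend_active[OF R Q test_e, of "\<beta> e"] by (simp add: ok_def)
      next
        case False
        then have "Q t = 0" for t by (simp add: Q_def inactive)
        then show ?thesis using extend_inactive[OF R, of e "\<alpha> e"] test_e un by simp
      qed
      then show ?case using E_eq[OF un(1)[of e], of "\<beta> e"] by simp
    qed
  qed
  from this[of UNIV \<alpha> \<beta>] show ?thesis using \<alpha> \<beta> active by (simp add: E_def ok_def)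
qed

section \<open>Commutation on the unit cube\<close>

text \<open>
  The common form of the gradient, the curl and the divergence: each of their components is the
  divergence of a vector field.
\<close>

definition weak_div :: "(real^3) set \<Rightarrow> (real^3 \<Rightarrow> real^3) \<Rightarrow> (real^3 \<Rightarrow> real) \<Rightarrow> bool" where
  "weak_div D u w \<longleftrightarrow> (\<forall>\<psi>. test_fun D \<psi> \<longrightarrow>
     (LINT x|lebesgue_on D. \<psi> x * w x) = - (LINT x|lebesgue_on D. u x \<bullet> grad \<psi> x))"

lemma mem_cube: "x \<in> cube \<longleftrightarrow> (\<forall>d. 0 < x $ d \<and> x $ d < 1)"
  by (auto simp: cube_def mem_box_cart)

lemma cube_borel[measurable]: "cube \<in> sets borel"
  by (simp add: cube_def)

lemma cube_lebesgue: "cube \<in> sets lebesgue"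
  by (simp add: cube_def)

lemma cube_finite: "emeasure lborel cube < \<infinity>"
  by (simp add: cube_def emeasure_lborel_box_eq)

lemma AE_lebesgue_on_cube: "(AE x in lebesgue_on cube. P x) \<longleftrightarrow> (AE x in lborel. x \<in> cube \<longrightarrow> P x)"
  by (simp add: AE_restrict_space_iff cube_lebesgue AE_completion_iff)

lemma cube_integral:
  fixes F G :: "real^3 \<Rightarrow> real"
  assumes "G \<in> borel_measurable borel" "AE x in lborel. x \<in> cube \<longrightarrow> F x = G x"
  shows "(LINT x|lebesgue_on cube. F x) = (LINT x|lborel. indicator cube x * G x)"
proof -
  have "(LINT x|lebesgue_on cube. F x) = (LINT x|lebesgue. indicator cube x *\<^sub>R F x)"
    using cube_lebesgue by (simp add: integral_restrict_space)
  also have "\<dots> = (LINT x|lborel. indicator cube x * G x)"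
    using assms by (intro lebesgue_integral_AE_borel) (auto elim!: eventually_mono simp: indicator_def)
  finally show ?thesis .
qed

lemma L2_bounded:
  fixes f :: "real^3 \<Rightarrow> 'b::euclidean_space"
  assumes g: "g \<in> borel_measurable borel" "\<And>x. norm (g x) \<le> C" and ae: "AE x in lborel. x \<in> cube \<longrightarrow> f x = g x"
  shows "L2_on cube f"
proof -
  have "AE x in lborel. indicator cube x *\<^sub>R f x = indicator cube x *\<^sub>R g x"
    using ae by eventually_elim (auto simp: indicator_def)
  then have "(\<lambda>x. indicator cube x *\<^sub>R f x) \<in> borel_measurable lebesgue"
    using g(1) by (intro lebesgue_measurable_AE[of "\<lambda>x. indicator cube x *\<^sub>R g x"]) auto
  then have m: "f \<in> borel_measurable (lebesgue_on cube)"
    using cube_lebesgue by (simp add: borel_measurable_restrict_space_iff)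
  have "finite_measure (lebesgue_on cube)"
    using cube_finite cube_lebesgue by (intro finite_measureI) (simp add: emeasure_restrict_space space_restrict_space)
  then have "integrable (lebesgue_on cube) (\<lambda>x. (norm (f x))\<^sup>2)"
  proof (rule finite_measure.integrable_const_bound)
    have "(norm (g x))\<^sup>2 \<le> C\<^sup>2" for x using g(2) by (intro power_mono) auto
    then show "AE x in lebesgue_on cube. norm ((norm (f x))\<^sup>2) \<le> C\<^sup>2"
      unfolding AE_lebesgue_on_cube using ae by (auto elim!: eventually_mono)
    show "(\<lambda>x. (norm (f x))\<^sup>2) \<in> borel_measurable (lebesgue_on cube)" using m by measurable
  qed
  then show ?thesis using m by (simp add: L2_on_def)
qed

lemma L2_representative:
  fixes f :: "real^3 \<Rightarrow> real"
  assumes "L2_on cube f"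
  obtains g where "integrable lborel g" "AE x in lborel. x \<in> cube \<longrightarrow> f x = g x" "\<And>x. x \<notin> cube \<Longrightarrow> g x = 0"
proof -
  have m: "f \<in> borel_measurable (lebesgue_on cube)" and sq: "integrable (lebesgue_on cube) (\<lambda>x. (norm (f x))\<^sup>2)"
    using assms by (auto simp: L2_on_def)
  have fin: "finite_measure (lebesgue_on cube)"
    using cube_finite cube_lebesgue by (intro finite_measureI) (simp add: emeasure_restrict_space space_restrict_space)
  have "integrable (lebesgue_on cube) (\<lambda>x. (norm (f x))\<^sup>2 + 1)"
    by (intro Bochner_Integration.integrable_add sq finite_measure.integrable_const[OF fin])
  then have "integrable (lebesgue_on cube) f"
  proof (rule Bochner_Integration.integrable_bound[OF _ m], intro AE_I2)
    fix x
    have "0 \<le> (\<bar>f x\<bar> - 1)\<^sup>2" by simp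
    then have "2 * \<bar>f x\<bar> \<le> \<bar>f x\<bar>\<^sup>2 + 1" by (simp add: power2_eq_square algebra_simps)
    moreover have "0 \<le> \<bar>f x\<bar>\<^sup>2" by simp
    ultimately show "norm (f x) \<le> norm ((norm (f x))\<^sup>2 + 1)" by simp
  qed
  then have i: "integrable lebesgue (\<lambda>x. indicator cube x * f x)"
    using cube_lebesgue by (simp add: integrable_restrict_space)
  then obtain g' where g': "g' \<in> borel_measurable lborel" "AE x in lborel. indicator cube x * f x = g' x"
    using completion_ex_borel_measurable_real[of "\<lambda>x. indicator cube x * f x" lborel] borel_measurable_integrable by blast
  define g where "g x = indicator cube x * g' x" for x
  have gm: "g \<in> borel_measurable lborel" unfolding g_def using g'(1) by measurable
  have ae: "AE x in lborel. indicator cube x * f x = g x"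
    using g'(2) by eventually_elim (auto simp: g_def indicator_def)
  have "integrable lebesgue g"
    using i by (rule integrable_cong_AE_imp) (use ae gm in \<open>auto intro!: AE_completion measurable_completion elim: eventually_mono\<close>)
  then have "integrable lborel g" using integrable_completion[OF gm] by simp
  moreover have "AE x in lborel. x \<in> cube \<longrightarrow> f x = g x" using ae by eventually_elim auto
  ultimately show thesis by (rule that) (simp add: g_def)
qed

lemma smooth_differentiable: "smooth \<psi> \<Longrightarrow> \<psi> differentiable (at x)" "smooth \<psi> \<Longrightarrow> pd k \<psi> differentiable (at x)"
proof -
  assume s: "smooth \<psi>"
  have "foldr pd [] \<psi> differentiable (at x)" "foldr pd [k] \<psi> differentiable (at x)"
    using s unfolding smooth_def by blast+
  then show "\<psi> differentiable (at x)" "pd k \<psi> differentiable (at x)" by simp_all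
qed

lemma test_fun_continuous:
  assumes "test_fun D \<psi>" shows "continuous_on S \<psi>" "continuous_on S (pd k \<psi>)"
  using assms smooth_differentiable
  by (auto simp: test_fun_def intro!: continuous_at_imp_continuous_on differentiable_imp_continuous_within)

lemma test_fun_measurable:
  assumes "test_fun D \<psi>" shows "\<psi> \<in> borel_measurable borel" "pd k \<psi> \<in> borel_measurable borel"
  by (rule borel_measurable_continuous_onI[OF test_fun_continuous(1)[OF assms]],
      rule borel_measurable_continuous_onI[OF test_fun_continuous(2)[OF assms]])

lemma test_fun_outside:
  assumes "test_fun D \<psi>" "x \<notin> closure {x. \<psi> x \<noteq> 0}" shows "\<psi> x = 0" "pd k \<psi> x = 0"
proof -
  have *: "\<psi> y = 0" if "y \<notin> closure {x. \<psi> x \<noteq> 0}" for y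
    using that subsetD[OF closure_subset[of "{x. \<psi> x \<noteq> 0}"], of y] by auto
  then show "\<psi> x = 0" using assms(2) .
  have "\<forall>\<^sub>F y in nhds x. y \<in> - closure {x. \<psi> x \<noteq> 0}"
    using assms(2) by (intro eventually_nhds_in_open) auto
  then have ev: "\<forall>\<^sub>F y in nhds x. \<psi> y = 0"
    by (rule eventually_mono) (rule *, unfold Compl_iff, assumption)
  have "(\<psi> has_derivative (\<lambda>_. 0)) (at x)"
  proof (rule has_derivative_transform_eventually[of "\<lambda>_. 0"])
    show "\<forall>\<^sub>F y in at x. 0 = \<psi> y" using ev by (auto simp: eventually_at_filter elim: eventually_mono)
  qed (use \<open>\<psi> x = 0\<close> in auto)
  then show "pd k \<psi> x = 0" unfolding pd_def by (simp add: frechet_derivative_at[symmetric])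
qed

lemma test_fun_bounded:
  assumes "test_fun D \<psi>" shows "\<exists>C. \<forall>x. \<bar>\<psi> x\<bar> \<le> C" "\<exists>C. \<forall>x. \<bar>pd k \<psi> x\<bar> \<le> C"
proof -
  let ?K = "closure {x. \<psi> x \<noteq> 0}"
  have *: "\<exists>C. \<forall>x. \<bar>f x\<bar> \<le> C" if "continuous_on ?K f" "\<And>x. x \<notin> ?K \<Longrightarrow> f x = 0" for f :: "real^3 \<Rightarrow> real"
  proof -
    have "compact (f ` ?K)" using that(1) assms by (intro compact_continuous_image) (auto simp: test_fun_def)
    then obtain C where C: "\<And>x. x \<in> ?K \<Longrightarrow> \<bar>f x\<bar> \<le> C"
      using compact_imp_bounded bounded_iff by (metis imageI real_norm_def)
    have "\<bar>f x\<bar> \<le> \<bar>C\<bar>" for x using C[of x] that(2)[of x] by (cases "x \<in> ?K") auto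
    then show ?thesis by blast
  qed
  show "\<exists>C. \<forall>x. \<bar>\<psi> x\<bar> \<le> C" "\<exists>C. \<forall>x. \<bar>pd k \<psi> x\<bar> \<le> C"
    by (intro * test_fun_continuous[OF assms] test_fun_outside[OF assms]; assumption)+
qed

lemma test_fun_line_derivative:
  assumes "smooth \<psi>"
  shows "((\<lambda>t. \<psi> (upd x k t)) has_real_derivative pd k \<psi> (upd x k t)) (at t)"
proof -
  have "upd x k = (\<lambda>t. upd x k 0 + t *\<^sub>R axis k 1)"
    by (auto simp: upd_def vec_eq_iff axis_def)
  moreover have "((\<lambda>t. upd x k 0 + t *\<^sub>R axis k (1::real)) has_derivative (\<lambda>h. h *\<^sub>R axis k 1)) (at t)"
    by (auto intro!: derivative_eq_intros)
  ultimately have u: "(upd x k has_derivative (\<lambda>h. h *\<^sub>R axis k 1)) (at t)" by simp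
  have d: "(\<psi> has_derivative frechet_derivative \<psi> (at (upd x k t))) (at (upd x k t))"
    using smooth_differentiable(1)[OF assms] by (simp add: frechet_derivative_works)
  have "((\<lambda>t. \<psi> (upd x k t)) has_derivative (\<lambda>h. frechet_derivative \<psi> (at (upd x k t)) (h *\<^sub>R axis k 1))) (at t)"
    by (rule has_derivative_compose[OF u d])
  moreover have "frechet_derivative \<psi> (at (upd x k t)) (h *\<^sub>R axis k 1) = pd k \<psi> (upd x k t) * h" for h
    using linear_cmul[OF has_derivative_linear[OF d]] by (simp add: pd_def mult.commute)
  ultimately show ?thesis by (simp add: has_field_derivative_def)
qed

lemma integrable_tensor: "(\<And>d. unit_fun (f d)) \<Longrightarrow> integrable lborel (tensor f)"
proof -
  assume f: "\<And>d. unit_fun (f d)"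
  have "integrable lborel (\<lambda>t. indicator cube t * (\<Prod>d\<in>UNIV. f d (t $ d)))"
    using cube_finite by (intro integrable_mult_prod f integrable_real_indicator) auto
  moreover have "indicator cube t * (\<Prod>d\<in>UNIV. f d (t $ d)) = tensor f t" for t
    using f by (auto simp: tensor_def indicator_def mem_cube unit_fun_def)
  ultimately show ?thesis by simp
qed

text \<open>
  Integration by parts on lines: a product has a weak derivative in direction \<open>k\<close> if its factor in
  this direction is continuous and differentiable up to finitely many points.
\<close>

lemma tensor_weak_derivative:
  assumes \<psi>: "test_fun cube \<psi>" and f: "\<And>d. unit_fun (f d)" and g: "unit_fun g" and K: "finite K"
    and cont: "\<And>t. 0 < t \<Longrightarrow> t < 1 \<Longrightarrow> isCont (f k) t"
    and der: "\<And>t. 0 < t \<Longrightarrow> t < 1 \<Longrightarrow> t \<notin> K \<Longrightarrow> (f k has_real_derivative g t) (at t)"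
  shows "(LINT x|lborel. \<psi> x * tensor (f(k := g)) x) = - (LINT x|lborel. pd k \<psi> x * tensor f x)"
proof -
  have sm: "smooth \<psi>" using \<psi> by (simp add: test_fun_def)
  have zero: "\<psi> x = 0" "pd k \<psi> x = 0" if "x \<notin> cube" for x
  proof -
    have nc: "x \<notin> closure {x. \<psi> x \<noteq> 0}" using that \<psi> unfolding test_fun_def by blast
    show "\<psi> x = 0" by (rule test_fun_outside(1)[OF \<psi> nc])
    show "pd k \<psi> x = 0" by (rule test_fun_outside(2)[OF \<psi> nc])
  qed
  have fg: "unit_fun ((f(k := g)) d)" for d using f g by simp
  have i1: "integrable lborel (\<lambda>x. \<psi> x * tensor (f(k := g)) x)"
    using test_fun_bounded(1)[OF \<psi>] integrable_mult_bounded[OF integrable_tensor[of "f(k := g)", OF fg], of \<psi>] test_fun_measurable[OF \<psi>]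
    by (auto simp: mult.commute)
  have i2: "integrable lborel (\<lambda>x. pd k \<psi> x * tensor f x)"
    using test_fun_bounded(2)[OF \<psi>, of k] integrable_mult_bounded[OF integrable_tensor[of f, OF f], of "pd k \<psi>"] test_fun_measurable[OF \<psi>]
    by (auto simp: mult.commute)
  have "(LINT x|lborel. \<psi> x * tensor (f(k := g)) x + pd k \<psi> x * tensor f x) = 0"
  proof (rule integral_eq_0_by_direction[where d = k])
    fix x
    define P where "P = (\<Prod>d\<in>UNIV - {k}. f d (x $ d))"
    define \<Phi> where "\<Phi> t = \<psi> (upd x k t) * f k t" for t
    define \<Phi>' where "\<Phi>' t = \<psi> (upd x k t) * g t + pd k \<psi> (upd x k t) * f k t" for t
    have P: "(\<Prod>d\<in>UNIV - {k}. f d (upd x k t $ d)) = P" for t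
      unfolding P_def by (intro prod.cong) (auto simp: upd_def)
    have upd_k: "upd x k t $ k = t" for t by (simp add: upd_def)
    have e: "\<psi> (upd x k t) * tensor (f(k := g)) (upd x k t) + pd k \<psi> (upd x k t) * tensor f (upd x k t) = P * \<Phi>' t" for t
      unfolding tensor_upd tensor_remove[of f _ k] P upd_k \<Phi>'_def by (simp add: algebra_simps)
    have line_cont: "isCont (\<lambda>t. \<psi> (upd x k t)) t" for t
      by (rule DERIV_isCont[OF test_fun_line_derivative[OF sm]])
    obtain C where C: "\<And>t. \<bar>f k t\<bar> \<le> C" using f[of k] by (auto simp: unit_fun_def)
    have end0: "isCont \<Phi> t" if "t \<le> 0 \<or> 1 \<le> t" for t
    proof -
      have 0: "\<psi> (upd x k t) = 0" using that by (intro zero) (auto simp: mem_cube upd_def intro!: exI[of _ k])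
      have "((\<lambda>s. \<psi> (upd x k s)) \<longlongrightarrow> 0) (at t)" using line_cont[of t] 0 by (simp add: isCont_def)
      then have "((\<lambda>s. \<bar>\<psi> (upd x k s)\<bar> * C) \<longlongrightarrow> \<bar>0\<bar> * C) (at t)" by (intro tendsto_intros)
      then have lim: "((\<lambda>s. \<bar>\<psi> (upd x k s)\<bar> * C) \<longlongrightarrow> 0) (at t)" by simp
      have "(\<Phi> \<longlongrightarrow> 0) (at t)"
        by (rule Lim_null_comparison[OF _ lim])
          (auto simp: \<Phi>_def abs_mult intro!: always_eventually mult_left_mono C)
      then show ?thesis by (simp add: isCont_def \<Phi>_def 0)
    qed
    have \<Phi>_cont: "isCont \<Phi> t" for t
    proof (cases "0 < t \<and> t < 1")
      case True
      then show ?thesis unfolding \<Phi>_def by (intro continuous_intros line_cont cont) auto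
    qed (use end0 in auto)
    have "(\<Phi>' has_integral (\<Phi> 1 - \<Phi> 0)) {0..1}"
    proof (rule fundamental_theorem_of_calculus_interior_strong[OF K])
      fix t assume "t \<in> {0<..<1} - K"
      then have "(\<Phi> has_real_derivative \<Phi>' t) (at t)"
        unfolding \<Phi>_def[abs_def] \<Phi>'_def
        using DERIV_mult[OF test_fun_line_derivative[OF sm] der[of t]] by (simp add: mult.commute add.commute)
      then show "(\<Phi> has_vector_derivative \<Phi>' t) (at t)" by (simp add: has_real_derivative_iff_has_vector_derivative)
    qed (use \<Phi>_cont in \<open>auto intro: continuous_at_imp_continuous_on\<close>)
    moreover have "\<Phi> 1 = 0" "\<Phi> 0 = 0" using f[of k] by (auto simp: \<Phi>_def unit_fun_def)
    ultimately have I: "(\<Phi>' has_integral 0) {0..1}" by simp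
    have lm: "(\<lambda>t. \<psi> (upd x k t)) \<in> borel_measurable borel"
      using line_cont by (intro borel_measurable_continuous_onI continuous_at_imp_continuous_on) auto
    have pm: "(\<lambda>t. pd k \<psi> (upd x k t)) \<in> borel_measurable borel"
    proof (rule measurable_compose[OF _ test_fun_measurable(2)[OF \<psi>]])
      have eq: "upd x k = (\<lambda>t. upd x k 0 + t *\<^sub>R axis k 1)" by (auto simp: upd_def vec_eq_iff axis_def)
      have c: "continuous_on UNIV (\<lambda>t. upd x k 0 + t *\<^sub>R axis k (1::real))" by (intro continuous_intros)
      show "upd x k \<in> borel_measurable borel" by (subst eq) (rule borel_measurable_continuous_onI[OF c])
    qed
    obtain C1 C2 where C12: "\<And>y. \<bar>\<psi> y\<bar> \<le> C1" "\<And>y. \<bar>pd k \<psi> y\<bar> \<le> C2" using test_fun_bounded[OF \<psi>] by meson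
    have int: "integrable lborel \<Phi>'"
    proof -
      have "integrable lborel (\<lambda>t. g t * \<psi> (upd x k t) + f k t * pd k \<psi> (upd x k t))"
        using C12 lm pm
        by (intro Bochner_Integration.integrable_add integrable_mult_bounded unit_fun_integrable f g) auto
      then show ?thesis by (simp add: \<Phi>'_def[abs_def] mult.commute)
    qed
    have "\<Phi>' t = indicator {0..1} t *\<^sub>R \<Phi>' t" for t
    proof (cases "t \<in> {0..1}")
      case False
      then have "t \<notin> {0<..<1}" by auto
      then have "f k t = 0" "g t = 0" using f[of k] g unfolding unit_fun_def by blast+
      then show ?thesis by (simp add: \<Phi>'_def)
    qed simp
    then have "(LINT t|lborel. \<Phi>' t) = (LINT t:{0..1}|lborel. \<Phi>' t)"
      unfolding set_lebesgue_integral_def by metis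
    also have "set_integrable lborel {0..1} \<Phi>'"
      unfolding set_integrable_def using int by (intro integrable_mult_indicator) auto
    then have "(LINT t:{0..1}|lborel. \<Phi>' t) = 0"
      using set_borel_integral_eq_integral(2) I by (metis integral_unique)
    finally show "(LINT t|lborel. \<psi> (upd x k t) * tensor (f(k := g)) (upd x k t) + pd k \<psi> (upd x k t) * tensor f (upd x k t)) = 0"
      unfolding e by simp
  qed (use i1 i2 in auto)
  then show ?thesis using i1 i2 by simp
qed

lemma tail_integral_eq_unit_prim:
  assumes k: "unit_fun \<kappa>" and 0: "(LINT t|lborel. \<kappa> t) = 0"
  shows "tail_integral \<kappa> t = unit_prim (\<lambda>s. - \<kappa> s) t"
proof (cases "0 < t \<and> t < 1")
  case True
  have i: "integrable lborel (\<lambda>s. indicator {t..} s * \<kappa> s)" "integrable lborel (\<lambda>s. indicator {0<..<1} s * indicator {..t} s * \<kappa> s)"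
    using integrable_mult_bounded[OF unit_fun_integrable[OF k], of "indicator {t..}" 1]
      integrable_mult_bounded[OF unit_fun_integrable[OF k], of "\<lambda>s. indicator {0<..<1} s * indicator {..t} s" 1]
    by (simp_all add: mult.commute indicator_def)
  have "(LINT s|lborel. indicator {t..} s * \<kappa> s) + (LINT s|lborel. indicator {0<..<1} s * indicator {..t} s * \<kappa> s)
      = (LINT s|lborel. indicator {t..} s * \<kappa> s + indicator {0<..<1} s * indicator {..t} s * \<kappa> s)"
    using i by simp
  also have "\<dots> = (LINT s|lborel. \<kappa> s)"
  proof (rule integral_cong_AE)
    show "AE s in lborel. indicator {t..} s * \<kappa> s + indicator {0<..<1} s * indicator {..t} s * \<kappa> s = \<kappa> s"
      using AE_not_in_finite[of "{t}"] k by (auto elim!: eventually_mono simp: indicator_def unit_fun_def)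
  qed (use i unit_fun_integrable[OF k] in \<open>auto intro: borel_measurable_integrable\<close>)
  finally show ?thesis using True 0 by (simp add: tail_integral_def unit_prim_def prim_integral_def)
qed (auto simp: tail_integral_def unit_prim_def)

lemma tail_integral_lincomb:
  assumes "\<And>i. i < n \<Longrightarrow> unit_fun (f i)"
  shows "tail_integral (\<lambda>t. \<Sum>i<n. c i * f i t) s = (\<Sum>i<n. c i * tail_integral (f i) s)"
proof -
  have i: "integrable lborel (\<lambda>t. c i * (indicator {s..} t * f i t))" if "i < n" for i
    using integrable_mult_bounded[OF unit_fun_integrable[OF assms[OF that]], of "indicator {s..}" 1]
    by (simp add: mult.commute indicator_def)
  have "(LINT t|lborel. indicator {s..} t * (\<Sum>i<n. c i * f i t)) = (LINT t|lborel. (\<Sum>i<n. c i * (indicator {s..} t * f i t)))"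
    by (simp add: sum_distrib_left mult_ac)
  also have "\<dots> = (\<Sum>i<n. LINT t|lborel. c i * (indicator {s..} t * f i t))"
    using i by (intro Bochner_Integration.integral_sum) auto
  finally show ?thesis by (simp add: tail_integral_def sum_distrib_left mult_ac)
qed

lemma AE_off_knots:
  assumes "\<And>d. admissible (p d) (\<Xi> d)"
  shows "AE x in lborel. x \<in> cube \<longrightarrow> off_knots \<Xi> x"
proof -
  have "AE x :: real^3 in lborel. x $ d \<notin> range (knot (\<Xi> d))" for d
  proof -
    have fin: "finite (range (knot (\<Xi> d)))" using spline_knots.finite_knots[OF spline_knots.intro[OF assms]] .
    have "AE x :: real^3 in lborel. x $ d \<noteq> c" for c
    proof -
      have "negligible {x :: real^3. axis d 1 \<bullet> x = c}"
        by (rule negligible_hyperplane) (simp add: axis_eq_0_iff)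
      then have "{x :: real^3. x $ d = c} \<in> null_sets lebesgue"
        by (simp add: inner_axis' negligible_iff_null_sets)
      from AE_not_in[OF this] have "AE x :: real^3 in lebesgue. x $ d \<noteq> c" by simp
      then show ?thesis by (simp add: AE_completion_iff)
    qed
    then have "AE x :: real^3 in lborel. \<forall>c\<in>range (knot (\<Xi> d)). x $ d \<noteq> c"
      using fin by (intro AE_finite_allI) auto
    then show ?thesis by eventually_elim auto
  qed
  then have "AE x :: real^3 in lborel. \<forall>d\<in>UNIV. x $ d \<notin> range (knot (\<Xi> d))"
    by (intro AE_finite_allI) auto
  then show ?thesis by eventually_elim (auto simp: off_knots_def mem_cube)
qed

lemma prod_sum_tensor:
  fixes f :: "3 \<Rightarrow> nat \<Rightarrow> real"
  shows "(\<Prod>d\<in>UNIV. \<Sum>i<m d. f d i) = (\<Sum>\<iota>\<in>Pi\<^sub>E UNIV (\<lambda>d. {..<m d}). \<Prod>d\<in>UNIV. f d (\<iota> d))"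
  by (rule prod_sum_PiE) auto

locale spline_cube =
  fixes p :: "3 \<Rightarrow> nat" and \<Xi> :: "3 \<Rightarrow> real list"
  assumes adm: "admissible (p d) (\<Xi> d)"
begin

sublocale dir: spline_knots "p d" "\<Xi> d" for d
  by (rule spline_knots.intro[OF adm])

abbreviation "N d \<equiv> num_bsplines (p d) (\<Xi> d)"

definition index :: "(3 \<Rightarrow> nat) set" where
  "index = Pi\<^sub>E UNIV (\<lambda>d. {..<N d})"

lemma indexD: "\<iota> \<in> index \<Longrightarrow> \<iota> d < N d"
  by (auto simp: index_def)

definition primals :: "nat^3 \<Rightarrow> (3 \<Rightarrow> nat) \<Rightarrow> 3 \<Rightarrow> real \<Rightarrow> real" where
  "primals a \<iota> d = primal (p d) (\<Xi> d) (a $ d) (\<iota> d)"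

definition duals :: "nat^3 \<Rightarrow> (3 \<Rightarrow> nat) \<Rightarrow> 3 \<Rightarrow> real \<Rightarrow> real" where
  "duals a \<iota> d = dual (p d) (\<Xi> d) (a $ d) (\<iota> d)"

lemma unit_primals: "unit_fun (primals a \<iota> d)"
  unfolding primals_def by (rule dir.unit_fun_primal)

lemma unit_duals: "\<iota> \<in> index \<Longrightarrow> unit_fun (duals a \<iota> d)"
  unfolding duals_def by (intro dir.unit_fun_dual indexD)

lemma primals_weak_derivative:
  assumes "test_fun cube \<psi>" "a $ k \<le> 1"
  shows "(LINT x|lborel. \<psi> x * tensor (primals (a + axis k 1) \<iota>) x) = - (LINT x|lborel. pd k \<psi> x * tensor (primals a \<iota>) x)"
proof -
  have eq: "primals (a + axis k 1) \<iota> = (primals a \<iota>)(k := primal (p k) (\<Xi> k) (Suc (a $ k)) (\<iota> k))"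
    by (auto simp: primals_def axis_def)
  have cont: "isCont (primals a \<iota> k) t" if "0 < t" "t < 1" for t
  proof -
    have "isCont (bspline_deriv (knot (\<Xi> k)) (a $ k) (p k - 0) (\<iota> k)) t"
      using assms(2) that by (intro dir.bspline_deriv_cont) auto
    moreover have "\<forall>\<^sub>F y in nhds t. y \<in> {0<..<1}" using that by (intro eventually_nhds_in_open) auto
    then have "\<forall>\<^sub>F y in nhds t. primals a \<iota> k y = bspline_deriv (knot (\<Xi> k)) (a $ k) (p k - 0) (\<iota> k) y"
      by eventually_elim (simp add: primals_def primal_def)
    ultimately show ?thesis using isCont_cong by blast
  qed
  have der: "(primals a \<iota> k has_real_derivative primal (p k) (\<Xi> k) (Suc (a $ k)) (\<iota> k) t) (at t)"
    if "0 < t" "t < 1" "t \<notin> range (knot (\<Xi> k))" for t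
    unfolding primals_def by (rule dir.primal_deriv[OF that])
  show ?thesis unfolding eq
    by (rule tensor_weak_derivative[where f = "primals a \<iota>" and k = k and K = "range (knot (\<Xi> k))",
          OF assms(1) unit_primals dir.unit_fun_primal dir.finite_knots cont der])
qed

definition coefficient :: "nat^3 \<Rightarrow> (real^3 \<Rightarrow> real) \<Rightarrow> (3 \<Rightarrow> nat) \<Rightarrow> real" where
  "coefficient a g \<iota> = (LINT t|lborel. g t * tensor (duals a \<iota>) t)"

lemma kernel_expansion:
  assumes g: "integrable lborel g"
  shows "(LINT t|lborel. g t * (\<Prod>d\<in>UNIV. \<Sum>i<N d. F d i * dual (p d) (\<Xi> d) (a $ d) i (t $ d)))
    = (\<Sum>\<iota>\<in>index. coefficient a g \<iota> * (\<Prod>d\<in>UNIV. F d (\<iota> d)))"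
proof -
  have "(LINT t|lborel. g t * (\<Prod>d\<in>UNIV. \<Sum>i<N d. F d i * dual (p d) (\<Xi> d) (a $ d) i (t $ d)))
     = (LINT t|lborel. (\<Sum>\<iota>\<in>index. (\<Prod>d\<in>UNIV. F d (\<iota> d)) * (g t * tensor (duals a \<iota>) t)))"
    unfolding prod_sum_tensor index_def[symmetric]
    by (simp add: sum_distrib_left prod.distrib tensor_def duals_def mult_ac)
  also have "\<dots> = (\<Sum>\<iota>\<in>index. LINT t|lborel. (\<Prod>d\<in>UNIV. F d (\<iota> d)) * (g t * tensor (duals a \<iota>) t))"
    unfolding tensor_def[of "duals _ _"]
    by (intro Bochner_Integration.integral_sum integrable_mult_right integrable_mult_prod g unit_duals)
  finally show ?thesis by (simp add: coefficient_def mult.commute)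
qed

lemma tensor_proj_expansion:
  assumes a: "\<And>d. a $ d \<le> 2" and g: "integrable lborel g" and fg: "AE x in lborel. x \<in> cube \<longrightarrow> f x = g x"
  shows "AE x in lborel. x \<in> cube \<longrightarrow> tensor_proj p \<Xi> a f x = (\<Sum>\<iota>\<in>index. coefficient a g \<iota> * tensor (primals a \<iota>) x)"
  using AE_off_knots[of p \<Xi>, OF adm]
proof eventually_elim
  case (elim x)
  show ?case
  proof
    assume "x \<in> cube"
    then have "tensor_proj p \<Xi> a f x = (LINT t|lborel. g t * tensor_kernel p \<Xi> a x t)"
      using elim by (intro tensor_proj_kernel adm a g fg) auto
    also have "\<dots> = (\<Sum>\<iota>\<in>index. coefficient a g \<iota> * tensor (primals a \<iota>) x)"
      using kernel_expansion[OF g, of "\<lambda>d i. primal (p d) (\<Xi> d) (a $ d) i (x $ d)" a]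
      by (simp add: tensor_kernel_def kernel_def tensor_def primals_def)
    finally show "tensor_proj p \<Xi> a f x = (\<Sum>\<iota>\<in>index. coefficient a g \<iota> * tensor (primals a \<iota>) x)" .
  qed
qed

definition expansion :: "nat^3 \<Rightarrow> (real^3 \<Rightarrow> real) \<Rightarrow> real^3 \<Rightarrow> real" where
  "expansion a g x = (\<Sum>\<iota>\<in>index. coefficient a g \<iota> * tensor (primals a \<iota>) x)"

lemma tensor_measurable: "(\<And>d. unit_fun (f d)) \<Longrightarrow> tensor f \<in> borel_measurable borel"
  using borel_measurable_integrable[OF integrable_tensor] by auto

lemma tensor_bounded:
  assumes "\<And>d. unit_fun (f d)" shows "\<exists>C. \<forall>x. \<bar>tensor f x\<bar> \<le> C"
proof -
  have "\<forall>d. \<exists>C. \<forall>t. \<bar>f d t\<bar> \<le> C" using assms by (simp add: unit_fun_def)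
  then obtain C where C: "\<And>d t. \<bar>f d t\<bar> \<le> C d" by metis
  have "\<bar>tensor f x\<bar> \<le> (\<Prod>d\<in>UNIV. C d)" for x
    unfolding tensor_def abs_prod by (intro prod_mono) (auto simp: C)
  then show ?thesis by blast
qed

lemma tensor_primals:
  "integrable lborel (tensor (primals a \<iota>))" "tensor (primals a \<iota>) \<in> borel_measurable borel"
  "\<exists>C. \<forall>x. \<bar>tensor (primals a \<iota>) x\<bar> \<le> C"
  by (rule integrable_tensor tensor_measurable tensor_bounded, rule unit_primals)+

lemma expansion_measurable[measurable]: "expansion a g \<in> borel_measurable borel"
proof -
  note [measurable] = tensor_primals(2)
  show ?thesis unfolding expansion_def by measurable
qed

lemma expansion_bounded: "\<exists>C. \<forall>x. \<bar>expansion a g x\<bar> \<le> C"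
proof -
  have "\<forall>\<iota>. \<exists>C. \<forall>x. \<bar>tensor (primals a \<iota>) x\<bar> \<le> C" using tensor_primals(3) by blast
  then obtain C where C: "\<And>\<iota> x. \<bar>tensor (primals a \<iota>) x\<bar> \<le> C \<iota>" by metis
  have "\<bar>expansion a g x\<bar> \<le> (\<Sum>\<iota>\<in>index. \<bar>coefficient a g \<iota>\<bar> * C \<iota>)" for x
    unfolding expansion_def
    by (intro order.trans[OF sum_abs] sum_mono) (auto simp: abs_mult intro!: mult_left_mono C)
  then show ?thesis by blast
qed

lemma L2_tensor_proj:
  assumes "\<And>d. a $ d \<le> 2" "L2_on cube f" shows "L2_on cube (tensor_proj p \<Xi> a f)"
proof -
  obtain g where g: "integrable lborel g" "AE x in lborel. x \<in> cube \<longrightarrow> f x = g x"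
    using L2_representative[OF assms(2)] by metis
  obtain C where "\<And>x. \<bar>expansion a g x\<bar> \<le> C" using expansion_bounded by blast
  then show ?thesis
    using tensor_proj_expansion[OF assms(1) g]
    by (intro L2_bounded[of "expansion a g"]) (auto simp: expansion_def)
qed

text \<open>
  The derivative in \<open>y\<close> of the kernel of order \<open>a - 1\<close>, which is minus the derivative in \<open>t\<close> of the kernel
  of order \<open>a\<close>.
\<close>

definition deriv_kernel :: "3 \<Rightarrow> nat \<Rightarrow> real \<Rightarrow> real \<Rightarrow> real" where
  "deriv_kernel d a y t = (\<Sum>i<N d. primal (p d) (\<Xi> d) a i y * dual (p d) (\<Xi> d) (a - 1) i t)"

text \<open>
  The tensor product kernel, as a function of the variable of integration, is admissible in the
  extended weak identity: in each direction of positive order it is the primitive of a bounded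
  function of mean zero, by the vanishing of the kernel at both ends.
\<close>

lemma kernel_pairing:
  assumes x: "off_knots \<Xi> x" and a: "\<And>d. a $ d \<le> 2"
    and w: "integrable lborel w" and u: "\<And>k. integrable lborel (u k)"
    and inactive: "\<And>k y. a $ k = 0 \<Longrightarrow> u k y = 0"
    and test: "\<And>\<theta>. (\<And>d. test1 (\<theta> d)) \<Longrightarrow>
      (LINT t|lborel. w t * tensor \<theta> t) + (\<Sum>k\<in>UNIV. LINT t|lborel. u k t * tensor (\<theta>(k := deriv (\<theta> k))) t) = 0"
  shows "(LINT t|lborel. w t * tensor_kernel p \<Xi> a x t) =
    (\<Sum>k\<in>UNIV. if a $ k = 0 then 0 else LINT t|lborel. u k t *
       tensor ((\<lambda>d. kernel (p d) (\<Xi> d) (a $ d) (x $ d))(k := deriv_kernel k (a $ k) (x $ k))) t)"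
proof -
  define \<alpha> where "\<alpha> d = kernel (p d) (\<Xi> d) (a $ d) (x $ d)" for d
  define \<kappa> where "\<kappa> d = deriv_kernel d (a $ d) (x $ d)" for d
  define \<beta> where "\<beta> d t = - \<kappa> d t" for d t
  have \<kappa>: "unit_fun (\<kappa> d)" for d
    unfolding \<kappa>_def deriv_kernel_def by (intro unit_fun_sum unit_fun_cmult dir.unit_fun_dual)
  have \<beta>: "unit_fun (\<beta> d)" for d using unit_fun_cmult[OF \<kappa>, of "-1"] by (simp add: \<beta>_def[abs_def])
  have \<alpha>: "unit_fun (\<alpha> d)" for d unfolding \<alpha>_def by (rule dir.unit_fun_kernel)
  have pair: "(LINT t|lborel. \<beta> d t) = 0 \<and> \<alpha> d = unit_prim (\<beta> d)" if d: "d \<in> {d. a $ d \<noteq> 0}" for d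
  proof -
    obtain b where b: "a $ d = Suc b" using d by (auto simp: gr0_conv_Suc)
    have "(LINT t|lborel. \<kappa> d t) = (\<Sum>i<N d. primal (p d) (\<Xi> d) (Suc b) i (x $ d) * (LINT t|lborel. dual (p d) (\<Xi> d) b i t))"
      unfolding \<kappa>_def deriv_kernel_def b
      by (subst Bochner_Integration.integral_sum) (auto intro!: integrable_mult_right unit_fun_integrable dir.unit_fun_dual)
    also have "\<dots> = 0"
      using x a[of d] b by (intro dir.kernel_boundary) (auto simp: off_knots_def)
    finally have 0: "(LINT t|lborel. \<kappa> d t) = 0" .
    have "\<alpha> d t = unit_prim (\<beta> d) t" for t
    proof -
      have "unit_prim (\<beta> d) t = tail_integral (\<kappa> d) t"
        using tail_integral_eq_unit_prim[OF \<kappa> 0] by (simp add: \<beta>_def[abs_def])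
      also have "\<dots> = \<alpha> d t"
        unfolding \<kappa>_def deriv_kernel_def b \<alpha>_def kernel_def
        by (subst tail_integral_lincomb) (auto simp: dir.unit_fun_dual)
      finally show ?thesis by simp
    qed
    then show ?thesis using 0 by (auto simp: \<beta>_def)
  qed
  have "(LINT t|lborel. w t * tensor \<alpha> t) + (\<Sum>k\<in>UNIV. LINT t|lborel. u k t * tensor (\<alpha>(k := \<beta> k)) t) = 0"
    by (rule extend_tensor[where S = "{d. a $ d \<noteq> 0}", OF w u _ test \<beta> \<alpha> pair]) (use inactive in auto)
  moreover have "(LINT t|lborel. u k t * tensor (\<alpha>(k := \<beta> k)) t)
      = - (if a $ k = 0 then 0 else LINT t|lborel. u k t * tensor (\<alpha>(k := \<kappa> k)) t)" for k
    using inactive[of k] by (auto simp: tensor_upd \<beta>_def)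
  moreover have "tensor \<alpha> t = tensor_kernel p \<Xi> a x t" for t
    by (simp add: tensor_def tensor_kernel_def \<alpha>_def)
  ultimately show ?thesis unfolding \<kappa>_def \<alpha>_def by (simp add: sum_negf)
qed

lemma index_minus: "(a - axis k 1) $ d = (if d = k then a $ k - 1 else (a $ d :: nat))"
  by (simp add: axis_def)

lemma pairing_expansion:
  assumes g: "integrable lborel g" and k: "a $ k \<noteq> 0"
  shows "(LINT t|lborel. g t * tensor ((\<lambda>d. kernel (p d) (\<Xi> d) (a $ d) (x $ d))(k := deriv_kernel k (a $ k) (x $ k))) t)
    = (\<Sum>\<iota>\<in>index. coefficient (a - axis k 1) g \<iota> * tensor (primals a \<iota>) x)"
proof -
  have "((\<lambda>d. kernel (p d) (\<Xi> d) (a $ d) (x $ d))(k := deriv_kernel k (a $ k) (x $ k))) d t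
     = (\<Sum>i<N d. primal (p d) (\<Xi> d) (a $ d) i (x $ d) * dual (p d) (\<Xi> d) ((a - axis k 1) $ d) i t)" for d t
    unfolding index_minus by (auto simp: kernel_def deriv_kernel_def)
  then show ?thesis
    using kernel_expansion[OF g, of "\<lambda>d i. primal (p d) (\<Xi> d) (a $ d) i (x $ d)" "a - axis k 1"]
    by (simp add: tensor_def primals_def)
qed

lemma expansion_weak_derivative:
  assumes \<psi>: "test_fun cube \<psi>" and a: "a $ k \<noteq> 0" "a $ k \<le> 2"
  shows "(LINT x|lborel. \<psi> x * (\<Sum>\<iota>\<in>index. c \<iota> * tensor (primals a \<iota>) x))
    = - (LINT x|lborel. pd k \<psi> x * (\<Sum>\<iota>\<in>index. c \<iota> * tensor (primals (a - axis k 1) \<iota>) x))"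
proof -
  obtain C1 C2 where C: "\<And>y. \<bar>\<psi> y\<bar> \<le> C1" "\<And>y. \<bar>pd k \<psi> y\<bar> \<le> C2" using test_fun_bounded[OF \<psi>] by meson
  have i: "integrable lborel (\<lambda>x. f x * tensor (primals b \<iota>) x)"
    if "f \<in> borel_measurable borel" "\<And>y. \<bar>f y\<bar> \<le> D" for b \<iota> f D
    using integrable_mult_bounded[OF tensor_primals(1), of f D] that by (simp add: mult.commute)
  have exp: "(LINT x|lborel. f x * (\<Sum>\<iota>\<in>index. c \<iota> * tensor (primals b \<iota>) x))
     = (\<Sum>\<iota>\<in>index. c \<iota> * (LINT x|lborel. f x * tensor (primals b \<iota>) x))"
    if "f \<in> borel_measurable borel" "\<And>y. \<bar>f y\<bar> \<le> D" for b f D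
  proof -
    have "(LINT x|lborel. f x * (\<Sum>\<iota>\<in>index. c \<iota> * tensor (primals b \<iota>) x))
      = (LINT x|lborel. (\<Sum>\<iota>\<in>index. c \<iota> * (f x * tensor (primals b \<iota>) x)))"
      by (simp add: sum_distrib_left mult_ac)
    also have "\<dots> = (\<Sum>\<iota>\<in>index. LINT x|lborel. c \<iota> * (f x * tensor (primals b \<iota>) x))"
      by (intro Bochner_Integration.integral_sum integrable_mult_right i[OF that])
    finally show ?thesis by simp
  qed
  have a': "a - axis k 1 + axis k 1 = a" using a(1) by (auto simp: vec_eq_iff axis_def)
  have le: "(a - axis k 1) $ k \<le> 1" using a by (simp add: index_minus)
  show ?thesis
    unfolding exp[OF test_fun_measurable(1)[OF \<psi>] C(1)] exp[OF test_fun_measurable(2)[OF \<psi>] C(2)]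
    using primals_weak_derivative[OF \<psi> le, unfolded a'] by (simp add: sum_negf)
qed

text \<open>
  The projections commute with the divergence. The projection of \<open>w\<close> at \<open>x\<close> is \<open>w\<close> tested with the
  kernel; the weak identity turns it into the components of \<open>u\<close> tested with derivatives of the kernel,
  and these are derivatives in \<open>x\<close> of the kernels that define the projections of the components.
\<close>

theorem tensor_proj_weak_div:
  assumes a: "\<And>d. a $ d \<le> 2" and u: "\<And>k. L2_on cube (\<lambda>x. u x $ k)" and w: "L2_on cube w"
    and div: "weak_div cube u w" and inactive: "\<And>k x. a $ k = 0 \<Longrightarrow> u x $ k = 0"
  shows "weak_div cube (\<lambda>x. \<chi> k. if a $ k = 0 then 0 else tensor_proj p \<Xi> (a - axis k 1) (\<lambda>y. u y $ k) x)
    (tensor_proj p \<Xi> a w)"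
proof -
  obtain w' where w': "integrable lborel w'" "AE x in lborel. x \<in> cube \<longrightarrow> w x = w' x" "\<And>x. x \<notin> cube \<Longrightarrow> w' x = 0"
    using L2_representative[OF w] by metis
  have "\<forall>k. \<exists>g. integrable lborel g \<and> (AE x in lborel. x \<in> cube \<longrightarrow> u x $ k = g x) \<and> (\<forall>x. x \<notin> cube \<longrightarrow> g x = 0)
      \<and> (a $ k = 0 \<longrightarrow> (\<forall>x. g x = 0))"
  proof
    fix k
    show "\<exists>g. integrable lborel g \<and> (AE x in lborel. x \<in> cube \<longrightarrow> u x $ k = g x) \<and> (\<forall>x. x \<notin> cube \<longrightarrow> g x = 0)
      \<and> (a $ k = 0 \<longrightarrow> (\<forall>x. g x = 0))"
    proof (cases "a $ k = 0")
      case True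
      then show ?thesis using inactive by (intro exI[of _ "\<lambda>_. 0"]) auto
    next
      case False
      obtain g where "integrable lborel g" "AE x in lborel. x \<in> cube \<longrightarrow> u x $ k = g x" "\<And>x. x \<notin> cube \<Longrightarrow> g x = 0"
        by (fact L2_representative[OF u[of k]])
      then show ?thesis using False by (intro exI[of _ g]) simp
    qed
  qed
  from choice[OF this] obtain u' where u'0: "\<And>k. integrable lborel (u' k) \<and> (AE x in lborel. x \<in> cube \<longrightarrow> u x $ k = u' k x)
      \<and> (\<forall>x. x \<notin> cube \<longrightarrow> u' k x = 0) \<and> (a $ k = 0 \<longrightarrow> (\<forall>x. u' k x = 0))" by blast
  have u': "\<And>k. integrable lborel (u' k)" "\<And>k. AE x in lborel. x \<in> cube \<longrightarrow> u x $ k = u' k x"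
    "\<And>k x. x \<notin> cube \<Longrightarrow> u' k x = 0" "\<And>k x. a $ k = 0 \<Longrightarrow> u' k x = 0"
    using u'0 by simp_all
  note [measurable] = borel_measurable_integrable[OF w'(1)] borel_measurable_integrable[OF u'(1)]
  have inner: "v \<bullet> grad \<psi> x = (\<Sum>k\<in>UNIV. v $ k * pd k \<psi> x)" for v \<psi> x
    by (simp add: inner_vec_def grad_def)
  have test: "(LINT t|lborel. w' t * tensor \<theta> t) + (\<Sum>k\<in>UNIV. LINT t|lborel. u' k t * tensor (\<theta>(k := deriv (\<theta> k))) t) = 0"
    if \<theta>: "\<And>d. test1 (\<theta> d)" for \<theta>
  proof -
    have \<psi>: "test_fun cube (tensor \<theta>)" by (rule test_fun_tensor[OF \<theta>])
    have sm: "smooth1 (\<theta> d)" for d using \<theta> by (simp add: test1_def)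
    have pd: "pd k (tensor \<theta>) = tensor (\<theta>(k := deriv (\<theta> k)))" for k by (rule pd_tensor(1)[OF sm])
    note [measurable] = test_fun_measurable[OF \<psi>]
    obtain C where C: "\<And>k y. \<bar>pd k (tensor \<theta>) y\<bar> \<le> C k" using test_fun_bounded(2)[OF \<psi>] by metis
    have i: "integrable lborel (\<lambda>x. u' k x * pd k (tensor \<theta>) x)" for k
      by (rule integrable_mult_bounded[OF u'(1) _ C]) measurable
    have "(LINT x|lebesgue_on cube. tensor \<theta> x * w x) = (LINT x|lborel. indicator cube x * (tensor \<theta> x * w' x))"
      by (rule cube_integral) (use w'(2) in \<open>auto elim!: eventually_mono\<close>)
    also have "\<dots> = (LINT x|lborel. w' x * tensor \<theta> x)"
      by (intro Bochner_Integration.integral_cong) (auto simp: indicator_def w'(3))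
    finally have 1: "(LINT x|lebesgue_on cube. tensor \<theta> x * w x) = (LINT x|lborel. w' x * tensor \<theta> x)" .
    have ae: "AE x in lborel. \<forall>k\<in>UNIV. x \<in> cube \<longrightarrow> u x $ k = u' k x"
      by (rule AE_finite_allI) (use u'(2) in auto)
    have "(LINT x|lebesgue_on cube. u x \<bullet> grad (tensor \<theta>) x)
       = (LINT x|lborel. indicator cube x * (\<Sum>k\<in>UNIV. u' k x * pd k (tensor \<theta>) x))"
      unfolding inner by (rule cube_integral) (measurable, use ae in \<open>auto elim!: eventually_mono\<close>)
    also have "\<dots> = (LINT x|lborel. (\<Sum>k\<in>UNIV. u' k x * pd k (tensor \<theta>) x))"
      by (intro Bochner_Integration.integral_cong) (auto simp: indicator_def u'(3))
    also have "\<dots> = (\<Sum>k\<in>UNIV. LINT x|lborel. u' k x * pd k (tensor \<theta>) x)"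
      by (intro Bochner_Integration.integral_sum i)
    finally show ?thesis using div \<psi> 1 unfolding weak_div_def pd by fastforce
  qed
  have minus_le: "(a - axis k 1) $ d \<le> 2" for k d using a[of d] by (simp add: index_minus)
  have W: "AE x in lborel. x \<in> cube \<longrightarrow> tensor_proj p \<Xi> a w x =
      (\<Sum>k\<in>UNIV. if a $ k = 0 then 0 else (\<Sum>\<iota>\<in>index. coefficient (a - axis k 1) (u' k) \<iota> * tensor (primals a \<iota>) x))"
    using AE_off_knots[of p \<Xi>, OF adm]
  proof eventually_elim
    case (elim x)
    show ?case
    proof
      assume "x \<in> cube"
      then have x: "off_knots \<Xi> x" using elim by simp
      have "tensor_proj p \<Xi> a w x = (LINT t|lborel. w' t * tensor_kernel p \<Xi> a x t)"
        by (rule tensor_proj_kernel[OF adm a w'(1,2) x])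
      also have "\<dots> = (\<Sum>k\<in>UNIV. if a $ k = 0 then 0 else LINT t|lborel. u' k t *
         tensor ((\<lambda>d. kernel (p d) (\<Xi> d) (a $ d) (x $ d))(k := deriv_kernel k (a $ k) (x $ k))) t)"
        by (rule kernel_pairing[OF x a w'(1) u'(1,4) test])
      finally show "tensor_proj p \<Xi> a w x = (\<Sum>k\<in>UNIV. if a $ k = 0 then 0 else
          (\<Sum>\<iota>\<in>index. coefficient (a - axis k 1) (u' k) \<iota> * tensor (primals a \<iota>) x))"
        using pairing_expansion[OF u'(1), of a] by (simp cong: if_cong)
    qed
  qed
  have "AE x in lborel. \<forall>k\<in>UNIV. x \<in> cube \<longrightarrow> tensor_proj p \<Xi> (a - axis k 1) (\<lambda>y. u y $ k) x = expansion (a - axis k 1) (u' k) x"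
    unfolding expansion_def by (rule AE_finite_allI) (use tensor_proj_expansion[OF minus_le u'(1,2)] in auto)
  then have U: "AE x in lborel. \<forall>k. x \<in> cube \<longrightarrow> tensor_proj p \<Xi> (a - axis k 1) (\<lambda>y. u y $ k) x = expansion (a - axis k 1) (u' k) x"
    by simp
  show ?thesis
    unfolding weak_div_def
  proof (intro allI impI)
    fix \<psi> assume \<psi>: "test_fun cube \<psi>"
    note [measurable] = test_fun_measurable[OF \<psi>] tensor_primals(2)
    have zero: "\<psi> x = 0" "pd k \<psi> x = 0" if "x \<notin> cube" for x k
    proof -
      have nc: "x \<notin> closure {x. \<psi> x \<noteq> 0}" using that \<psi> unfolding test_fun_def by blast
      show "\<psi> x = 0" by (rule test_fun_outside(1)[OF \<psi> nc])
      show "pd k \<psi> x = 0" by (rule test_fun_outside(2)[OF \<psi> nc])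
    qed
    obtain C1 where C1: "\<And>y. \<bar>\<psi> y\<bar> \<le> C1" using test_fun_bounded(1)[OF \<psi>] by blast
    obtain C2 where C2: "\<And>k y. \<bar>pd k \<psi> y\<bar> \<le> C2 k" using test_fun_bounded(2)[OF \<psi>] by metis
    let ?V = "\<lambda>k b x. if a $ k = 0 then 0 else (\<Sum>\<iota>\<in>index. coefficient (a - axis k 1) (u' k) \<iota> * tensor (primals b \<iota>) x)"
    have iV: "integrable lborel (\<lambda>x. f x * ?V k b x)" if "f \<in> borel_measurable borel" "\<And>y. \<bar>f y\<bar> \<le> D" for f D k b
    proof -
      have "integrable lborel (\<lambda>x. ?V k b x)"
      proof (cases "a $ k = 0")
        case False
        have "integrable lborel (\<lambda>x. \<Sum>\<iota>\<in>index. coefficient (a - axis k 1) (u' k) \<iota> * tensor (primals b \<iota>) x)"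
          by (intro Bochner_Integration.integrable_sum integrable_mult_right tensor_primals(1))
        then show ?thesis using False by simp
      qed simp
      then show ?thesis using integrable_mult_bounded[of lborel "\<lambda>x. ?V k b x" f D] that by (simp add: mult.commute)
    qed
    have "(LINT x|lebesgue_on cube. \<psi> x * tensor_proj p \<Xi> a w x) = (LINT x|lborel. indicator cube x * (\<psi> x * (\<Sum>k\<in>UNIV. ?V k a x)))"
      by (rule cube_integral) (measurable, use W in \<open>auto elim!: eventually_mono\<close>)
    also have "\<dots> = (LINT x|lborel. (\<Sum>k\<in>UNIV. \<psi> x * ?V k a x))"
      by (intro Bochner_Integration.integral_cong) (auto simp: indicator_def zero sum_distrib_left)
    also have "\<dots> = (\<Sum>k\<in>UNIV. LINT x|lborel. \<psi> x * ?V k a x)"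
      by (intro Bochner_Integration.integral_sum iV[OF _ C1]) measurable
    also have "\<dots> = (\<Sum>k\<in>UNIV. - (LINT x|lborel. pd k \<psi> x * ?V k (a - axis k 1) x))"
    proof (intro sum.cong refl)
      fix k
      show "(LINT x|lborel. \<psi> x * ?V k a x) = - (LINT x|lborel. pd k \<psi> x * ?V k (a - axis k 1) x)"
        using expansion_weak_derivative[OF \<psi> _ a[of k]] by (cases "a $ k = 0") auto
    qed
    also have "\<dots> = - (LINT x|lborel. (\<Sum>k\<in>UNIV. pd k \<psi> x * ?V k (a - axis k 1) x))"
      by (subst Bochner_Integration.integral_sum) (auto simp: sum_negf intro!: iV[OF _ C2])
    also have "(LINT x|lborel. (\<Sum>k\<in>UNIV. pd k \<psi> x * ?V k (a - axis k 1) x))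
      = (LINT x|lborel. indicator cube x * (\<Sum>k\<in>UNIV. ?V k (a - axis k 1) x * pd k \<psi> x))"
      by (intro Bochner_Integration.integral_cong) (auto simp: indicator_def zero mult.commute)
    also have "\<dots> = (LINT x|lebesgue_on cube. (\<chi> k. if a $ k = 0 then 0 else tensor_proj p \<Xi> (a - axis k 1) (\<lambda>y. u y $ k) x) \<bullet> grad \<psi> x)"
      unfolding inner by (rule cube_integral[symmetric])
        (measurable, use U in \<open>auto elim!: eventually_mono simp: expansion_def intro!: sum.cong\<close>)
    finally show "(LINT x|lebesgue_on cube. \<psi> x * tensor_proj p \<Xi> a w x) =
      - (LINT x|lebesgue_on cube. (\<chi> k. if a $ k = 0 then 0 else tensor_proj p \<Xi> (a - axis k 1) (\<lambda>y. u y $ k) x) \<bullet> grad \<psi> x)" .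
  qed
qed

end

section \<open>The spline spaces on the unit cube\<close>

context spline_knots begin

text \<open>
  The derivative of order \<open>b\<close> of a B-spline of the space of degree \<open>p - q\<close>, made into a function that
  is supported in the unit interval.
\<close>

definition cut :: "nat \<Rightarrow> nat \<Rightarrow> nat \<Rightarrow> real \<Rightarrow> real" where
  "cut b q i x = indicator {0<..<1} x * bspline_deriv \<xi> b (p - q) i x"

lemma unit_fun_cut: "unit_fun (cut b q i)"
proof -
  obtain C where C: "\<And>x. \<bar>bspline_deriv \<xi> b (p - q) i x\<bar> \<le> C" using bspline_deriv_bounded[OF knot_mono] by blast
  have "0 \<le> C" using order.trans[OF abs_ge_zero C[of 0]] .
  then have "\<bar>cut b q i x\<bar> \<le> C" for x using C[of x] by (auto simp: cut_def indicator_def)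
  moreover have "cut b q i \<in> borel_measurable borel" unfolding cut_def by measurable
  ultimately show ?thesis unfolding unit_fun_def by (auto simp: cut_def)
qed

lemma cut_eventually:
  assumes "0 < t" "t < 1" shows "\<forall>\<^sub>F y in nhds t. cut b q i y = bspline_deriv \<xi> b (p - q) i y"
proof -
  have "\<forall>\<^sub>F y in nhds t. y \<in> {0<..<1}" using assms by (intro eventually_nhds_in_open) auto
  then show ?thesis by eventually_elim (simp add: cut_def)
qed

lemma cut_cont: "b + q \<le> 1 \<Longrightarrow> 0 < t \<Longrightarrow> t < 1 \<Longrightarrow> isCont (cut b q i) t"
  using bspline_deriv_cont[of b q t i] isCont_cong[OF cut_eventually[of t b q i]] by simp

lemma cut_deriv:
  assumes "0 < t" "t < 1" "t \<notin> range \<xi>"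
  shows "(cut b q i has_real_derivative cut (Suc b) q i t) (at t)"
proof -
  have "cut (Suc b) q i t = bspline_deriv \<xi> (Suc b) (p - q) i t" using assms by (simp add: cut_def)
  then show ?thesis
    using bspline_deriv_deriv[OF knot_mono assms(3)] by (subst DERIV_cong_ev[OF refl cut_eventually[OF assms(1,2)]])
qed

lemma spline_fun_cut: "b + q \<le> p \<Longrightarrow> spline_fun (b + q) (cut b q i)"
  using spline_fun_bspline_deriv[of b q i] unfolding spline_fun_def by (simp add: cut_def)

end

context spline_cube begin

definition basis :: "nat^3 \<Rightarrow> 3 \<Rightarrow> nat \<Rightarrow> real \<Rightarrow> real" where
  "basis a d i = bspline (knot (\<Xi> d)) (p d - a $ d) (i + a $ d)"

lemma spline_space_iff:
  assumes a: "\<And>d. a $ d \<le> 2"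
  shows "F \<in> spline_space p \<Xi> a \<longleftrightarrow> (\<exists>c. AE x in lborel. x \<in> cube \<longrightarrow>
    F x = (\<Sum>i<N 1 - a $ 1. \<Sum>j<N 2 - a $ 2. \<Sum>k<N 3 - a $ 3.
       c i j k * (basis a 1 i (x $ 1) * basis a 2 j (x $ 2) * basis a 3 k (x $ 3))))"
proof -
  have le: "a $ d \<le> p d" for d using a[of d] dir.p_ge_2[of d] by simp
  have "(\<Sum>i<num_bsplines (p 1 - a $ 1) (reduce_knots (a $ 1) (\<Xi> 1)).
         \<Sum>j<num_bsplines (p 2 - a $ 2) (reduce_knots (a $ 2) (\<Xi> 2)).
         \<Sum>k<num_bsplines (p 3 - a $ 3) (reduce_knots (a $ 3) (\<Xi> 3)). c i j k *
        (bspline ((!) (reduce_knots (a $ 1) (\<Xi> 1))) (p 1 - a $ 1) i (x $ 1) *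
         bspline ((!) (reduce_knots (a $ 2) (\<Xi> 2))) (p 2 - a $ 2) j (x $ 2) *
         bspline ((!) (reduce_knots (a $ 3) (\<Xi> 3))) (p 3 - a $ 3) k (x $ 3)))
     = (\<Sum>i<N 1 - a $ 1. \<Sum>j<N 2 - a $ 2. \<Sum>k<N 3 - a $ 3.
       c i j k * (basis a 1 i (x $ 1) * basis a 2 j (x $ 2) * basis a 3 k (x $ 3)))" for c and x :: "real^3"
    unfolding dir.num_reduce[OF le] by (intro sum.cong refl) (simp add: dir.bspline_reduce[OF le] basis_def)
  then show ?thesis unfolding spline_space_def Let_def by (simp add: AE_lebesgue_on_cube)
qed

lemma spline_space_add:
  assumes a: "\<And>d. a $ d \<le> 2" and F: "F \<in> spline_space p \<Xi> a" and G: "G \<in> spline_space p \<Xi> a"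
    and H: "AE x in lborel. x \<in> cube \<longrightarrow> H x = r * F x + s * G x"
  shows "H \<in> spline_space p \<Xi> a"
proof -
  obtain c e where c: "AE x in lborel. x \<in> cube \<longrightarrow>
      F x = (\<Sum>i<N 1 - a $ 1. \<Sum>j<N 2 - a $ 2. \<Sum>k<N 3 - a $ 3.
       c i j k * (basis a 1 i (x $ 1) * basis a 2 j (x $ 2) * basis a 3 k (x $ 3)))"
    and e: "AE x in lborel. x \<in> cube \<longrightarrow>
      G x = (\<Sum>i<N 1 - a $ 1. \<Sum>j<N 2 - a $ 2. \<Sum>k<N 3 - a $ 3.
       e i j k * (basis a 1 i (x $ 1) * basis a 2 j (x $ 2) * basis a 3 k (x $ 3)))"
    using F G unfolding spline_space_iff[OF a] by blast
  have "AE x in lborel. x \<in> cube \<longrightarrow> H x = (\<Sum>i<N 1 - a $ 1. \<Sum>j<N 2 - a $ 2. \<Sum>k<N 3 - a $ 3.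
       (r * c i j k + s * e i j k) * (basis a 1 i (x $ 1) * basis a 2 j (x $ 2) * basis a 3 k (x $ 3)))"
    using c e H by eventually_elim (simp add: sum_distrib_left sum.distrib algebra_simps)
  then show ?thesis unfolding spline_space_iff[OF a] by (rule exI[of _ "\<lambda>i j k. r * c i j k + s * e i j k"])
qed

lemma spline_space_sum:
  assumes a: "\<And>d. a $ d \<le> 2" and "finite Z" and F: "\<And>z. z \<in> Z \<Longrightarrow> F z \<in> spline_space p \<Xi> a"
  shows "(\<lambda>x. \<Sum>z\<in>Z. r z * F z x) \<in> spline_space p \<Xi> a"
  using assms(2) F
proof induction
  case empty
  show ?case unfolding spline_space_iff[OF a] by (rule exI[of _ "\<lambda>_ _ _. 0"]) simp
next
  case (insert z Z)
  then have F: "F z \<in> spline_space p \<Xi> a" and S: "(\<lambda>x. \<Sum>z\<in>Z. r z * F z x) \<in> spline_space p \<Xi> a"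
    by auto
  show ?case
    by (rule spline_space_add[OF a F S, where r = "r z" and s = 1]) (simp add: insert.hyps)
qed

lemma triple_sum_product:
  fixes A B C :: "nat \<Rightarrow> real"
  shows "sum A S * sum B T * sum C U = (\<Sum>i\<in>S. \<Sum>j\<in>T. \<Sum>k\<in>U. A i * B j * C k)"
  by (subst sum_product, simp only: sum_distrib_right, simp only: sum_distrib_left)

lemma spline_space_tensor:
  assumes a: "\<And>d. a $ d \<le> 2" and f: "\<And>d. dir.spline_fun d (a $ d) (f d)"
  shows "tensor f \<in> spline_space p \<Xi> a"
proof -
  have "\<forall>d. \<exists>c. \<forall>x. 0 < x \<and> x < 1 \<longrightarrow> f d x = (\<Sum>j<N d - a $ d. c j * basis a d j x)"
    using f unfolding dir.spline_fun_def basis_def by blast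
  then obtain c where c: "\<And>d x. 0 < x \<Longrightarrow> x < 1 \<Longrightarrow> f d x = (\<Sum>j<N d - a $ d. c d j * basis a d j x)" by metis
  have "tensor f x = (\<Sum>i<N 1 - a $ 1. \<Sum>j<N 2 - a $ 2. \<Sum>k<N 3 - a $ 3.
       (c 1 i * c 2 j * c 3 k) * (basis a 1 i (x $ 1) * basis a 2 j (x $ 2) * basis a 3 k (x $ 3)))" if "x \<in> cube" for x
  proof -
    have "tensor f x = (\<Sum>i<N 1 - a $ 1. c 1 i * basis a 1 i (x $ 1)) * (\<Sum>j<N 2 - a $ 2. c 2 j * basis a 2 j (x $ 2))
        * (\<Sum>k<N 3 - a $ 3. c 3 k * basis a 3 k (x $ 3))"
      using that c by (simp add: tensor_def prod_3 mem_cube)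
    also have "\<dots> = (\<Sum>i<N 1 - a $ 1. \<Sum>j<N 2 - a $ 2. \<Sum>k<N 3 - a $ 3. (c 1 i * basis a 1 i (x $ 1)) *
        (c 2 j * basis a 2 j (x $ 2)) * (c 3 k * basis a 3 k (x $ 3)))"
      by (rule triple_sum_product)
    finally show ?thesis by (simp add: mult_ac)
  qed
  then have "AE x in lborel. x \<in> cube \<longrightarrow> tensor f x = (\<Sum>i<N 1 - a $ 1. \<Sum>j<N 2 - a $ 2. \<Sum>k<N 3 - a $ 3.
       (c 1 i * c 2 j * c 3 k) * (basis a 1 i (x $ 1) * basis a 2 j (x $ 2) * basis a 3 k (x $ 3)))" by auto
  then show ?thesis unfolding spline_space_iff[OF a] by (rule exI[of _ "\<lambda>i j k. c 1 i * c 2 j * c 3 k"])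
qed

lemma spline_space_representation:
  assumes a: "\<And>d. a $ d \<le> 2" and F: "F \<in> spline_space p \<Xi> a"
  obtains Z :: "(nat \<times> nat \<times> nat) set" and c m where "finite Z"
    "AE x in lborel. x \<in> cube \<longrightarrow> F x = (\<Sum>z\<in>Z. c z * tensor (\<lambda>d. dir.cut d 0 (a $ d) (m z d)) x)"
proof -
  obtain c where c: "AE x in lborel. x \<in> cube \<longrightarrow>
      F x = (\<Sum>i<N 1 - a $ 1. \<Sum>j<N 2 - a $ 2. \<Sum>k<N 3 - a $ 3.
       c i j k * (basis a 1 i (x $ 1) * basis a 2 j (x $ 2) * basis a 3 k (x $ 3)))"
    using F unfolding spline_space_iff[OF a] by blast
  define Z where "Z = {..<N 1 - a $ 1} \<times> {..<N 2 - a $ 2} \<times> {..<N 3 - a $ 3}"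
  define m where "m = (\<lambda>(i, j, k) d. (if d = 1 then i else if d = (2::3) then j else k) + a $ d)"
  have "AE x in lborel. x \<in> cube \<longrightarrow> F x = (\<Sum>z\<in>Z. (case z of (i, j, k) \<Rightarrow> c i j k) * tensor (\<lambda>d. dir.cut d 0 (a $ d) (m z d)) x)"
    using c
  proof eventually_elim
    case (elim x)
    show ?case
    proof
      assume x: "x \<in> cube"
      have "(\<Sum>z\<in>Z. (case z of (i, j, k) \<Rightarrow> c i j k) * tensor (\<lambda>d. dir.cut d 0 (a $ d) (m z d)) x)
        = (\<Sum>i<N 1 - a $ 1. \<Sum>j<N 2 - a $ 2. \<Sum>k<N 3 - a $ 3. c i j k * tensor (\<lambda>d. dir.cut d 0 (a $ d) (m (i, j, k) d)) x)"
        unfolding Z_def by (simp add: sum.cartesian_product case_prod_beta')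
      also have "\<dots> = F x"
        using x elim by (simp add: tensor_def prod_3 dir.cut_def m_def basis_def mem_cube)
      finally show "F x = (\<Sum>z\<in>Z. (case z of (i, j, k) \<Rightarrow> c i j k) * tensor (\<lambda>d. dir.cut d 0 (a $ d) (m z d)) x)" by simp
    qed
  qed
  then show thesis by (intro that[of Z]) (auto simp: Z_def)
qed

lemma weak_derivative_sum:
  assumes Z: "finite Z" and f: "\<And>z d. unit_fun (f z d)" and g: "\<And>z. unit_fun (g z)"
    and cont: "\<And>z t. 0 < t \<Longrightarrow> t < 1 \<Longrightarrow> isCont (f z k) t"
    and der: "\<And>z t. 0 < t \<Longrightarrow> t < 1 \<Longrightarrow> t \<notin> range (knot (\<Xi> k)) \<Longrightarrow> (f z k has_real_derivative g z t) (at t)"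
    and F: "AE x in lborel. x \<in> cube \<longrightarrow> F x = (\<Sum>z\<in>Z. c z * tensor (f z) x)"
    and G: "AE x in lborel. x \<in> cube \<longrightarrow> G x = (\<Sum>z\<in>Z. c z * tensor ((f z)(k := g z)) x)"
  shows "weak_div cube (\<lambda>x. F x *\<^sub>R axis k 1) G"
  unfolding weak_div_def
proof (intro allI impI)
  fix \<psi> assume \<psi>: "test_fun cube \<psi>"
  have fg: "unit_fun (((f z)(k := g z)) d)" for z d using f g by simp
  have tm: "tensor (f z) \<in> borel_measurable borel" "tensor ((f z)(k := g z)) \<in> borel_measurable borel" for z
    by (rule tensor_measurable, rule f fg)+
  have ti: "integrable lborel (tensor (f z))" "integrable lborel (tensor ((f z)(k := g z)))" for z
    by (rule integrable_tensor, rule f fg)+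
  note [measurable] = test_fun_measurable[OF \<psi>] tm
  have zero: "\<psi> x = 0" "pd k \<psi> x = 0" if "x \<notin> cube" for x
  proof -
    have nc: "x \<notin> closure {x. \<psi> x \<noteq> 0}" using that \<psi> unfolding test_fun_def by blast
    show "\<psi> x = 0" by (rule test_fun_outside(1)[OF \<psi> nc])
    show "pd k \<psi> x = 0" by (rule test_fun_outside(2)[OF \<psi> nc])
  qed
  obtain C1 C2 where C: "\<And>y. \<bar>\<psi> y\<bar> \<le> C1" "\<And>y. \<bar>pd k \<psi> y\<bar> \<le> C2" using test_fun_bounded[OF \<psi>] by meson
  have i1: "integrable lborel (\<lambda>x. \<psi> x * tensor ((f z)(k := g z)) x)" for z
  proof -
    have "\<psi> \<in> borel_measurable lborel" by measurable
    from integrable_mult_bounded[OF ti(2) this C(1)] show ?thesis by (simp add: mult.commute)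
  qed
  have i2: "integrable lborel (\<lambda>x. pd k \<psi> x * tensor (f z) x)" for z
  proof -
    have "pd k \<psi> \<in> borel_measurable lborel" by measurable
    from integrable_mult_bounded[OF ti(1) this C(2)] show ?thesis by (simp add: mult.commute)
  qed
  have "(LINT x|lebesgue_on cube. \<psi> x * G x) = (LINT x|lborel. indicator cube x * (\<psi> x * (\<Sum>z\<in>Z. c z * tensor ((f z)(k := g z)) x)))"
    by (rule cube_integral) (measurable, use G in \<open>auto elim!: eventually_mono\<close>)
  also have "\<dots> = (LINT x|lborel. (\<Sum>z\<in>Z. c z * (\<psi> x * tensor ((f z)(k := g z)) x)))"
    by (intro Bochner_Integration.integral_cong) (auto simp: indicator_def zero sum_distrib_left mult_ac)
  also have "\<dots> = (\<Sum>z\<in>Z. LINT x|lborel. c z * (\<psi> x * tensor ((f z)(k := g z)) x))"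
    by (intro Bochner_Integration.integral_sum integrable_mult_right i1)
  also have "\<dots> = (\<Sum>z\<in>Z. - (LINT x|lborel. c z * (pd k \<psi> x * tensor (f z) x)))"
  proof (intro sum.cong refl)
    fix z
    have "(LINT x|lborel. \<psi> x * tensor ((f z)(k := g z)) x) = - (LINT x|lborel. pd k \<psi> x * tensor (f z) x)"
      by (rule tensor_weak_derivative[where f = "f z" and k = k and K = "range (knot (\<Xi> k))", OF \<psi> f g dir.finite_knots cont der])
    then show "(LINT x|lborel. c z * (\<psi> x * tensor ((f z)(k := g z)) x)) = - (LINT x|lborel. c z * (pd k \<psi> x * tensor (f z) x))"
      by simp
  qed
  also have "\<dots> = - (LINT x|lborel. (\<Sum>z\<in>Z. c z * (pd k \<psi> x * tensor (f z) x)))"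
    by (subst Bochner_Integration.integral_sum) (auto simp: sum_negf intro!: integrable_mult_right i2)
  also have "(LINT x|lborel. (\<Sum>z\<in>Z. c z * (pd k \<psi> x * tensor (f z) x)))
     = (LINT x|lborel. indicator cube x * ((\<Sum>z\<in>Z. c z * tensor (f z) x) * pd k \<psi> x))"
    by (intro Bochner_Integration.integral_cong) (auto simp: indicator_def zero sum_distrib_left mult_ac)
  also have "\<dots> = (LINT x|lebesgue_on cube. (F x *\<^sub>R axis k 1) \<bullet> grad \<psi> x)"
    unfolding inner_scaleR_left inner_axis' by (rule cube_integral[symmetric])
      (measurable, use F in \<open>auto elim!: eventually_mono simp: grad_def\<close>)
  finally show "(LINT x|lebesgue_on cube. \<psi> x * G x) = - (LINT x|lebesgue_on cube. (F x *\<^sub>R axis k 1) \<bullet> grad \<psi> x)" .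
qed

lemma L2_tensor_sum:
  assumes Z: "finite Z" and f: "\<And>z d. unit_fun (f z d)"
    and F: "AE x in lborel. x \<in> cube \<longrightarrow> F x = (\<Sum>z\<in>Z. c z * tensor (f z) x)"
  shows "L2_on cube F"
proof -
  have "\<exists>C. \<forall>x. \<bar>tensor (f z) x\<bar> \<le> C" for z by (rule tensor_bounded, rule f)
  then obtain C where C: "\<And>z x. \<bar>tensor (f z) x\<bar> \<le> C z" by metis
  have [measurable]: "tensor (f z) \<in> borel_measurable borel" for z by (rule tensor_measurable, rule f)
  show ?thesis
  proof (rule L2_bounded[OF _ _ F])
    show "norm (\<Sum>z\<in>Z. c z * tensor (f z) x) \<le> (\<Sum>z\<in>Z. \<bar>c z\<bar> * C z)" for x
      unfolding real_norm_def by (intro order.trans[OF sum_abs] sum_mono) (auto simp: abs_mult intro!: mult_left_mono C)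
  qed measurable
qed

lemma spline_space_L2:
  assumes a: "\<And>d. a $ d \<le> 2" and F: "F \<in> spline_space p \<Xi> a" shows "L2_on cube F"
proof -
  obtain Z :: "(nat \<times> nat \<times> nat) set" and c m where Z: "finite Z"
    "AE x in lborel. x \<in> cube \<longrightarrow> F x = (\<Sum>z\<in>Z. c z * tensor (\<lambda>d. dir.cut d 0 (a $ d) (m z d)) x)"
    by (fact spline_space_representation[OF a F])
  show ?thesis by (rule L2_tensor_sum[OF Z(1) dir.unit_fun_cut Z(2)])
qed

lemma axis_le:
  assumes "\<And>d. a $ d \<le> (2::nat)" "a $ k \<le> 1" shows "(a + axis k 1) $ d \<le> 2"
  using assms(1)[of d] assms(2) by (auto simp: axis_def)

text \<open>
  The degree in direction \<open>k\<close> is at least \<open>p k - 1\<close>, hence at least the multiplicity of the interior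
  knots. The spline is therefore continuous in this direction, and its piecewise derivative is its weak
  derivative.
\<close>

lemma spline_space_derivative:
  assumes a: "\<And>d. a $ d \<le> 2" "a $ k \<le> 1" and F: "F \<in> spline_space p \<Xi> a"
  shows "\<exists>G\<in>spline_space p \<Xi> (a + axis k 1). weak_div cube (\<lambda>x. F x *\<^sub>R axis k 1) G"
proof -
  obtain Z :: "(nat \<times> nat \<times> nat) set" and c m where Z: "finite Z"
    "AE x in lborel. x \<in> cube \<longrightarrow> F x = (\<Sum>z\<in>Z. c z * tensor (\<lambda>d. dir.cut d 0 (a $ d) (m z d)) x)"
    by (fact spline_space_representation[OF a(1) F])
  define f where "f z d = dir.cut d 0 (a $ d) (m z d)" for z d
  define g where "g z = dir.cut k 1 (a $ k) (m z k)" for z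
  define G where "G x = (\<Sum>z\<in>Z. c z * tensor ((f z)(k := g z)) x)" for x
  have "weak_div cube (\<lambda>x. F x *\<^sub>R axis k 1) G"
  proof (rule weak_derivative_sum[OF Z(1)])
    show "isCont (f z k) t" if "0 < t" "t < 1" for z t
      unfolding f_def using that a(2) by (intro dir.cut_cont) auto
    show "(f z k has_real_derivative g z t) (at t)" if "0 < t" "t < 1" "t \<notin> range (knot (\<Xi> k))" for z t
      unfolding f_def g_def One_nat_def by (rule dir.cut_deriv[OF that])
  qed (use Z(2) in \<open>auto simp: f_def[abs_def] g_def G_def dir.unit_fun_cut\<close>)
  moreover have "tensor ((f z)(k := g z)) \<in> spline_space p \<Xi> (a + axis k 1)" for z
  proof (rule spline_space_tensor[OF axis_le[OF a]])
    fix d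
    have le: "a $ k + 1 \<le> p k" "a $ d \<le> p d" using a(1)[of d] a(2) dir.p_ge_2[of k] dir.p_ge_2[of d] by linarith+
    show "dir.spline_fun d ((a + axis k 1) $ d) (((f z)(k := g z)) d)"
      using dir.spline_fun_cut[of 0 "a $ d" d] dir.spline_fun_cut[of 1 "a $ k" k] le
      by (auto simp: axis_def f_def g_def)
  qed
  then have "G \<in> spline_space p \<Xi> (a + axis k 1)"
    unfolding G_def[abs_def] by (intro spline_space_sum[OF axis_le[OF a]] Z(1))
  ultimately show ?thesis by blast
qed

text \<open>
  For the Hessian, one function is given for each multi-order, independently of the succession of the
  derivatives, so that the matrix of second derivatives is symmetric.
\<close>

lemma spline_space_derivatives:
  assumes F: "F \<in> spline_space p \<Xi> 0"
  shows "\<exists>D. (\<forall>a. (\<forall>d. a $ d \<le> 2) \<longrightarrow> D a \<in> spline_space p \<Xi> a) \<and> (AE x in lborel. x \<in> cube \<longrightarrow> F x = D 0 x) \<and>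
    (\<forall>a k. a $ k \<le> 1 \<longrightarrow> weak_div cube (\<lambda>x. D a x *\<^sub>R axis k 1) (D (a + axis k 1)))"
proof -
  have 0: "(0 :: nat^3) $ d \<le> 2" for d by simp
  obtain Z :: "(nat \<times> nat \<times> nat) set" and c m where Z: "finite Z"
    "AE x in lborel. x \<in> cube \<longrightarrow> F x = (\<Sum>z\<in>Z. c z * tensor (\<lambda>d. dir.cut d 0 ((0 :: nat^3) $ d) (m z d)) x)"
    by (fact spline_space_representation[OF 0 F])
  define f where "f a z d = dir.cut d (a $ d) 0 (m z d)" for a :: "nat^3" and z d
  define D where "D a x = (\<Sum>z\<in>Z. c z * tensor (f a z) x)" for a x
  have "D a \<in> spline_space p \<Xi> a" if a: "\<forall>d. a $ d \<le> 2" for a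
  proof -
    have "a $ d + 0 \<le> p d" for d using a dir.p_ge_2[of d] by (auto intro: order.trans)
    then have "dir.spline_fun d (a $ d + 0) (dir.cut d (a $ d) 0 i)" for d i by (rule dir.spline_fun_cut)
    then have "tensor (f a z) \<in> spline_space p \<Xi> a" for z
      using a by (intro spline_space_tensor) (auto simp: f_def)
    then show ?thesis unfolding D_def[abs_def] using a Z(1) by (intro spline_space_sum) auto
  qed
  moreover have "AE x in lborel. x \<in> cube \<longrightarrow> F x = D 0 x"
    using Z(2) by (simp add: D_def f_def[abs_def])
  moreover have "weak_div cube (\<lambda>x. D a x *\<^sub>R axis k 1) (D (a + axis k 1))" if a: "a $ k \<le> 1" for a k
  proof (rule weak_derivative_sum[OF Z(1), where f = "f a" and g = "\<lambda>z. f (a + axis k 1) z k"])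
    show "isCont (f a z k) t" if "0 < t" "t < 1" for z t
      unfolding f_def using that a by (intro dir.cut_cont) auto
    show "(f a z k has_real_derivative f (a + axis k 1) z k t) (at t)" if "0 < t" "t < 1" "t \<notin> range (knot (\<Xi> k))" for z t
      unfolding f_def using dir.cut_deriv[OF that] by (simp add: axis_def)
    have "f (a + axis k 1) z = (f a z)(k := f (a + axis k 1) z k)" for z
      by (auto simp: f_def axis_def)
    then show "AE x in lborel. x \<in> cube \<longrightarrow> D (a + axis k 1) x = (\<Sum>z\<in>Z. c z * tensor ((f a z)(k := f (a + axis k 1) z k)) x)"
      by (simp add: D_def)
  qed (auto simp: f_def[abs_def] D_def dir.unit_fun_cut)
  ultimately show ?thesis by blast
qed

end

section \<open>Weak differential operators in terms of the divergence\<close>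

lemma L2_on_nth: "L2_on D f \<Longrightarrow> L2_on D (\<lambda>x. f x $ k)" for f :: "real^3 \<Rightarrow> 'b::euclidean_space^'n"
proof -
  assume f: "L2_on D f"
  have m: "f \<in> borel_measurable (lebesgue_on D)" and i: "integrable (lebesgue_on D) (\<lambda>x. (norm (f x))\<^sup>2)"
    using f by (auto simp: L2_on_def)
  have c: "(\<lambda>v :: 'b^'n. v $ k) \<in> borel_measurable borel"
    by (intro borel_measurable_continuous_onI continuous_intros)
  have mk: "(\<lambda>x. f x $ k) \<in> borel_measurable (lebesgue_on D)"
    using measurable_compose[OF m c] .
  have "integrable (lebesgue_on D) (\<lambda>x. (norm (f x $ k))\<^sup>2)"
  proof (rule Bochner_Integration.integrable_bound[OF i])
    show "(\<lambda>x. (norm (f x $ k))\<^sup>2) \<in> borel_measurable (lebesgue_on D)" using mk by measurable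
    show "AE x in lebesgue_on D. norm ((norm (f x $ k))\<^sup>2) \<le> norm ((norm (f x))\<^sup>2)"
      using Finite_Cartesian_Product.norm_nth_le[of "f _" k]
      by (intro AE_I2) (simp add: power_mono)
  qed
  then show ?thesis using mk by (simp add: L2_on_def)
qed

lemma L2_on_add:
  fixes f g :: "real^3 \<Rightarrow> real"
  assumes "L2_on D f" "L2_on D g" shows "L2_on D (\<lambda>x. r * f x + s * g x)"
proof -
  have m: "f \<in> borel_measurable (lebesgue_on D)" "g \<in> borel_measurable (lebesgue_on D)"
    and i: "integrable (lebesgue_on D) (\<lambda>x. (f x)\<^sup>2)" "integrable (lebesgue_on D) (\<lambda>x. (g x)\<^sup>2)"
    using assms by (auto simp: L2_on_def)
  have "integrable (lebesgue_on D) (\<lambda>x. 2 * r\<^sup>2 * (f x)\<^sup>2 + 2 * s\<^sup>2 * (g x)\<^sup>2)" using i by simp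
  then have "integrable (lebesgue_on D) (\<lambda>x. (r * f x + s * g x)\<^sup>2)"
  proof (rule Bochner_Integration.integrable_bound)
    show "(\<lambda>x. (r * f x + s * g x)\<^sup>2) \<in> borel_measurable (lebesgue_on D)" using m by measurable
    have "(r * a + s * b)\<^sup>2 \<le> 2 * r\<^sup>2 * a\<^sup>2 + 2 * s\<^sup>2 * b\<^sup>2" for a b
    proof -
      have "0 \<le> (r * a - s * b)\<^sup>2" by simp
      then show ?thesis by (simp add: power2_eq_square algebra_simps)
    qed
    then show "AE x in lebesgue_on D. norm ((r * f x + s * g x)\<^sup>2) \<le> norm (2 * r\<^sup>2 * (f x)\<^sup>2 + 2 * s\<^sup>2 * (g x)\<^sup>2)"
      by (intro AE_I2) (simp add: order.trans[OF _ abs_ge_self])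
  qed
  then show ?thesis using m by (simp add: L2_on_def)
qed

lemma L2_on_sum:
  fixes f :: "'i \<Rightarrow> real^3 \<Rightarrow> real"
  assumes "finite I" "\<And>i. i \<in> I \<Longrightarrow> L2_on D (f i)" shows "L2_on D (\<lambda>x. \<Sum>i\<in>I. r i * f i x)"
  using assms
proof induction
  case empty
  show ?case by (simp add: L2_on_def)
next
  case (insert i I)
  then show ?case using L2_on_add[of D "f i" "\<lambda>x. \<Sum>i\<in>I. r i * f i x" "r i" 1] by simp
qed

lemma L2_on_vec_iff:
  fixes f :: "real^3 \<Rightarrow> 'b::euclidean_space^'n"
  shows "L2_on D f \<longleftrightarrow> (\<forall>k. L2_on D (\<lambda>x. f x $ k))"
proof
  assume f: "\<forall>k. L2_on D (\<lambda>x. f x $ k)"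
  have fe: "f x = (\<Sum>k\<in>UNIV. axis k (f x $ k))" for x
    by (simp add: vec_eq_iff axis_def if_distrib cong: if_cong)
  have "linear (axis k :: 'b \<Rightarrow> 'b^'n)" for k
    by (rule linearI) (auto simp: axis_def vec_eq_iff)
  then have am: "(axis k :: 'b \<Rightarrow> 'b^'n) \<in> borel_measurable borel" for k
    by (intro borel_measurable_continuous_onI linear_continuous_on linear_conv_bounded_linear[THEN iffD1])
  have "(\<lambda>x. f x $ k) \<in> borel_measurable (lebesgue_on D)" for k using f by (auto simp: L2_on_def)
  then have "(\<lambda>x. axis k (f x $ k) :: 'b^'n) \<in> borel_measurable (lebesgue_on D)" for k
    by (rule measurable_compose[OF _ am])
  then have "(\<lambda>x. \<Sum>k\<in>UNIV. axis k (f x $ k)) \<in> borel_measurable (lebesgue_on D)"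
    by (intro borel_measurable_sum)
  then have m: "f \<in> borel_measurable (lebesgue_on D)" using fe by simp
  have n: "(norm (f x))\<^sup>2 = (\<Sum>k\<in>UNIV. (norm (f x $ k))\<^sup>2)" for x
    by (simp add: norm_vec_def L2_set_def sum_nonneg)
  have "integrable (lebesgue_on D) (\<lambda>x. \<Sum>k\<in>UNIV. (norm (f x $ k))\<^sup>2)"
    using f by (intro Bochner_Integration.integrable_sum) (auto simp: L2_on_def)
  then show "L2_on D f" using m n by (simp add: L2_on_def)
qed (use L2_on_nth in blast)

lemma L2_on_mat_iff:
  fixes f :: "real^3 \<Rightarrow> real^'n^'m"
  shows "L2_on D f \<longleftrightarrow> (\<forall>i k. L2_on D (\<lambda>x. f x $ i $ k))"
  by (simp add: L2_on_vec_iff)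

lemma L2_test_integrable:
  fixes w h :: "real^3 \<Rightarrow> real"
  assumes D: "D \<in> sets lebesgue" and w: "L2_on D w" and K: "compact K"
    and h: "h \<in> borel_measurable borel" "\<And>x. \<bar>h x\<bar> \<le> C" "\<And>x. x \<notin> K \<Longrightarrow> h x = 0"
  shows "integrable (lebesgue_on D) (\<lambda>x. h x * w x)"
proof -
  have m: "w \<in> borel_measurable (lebesgue_on D)" and sq: "integrable (lebesgue_on D) (\<lambda>x. (w x)\<^sup>2)"
    using w by (auto simp: L2_on_def)
  have hm: "h \<in> borel_measurable (lebesgue_on D)"
    using h(1) by (intro measurable_restrict_space1 measurable_completion) simp
  have "K \<in> lmeasurable" using K by (rule lmeasurable_compact)
  then have "integrable lebesgue (indicator K :: real^3 \<Rightarrow> real)"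
    by (intro integrable_real_indicator) (auto simp: fmeasurable_def)
  then have i: "integrable lebesgue (\<lambda>x. indicator D x *\<^sub>R (indicator K x :: real))"
    by (rule integrable_mult_indicator[OF D])
  have DD: "D \<inter> space lebesgue \<in> sets lebesgue" using D by simp
  have "integrable (lebesgue_on D) (indicator K :: real^3 \<Rightarrow> real)"
    by (rule integrable_restrict_space[OF DD, THEN iffD2, OF i])
  then have "integrable (lebesgue_on D) (\<lambda>x. C * ((w x)\<^sup>2 + indicator K x))" using sq by simp
  then show ?thesis
  proof (rule Bochner_Integration.integrable_bound)
    show "(\<lambda>x. h x * w x) \<in> borel_measurable (lebesgue_on D)" using m hm by measurable
    show "AE x in lebesgue_on D. norm (h x * w x) \<le> norm (C * ((w x)\<^sup>2 + indicator K x))"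
    proof (rule AE_I2)
      fix x
      have C: "0 \<le> C" using h(2)[of x] by simp
      show "norm (h x * w x) \<le> norm (C * ((w x)\<^sup>2 + indicator K x))"
      proof (cases "x \<in> K")
        case True
        have "0 \<le> (\<bar>w x\<bar> - 1)\<^sup>2" "0 \<le> (w x)\<^sup>2" by simp_all
        then have "\<bar>w x\<bar> \<le> (w x)\<^sup>2 + 1" by (simp add: power2_eq_square algebra_simps)
        then have "\<bar>h x\<bar> * \<bar>w x\<bar> \<le> C * ((w x)\<^sup>2 + 1)" using h(2)[of x] C by (intro mult_mono) auto
        then show ?thesis using True C by (simp add: abs_mult)
      next
        case False
        then show ?thesis using h(3) by simp
      qed
    qed
  qed
qed

lemma test_fun_L2_integrable:
  assumes D: "D \<in> sets lebesgue" and \<psi>: "test_fun D \<psi>" and w: "L2_on D w"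
  shows "integrable (lebesgue_on D) (\<lambda>x. \<psi> x * w x)" "integrable (lebesgue_on D) (\<lambda>x. pd k \<psi> x * w x)"
proof -
  have K: "compact (closure {x. \<psi> x \<noteq> 0})" using \<psi> by (simp add: test_fun_def)
  obtain C1 C2 where C: "\<And>y. \<bar>\<psi> y\<bar> \<le> C1" "\<And>y. \<bar>pd k \<psi> y\<bar> \<le> C2" using test_fun_bounded[OF \<psi>] by meson
  show "integrable (lebesgue_on D) (\<lambda>x. \<psi> x * w x)"
    by (rule L2_test_integrable[OF D w K test_fun_measurable(1)[OF \<psi>] C(1) test_fun_outside(1)[OF \<psi>]])
  show "integrable (lebesgue_on D) (\<lambda>x. pd k \<psi> x * w x)"
    by (rule L2_test_integrable[OF D w K test_fun_measurable(2)[OF \<psi>] C(2) test_fun_outside(2)[OF \<psi>]])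
qed

lemma inner_grad: "v \<bullet> grad \<psi> x = (\<Sum>k\<in>UNIV. pd k \<psi> x * v $ k)"
  by (simp add: inner_vec_def grad_def mult.commute)

lemma test_fun_L2_inner_integrable:
  assumes D: "D \<in> sets lebesgue" and \<psi>: "test_fun D \<psi>" and u: "L2_on D u"
  shows "integrable (lebesgue_on D) (\<lambda>x. u x \<bullet> grad \<psi> x)"
  unfolding inner_grad
  by (intro Bochner_Integration.integrable_sum test_fun_L2_integrable[OF D \<psi>] L2_on_nth[OF u])

lemma weak_div_sum:
  assumes D: "D \<in> sets lebesgue" and "finite I"
    and u: "\<And>i. i \<in> I \<Longrightarrow> L2_on D (u i)" and w: "\<And>i. i \<in> I \<Longrightarrow> L2_on D (w i)"
    and div: "\<And>i. i \<in> I \<Longrightarrow> weak_div D (u i) (w i)"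
  shows "weak_div D (\<lambda>x. \<Sum>i\<in>I. r i *\<^sub>R u i x) (\<lambda>x. \<Sum>i\<in>I. r i * w i x)"
  unfolding weak_div_def
proof (intro allI impI)
  fix \<psi> assume \<psi>: "test_fun D \<psi>"
  have "(LINT x|lebesgue_on D. \<psi> x * (\<Sum>i\<in>I. r i * w i x)) = (LINT x|lebesgue_on D. (\<Sum>i\<in>I. r i * (\<psi> x * w i x)))"
    by (simp add: sum_distrib_left mult_ac)
  also have "\<dots> = (\<Sum>i\<in>I. LINT x|lebesgue_on D. r i * (\<psi> x * w i x))"
    by (intro Bochner_Integration.integral_sum integrable_mult_right test_fun_L2_integrable(1)[OF D \<psi>] w)
  also have "\<dots> = (\<Sum>i\<in>I. - (LINT x|lebesgue_on D. r i * (u i x \<bullet> grad \<psi> x)))"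
    using div \<psi> by (intro sum.cong) (auto simp: weak_div_def)
  also have "\<dots> = - (LINT x|lebesgue_on D. (\<Sum>i\<in>I. r i * (u i x \<bullet> grad \<psi> x)))"
    by (subst Bochner_Integration.integral_sum)
      (auto simp: sum_negf intro!: integrable_mult_right test_fun_L2_inner_integrable[OF D \<psi>] u)
  finally show "(LINT x|lebesgue_on D. \<psi> x * (\<Sum>i\<in>I. r i * w i x)) = - (LINT x|lebesgue_on D. (\<Sum>i\<in>I. r i *\<^sub>R u i x) \<bullet> grad \<psi> x)"
    by (simp add: inner_sum_left)
qed

lemma vec_integral_eqI:
  fixes f g :: "'a::euclidean_space \<Rightarrow> real^3"
  assumes D: "D \<in> sets lebesgue" and f: "\<And>k. integrable (lebesgue_on D) (\<lambda>x. f x $ k)"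
  shows "(LINT x|lebesgue_on D. f x) $ k = (LINT x|lebesgue_on D. f x $ k)"
proof -
  have "integrable (lebesgue_on D) f" using f integrable_iff_component[OF D] by blast
  then show ?thesis by (rule integral_bounded_linear[OF bounded_linear_vec_nth, symmetric])
qed

lemma has_weak_grad_iff:
  assumes D: "D \<in> sets lebesgue"
  shows "has_weak_grad D \<phi> g \<longleftrightarrow> L2_on D \<phi> \<and> L2_on D g \<and>
    (\<forall>k. weak_div D (\<lambda>x. \<phi> x *\<^sub>R axis k 1) (\<lambda>x. g x $ k))"
proof -
  have "(LINT x|lebesgue_on D. \<psi> x *\<^sub>R g x) = - (LINT x|lebesgue_on D. \<phi> x *\<^sub>R grad \<psi> x) \<longleftrightarrow>
      (\<forall>k. (LINT x|lebesgue_on D. \<psi> x * g x $ k) = - (LINT x|lebesgue_on D. (\<phi> x *\<^sub>R axis k 1) \<bullet> grad \<psi> x))"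
    if L2: "L2_on D \<phi>" "L2_on D g" and \<psi>: "test_fun D \<psi>" for \<psi>
  proof -
    have "(LINT x|lebesgue_on D. \<psi> x *\<^sub>R g x) $ k = (LINT x|lebesgue_on D. \<psi> x * g x $ k)" for k
      using test_fun_L2_integrable(1)[OF D \<psi> L2_on_nth[OF L2(2)]] vec_integral_eqI[OF D, of "\<lambda>x. \<psi> x *\<^sub>R g x"] by simp
    moreover have "(LINT x|lebesgue_on D. \<phi> x *\<^sub>R grad \<psi> x) $ k = (LINT x|lebesgue_on D. (\<phi> x *\<^sub>R axis k 1) \<bullet> grad \<psi> x)" for k
      using test_fun_L2_integrable(2)[OF D \<psi> L2(1)] vec_integral_eqI[OF D, of "\<lambda>x. \<phi> x *\<^sub>R grad \<psi> x"]
      by (simp add: grad_def inner_axis' mult.commute)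
    ultimately show ?thesis by (simp add: vec_eq_iff)
  qed
  then show ?thesis unfolding has_weak_grad_def weak_div_def by blast
qed

lemma cross_grad: "cross3 s y $ k = - (cross3 s (axis k 1) \<bullet> y)"
proof -
  have "cross3 s y $ k = cross3 s y \<bullet> axis k 1" by (simp add: inner_axis)
  also have "\<dots> = cross3 (axis k 1) s \<bullet> y" by (metis cross_triple)
  also have "\<dots> = - (cross3 s (axis k 1) \<bullet> y)" by (metis cross_skew inner_minus_left)
  finally show ?thesis .
qed

lemma L2_on_cross:
  assumes "L2_on D s" shows "L2_on D (\<lambda>x. cross3 (s x) c)"
unfolding L2_on_vec_iff
proof
  fix k
  have lin: "cross3 v c = (\<Sum>j\<in>UNIV. v $ j *\<^sub>R cross3 (axis j 1) c)" for v
    by (simp add: cross3_def sum_3 axis_def vec_eq_iff forall_3 algebra_simps)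
  have eq: "cross3 (s x) c $ k = (\<Sum>j\<in>UNIV. cross3 (axis j 1) c $ k * s x $ j)" for x
    by (subst lin) (simp add: mult.commute)
  show "L2_on D (\<lambda>x. cross3 (s x) c $ k)"
    unfolding eq by (rule L2_on_sum) (simp, rule L2_on_nth[OF assms])
qed

text \<open>
  Component \<open>k\<close> of the curl of a field \<open>s\<close> is the divergence of \<open>s \<times> e\<^sub>k\<close>.
\<close>

lemma has_weak_curl_iff:
  assumes D: "D \<in> sets lebesgue"
  shows "has_weak_curl D S T \<longleftrightarrow> L2_on D S \<and> L2_on D T \<and>
    (\<forall>i k. weak_div D (\<lambda>x. cross3 (S x $ i) (axis k 1)) (\<lambda>x. T x $ i $ k))"
proof -
  have "(LINT x|lebesgue_on D. \<psi> x *\<^sub>R (T x $ i)) = (LINT x|lebesgue_on D. cross3 (S x $ i) (grad \<psi> x)) \<longleftrightarrow>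
      (\<forall>k. (LINT x|lebesgue_on D. \<psi> x * T x $ i $ k) = - (LINT x|lebesgue_on D. cross3 (S x $ i) (axis k 1) \<bullet> grad \<psi> x))"
    if L2: "L2_on D S" "L2_on D T" and \<psi>: "test_fun D \<psi>" for \<psi> i
  proof -
    have "L2_on D (\<lambda>x. S x $ i)" using L2(1) by (simp add: L2_on_vec_iff)
    then have "integrable (lebesgue_on D) (\<lambda>x. cross3 (S x $ i) (grad \<psi> x) $ k)" for k
      unfolding cross_grad using test_fun_L2_inner_integrable[OF D \<psi> L2_on_cross] by simp
    then have "(LINT x|lebesgue_on D. cross3 (S x $ i) (grad \<psi> x)) $ k = - (LINT x|lebesgue_on D. cross3 (S x $ i) (axis k 1) \<bullet> grad \<psi> x)" for k
      using vec_integral_eqI[OF D, of "\<lambda>x. cross3 (S x $ i) (grad \<psi> x)"] by (simp add: cross_grad)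
    moreover have "(LINT x|lebesgue_on D. \<psi> x *\<^sub>R (T x $ i)) $ k = (LINT x|lebesgue_on D. \<psi> x * T x $ i $ k)" for k
      using test_fun_L2_integrable(1)[OF D \<psi>] L2(2) vec_integral_eqI[OF D, of "\<lambda>x. \<psi> x *\<^sub>R (T x $ i)"]
      by (simp add: L2_on_mat_iff)
    ultimately show ?thesis by (simp add: vec_eq_iff)
  qed
  then show ?thesis unfolding has_weak_curl_def weak_div_def by blast
qed

lemma has_weak_div_iff:
  "has_weak_div D T v \<longleftrightarrow> L2_on D T \<and> L2_on D v \<and> (\<forall>i. weak_div D (\<lambda>x. T x $ i) (\<lambda>x. v x $ i))"
  unfolding has_weak_div_def weak_div_def by blast

section \<open>Affine changes of variables\<close>

lemma smoothI:
  assumes "\<psi> \<in> S" "\<And>\<phi> x. \<phi> \<in> S \<Longrightarrow> \<phi> differentiable (at x)" "\<And>\<phi> k. \<phi> \<in> S \<Longrightarrow> pd k \<phi> \<in> S"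
  shows "smooth \<psi>"
proof -
  have "foldr pd ks \<psi> \<in> S" for ks by (induction ks) (use assms in auto)
  then show ?thesis unfolding smooth_def using assms(2) by blast
qed

lemma smooth_pd: assumes "smooth \<phi>" shows "smooth (pd k \<phi>)"
proof -
  have "foldr pd (ks @ [k]) \<phi> differentiable (at x)" for ks x using assms unfolding smooth_def by blast
  then show ?thesis by (simp add: smooth_def)
qed

lemma F_map_has_derivative: "(F_map M c has_derivative (*v) M) (at x)"
proof -
  have "((\<lambda>x. M *v x + c) has_derivative (\<lambda>h. M *v h + 0)) (at x)"
    by (intro has_derivative_add has_derivative_const bounded_linear_imp_has_derivative matrix_vector_mul_bounded_linear)
  then show ?thesis by (simp add: F_map_def[abs_def])
qed

lemma pd_affine:
  assumes "\<phi> differentiable (at (F_map M c x))"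
  shows "(\<lambda>x. \<phi> (F_map M c x)) differentiable (at x)"
    "pd k (\<lambda>x. \<phi> (F_map M c x)) x = (\<Sum>j\<in>UNIV. M $ j $ k * pd j \<phi> (F_map M c x))"
proof -
  let ?D = "frechet_derivative \<phi> (at (F_map M c x))"
  have d: "(\<phi> has_derivative ?D) (at (F_map M c x))" using assms by (simp add: frechet_derivative_works)
  then have D: "((\<lambda>x. \<phi> (F_map M c x)) has_derivative (\<lambda>h. ?D (M *v h))) (at x)"
    by (rule has_derivative_compose[OF F_map_has_derivative])
  then show "(\<lambda>x. \<phi> (F_map M c x)) differentiable (at x)" by (auto simp: differentiable_def)
  have lin: "linear ?D" using d by (rule has_derivative_linear)
  have "pd k (\<lambda>x. \<phi> (F_map M c x)) x = ?D (M *v axis k 1)"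
    unfolding pd_def frechet_derivative_at[OF D, symmetric] ..
  also have "M *v axis k 1 = (\<Sum>j\<in>UNIV. M $ j $ k *\<^sub>R axis j 1)"
    by (simp add: vec_eq_iff matrix_vector_mult_def axis_def if_distrib cong: if_cong)
  also have "?D \<dots> = (\<Sum>j\<in>UNIV. M $ j $ k * pd j \<phi> (F_map M c x))"
    by (simp add: linear_sum[OF lin] linear_cmul[OF lin] pd_def)
  finally show "pd k (\<lambda>x. \<phi> (F_map M c x)) x = (\<Sum>j\<in>UNIV. M $ j $ k * pd j \<phi> (F_map M c x))" .
qed

text \<open>
  The chain rule leads from compositions with the affine map to linear combinations of them, and this
  class is closed under partial derivatives.
\<close>

inductive_set affine_comb :: "real^3^3 \<Rightarrow> real^3 \<Rightarrow> (real^3 \<Rightarrow> real) set" for M c where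
  compose: "smooth \<phi> \<Longrightarrow> (\<lambda>x. \<phi> (F_map M c x)) \<in> affine_comb M c"
| lincomb: "f \<in> affine_comb M c \<Longrightarrow> g \<in> affine_comb M c \<Longrightarrow> (\<lambda>x. r * f x + s * g x) \<in> affine_comb M c"

lemma smooth_affine:
  assumes "smooth \<phi>" shows "smooth (\<lambda>x. \<phi> (F_map M c x))"
proof (rule smoothI[of _ "affine_comb M c"])
  show "(\<lambda>x. \<phi> (F_map M c x)) \<in> affine_comb M c" by (rule compose[OF assms])
  show diff: "f differentiable (at x)" if "f \<in> affine_comb M c" for f x
    using that 
  proof induction
    case (compose \<phi>)
    show ?case by (rule pd_affine(1)[OF smooth_differentiable(1)[OF compose]])
  qed (auto intro!: derivative_intros)
  show "pd k f \<in> affine_comb M c" if "f \<in> affine_comb M c" for f k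
    using that
  proof induction
    case (compose \<phi>)
    have "pd k (\<lambda>x. \<phi> (F_map M c x)) = (\<lambda>x. M $ 1 $ k * pd 1 \<phi> (F_map M c x) +
        1 * (M $ 2 $ k * pd 2 \<phi> (F_map M c x) + M $ 3 $ k * pd 3 \<phi> (F_map M c x)))"
      using pd_affine(2)[OF smooth_differentiable(1)[OF compose]] by (auto simp: sum_3)
    also have "\<dots> \<in> affine_comb M c"
      using compose by (intro affine_comb.intros smooth_pd)
    finally show ?case .
  next
    case (lincomb f g r s)
    have "pd k (\<lambda>x. r * f x + s * g x) = (\<lambda>x. r * pd k f x + s * pd k g x)"
    proof
      fix x
      have "(f has_derivative frechet_derivative f (at x)) (at x)" "(g has_derivative frechet_derivative g (at x)) (at x)"
        using diff lincomb by (auto simp: frechet_derivative_works[symmetric])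
      then have d: "((\<lambda>x. r * f x + s * g x) has_derivative (\<lambda>h. r * frechet_derivative f (at x) h + s * frechet_derivative g (at x) h)) (at x)"
        by (intro has_derivative_add has_derivative_mult_right)
      show "pd k (\<lambda>x. r * f x + s * g x) x = r * pd k f x + s * pd k g x"
        unfolding pd_def frechet_derivative_at[OF d, symmetric] ..
    qed
    then show ?case using lincomb affine_comb.lincomb by simp
  qed
qed

locale affine_map =
  fixes A :: "real^3^3" and b :: "real^3"
  assumes inv_A: "invertible A"
begin

abbreviation "B \<equiv> matrix_inv A"
abbreviation "F \<equiv> F_map A b"
abbreviation "G \<equiv> F_map B (- (B *v b))"

lemma AB: "A ** B = mat 1" "B ** A = mat 1"
proof -
  have "\<exists>A'. A ** A' = mat 1 \<and> A' ** A = mat 1" using inv_A by (simp add: invertible_def)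
  then have "A ** B = mat 1 \<and> B ** A = mat 1" unfolding matrix_inv_def by (rule someI_ex)
  then show "A ** B = mat 1" "B ** A = mat 1" by auto
qed

lemma inv_B: "invertible B" "matrix_inv B = A"
proof -
  show B: "invertible B" using AB by (auto simp: invertible_def)
  then have "\<exists>A'. B ** A' = mat 1 \<and> A' ** B = mat 1" by (simp add: invertible_def)
  then have *: "B ** matrix_inv B = mat 1 \<and> matrix_inv B ** B = mat 1"
    unfolding matrix_inv_def[of B] by (rule someI_ex)
  have "matrix_inv B = (A ** B) ** matrix_inv B" by (simp add: AB)
  also have "\<dots> = A" using * by (simp add: matrix_mul_assoc[symmetric])
  finally show "matrix_inv B = A" .
qed

lemma det_A: "det A \<noteq> 0" and det_AB: "det A * det B = 1"
  using inv_A AB(1) det_mul[of A B] by (auto simp: invertible_det_nz)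

lemma G_F: "G (F x) = x"
  by (simp add: F_map_def matrix_vector_right_distrib matrix_vector_mul_assoc AB)

lemma F_G: "F (G y) = y"
  by (simp add: F_map_def matrix_vector_right_distrib matrix_vector_mul_assoc AB matrix_vector_mult_diff_distrib)

lemma inj_F: "inj_on F S"
  by (rule inj_on_inverseI[of _ G]) (rule G_F)

lemma image_lebesgue: "D \<in> sets lebesgue \<Longrightarrow> F ` D \<in> sets lebesgue"
  using F_map_has_derivative[of A b]
  by (intro differentiable_image_in_sets_lebesgue)
    (auto simp: differentiable_on_def differentiable_def intro: has_derivative_at_withinI)

lemma image_G_F: "G ` F ` D = D"
  by (simp add: image_image G_F)

lemma affine_integral:
  fixes h :: "real^3 \<Rightarrow> real"
  assumes D: "D \<in> sets lebesgue" and h: "integrable (lebesgue_on (F ` D)) h"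
  shows "integrable (lebesgue_on D) (\<lambda>x. h (F x))"
    "(LINT y|lebesgue_on (F ` D). h y) = \<bar>det A\<bar> * (LINT x|lebesgue_on D. h (F x))"
proof -
  define f where "f y = (vec (h y) :: real^1)" for y
  have FD: "F ` D \<in> sets lebesgue" by (rule image_lebesgue[OF D])
  have abs: "g absolutely_integrable_on S \<longleftrightarrow> integrable (lebesgue_on S) g"
    if "S \<in> sets lebesgue" for S and g :: "real^3 \<Rightarrow> real^1"
    unfolding set_integrable_def using that by (subst integrable_restrict_space) auto
  have f: "integrable (lebesgue_on (F ` D)) f"
    unfolding integrable_iff_component[OF FD] f_def using h by simp
  have *: "(\<lambda>x. \<bar>det A\<bar> *\<^sub>R f (F x)) absolutely_integrable_on D \<and> integral D (\<lambda>x. \<bar>det A\<bar> *\<^sub>R f (F x)) = integral (F ` D) f"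
    using has_absolute_integral_change_of_variables[OF D has_derivative_at_withinI[OF F_map_has_derivative] inj_F, of f "integral (F ` D) f"]
      f abs[OF FD] by (simp add: matrix_of_matrix_vector_mul)
  then have i: "integrable (lebesgue_on D) (\<lambda>x. \<bar>det A\<bar> *\<^sub>R f (F x))" using abs[OF D] by simp
  then have "integrable (lebesgue_on D) (\<lambda>x. (\<bar>det A\<bar> *\<^sub>R f (F x)) $ 1)"
    by (rule integrable_bounded_linear[OF bounded_linear_vec_nth])
  then show hF: "integrable (lebesgue_on D) (\<lambda>x. h (F x))" using det_A by (simp add: f_def)
  have "(LINT y|lebesgue_on (F ` D). h y) = (LINT y|lebesgue_on (F ` D). f y $ 1)" by (simp add: f_def)
  also have "\<dots> = (LINT y|lebesgue_on (F ` D). f y) $ 1"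
    by (rule integral_bounded_linear[OF bounded_linear_vec_nth f])
  also have "\<dots> = integral (F ` D) f $ 1"
    using has_integral_integral_lebesgue_on[OF f FD] by (simp add: integral_unique)
  also have "\<dots> = integral D (\<lambda>x. \<bar>det A\<bar> *\<^sub>R f (F x)) $ 1" using * by simp
  also have "\<dots> = (LINT x|lebesgue_on D. \<bar>det A\<bar> *\<^sub>R f (F x)) $ 1"
    by (simp only: integral_unique[OF has_integral_integral_lebesgue_on[OF i D]])
  also have "\<dots> = (LINT x|lebesgue_on D. (\<bar>det A\<bar> *\<^sub>R f (F x)) $ 1)"
    by (rule integral_bounded_linear[OF bounded_linear_vec_nth i, symmetric])
  finally show "(LINT y|lebesgue_on (F ` D). h y) = \<bar>det A\<bar> * (LINT x|lebesgue_on D. h (F x))" by (simp add: f_def)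
qed

lemma L2_affine:
  fixes f :: "real^3 \<Rightarrow> real"
  assumes D: "D \<in> sets lebesgue" and f: "L2_on (F ` D) f"
  shows "L2_on D (\<lambda>x. f (F x))"
proof -
  have m: "f \<in> borel_measurable (lebesgue_on (F ` D))" and i: "integrable (lebesgue_on (F ` D)) (\<lambda>x. (norm (f x))\<^sup>2)"
    using f by (auto simp: L2_on_def)
  have FD: "F ` D \<in> sets lebesgue" by (rule image_lebesgue[OF D])
  have "(\<lambda>x. f (F x)) \<in> borel_measurable (lebesgue_on D)"
  proof (rule measurableI)
    fix Y :: "real set" assume Y: "Y \<in> sets borel"
    have "f -` Y \<inter> (F ` D) \<in> sets (lebesgue_on (F ` D))" using measurable_sets[OF m Y] by (simp add: space_restrict_space)
    then have "f -` Y \<inter> (F ` D) \<in> sets lebesgue" using FD by (auto simp: sets_restrict_space_iff)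
    then have "G ` (f -` Y \<inter> (F ` D)) \<in> sets lebesgue"
      using F_map_has_derivative[of B "- (B *v b)"]
      by (intro differentiable_image_in_sets_lebesgue)
        (auto simp: differentiable_on_def differentiable_def intro: has_derivative_at_withinI)
    moreover have "G ` (f -` Y \<inter> (F ` D)) = (\<lambda>x. f (F x)) -` Y \<inter> D"
    proof (intro equalityI subsetI)
      fix x assume "x \<in> (\<lambda>x. f (F x)) -` Y \<inter> D"
      then have "G (F x) \<in> G ` (f -` Y \<inter> (F ` D))" by blast
      then show "x \<in> G ` (f -` Y \<inter> (F ` D))" by (simp only: G_F)
    next
      fix x assume "x \<in> G ` (f -` Y \<inter> (F ` D))"
      then obtain z where "z \<in> D" "f (F z) \<in> Y" "x = G (F z)" by blast
      then show "x \<in> (\<lambda>x. f (F x)) -` Y \<inter> D" by (simp only: G_F) simp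
    qed
    ultimately show "(\<lambda>x. f (F x)) -` Y \<inter> space (lebesgue_on D) \<in> sets (lebesgue_on D)"
      using D by (simp add: sets_restrict_space_iff space_restrict_space)
  qed simp
  then show ?thesis using affine_integral(1)[OF D i] by (simp add: L2_on_def)
qed

lemma L2_affine_vec: "D \<in> sets lebesgue \<Longrightarrow> L2_on (F ` D) f \<Longrightarrow> L2_on D (\<lambda>x. f (F x))" for f :: "real^3 \<Rightarrow> real^'n"
  using L2_affine[of D "\<lambda>x. f x $ k" for k] by (auto simp: L2_on_vec_iff)

lemma L2_affine_mat: "D \<in> sets lebesgue \<Longrightarrow> L2_on (F ` D) f \<Longrightarrow> L2_on D (\<lambda>x. f (F x))" for f :: "real^3 \<Rightarrow> real^'n^'m"
  using L2_affine[of D "\<lambda>x. f x $ i $ k" for i k] by (auto simp: L2_on_mat_iff)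

lemma test_fun_affine:
  assumes \<psi>: "test_fun D \<psi>" shows "test_fun (F ` D) (\<lambda>y. \<psi> (G y))"
proof -
  let ?K = "closure {x. \<psi> x \<noteq> 0}"
  have "continuous_on UNIV F"
    using F_map_has_derivative has_derivative_continuous by (metis continuous_at_imp_continuous_on)
  then have K: "compact (F ` ?K)"
    using \<psi> by (intro compact_continuous_image) (auto simp: test_fun_def intro: continuous_on_subset)
  have "{y. \<psi> (G y) \<noteq> 0} \<subseteq> F ` ?K"
  proof
    fix y assume "y \<in> {y. \<psi> (G y) \<noteq> 0}"
    then have "G y \<in> ?K" using closure_subset[of "{x. \<psi> x \<noteq> 0}"] by auto
    then have "F (G y) \<in> F ` ?K" by blast
    then show "y \<in> F ` ?K" by (simp add: F_G)
  qed
  then have cl: "closure {y. \<psi> (G y) \<noteq> 0} \<subseteq> F ` ?K"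
    using compact_imp_closed[OF K] by (rule closure_minimal)
  then have "compact (closure {y. \<psi> (G y) \<noteq> 0})"
    using K by (metis closed_closure compact_Int_closed inf.absorb_iff2)
  moreover have "?K \<subseteq> D" using \<psi> by (simp add: test_fun_def)
  ultimately show ?thesis
    using cl \<psi> smooth_affine[of \<psi> B "- (B *v b)"] unfolding test_fun_def by blast
qed

text \<open>
  The contravariant Piola transformation, without its constant factor \<open>det A\<close>.
\<close>

lemma weak_div_affine:
  assumes D: "D \<in> sets lebesgue" and u: "L2_on (F ` D) u" and w: "L2_on (F ` D) w"
    and div: "weak_div (F ` D) u w"
  shows "weak_div D (\<lambda>x. B *v u (F x)) (\<lambda>x. w (F x))"
  unfolding weak_div_def
proof (intro allI impI)
  fix \<psi> assume \<psi>: "test_fun D \<psi>"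
  let ?\<psi> = "\<lambda>y. \<psi> (G y)"
  have t: "test_fun (F ` D) ?\<psi>" by (rule test_fun_affine[OF \<psi>])
  have FD: "F ` D \<in> sets lebesgue" by (rule image_lebesgue[OF D])
  have sm: "smooth \<psi>" using \<psi> by (simp add: test_fun_def)
  have pdG: "pd k ?\<psi> y = (\<Sum>j\<in>UNIV. B $ j $ k * pd j \<psi> (G y))" for k y
    by (rule pd_affine(2)[OF smooth_differentiable(1)[OF sm]])
  have "grad ?\<psi> (F x) $ k = (transpose B *v grad \<psi> x) $ k" for x k
    unfolding grad_def vec_lambda_beta pdG G_F by (simp add: matrix_vector_mult_def transpose_def)
  then have "grad ?\<psi> (F x) = transpose B *v grad \<psi> x" for x by (simp add: vec_eq_iff)
  then have inner: "u (F x) \<bullet> grad ?\<psi> (F x) = (B *v u (F x)) \<bullet> grad \<psi> x" for x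
    by (metis dot_lmul_matrix inner_commute transpose_matrix_vector transpose_transpose)
  have "\<bar>det A\<bar> * (LINT x|lebesgue_on D. \<psi> x * w (F x)) = (LINT y|lebesgue_on (F ` D). ?\<psi> y * w y)"
    using affine_integral(2)[OF D test_fun_L2_integrable(1)[OF FD t w]] by (simp add: G_F)
  also have "\<dots> = - (LINT y|lebesgue_on (F ` D). u y \<bullet> grad ?\<psi> y)"
    using div t by (simp add: weak_div_def)
  also have "\<dots> = - (\<bar>det A\<bar> * (LINT x|lebesgue_on D. (B *v u (F x)) \<bullet> grad \<psi> x))"
    using affine_integral(2)[OF D test_fun_L2_inner_integrable[OF FD t u]] by (simp add: inner)
  finally have "\<bar>det A\<bar> * ((LINT x|lebesgue_on D. \<psi> x * w (F x)) + (LINT x|lebesgue_on D. (B *v u (F x)) \<bullet> grad \<psi> x)) = 0"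
    by (simp add: distrib_left)
  then show "(LINT x|lebesgue_on D. \<psi> x * w (F x)) = - (LINT x|lebesgue_on D. (B *v u (F x)) \<bullet> grad \<psi> x)"
    using det_A by (simp add: eq_neg_iff_add_eq_0)
qed

end

section \<open>Invariance of the operators under the pullbacks\<close>

lemma L2_on_cmult: "L2_on D f \<Longrightarrow> L2_on D (\<lambda>x. r * f x)" for f :: "real^3 \<Rightarrow> real"
  using L2_on_add[of D f f r 0] by simp

lemma L2_on_axis:
  assumes "L2_on D \<phi>" shows "L2_on D (\<lambda>x. \<phi> x *\<^sub>R axis k (1::real) :: real^3)"
  unfolding L2_on_vec_iff
proof
  fix i
  show "L2_on D (\<lambda>x. (\<phi> x *\<^sub>R axis k (1::real) :: real^3) $ i)"
    using L2_on_cmult[OF assms, of "(axis k 1 :: real^3) $ i"] by (simp add: mult.commute)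
qed

lemma L2_on_matrix_vector:
  fixes u :: "real^3 \<Rightarrow> real^3"
  assumes "L2_on D u" shows "L2_on D (\<lambda>x. M *v u x)"
  unfolding L2_on_vec_iff matrix_vector_mult_def vec_lambda_beta
  by (intro allI L2_on_sum L2_on_nth[OF assms]) simp

lemma L2_on_lincomb:
  fixes u :: "3 \<Rightarrow> real^3 \<Rightarrow> real^3"
  assumes "\<And>j. L2_on D (u j)" shows "L2_on D (\<lambda>x. \<Sum>j\<in>I. r j *\<^sub>R u j x)"
  unfolding L2_on_vec_iff sum_component vector_scaleR_component real_scaleR_def
  by (intro allI L2_on_sum L2_on_nth[OF assms]) simp

lemma has_weak_grad_sum:
  assumes D: "D \<in> sets lebesgue" and g: "\<And>j :: 3. has_weak_grad D (\<phi> j) (g j)"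
  shows "has_weak_grad D (\<lambda>x. \<Sum>j\<in>UNIV. r j * \<phi> j x) (\<lambda>x. \<Sum>j\<in>UNIV. r j *\<^sub>R g j x)"
proof -
  have L2: "L2_on D (\<phi> j)" "L2_on D (g j)" and wd: "weak_div D (\<lambda>x. \<phi> j x *\<^sub>R axis k 1) (\<lambda>x. g j x $ k)" for j k
    using g[of j] unfolding has_weak_grad_iff[OF D] by auto
  have u: "L2_on D (\<lambda>x. \<phi> j x *\<^sub>R axis k (1::real) :: real^3)" for j k
    by (rule L2_on_axis[OF L2(1)])
  show ?thesis unfolding has_weak_grad_iff[OF D]
  proof (intro conjI allI)
    show "L2_on D (\<lambda>x. \<Sum>j\<in>UNIV. r j * \<phi> j x)" by (intro L2_on_sum L2) simp
    show "L2_on D (\<lambda>x. \<Sum>j\<in>UNIV. r j *\<^sub>R g j x)" by (intro L2_on_lincomb L2)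
    fix k
    have "weak_div D (\<lambda>x. \<Sum>j\<in>UNIV. r j *\<^sub>R (\<phi> j x *\<^sub>R axis k 1)) (\<lambda>x. \<Sum>j\<in>UNIV. r j * g j x $ k)"
      by (rule weak_div_sum[OF D]) (simp, rule u, rule L2_on_nth[OF L2(2)], rule wd)
    then show "weak_div D (\<lambda>x. (\<Sum>j\<in>UNIV. r j * \<phi> j x) *\<^sub>R axis k 1) (\<lambda>x. (\<Sum>j\<in>UNIV. r j *\<^sub>R g j x) $ k)"
      by (simp add: scaleR_sum_left)
  qed
qed

text \<open>
  A pullback acts on a matrix function in two ways: \<open>C\<close> transforms each row as a field, and \<open>A\<close> forms
  linear combinations of the rows, with which the row-wise operators commute.
\<close>

lemma row_conjugate:
  fixes A M C :: "real^3^3"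
  shows "(transpose A ** M ** C) $ i = (\<Sum>j\<in>UNIV. A $ j $ i *\<^sub>R (transpose C *v M $ j))"
  by (simp add: vec_eq_iff matrix_matrix_mult_def transpose_def matrix_vector_mult_def sum_3 algebra_simps)

context affine_map begin

lemma grad_affine:
  assumes D: "D \<in> sets lebesgue" and g: "has_weak_grad (F ` D) \<phi> g"
  shows "has_weak_grad D (\<lambda>x. \<phi> (F x)) (\<lambda>x. transpose A *v g (F x))"
proof -
  have FD: "F ` D \<in> sets lebesgue" by (rule image_lebesgue[OF D])
  have L2: "L2_on (F ` D) \<phi>" "L2_on (F ` D) g" and wd: "weak_div (F ` D) (\<lambda>x. \<phi> x *\<^sub>R axis k 1) (\<lambda>x. g x $ k)" for k
    using g unfolding has_weak_grad_iff[OF FD] by auto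
  have u: "L2_on (F ` D) (\<lambda>x. \<phi> x *\<^sub>R axis k (1::real) :: real^3)" for k
    by (rule L2_on_axis[OF L2(1)])
  show ?thesis unfolding has_weak_grad_iff[OF D]
  proof (intro conjI allI)
    show "L2_on D (\<lambda>x. \<phi> (F x))" by (rule L2_affine[OF D L2(1)])
    show "L2_on D (\<lambda>x. transpose A *v g (F x))" by (rule L2_on_matrix_vector[OF L2_affine_vec[OF D L2(2)]])
    fix k
    let ?u = "\<lambda>y. \<Sum>j\<in>UNIV. A $ j $ k *\<^sub>R (\<phi> y *\<^sub>R axis j (1::real))" and ?w = "\<lambda>y. \<Sum>j\<in>UNIV. A $ j $ k * g y $ j"
    have "weak_div (F ` D) ?u ?w"
      by (rule weak_div_sum[OF FD]) (simp, rule u, rule L2_on_nth[OF L2(2)], rule wd)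
    moreover have "L2_on (F ` D) ?u" by (intro L2_on_lincomb u)
    moreover have "L2_on (F ` D) ?w" by (intro L2_on_sum L2_on_nth[OF L2(2)]) simp
    ultimately have "weak_div D (\<lambda>x. B *v ?u (F x)) (\<lambda>x. ?w (F x))" by (intro weak_div_affine[OF D])
    moreover have "B *v ?u y = \<phi> y *\<^sub>R axis k 1" for y
    proof -
      have "?u y = A *v (\<phi> y *\<^sub>R axis k 1)"
        by (simp add: vec_eq_iff matrix_vector_mult_def axis_def if_distrib cong: if_cong)
      then show ?thesis by (simp add: matrix_vector_mul_assoc AB)
    qed
    moreover have "?w y = (transpose A *v g y) $ k" for y
      by (simp add: matrix_vector_mult_def transpose_def)
    ultimately show "weak_div D (\<lambda>x. \<phi> (F x) *\<^sub>R axis k 1) (\<lambda>x. (transpose A *v g (F x)) $ k)" by simp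
  qed
qed

lemma hessian_affine:
  assumes D: "D \<in> sets lebesgue" and H: "has_weak_hessian (F ` D) \<phi> H"
  shows "has_weak_hessian D (Y1 A b \<phi>) (Y2 A b H)"
proof -
  obtain g where g: "has_weak_grad (F ` D) \<phi> g" "\<And>j. has_weak_grad (F ` D) (\<lambda>x. g x $ j) (\<lambda>x. H x $ j)"
    using H unfolding has_weak_hessian_def by blast
  have "has_weak_grad D (\<lambda>x. \<Sum>j\<in>UNIV. A $ j $ i * g (F x) $ j) (\<lambda>x. \<Sum>j\<in>UNIV. A $ j $ i *\<^sub>R (transpose A *v H (F x) $ j))" for i
    by (intro has_weak_grad_sum[OF D] grad_affine[OF D g(2)])
  moreover have "(\<Sum>j\<in>UNIV. A $ j $ i * v $ j) = (transpose A *v v) $ i" for v i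
    by (simp add: matrix_vector_mult_def transpose_def)
  ultimately have "has_weak_grad D (\<lambda>x. (transpose A *v g (F x)) $ i) (\<lambda>x. Y2 A b H x $ i)" for i
    by (simp add: Y2_def row_conjugate)
  moreover have "has_weak_grad D (Y1 A b \<phi>) (\<lambda>x. transpose A *v g (F x))"
    using grad_affine[OF D g(1)] by (simp add: Y1_def comp_def)
  ultimately show ?thesis unfolding has_weak_hessian_def by blast
qed

lemma L2_Y:
  assumes D: "D \<in> sets lebesgue" and S: "L2_on (F ` D) S"
  shows "L2_on D (Y2 A b S)" "L2_on D (Y3 A b S)"
proof -
  have S': "L2_on D (\<lambda>x. S (F x) $ j)" for j
    using L2_affine_mat[OF D S] by (simp add: L2_on_vec_iff)
  have comb: "L2_on D (\<lambda>x. \<Sum>j\<in>UNIV. r j *\<^sub>R (M *v S (F x) $ j))" for r :: "3 \<Rightarrow> real" and M :: "real^3^3"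
    by (rule L2_on_lincomb[OF L2_on_matrix_vector[OF S']])
  have row: "L2_on D (\<lambda>x. (transpose A ** S (F x) ** M) $ i)" for M :: "real^3^3" and i
    unfolding row_conjugate by (rule comb)
  have *: "L2_on D (\<lambda>x. transpose A ** S (F x) ** M)" for M :: "real^3^3"
    by (rule L2_on_vec_iff[THEN iffD2], rule allI, rule row)
  show "L2_on D (Y2 A b S)" unfolding Y2_def by (rule *)
  show "L2_on D (Y3 A b S)"
    using *[of "transpose B"] L2_on_cmult unfolding Y3_def L2_on_mat_iff by simp
qed

lemma tAB: "transpose A ** transpose B = mat 1" "transpose B ** transpose A = mat 1"
  by (simp_all add: matrix_transpose_mul[symmetric] AB transpose_mat)

text \<open>
  The rule \<open>A (A\<^sup>T s \<times> A\<^sup>T t) = det A (s \<times> t)\<close> for \<open>t = A\<^sup>-\<^sup>T e\<^sub>k\<close>. The right side is \<open>det A\<close> times the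
  transformed field of \<open>weak_div_affine\<close>, which is why the covariant transformation of the rows is the one for
  the curl.
\<close>

lemma cross_affine: "cross3 (transpose A *v s) (axis k 1) = det A *\<^sub>R (B *v cross3 s (transpose B *v axis k 1))"
proof -
  have "transpose A *v (transpose B *v axis k 1) = axis k (1::real)"
    by (simp only: matrix_vector_mul_assoc tAB matrix_vector_mul_lid)
  then have "A *v cross3 (transpose A *v s) (axis k 1) = det A *\<^sub>R cross3 s (transpose B *v axis k 1)"
    using cross_matrix_mult[of "transpose A" s "transpose B *v axis k 1"] by (simp add: det_transpose transpose_transpose)
  then have "B *v (A *v cross3 (transpose A *v s) (axis k 1)) = B *v (det A *\<^sub>R cross3 s (transpose B *v axis k 1))" by simp
  then show ?thesis by (simp add: matrix_vector_mul_assoc AB matrix_vector_mult_scaleR)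
qed

lemma curl_affine:
  assumes D: "D \<in> sets lebesgue" and ST: "has_weak_curl (F ` D) S T"
  shows "has_weak_curl D (Y2 A b S) (Y3 A b T)"
proof -
  have FD: "F ` D \<in> sets lebesgue" by (rule image_lebesgue[OF D])
  have L2: "L2_on (F ` D) S" "L2_on (F ` D) T"
    and wd: "weak_div (F ` D) (\<lambda>x. cross3 (S x $ i) (axis k 1)) (\<lambda>x. T x $ i $ k)" for i k
    using ST unfolding has_weak_curl_iff[OF FD] by auto
  have rows: "L2_on (F ` D) (\<lambda>x. S x $ j)" "L2_on (F ` D) (\<lambda>x. T x $ j)" for j
    using L2 by (auto simp: L2_on_vec_iff)
  have row: "weak_div D (\<lambda>x. B *v cross3 (S (F x) $ j) (transpose B *v axis k 1)) (\<lambda>x. (B *v T (F x) $ j) $ k)" for j k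
  proof -
    let ?u = "\<lambda>y. \<Sum>l\<in>UNIV. B $ k $ l *\<^sub>R cross3 (S y $ j) (axis l 1)" and ?w = "\<lambda>y. \<Sum>l\<in>UNIV. B $ k $ l * T y $ j $ l"
    have "weak_div (F ` D) ?u ?w"
      by (rule weak_div_sum[OF FD]) (simp, rule L2_on_cross[OF rows(1)], rule L2_on_nth[OF rows(2)], rule wd)
    moreover have "L2_on (F ` D) ?u" by (intro L2_on_lincomb L2_on_cross rows)
    moreover have "L2_on (F ` D) ?w" by (intro L2_on_sum L2_on_nth[OF rows(2)]) simp
    ultimately have "weak_div D (\<lambda>x. B *v ?u (F x)) (\<lambda>x. ?w (F x))" by (intro weak_div_affine[OF D])
    moreover have "?u y = cross3 (S y $ j) (transpose B *v axis k 1)" for y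
      using exhaust_3[of k]
      by (auto simp: vec_eq_iff forall_3 sum_3 cross3_def matrix_vector_mult_def transpose_def axis_def algebra_simps)
    moreover have "?w y = (B *v T y $ j) $ k" for y
      by (simp add: matrix_vector_mult_def)
    ultimately show ?thesis by simp
  qed
  show ?thesis unfolding has_weak_curl_iff[OF D]
  proof (intro conjI allI L2_Y[OF D] L2)
    fix i k
    let ?u = "\<lambda>j x. B *v cross3 (S (F x) $ j) (transpose B *v axis k 1)" and ?w = "\<lambda>j x. (B *v T (F x) $ j) $ k"
    have rD: "L2_on D (\<lambda>x. S (F x) $ j)" "L2_on D (\<lambda>x. T (F x) $ j)" for j
      using L2_affine_mat[OF D L2(1)] L2_affine_mat[OF D L2(2)] by (auto simp: L2_on_vec_iff)
    have "weak_div D (\<lambda>x. \<Sum>j\<in>UNIV. (det A * A $ j $ i) *\<^sub>R ?u j x) (\<lambda>x. \<Sum>j\<in>UNIV. (det A * A $ j $ i) * ?w j x)"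
      by (rule weak_div_sum[OF D]) (simp, rule L2_on_matrix_vector[OF L2_on_cross[OF rD(1)]],
        rule L2_on_nth[OF L2_on_matrix_vector[OF rD(2)]], rule row)
    moreover have "(\<Sum>j\<in>UNIV. (det A * A $ j $ i) *\<^sub>R ?u j x) = cross3 (Y2 A b S x $ i) (axis k 1)" for x
    proof -
      have "cross3 (Y2 A b S x $ i) (axis k 1) = (\<Sum>j\<in>UNIV. A $ j $ i *\<^sub>R cross3 (transpose A *v S (F x) $ j) (axis k 1))"
        by (simp add: Y2_def row_conjugate sum_3 cross_add_left cross_mult_left)
      then show ?thesis by (simp only: cross_affine scaleR_scaleR mult.commute)
    qed
    moreover have "(\<Sum>j\<in>UNIV. (det A * A $ j $ i) * ?w j x) = Y3 A b T x $ i $ k" for x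
      by (simp add: Y3_def row_conjugate transpose_transpose sum_distrib_left mult.assoc)
    ultimately show "weak_div D (\<lambda>x. cross3 (Y2 A b S x $ i) (axis k 1)) (\<lambda>x. Y3 A b T x $ i $ k)" by simp
  qed
qed

lemma div_affine:
  assumes D: "D \<in> sets lebesgue" and Tv: "has_weak_div (F ` D) T v"
  shows "has_weak_div D (Y3 A b T) (Y4 A b v)"
proof -
  have L2: "L2_on (F ` D) T" "L2_on (F ` D) v" and wd: "weak_div (F ` D) (\<lambda>x. T x $ i) (\<lambda>x. v x $ i)" for i
    using Tv unfolding has_weak_div_iff by auto
  have rows: "L2_on (F ` D) (\<lambda>x. T x $ j)" for j using L2(1) by (simp add: L2_on_vec_iff)
  have row: "weak_div D (\<lambda>x. B *v T (F x) $ j) (\<lambda>x. v (F x) $ j)" for j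
    by (rule weak_div_affine[OF D rows L2_on_nth[OF L2(2)] wd])
  have rD: "L2_on D (\<lambda>x. T (F x) $ j)" for j
    using L2_affine_mat[OF D L2(1)] by (auto simp: L2_on_vec_iff)
  have vD: "L2_on D (\<lambda>x. v (F x))" by (rule L2_affine_vec[OF D L2(2)])
  show ?thesis unfolding has_weak_div_iff
  proof (intro conjI allI L2_Y[OF D] L2)
    show "L2_on D (Y4 A b v)"
      unfolding Y4_def L2_on_vec_iff vector_scaleR_component real_scaleR_def
      by (intro allI) (rule L2_on_cmult[OF L2_on_nth[OF L2_on_matrix_vector[OF vD]]])
    fix i
    have "weak_div D (\<lambda>x. \<Sum>j\<in>UNIV. (det A * A $ j $ i) *\<^sub>R (B *v T (F x) $ j)) (\<lambda>x. \<Sum>j\<in>UNIV. (det A * A $ j $ i) * v (F x) $ j)"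
      by (rule weak_div_sum[OF D]) (simp, rule L2_on_matrix_vector[OF rD], rule L2_on_nth[OF vD], rule row)
    moreover have "(\<Sum>j\<in>UNIV. (det A * A $ j $ i) *\<^sub>R (B *v T (F x) $ j)) = Y3 A b T x $ i" for x
      by (simp add: Y3_def row_conjugate transpose_transpose scaleR_sum_right)
    moreover have "(\<Sum>j\<in>UNIV. (det A * A $ j $ i) * v (F x) $ j) = Y4 A b v x $ i" for x
      by (simp add: Y4_def matrix_vector_mult_def transpose_def sum_distrib_left mult.assoc)
    ultimately show "weak_div D (\<lambda>x. Y3 A b T x $ i) (\<lambda>x. Y4 A b v x $ i)" by simp
  qed
qed

abbreviation "b' \<equiv> - (B *v b)"

lemma conj_cancel:
  assumes "P ** Q = mat 1" "R ** T = mat 1" shows "P ** (Q ** M ** R) ** T = (M :: real^3^3)"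
proof -
  have "P ** (Q ** M ** R) ** T = (P ** Q) ** M ** (R ** T)" by (simp add: matrix_mul_assoc)
  then show ?thesis by (simp add: assms)
qed

lemma Y1_inverse: "Y1 A b (Y1 B b' \<phi>) = \<phi>" "Y1 B b' (Y1 A b \<phi>) = \<phi>"
  by (auto simp: Y1_def G_F F_G)

lemma Y2_inverse: "Y2 A b (Y2 B b' S) = S" "Y2 B b' (Y2 A b S) = S"
  unfolding Y2_def by (simp_all only: G_F F_G conj_cancel[OF tAB(1) AB(2)] conj_cancel[OF tAB(2) AB(1)])

lemma scaleR_conj: "P ** (c *\<^sub>R M) ** Q = c *\<^sub>R (P ** M ** Q)" for M :: "real^3^3"
  by (simp add: matrix_scalar_ac scalar_matrix_assoc)

lemma Y3_inverse: "Y3 A b (Y3 B b' T) = T" "Y3 B b' (Y3 A b T) = T"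
  unfolding Y3_def inv_B
  by (simp_all only: G_F F_G scaleR_conj conj_cancel[OF tAB(1) tAB(1)] conj_cancel[OF tAB(2) tAB(2)] scaleR_scaleR)
    (simp_all add: det_AB mult.commute[of "det B"])

lemma Y4_inverse: "Y4 A b (Y4 B b' v) = v" "Y4 B b' (Y4 A b v) = v"
  unfolding Y4_def
  by (simp_all only: G_F F_G matrix_vector_mult_scaleR matrix_vector_mul_assoc tAB scaleR_scaleR)
    (simp_all add: det_AB mult.commute[of "det B"])

lemma inverse_affine: "affine_map B"
  by (rule affine_map.intro[OF inv_B(1)])

text \<open>
  The converse directions are the same statements for the inverse affine map, whose pullbacks are
  inverse to the given ones.
\<close>

lemma hessian_iff:
  assumes D: "D \<in> sets lebesgue"
  shows "has_weak_hessian (F ` D) \<phi> H \<longleftrightarrow> has_weak_hessian D (Y1 A b \<phi>) (Y2 A b H)"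
proof
  assume "has_weak_hessian D (Y1 A b \<phi>) (Y2 A b H)"
  then have "has_weak_hessian (G ` F ` D) (Y1 A b \<phi>) (Y2 A b H)" by (simp only: image_G_F)
  from affine_map.hessian_affine[OF inverse_affine image_lebesgue[OF D] this]
  show "has_weak_hessian (F ` D) \<phi> H" by (simp only: Y1_inverse Y2_inverse)
qed (rule hessian_affine[OF D])

lemma curl_iff:
  assumes D: "D \<in> sets lebesgue"
  shows "has_weak_curl (F ` D) S T \<longleftrightarrow> has_weak_curl D (Y2 A b S) (Y3 A b T)"
proof
  assume "has_weak_curl D (Y2 A b S) (Y3 A b T)"
  then have "has_weak_curl (G ` F ` D) (Y2 A b S) (Y3 A b T)" by (simp only: image_G_F)
  from affine_map.curl_affine[OF inverse_affine image_lebesgue[OF D] this]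
  show "has_weak_curl (F ` D) S T" by (simp only: Y2_inverse Y3_inverse)
qed (rule curl_affine[OF D])

lemma div_iff:
  assumes D: "D \<in> sets lebesgue"
  shows "has_weak_div (F ` D) T v \<longleftrightarrow> has_weak_div D (Y3 A b T) (Y4 A b v)"
proof
  assume "has_weak_div D (Y3 A b T) (Y4 A b v)"
  then have "has_weak_div (G ` F ` D) (Y3 A b T) (Y4 A b v)" by (simp only: image_G_F)
  from affine_map.div_affine[OF inverse_affine image_lebesgue[OF D] this]
  show "has_weak_div (F ` D) T v" by (simp only: Y3_inverse Y4_inverse)
qed (rule div_affine[OF D])

lemma inv_Y: "inv (Y1 A b) = Y1 B b'" "inv (Y2 A b) = Y2 B b'" "inv (Y3 A b) = Y3 B b'" "inv (Y4 A b) = Y4 B b'"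
  by (rule inv_equality; rule Y1_inverse Y2_inverse Y3_inverse Y4_inverse)+

lemma Y_Pi:
  "Y1 A b (Pi1 A b p \<Xi> \<phi>) = Pihat1 p \<Xi> (Y1 A b \<phi>)" "Y2 A b (Pi2 A b p \<Xi> S) = Pihat2 p \<Xi> (Y2 A b S)"
  "Y3 A b (Pi3 A b p \<Xi> T) = Pihat3 p \<Xi> (Y3 A b T)" "Y4 A b (Pi4 A b p \<Xi> v) = Pihat4 p \<Xi> (Y4 A b v)"
  by (simp_all add: Pi1_def Pi2_def Pi3_def Pi4_def inv_Y Y1_inverse Y2_inverse Y3_inverse Y4_inverse)

end

section \<open>The three differential operators on the unit cube\<close>

lemma weak_div_cong:
  assumes D: "D \<in> sets lebesgue" and u: "L2_on D u" "L2_on D u'" and w: "L2_on D w" "L2_on D w'"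
    and eq: "AE x in lebesgue_on D. u x = u' x" "AE x in lebesgue_on D. w x = w' x" and div: "weak_div D u w"
  shows "weak_div D u' w'"
  unfolding weak_div_def
proof (intro allI impI)
  fix \<psi> assume \<psi>: "test_fun D \<psi>"
  have "(LINT x|lebesgue_on D. \<psi> x * w x) = (LINT x|lebesgue_on D. \<psi> x * w' x)"
    by (intro integral_cong_AE borel_measurable_integrable test_fun_L2_integrable(1)[OF D \<psi>] w)
      (use eq(2) in \<open>auto elim!: eventually_mono\<close>)
  moreover have "(LINT x|lebesgue_on D. u x \<bullet> grad \<psi> x) = (LINT x|lebesgue_on D. u' x \<bullet> grad \<psi> x)"
    by (intro integral_cong_AE borel_measurable_integrable test_fun_L2_inner_integrable[OF D \<psi>] u)
      (use eq(1) in \<open>auto elim!: eventually_mono\<close>)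
  ultimately show "(LINT x|lebesgue_on D. \<psi> x * w' x) = - (LINT x|lebesgue_on D. u' x \<bullet> grad \<psi> x)"
    using div \<psi> by (simp add: weak_div_def)
qed

lemma arr1_eq: "arr1 = 0"
  by (simp add: arr1_def vec_eq_iff forall_3)

lemma arr2_nth: "arr2 $ i $ j = axis i 1 + axis j 1"
  using exhaust_3[of i] exhaust_3[of j] by (auto simp: arr2_def vec_eq_iff forall_3 axis_def)

lemma arr2_sym: "arr2 $ i $ j = arr2 $ j $ i"
  by (simp add: arr2_nth add.commute)

lemma arr3_nth: "arr3 $ i $ k = axis i 1 + (\<chi> d. if d = k then 0 else 1)"
  using exhaust_3[of i] exhaust_3[of k] by (auto simp: arr3_def vec_eq_iff forall_3 axis_def)

lemma arr4_nth: "arr4 $ i = axis i 1 + 1"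
  using exhaust_3[of i] by (auto simp: arr4_def vec_eq_iff forall_3 axis_def)

lemma arr_le: "arr2 $ i $ j $ d \<le> 2" "arr3 $ i $ j $ d \<le> 2" "arr4 $ i $ d \<le> 2"
  by (auto simp: arr2_nth arr3_nth arr4_nth axis_def)

text \<open>
  For \<open>k \<noteq> j\<close> the component \<open>j\<close> of \<open>s \<times> e\<^sub>k\<close> is, up to the sign \<open>eps k j\<close>, the component of \<open>s\<close> with the
  third index. On the diagonal \<open>third\<close> has an arbitrary value, next to the factor \<open>eps k k = 0\<close>.
\<close>

definition third :: "3 \<Rightarrow> 3 \<Rightarrow> 3" where
  "third k j = (if k \<noteq> 1 \<and> j \<noteq> 1 then 1 else if k \<noteq> 2 \<and> j \<noteq> 2 then 2 else 3)"

definition eps :: "3 \<Rightarrow> 3 \<Rightarrow> real" where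
  "eps k j = cross3 (axis (third k j) 1) (axis k 1) $ j"

lemma cross_axis_nth: "cross3 s (axis k 1) $ j = eps k j * s $ third k j"
  using exhaust_3[of k] exhaust_3[of j] by (auto simp: eps_def third_def cross3_def axis_def)

lemma eps_same: "eps k k = 0"
  using exhaust_3[of k] by (auto simp: eps_def third_def cross3_def axis_def)

lemma arr3_third: "j \<noteq> k \<Longrightarrow> arr3 $ i $ k = arr2 $ i $ third k j + axis j 1"
  using exhaust_3[of k] exhaust_3[of j]
  by (auto simp: arr3_nth arr2_nth third_def vec_eq_iff forall_3 axis_def)

lemma arr2_third: "j \<noteq> k \<Longrightarrow> arr2 $ i $ third k j $ j \<le> 1"
  using exhaust_3[of k] exhaust_3[of j]
  by (auto simp: arr2_nth third_def axis_def)

lemma arr4_eq: "arr4 $ i = arr3 $ i $ k + axis k 1"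
  by (auto simp: arr3_nth arr4_nth vec_eq_iff axis_def)

lemma arr3_same: "arr3 $ i $ k $ k \<le> 1"
  by (auto simp: arr3_nth axis_def)

context spline_cube begin

lemma tensor_proj_cmult:
  assumes a: "\<And>d. a $ d \<le> 2" and f: "L2_on cube f"
  shows "AE x in lebesgue_on cube. tensor_proj p \<Xi> a (\<lambda>y. c * f y) x = c * tensor_proj p \<Xi> a f x"
proof -
  obtain g where g: "integrable lborel g" "AE x in lborel. x \<in> cube \<longrightarrow> f x = g x"
    using L2_representative[OF f] by metis
  have cg: "integrable lborel (\<lambda>x. c * g x)" "AE x in lborel. x \<in> cube \<longrightarrow> c * f x = c * g x"
    using g by (auto elim!: eventually_mono)
  have coeff: "coefficient a (\<lambda>x. c * g x) \<iota> = c * coefficient a g \<iota>" for \<iota>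
    by (simp add: coefficient_def mult.assoc)
  show ?thesis
    using tensor_proj_expansion[OF a g] tensor_proj_expansion[OF a cg]
    unfolding AE_lebesgue_on_cube by eventually_elim (auto simp: coeff sum_distrib_left mult.assoc)
qed

text \<open>
  Components are given up to constant factors here; a zero factor marks a direction in which the
  projection takes no derivative.
\<close>

lemma weak_div_commute:
  assumes a: "\<And>d. a $ d \<le> 2" and f: "\<And>k. L2_on cube (f k)" and w: "L2_on cube w"
    and r: "\<And>k. r k = 0 \<or> a $ k \<noteq> 0" and div: "weak_div cube (\<lambda>x. \<chi> k. r k * f k x) w"
  shows "weak_div cube (\<lambda>x. \<chi> k. r k * tensor_proj p \<Xi> (a - axis k 1) (f k) x) (tensor_proj p \<Xi> a w)"
proof (rule weak_div_cong[OF cube_lebesgue])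
  have le: "(a - axis k 1) $ d \<le> 2" for k d using a[of d] by (simp add: index_minus)
  have r0: "a $ k = 0 \<Longrightarrow> r k = 0" for k using r[of k] by simp
  let ?u = "\<lambda>x. \<chi> k. if a $ k = 0 then 0 else tensor_proj p \<Xi> (a - axis k 1) (\<lambda>y. r k * f k y) x"
  have "weak_div cube (\<lambda>x. \<chi> k. if a $ k = 0 then 0 else tensor_proj p \<Xi> (a - axis k 1) (\<lambda>y. (\<chi> k. r k * f k y) $ k) x)
      (tensor_proj p \<Xi> a w)"
  proof (rule tensor_proj_weak_div[OF a _ w div])
    show "(\<chi> k. r k * f k x) $ k = 0" if "a $ k = 0" for k x using r[of k] that by simp
  qed (simp add: L2_on_cmult f)
  then show "weak_div cube ?u (tensor_proj p \<Xi> a w)" by (simp only: vec_lambda_beta)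
  have "L2_on cube (\<lambda>x. ?u x $ k)" for k
    by (cases "a $ k = 0") (use L2_tensor_proj[OF le L2_on_cmult[OF f]] L2_on_cmult[OF f, of 0] in auto)
  then show "L2_on cube ?u" by (simp add: L2_on_vec_iff)
  show "L2_on cube (\<lambda>x. \<chi> k. r k * tensor_proj p \<Xi> (a - axis k 1) (f k) x)"
    unfolding L2_on_vec_iff vec_lambda_beta by (intro allI L2_on_cmult L2_tensor_proj le f)
  have "AE x in lebesgue_on cube. \<forall>k\<in>UNIV.
      tensor_proj p \<Xi> (a - axis k 1) (\<lambda>y. r k * f k y) x = r k * tensor_proj p \<Xi> (a - axis k 1) (f k) x"
    by (rule AE_finite_allI) (simp, rule tensor_proj_cmult[OF le f])
  then show "AE x in lebesgue_on cube. ?u x = (\<chi> k. r k * tensor_proj p \<Xi> (a - axis k 1) (f k) x)"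
    by eventually_elim (auto simp: vec_eq_iff r0)
qed (use L2_tensor_proj[OF a w] in auto)

lemma partial_commute:
  assumes a: "\<And>d. a $ d \<le> 2" "a $ k \<le> 1" and f: "L2_on cube f" and w: "L2_on cube w"
    and div: "weak_div cube (\<lambda>x. f x *\<^sub>R axis k 1) w"
  shows "weak_div cube (\<lambda>x. tensor_proj p \<Xi> a f x *\<^sub>R axis k 1) (tensor_proj p \<Xi> (a + axis k 1) w)"
proof -
  have *: "y *\<^sub>R axis k 1 = (\<chi> j. (if j = k then 1 else 0) * z j)" if "z k = y" for y :: real and z
    using that by (auto simp: vec_eq_iff axis_def)
  have "weak_div cube (\<lambda>x. \<chi> j. (if j = k then 1 else 0) * tensor_proj p \<Xi> (a + axis k 1 - axis j 1) f x)
      (tensor_proj p \<Xi> (a + axis k 1) w)"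
    using div by (intro weak_div_commute axis_le a f w) (auto simp: *[symmetric])
  moreover have "(\<chi> j. (if j = k then 1 else 0) * tensor_proj p \<Xi> (a + axis k 1 - axis j 1) f x)
      = tensor_proj p \<Xi> a f x *\<^sub>R axis k 1" for x
    by (rule *[symmetric]) simp
  ultimately show ?thesis by simp
qed

text \<open>
  The gradient in between is projected componentwise, with one order in the direction of the component.
\<close>

lemma hessian_commute:
  assumes "has_weak_hessian cube \<phi> H"
  shows "has_weak_hessian cube (Pihat1 p \<Xi> \<phi>) (Pihat2 p \<Xi> H)"
proof -
  obtain g where g: "has_weak_grad cube \<phi> g" "\<And>i. has_weak_grad cube (\<lambda>x. g x $ i) (\<lambda>x. H x $ i)"
    using assms unfolding has_weak_hessian_def by blast
  have L2: "L2_on cube \<phi>" "L2_on cube (\<lambda>x. g x $ i)" "L2_on cube (\<lambda>x. H x $ i $ j)" for i j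
    using g(1) g(2)[of i] by (auto simp: has_weak_grad_def intro: L2_on_nth)
  have wd: "weak_div cube (\<lambda>x. \<phi> x *\<^sub>R axis i 1) (\<lambda>x. g x $ i)"
    "weak_div cube (\<lambda>x. g x $ i *\<^sub>R axis j 1) (\<lambda>x. H x $ i $ j)" for i j
    using g(1) g(2)[of i] by (auto simp: has_weak_grad_iff[OF cube_lebesgue])
  have ax: "(axis i 1 :: nat^3) $ d \<le> 1" "(axis i 1 :: nat^3) $ d \<le> 2" for i d by (auto simp: axis_def)
  have hess: "weak_div cube (\<lambda>x. tensor_proj p \<Xi> (axis i 1) (\<lambda>x. g x $ i) x *\<^sub>R axis j 1)
      (tensor_proj p \<Xi> (arr2 $ i $ j) (\<lambda>x. H x $ i $ j))" for i j
    unfolding arr2_nth by (rule partial_commute[OF ax(2) ax(1) L2(2) L2(3) wd(2)])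
  have grd: "weak_div cube (\<lambda>x. tensor_proj p \<Xi> 0 \<phi> x *\<^sub>R axis i 1)
      (tensor_proj p \<Xi> (axis i 1) (\<lambda>x. g x $ i))" for i
    using partial_commute[OF _ _ L2(1) L2(2) wd(1), of 0 i] by simp
  have L2': "L2_on cube (tensor_proj p \<Xi> 0 \<phi>)" "L2_on cube (tensor_proj p \<Xi> (axis i 1) (\<lambda>x. g x $ i))"
    "L2_on cube (tensor_proj p \<Xi> (arr2 $ i $ j) (\<lambda>x. H x $ i $ j))" for i j
    by (simp add: L2_tensor_proj L2, rule L2_tensor_proj[OF ax(2) L2(2)], rule L2_tensor_proj[OF arr_le(1) L2(3)])
  have "has_weak_grad cube (Pihat1 p \<Xi> \<phi>) (\<lambda>x. \<chi> i. tensor_proj p \<Xi> (axis i 1) (\<lambda>x. g x $ i) x)"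
    unfolding has_weak_grad_iff[OF cube_lebesgue] Pihat1_def arr1_eq L2_on_vec_iff using L2' grd by simp
  moreover have "has_weak_grad cube (tensor_proj p \<Xi> (axis i 1) (\<lambda>x. g x $ i)) (\<lambda>x. Pihat2 p \<Xi> H x $ i)" for i
    unfolding has_weak_grad_iff[OF cube_lebesgue] Pihat2_def L2_on_vec_iff using L2' hess by simp
  ultimately show ?thesis unfolding has_weak_hessian_def by auto
qed

text \<open>
  The entry \<open>(i, k)\<close> of the curl consists of derivatives in directions \<open>j \<noteq> k\<close> of the entries
  \<open>(i, third k j)\<close>; by \<open>arr3_third\<close> the multi-orders of these entries are those of the entry of the curl
  with one derivative in direction \<open>j\<close> taken away.
\<close>

lemma curl_commute:
  assumes "has_weak_curl cube S T"
  shows "has_weak_curl cube (Pihat2 p \<Xi> S) (Pihat3 p \<Xi> T)"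
proof -
  have L2: "L2_on cube (\<lambda>x. S x $ i $ j)" "L2_on cube (\<lambda>x. T x $ i $ j)" for i j
    using assms by (auto simp: has_weak_curl_def L2_on_mat_iff)
  have wd: "weak_div cube (\<lambda>x. \<chi> j. eps k j * S x $ i $ third k j) (\<lambda>x. T x $ i $ k)" for i k
    using assms unfolding has_weak_curl_iff[OF cube_lebesgue] cross_axis_nth[symmetric] by simp
  have "weak_div cube (\<lambda>x. cross3 (Pihat2 p \<Xi> S x $ i) (axis k 1)) (\<lambda>x. Pihat3 p \<Xi> T x $ i $ k)" for i k
  proof -
    have r: "eps k j = 0 \<or> arr3 $ i $ k $ j \<noteq> 0" for j
      by (cases "j = k") (auto simp: eps_same arr3_nth)
    have "weak_div cube (\<lambda>x. \<chi> j. eps k j * tensor_proj p \<Xi> (arr3 $ i $ k - axis j 1) (\<lambda>x. S x $ i $ third k j) x)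
        (tensor_proj p \<Xi> (arr3 $ i $ k) (\<lambda>x. T x $ i $ k))"
      by (rule weak_div_commute[OF arr_le(2) L2 r wd])
    moreover have "eps k j * tensor_proj p \<Xi> (arr3 $ i $ k - axis j 1) (\<lambda>x. S x $ i $ third k j) x
        = eps k j * Pihat2 p \<Xi> S x $ i $ third k j" for j x
      by (cases "j = k") (simp_all add: eps_same arr3_third Pihat2_def)
    moreover have "cross3 s (axis k 1) = (\<chi> j. eps k j * s $ third k j)" for s
      by (simp add: vec_eq_iff cross_axis_nth)
    ultimately show ?thesis by (simp only: Pihat3_def vec_lambda_beta)
  qed
  then show ?thesis unfolding has_weak_curl_iff[OF cube_lebesgue] L2_on_mat_iff
    by (simp add: Pihat2_def Pihat3_def L2_tensor_proj arr_le L2)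
qed

lemma div_commute:
  assumes "has_weak_div cube T v"
  shows "has_weak_div cube (Pihat3 p \<Xi> T) (Pihat4 p \<Xi> v)"
proof -
  have L2: "L2_on cube (\<lambda>x. T x $ i $ j)" "L2_on cube (\<lambda>x. v x $ i)" for i j
    using assms L2_on_nth[of cube v] by (auto simp: has_weak_div_def L2_on_mat_iff)
  have wd: "weak_div cube (\<lambda>x. \<chi> j. 1 * T x $ i $ j) (\<lambda>x. v x $ i)" for i
    using assms unfolding has_weak_div_iff by simp
  have r: "(1::real) = 0 \<or> arr4 $ i $ j \<noteq> 0" for i j by (simp add: arr4_nth)
  have "weak_div cube (\<lambda>x. Pihat3 p \<Xi> T x $ i) (\<lambda>x. Pihat4 p \<Xi> v x $ i)" for i
  proof -
    have "weak_div cube (\<lambda>x. \<chi> j. 1 * tensor_proj p \<Xi> (arr4 $ i - axis j 1) (\<lambda>x. T x $ i $ j) x)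
        (tensor_proj p \<Xi> (arr4 $ i) (\<lambda>x. v x $ i))"
      by (rule weak_div_commute[OF arr_le(3) L2 r wd])
    moreover have "arr4 $ i - axis j 1 = arr3 $ i $ j" for j by (simp add: arr4_eq[of i j])
    moreover have "(\<chi> j. Pihat3 p \<Xi> T x $ i $ j) = Pihat3 p \<Xi> T x $ i" for x by (simp add: vec_eq_iff)
    ultimately show ?thesis by (simp only: Pihat3_def Pihat4_def vec_lambda_beta mult_1)
  qed
  then show ?thesis unfolding has_weak_div_iff L2_on_mat_iff L2_on_vec_iff[of _ "Pihat4 _ _ _"]
    by (simp add: Pihat3_def Pihat4_def L2_tensor_proj arr_le L2)
qed

lemma hessian_subcomplex:
  assumes "F \<in> Vhat1 p \<Xi>" shows "\<exists>H\<in>Vhat2 p \<Xi>. has_weak_hessian cube F H"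
proof -
  have F: "F \<in> spline_space p \<Xi> 0" using assms by (simp add: Vhat1_def arr1_eq)
  obtain D where D: "\<And>a. (\<And>d. a $ d \<le> 2) \<Longrightarrow> D a \<in> spline_space p \<Xi> a"
    "AE x in lborel. x \<in> cube \<longrightarrow> F x = D 0 x"
    "\<And>a k. a $ k \<le> 1 \<Longrightarrow> weak_div cube (\<lambda>x. D a x *\<^sub>R axis k 1) (D (a + axis k 1))"
    using spline_space_derivatives[OF F] by auto
  have ax: "(axis i 1 :: nat^3) $ d \<le> 1" "(axis i 1 :: nat^3) $ d \<le> 2" for i d by (auto simp: axis_def)
  have L2: "L2_on cube F" "L2_on cube (D 0)" "L2_on cube (D (axis i 1))" "L2_on cube (D (arr2 $ i $ j))" for i j
    by (rule spline_space_L2[OF _ F], simp, rule spline_space_L2[OF _ D(1)], simp, simp,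
      rule spline_space_L2[OF ax(2) D(1)[OF ax(2)]], rule spline_space_L2[OF arr_le(1) D(1)[OF arr_le(1)]])
  have "weak_div cube (\<lambda>x. D 0 x *\<^sub>R axis i 1) (D (axis i 1))" for i
    using D(3)[of 0 i] by simp
  then have grd: "weak_div cube (\<lambda>x. F x *\<^sub>R axis i 1) (D (axis i 1))" for i
    by (rule weak_div_cong[OF cube_lebesgue L2_on_axis[OF L2(2)] L2_on_axis[OF L2(1)] L2(3) L2(3), rotated 2])
      (use D(2) in \<open>auto simp: AE_lebesgue_on_cube elim!: eventually_mono\<close>)
  have hess: "weak_div cube (\<lambda>x. D (axis i 1) x *\<^sub>R axis j 1) (D (arr2 $ i $ j))" for i j
    unfolding arr2_nth by (rule D(3)[OF ax(1)])
  let ?H = "\<lambda>x. \<chi> i j. D (arr2 $ i $ j) x"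
  have "has_weak_grad cube F (\<lambda>x. \<chi> i. D (axis i 1) x)"
    unfolding has_weak_grad_iff[OF cube_lebesgue] L2_on_vec_iff using L2 grd by simp
  moreover have "has_weak_grad cube (D (axis i 1)) (\<lambda>x. ?H x $ i)" for i
    unfolding has_weak_grad_iff[OF cube_lebesgue] L2_on_vec_iff using L2 hess by simp
  ultimately have "has_weak_hessian cube F ?H" unfolding has_weak_hessian_def by auto
  moreover have "?H \<in> Vhat2 p \<Xi>"
    by (simp add: Vhat2_def symmetric_on_def transpose_def arr2_sym D(1) arr_le)
  ultimately show ?thesis by blast
qed

text \<open>
  A choice that depends on the spline only, so that equal splines have equal derivatives at every
  point. The cancellation of the trace of the curl relies on this.
\<close>

definition spline_derivative :: "nat^3 \<Rightarrow> (real^3 \<Rightarrow> real) \<Rightarrow> 3 \<Rightarrow> real^3 \<Rightarrow> real" where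
  "spline_derivative a f k =
    (SOME G. G \<in> spline_space p \<Xi> (a + axis k 1) \<and> weak_div cube (\<lambda>x. f x *\<^sub>R axis k 1) G)"

lemma spline_derivative:
  assumes "\<And>d. a $ d \<le> 2" "a $ k \<le> 1" "f \<in> spline_space p \<Xi> a"
  shows "spline_derivative a f k \<in> spline_space p \<Xi> (a + axis k 1)"
    "weak_div cube (\<lambda>x. f x *\<^sub>R axis k 1) (spline_derivative a f k)"
proof -
  have "\<exists>G. G \<in> spline_space p \<Xi> (a + axis k 1) \<and> weak_div cube (\<lambda>x. f x *\<^sub>R axis k 1) G"
    using spline_space_derivative[OF assms] by blast
  from someI_ex[OF this] show "spline_derivative a f k \<in> spline_space p \<Xi> (a + axis k 1)"
    "weak_div cube (\<lambda>x. f x *\<^sub>R axis k 1) (spline_derivative a f k)"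
    by (simp_all add: spline_derivative_def)
qed

text \<open>
  Symmetry holds almost everywhere only. The upper triangle provides a representative \<open>s\<close> that is
  symmetric at every point; its derivatives are chosen once for each pair of equal entries, and the
  terms of the trace of the curl cancel in pairs.
\<close>

lemma curl_subcomplex:
  assumes "S \<in> Vhat2 p \<Xi>" shows "\<exists>T\<in>Vhat3 p \<Xi>. has_weak_curl cube S T"
proof -
  have sym: "AE x in lebesgue_on cube. transpose (S x) = S x"
    and S: "\<And>i j. (\<lambda>x. S x $ i $ j) \<in> spline_space p \<Xi> (arr2 $ i $ j)"
    using assms by (auto simp: Vhat2_def symmetric_on_def)
  define s where "s i m x = (if i \<le> m then S x $ i $ m else S x $ m $ i)" for i m x
  have s_sym: "s i m = s m i" for i m
    using linear[of i m] by (auto simp: s_def fun_eq_iff dest: antisym)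
  have s_space: "s i m \<in> spline_space p \<Xi> (arr2 $ i $ m)" for i m
    unfolding s_def using S[of i m] S[of m i] by (cases "i \<le> m") (simp_all add: arr2_sym)
  have s_S: "AE x in lebesgue_on cube. \<forall>i m. s i m x = S x $ i $ m"
    using sym by eventually_elim (auto simp: s_def transpose_def vec_eq_iff)
  define D where "D i m j = spline_derivative (arr2 $ i $ m) (s i m) j" for i m j
  have D_sym: "D i m j = D m i j" for i m j by (simp add: D_def s_sym[of i] arr2_sym[of i])
  have D: "D i (third k j) j \<in> spline_space p \<Xi> (arr3 $ i $ k)"
    "weak_div cube (\<lambda>x. s i (third k j) x *\<^sub>R axis j 1) (D i (third k j) j)" if "j \<noteq> k" for i j k
    using spline_derivative[OF arr_le(1) arr2_third[OF that] s_space] by (simp_all add: D_def arr3_third[OF that])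
  define T where "T x = (\<chi> i k. \<Sum>j\<in>UNIV - {k}. eps k j * D i (third k j) j x)" for x
  have T: "(\<lambda>x. T x $ i $ k) \<in> spline_space p \<Xi> (arr3 $ i $ k)" for i k
    unfolding T_def vec_lambda_beta by (rule spline_space_sum[OF arr_le(2)]) (use D(1) in auto)
  have d3: "UNIV - {1} = {2, 3::3}" "UNIV - {2} = {1, 3::3}" "UNIV - {3} = {1, 2::3}"
    unfolding UNIV_3 by auto
  have "trace (T x) = 0" for x
    using D_sym[of 1 2 3] D_sym[of 1 3 2] D_sym[of 2 3 1]
    by (simp add: trace_def sum_3 T_def d3 eps_def third_def cross3_def axis_def)
  then have "T \<in> Vhat3 p \<Xi>" using T by (simp add: Vhat3_def tracefree_on_def)
  moreover have "has_weak_curl cube S T"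
    unfolding has_weak_curl_iff[OF cube_lebesgue]
  proof (intro conjI allI)
    show L2S: "L2_on cube S" unfolding L2_on_mat_iff by (intro allI spline_space_L2[OF arr_le(1) S])
    show "L2_on cube T" unfolding L2_on_mat_iff by (intro allI spline_space_L2[OF arr_le(2) T])
    fix i k
    have row: "L2_on cube (\<lambda>x. S x $ i)" using L2S by (simp add: L2_on_vec_iff)
    have L2s: "L2_on cube (\<lambda>x. s i m x *\<^sub>R axis j (1::real) :: real^3)" for m j
      by (rule L2_on_axis[OF spline_space_L2[OF arr_le(1) s_space]])
    have L2sum: "L2_on cube (\<lambda>x. \<Sum>j\<in>UNIV - {k}. eps k j *\<^sub>R (s i (third k j) x *\<^sub>R axis j (1::real)))"
      by (intro L2_on_lincomb L2s)
    have L2T: "L2_on cube (\<lambda>x. T x $ i $ k)" by (rule spline_space_L2[OF arr_le(2) T])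
    have "weak_div cube (\<lambda>x. \<Sum>j\<in>UNIV - {k}. eps k j *\<^sub>R (s i (third k j) x *\<^sub>R axis j 1))
        (\<lambda>x. \<Sum>j\<in>UNIV - {k}. eps k j * D i (third k j) j x)"
      by (rule weak_div_sum[OF cube_lebesgue]) (use D(2) L2s spline_space_L2[OF arr_le(2) D(1)] in auto)
    then have "weak_div cube (\<lambda>x. \<Sum>j\<in>UNIV - {k}. eps k j *\<^sub>R (s i (third k j) x *\<^sub>R axis j 1)) (\<lambda>x. T x $ i $ k)"
      by (simp add: T_def)
    then show "weak_div cube (\<lambda>x. cross3 (S x $ i) (axis k 1)) (\<lambda>x. T x $ i $ k)"
    proof (rule weak_div_cong[OF cube_lebesgue L2sum L2_on_cross[OF row] L2T L2T, rotated 2])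
      show "AE x in lebesgue_on cube. (\<Sum>j\<in>UNIV - {k}. eps k j *\<^sub>R (s i (third k j) x *\<^sub>R axis j 1)) = cross3 (S x $ i) (axis k 1)"
        using s_S
      proof eventually_elim
        case (elim x)
        have "(\<Sum>j\<in>UNIV - {k}. eps k j *\<^sub>R (S x $ i $ third k j *\<^sub>R axis j 1)) $ l = eps k l * S x $ i $ third k l" for l
          by (cases "l = k") (simp_all add: axis_def if_distrib sum.delta eps_same cong: if_cong)
        then show ?case using elim by (simp add: vec_eq_iff cross_axis_nth)
      qed
    qed simp
  qed
  ultimately show ?thesis by blast
qed

lemma div_subcomplex:
  assumes "T \<in> Vhat3 p \<Xi>" shows "\<exists>v\<in>Vhat4 p \<Xi>. has_weak_div cube T v"
proof -
  have T: "\<And>i j. (\<lambda>x. T x $ i $ j) \<in> spline_space p \<Xi> (arr3 $ i $ j)"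
    using assms by (auto simp: Vhat3_def)
  define D where "D i k = spline_derivative (arr3 $ i $ k) (\<lambda>x. T x $ i $ k) k" for i k
  have D: "D i k \<in> spline_space p \<Xi> (arr4 $ i)" "weak_div cube (\<lambda>x. T x $ i $ k *\<^sub>R axis k 1) (D i k)" for i k
    using spline_derivative[OF arr_le(2) arr3_same T] unfolding D_def arr4_eq[of i k] by auto
  define v where "v x = (\<chi> i. \<Sum>k\<in>UNIV. 1 * D i k x)" for x
  have v: "(\<lambda>x. v x $ i) \<in> spline_space p \<Xi> (arr4 $ i)" for i
    unfolding v_def vec_lambda_beta by (rule spline_space_sum[OF arr_le(3)]) (use D(1) in auto)
  have "weak_div cube (\<lambda>x. T x $ i) (\<lambda>x. v x $ i)" for i
  proof -
    have "weak_div cube (\<lambda>x. \<Sum>k\<in>UNIV. 1 *\<^sub>R (T x $ i $ k *\<^sub>R axis k 1)) (\<lambda>x. \<Sum>k\<in>UNIV. 1 * D i k x)"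
      by (rule weak_div_sum[OF cube_lebesgue])
        (use D(2) L2_on_axis[OF spline_space_L2[OF arr_le(2) T]] spline_space_L2[OF arr_le(3) D(1)] in auto)
    moreover have "(\<Sum>k\<in>UNIV. 1 *\<^sub>R (T x $ i $ k *\<^sub>R axis k 1)) = T x $ i" for x
      by (simp add: vec_eq_iff forall_3 sum_3 axis_def)
    ultimately show ?thesis by (simp add: v_def)
  qed
  then have "has_weak_div cube T v"
    unfolding has_weak_div_iff L2_on_mat_iff L2_on_vec_iff[of _ v]
    by (auto intro: spline_space_L2[OF arr_le(2) T] spline_space_L2[OF arr_le(3) v])
  then show ?thesis using v by (auto simp: Vhat4_def)
qed

lemma Pihat1_affine:
  assumes f: "\<And>y. y \<in> cube \<Longrightarrow> f y = c + a \<bullet> y" and x: "x \<in> cube"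
  shows "Pihat1 p \<Xi> f x = c + a \<bullet> x"
proof -
  have 01: "0 < x $ d" "x $ d < 1" for d using x by (auto simp: mem_cube)
  have ip: "a \<bullet> triple (s, t, u) = a $ 1 * s + a $ 2 * t + a $ 3 * u" for s t u
    by (simp add: inner_vec_def sum_3)
  have f': "f (triple (s, t, u)) = c + a $ 1 * s + a $ 2 * t + a $ 3 * u"
    if "0 < s" "s < 1" "0 < t" "t < 1" "0 < u" "u < 1" for s t u
    using f[of "triple (s, t, u)"] that by (simp add: mem_cube forall_3 ip)
  have 3: "spline_proj (p 3) (\<Xi> 3) (\<lambda>u. f (triple (s, t, u))) (x $ 3) = (c + a $ 1 * s + a $ 2 * t) + a $ 3 * x $ 3"
    if "0 < s" "s < 1" "0 < t" "t < 1" for s t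
    by (rule dir.spline_proj_linear[OF 01]) (simp add: f' that)
  have 2: "spline_proj (p 2) (\<Xi> 2) (\<lambda>t. spline_proj (p 3) (\<Xi> 3) (\<lambda>u. f (triple (s, t, u))) (x $ 3)) (x $ 2)
      = (c + a $ 1 * s + a $ 3 * x $ 3) + a $ 2 * x $ 2" if "0 < s" "s < 1" for s
    by (rule dir.spline_proj_linear[OF 01]) (simp add: 3 that)
  have "spline_proj (p 1) (\<Xi> 1) (\<lambda>s. spline_proj (p 2) (\<Xi> 2) (\<lambda>t. spline_proj (p 3) (\<Xi> 3) (\<lambda>u. f (triple (s, t, u))) (x $ 3)) (x $ 2)) (x $ 1)
      = (c + a $ 2 * x $ 2 + a $ 3 * x $ 3) + a $ 1 * x $ 1"
    by (rule dir.spline_proj_linear[OF 01]) (simp add: 2)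
  moreover have "Pihat1 p \<Xi> f x = spline_proj (p 1) (\<Xi> 1) (\<lambda>s. spline_proj (p 2) (\<Xi> 2) (\<lambda>t. spline_proj (p 3) (\<Xi> 3) (\<lambda>u. f (triple (s, t, u))) (x $ 3)) (x $ 2)) (x $ 1)"
    unfolding Pihat1_def arr1_eq
    by (subst (1) triple_surj[of x], subst tensor_proj_triple) (simp add: spline_proj_order_def)
  ultimately show ?thesis by (simp add: inner_vec_def sum_3)
qed

end

theorem mainTheorem2:
  fixes A :: "real^3^3" and b :: "real^3"
    and p r :: "3 \<Rightarrow> nat" and \<Xi> :: "3 \<Rightarrow> real list"
  assumes "invertible A"
    and "\<forall>i. p i - 1 \<ge> r i \<and> r i \<ge> 1"
    and "\<forall>i. open_knot_vector (p i) (r i) (\<Xi> i)"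
  shows
    "(\<forall>\<phi>\<in>V1 A b p \<Xi>. \<exists>H\<in>V2 A b p \<Xi>. has_weak_hessian (phys_dom A b) \<phi> H) \<and>
     (\<forall>S\<in>V2 A b p \<Xi>. \<exists>T\<in>V3 A b p \<Xi>. has_weak_curl (phys_dom A b) S T) \<and>
     (\<forall>T\<in>V3 A b p \<Xi>. \<exists>v\<in>V4 A b p \<Xi>. has_weak_div (phys_dom A b) T v) \<and>
     (\<forall>\<phi>\<in>H2 (phys_dom A b). \<forall>H. has_weak_hessian (phys_dom A b) \<phi> H \<longrightarrow>
        has_weak_hessian (phys_dom A b) (Pi1 A b p \<Xi> \<phi>) (Pi2 A b p \<Xi> H)) \<and>
     (\<forall>S\<in>Hcurl_sym (phys_dom A b). \<forall>T. has_weak_curl (phys_dom A b) S T \<longrightarrow>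
        has_weak_curl (phys_dom A b) (Pi2 A b p \<Xi> S) (Pi3 A b p \<Xi> T)) \<and>
     (\<forall>T\<in>Hdiv_tracefree (phys_dom A b). \<forall>v. has_weak_div (phys_dom A b) T v \<longrightarrow>
        has_weak_div (phys_dom A b) (Pi3 A b p \<Xi> T) (Pi4 A b p \<Xi> v)) \<and>
     (\<forall>\<phi>\<in>P1 (phys_dom A b). \<forall>x\<in>phys_dom A b. Pi1 A b p \<Xi> \<phi> x = \<phi> x)"
proof -
  interpret affine_map A b using assms(1) by (rule affine_map.intro)
  interpret spline_cube p \<Xi>
    by (rule spline_cube.intro) (use assms(2,3) in \<open>auto simp: admissible_def\<close>)
  note pull = hessian_iff[OF cube_lebesgue] curl_iff[OF cube_lebesgue] div_iff[OF cube_lebesgue]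
  have hess: "\<exists>H\<in>V2 A b p \<Xi>. has_weak_hessian (phys_dom A b) \<phi> H" if \<phi>: "\<phi> \<in> V1 A b p \<Xi>" for \<phi>
  proof -
    obtain H where H: "H \<in> Vhat2 p \<Xi>" "has_weak_hessian cube (Y1 A b \<phi>) H"
      using hessian_subcomplex \<phi> unfolding V1_def by blast
    then show ?thesis
      by (intro bexI[of _ "Y2 (matrix_inv A) b' H"]) (simp_all add: V2_def phys_dom_def pull Y2_inverse)
  qed
  have curl: "\<exists>T\<in>V3 A b p \<Xi>. has_weak_curl (phys_dom A b) S T" if S: "S \<in> V2 A b p \<Xi>" for S
  proof -
    obtain T where T: "T \<in> Vhat3 p \<Xi>" "has_weak_curl cube (Y2 A b S) T"
      using curl_subcomplex S unfolding V2_def by blast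
    then show ?thesis
      by (intro bexI[of _ "Y3 (matrix_inv A) b' T"]) (simp_all add: V3_def phys_dom_def pull Y3_inverse)
  qed
  have div: "\<exists>v\<in>V4 A b p \<Xi>. has_weak_div (phys_dom A b) T v" if T: "T \<in> V3 A b p \<Xi>" for T
  proof -
    obtain v where v: "v \<in> Vhat4 p \<Xi>" "has_weak_div cube (Y3 A b T) v"
      using div_subcomplex T unfolding V3_def by blast
    then show ?thesis
      by (intro bexI[of _ "Y4 (matrix_inv A) b' v"]) (simp_all add: V4_def phys_dom_def pull Y4_inverse)
  qed
  have affine: "Pi1 A b p \<Xi> \<phi> x = \<phi> x" if \<phi>: "\<phi> \<in> P1 (phys_dom A b)" and x: "x \<in> phys_dom A b" for \<phi> x
  proof -
    obtain c a where ca: "\<And>y. y \<in> phys_dom A b \<Longrightarrow> \<phi> y = c + a \<bullet> y" using \<phi> by (auto simp: P1_def)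
    obtain z where z: "z \<in> cube" "x = F_map A b z" using x by (auto simp: phys_dom_def)
    have pulled: "Y1 A b \<phi> y = (c + a \<bullet> b) + (transpose A *v a) \<bullet> y" if "y \<in> cube" for y
    proof -
      have "Y1 A b \<phi> y = c + a \<bullet> (A *v y + b)" using that ca by (simp add: Y1_def phys_dom_def F_map_def)
      then show ?thesis by (simp add: inner_add_right dot_lmul_matrix)
    qed
    have "Pi1 A b p \<Xi> \<phi> x = Y1 A b (Pi1 A b p \<Xi> \<phi>) z" by (simp add: Y1_def z)
    also have "\<dots> = (c + a \<bullet> b) + (transpose A *v a) \<bullet> z" unfolding Y_Pi by (rule Pihat1_affine[OF pulled z(1)])
    also have "\<dots> = \<phi> x" using pulled[OF z(1)] by (simp add: Y1_def z)
    finally show ?thesis .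
  qed
  show ?thesis
    using hess curl div affine hessian_commute curl_commute div_commute
    by (simp add: phys_dom_def pull Y_Pi)
qed

end
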